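(* Let $k$ be a finite field of characteristic $p$, let $G$ be a profinite group, let $U$ be an indecomposable finitely generated profinite $k[[G]]$-module, and let $Q,R$ be vertices of $U$. Then there exists $x\in G$ such that $Q=xRx^{-1}$.
   Context: Conventions: $k[[G]]=\varprojlim_{N} k[G/N]$ ($N$ over open normal subgroups of $G$) is the completed group algebra. Modules are profinite left modules; homomorphisms and direct sum decompositions are continuous. For a closed subgroup $H\le G$, a profinite $k[[G]]$-module $U$ is relatively $H$-projective if for every continuous epimorphism $\beta:V\twoheadrightarrow W$ and continuous homomorphism $\varphi:U\to W$ of profinite $k[[G]]$-modules, there exists a continuous $k[[G]]$-homomorphism $\rho:U\to V$ with $\beta\rho=\varphi$ provided there is a continuous $k[[H]]$-homomorphism with this property. A vertex of a finitely generated indecomposable profinite $k[[G]]$-module $U$ is a closed subgroup $Q$ of $G$ such that $U$ is relatively $Q$-projective but $U$ is not relatively projective with respect to any proper closed subgroup of $Q$. *)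

theory Defs
  imports "HOL-Analysis.Analysis" "HOL-Algebra.Module" "HOL-Algebra.Multiplicative_Group"
begin

section \<open>Profinite spaces and profinite groups\<close>

definition totally_disconnected_space :: "'a topology \<Rightarrow> bool" where
  "totally_disconnected_space X \<longleftrightarrow> (\<forall>S. connectedin X S \<longrightarrow> (\<exists>a. S \<subseteq> {a}))"

definition profinite_space :: "'a topology \<Rightarrow> bool" where
  "profinite_space X \<longleftrightarrow> compact_space X \<and> Hausdorff_space X \<and> totally_disconnected_space X"

record 'g top_group = "'g monoid" +
  gtopology :: "'g topology"

locale profinite_group = group G for G :: "('g, 'b) top_group_scheme" (structure) +
  assumes topspace_gtopology: "topspace (gtopology G) = carrier G"
    and continuous_mult:
      "continuous_map (prod_topology (gtopology G) (gtopology G)) (gtopology G) (\<lambda>(x, y). x \<otimes> y)"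
    and continuous_inv: "continuous_map (gtopology G) (gtopology G) (\<lambda>x. inv x)"
    and profinite_topology: "profinite_space (gtopology G)"

definition sub_top_group :: "('g, 'b) top_group_scheme \<Rightarrow> 'g set \<Rightarrow> ('g, 'b) top_group_scheme" where
  "sub_top_group G H = G\<lparr>carrier := H, gtopology := subtopology (gtopology G) H\<rparr>"

definition closed_subgroup :: "'g set \<Rightarrow> ('g, 'b) top_group_scheme \<Rightarrow> bool" where
  "closed_subgroup H G \<longleftrightarrow> subgroup H G \<and> closedin (gtopology G) H"

definition open_normal_subgroups :: "('g, 'b) top_group_scheme \<Rightarrow> 'g set set" where
  "open_normal_subgroups G = {N. N \<lhd> G \<and> openin (gtopology G) N}"


section \<open>Completed group algebras\<close>

definition ring_char :: "('k, 'a) ring_scheme \<Rightarrow> nat" where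
  "ring_char k = group.ord (add_monoid k) \<one>\<^bsub>k\<^esub>"

definition group_algebra ::
    "('k, 'a) ring_scheme \<Rightarrow> ('h, 'b) monoid_scheme \<Rightarrow> ('h \<Rightarrow> 'k) ring" where
  "group_algebra k G =
    \<lparr>carrier = {f \<in> carrier G \<rightarrow>\<^sub>E carrier k. finite {x \<in> carrier G. f x \<noteq> \<zero>\<^bsub>k\<^esub>}},
     mult = (\<lambda>f h. \<lambda>x\<in>carrier G.
       \<Oplus>\<^bsub>k\<^esub>y\<in>{y \<in> carrier G. f y \<noteq> \<zero>\<^bsub>k\<^esub>}. f y \<otimes>\<^bsub>k\<^esub> h (inv\<^bsub>G\<^esub> y \<otimes>\<^bsub>G\<^esub> x)),
     one = (\<lambda>x\<in>carrier G. if x = \<one>\<^bsub>G\<^esub> then \<one>\<^bsub>k\<^esub> else \<zero>\<^bsub>k\<^esub>),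
     zero = (\<lambda>x\<in>carrier G. \<zero>\<^bsub>k\<^esub>),
     add = (\<lambda>f h. \<lambda>x\<in>carrier G. f x \<oplus>\<^bsub>k\<^esub> h x)\<rparr>"

text \<open>If every member of the finite set of cosets \<open>A\<close> is contained in exactly one member of the
  set of cosets \<open>B\<close>, then \<open>coset_push k A B\<close> is the \<open>k\<close>-linear extension of the map \<open>A \<rightarrow> B\<close>
  sending a coset to the one containing it.  For \<open>N \<subseteq> M\<close> this is the canonical map
  \<open>k[G/N] \<rightarrow> k[G/M]\<close>; for a subgroup \<open>H\<close> of \<open>G\<close> it is \<open>k[H/(H \<inter> N)] \<rightarrow> k[G/N]\<close>.\<close>

definition coset_push ::
    "('k, 'a) ring_scheme \<Rightarrow> 'g set set \<Rightarrow> 'g set set \<Rightarrow> ('g set \<Rightarrow> 'k) \<Rightarrow> 'g set \<Rightarrow> 'k" where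
  "coset_push k A B a = (\<lambda>C\<in>B. \<Oplus>\<^bsub>k\<^esub>D\<in>{D \<in> A. D \<subseteq> C}. a D)"

record 'r top_ring = "'r ring" +
  rtopology :: "'r topology"

type_synonym ('g, 'k) cga = "'g set \<Rightarrow> 'g set \<Rightarrow> 'k"

definition cga_carrier ::
    "('k, 'a) ring_scheme \<Rightarrow> ('g, 'b) top_group_scheme \<Rightarrow> ('g, 'k) cga set" where
  "cga_carrier k G =
    {a \<in> (\<Pi>\<^sub>E N\<in>open_normal_subgroups G. carrier (group_algebra k (G Mod N))).
      \<forall>N\<in>open_normal_subgroups G. \<forall>M\<in>open_normal_subgroups G. N \<subseteq> M \<longrightarrow>
        a M = coset_push k (carrier (G Mod N)) (carrier (G Mod M)) (a N)}"

text \<open>The topology is that of an inverse limit of discrete spaces, which is the intended one for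
  finite \<open>k\<close>.\<close>

definition completed_group_algebra ::
    "('k, 'a) ring_scheme \<Rightarrow> ('g, 'b) top_group_scheme \<Rightarrow> ('g, 'k) cga top_ring" where
  "completed_group_algebra k G =
    \<lparr>carrier = cga_carrier k G,
     mult = (\<lambda>a b. \<lambda>N\<in>open_normal_subgroups G. a N \<otimes>\<^bsub>group_algebra k (G Mod N)\<^esub> b N),
     one = (\<lambda>N\<in>open_normal_subgroups G. \<one>\<^bsub>group_algebra k (G Mod N)\<^esub>),
     zero = (\<lambda>N\<in>open_normal_subgroups G. \<zero>\<^bsub>group_algebra k (G Mod N)\<^esub>),
     add = (\<lambda>a b. \<lambda>N\<in>open_normal_subgroups G. a N \<oplus>\<^bsub>group_algebra k (G Mod N)\<^esub> b N),
     rtopology = subtopology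
       (product_topology (\<lambda>N. discrete_topology (carrier (group_algebra k (G Mod N))))
         (open_normal_subgroups G))
       (cga_carrier k G)\<rparr>"

text \<open>The canonical map \<open>k[[H]] \<rightarrow> k[[G]]\<close> for a closed subgroup \<open>H\<close> of \<open>G\<close>.\<close>

definition cga_incl ::
    "('k, 'a) ring_scheme \<Rightarrow> ('g, 'b) top_group_scheme \<Rightarrow> 'g set \<Rightarrow> ('g, 'k) cga \<Rightarrow> ('g, 'k) cga" where
  "cga_incl k G H b = (\<lambda>N\<in>open_normal_subgroups G.
     coset_push k (carrier (sub_top_group G H Mod (H \<inter> N))) (carrier (G Mod N)) (b (H \<inter> N)))"


section \<open>Profinite modules\<close>

text \<open>The locale \<open>module\<close> of HOL-Algebra is restricted to commutative rings, so left modules over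
  arbitrary rings are introduced here, with the same axioms.\<close>

locale left_module = R?: ring R + M?: abelian_group M
    for R :: "('r, 'a) ring_scheme" (structure) and M :: "('r, 'm, 'b) module_scheme" (structure) +
  assumes smult_closed [simp, intro]:
      "\<lbrakk>a \<in> carrier R; x \<in> carrier M\<rbrakk> \<Longrightarrow> a \<odot>\<^bsub>M\<^esub> x \<in> carrier M"
    and smult_l_distr:
      "\<lbrakk>a \<in> carrier R; b \<in> carrier R; x \<in> carrier M\<rbrakk> \<Longrightarrow>
        (a \<oplus>\<^bsub>R\<^esub> b) \<odot>\<^bsub>M\<^esub> x = a \<odot>\<^bsub>M\<^esub> x \<oplus>\<^bsub>M\<^esub> b \<odot>\<^bsub>M\<^esub> x"
    and smult_r_distr:
      "\<lbrakk>a \<in> carrier R; x \<in> carrier M; y \<in> carrier M\<rbrakk> \<Longrightarrow>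
        a \<odot>\<^bsub>M\<^esub> (x \<oplus>\<^bsub>M\<^esub> y) = a \<odot>\<^bsub>M\<^esub> x \<oplus>\<^bsub>M\<^esub> a \<odot>\<^bsub>M\<^esub> y"
    and smult_assoc1:
      "\<lbrakk>a \<in> carrier R; b \<in> carrier R; x \<in> carrier M\<rbrakk> \<Longrightarrow>
        (a \<otimes>\<^bsub>R\<^esub> b) \<odot>\<^bsub>M\<^esub> x = a \<odot>\<^bsub>M\<^esub> (b \<odot>\<^bsub>M\<^esub> x)"
    and smult_one [simp]: "x \<in> carrier M \<Longrightarrow> \<one>\<^bsub>R\<^esub> \<odot>\<^bsub>M\<^esub> x = x"

record ('r, 'm) top_module = "('r, 'm) module" +
  mtopology :: "'m topology"

locale profinite_module = left_module R M
    for R :: "('r, 'a) top_ring_scheme" (structure)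
      and M :: "('r, 'm, 'b) top_module_scheme" (structure) +
  assumes topspace_mtopology: "topspace (mtopology M) = carrier M"
    and continuous_add:
      "continuous_map (prod_topology (mtopology M) (mtopology M)) (mtopology M)
        (\<lambda>(x, y). x \<oplus>\<^bsub>M\<^esub> y)"
    and continuous_smult:
      "continuous_map (prod_topology (rtopology R) (mtopology M)) (mtopology M)
        (\<lambda>(r, x). r \<odot>\<^bsub>M\<^esub> x)"
    and profinite_topology: "profinite_space (mtopology M)"

definition continuous_hom ::
    "('r, 'a) ring_scheme \<Rightarrow> ('r, 'm, 'b) top_module_scheme \<Rightarrow> ('r, 'n, 'c) top_module_scheme
      \<Rightarrow> ('m \<Rightarrow> 'n) set" where
  "continuous_hom R M N =
    {f \<in> carrier M \<rightarrow> carrier N.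
      (\<forall>x\<in>carrier M. \<forall>y\<in>carrier M. f (x \<oplus>\<^bsub>M\<^esub> y) = f x \<oplus>\<^bsub>N\<^esub> f y) \<and>
      (\<forall>r\<in>carrier R. \<forall>x\<in>carrier M. f (r \<odot>\<^bsub>M\<^esub> x) = r \<odot>\<^bsub>N\<^esub> f x) \<and>
      continuous_map (mtopology M) (mtopology N) f}"

definition continuous_epi ::
    "('r, 'a) ring_scheme \<Rightarrow> ('r, 'm, 'b) top_module_scheme \<Rightarrow> ('r, 'n, 'c) top_module_scheme
      \<Rightarrow> ('m \<Rightarrow> 'n) set" where
  "continuous_epi R M N = {f \<in> continuous_hom R M N. f ` carrier M = carrier N}"

definition restrict_scalars ::
    "('r \<Rightarrow> 'r) \<Rightarrow> ('r, 'm, 'b) top_module_scheme \<Rightarrow> ('r, 'm, 'b) top_module_scheme" where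
  "restrict_scalars \<theta> M = M\<lparr>smult := (\<lambda>r x. \<theta> r \<odot>\<^bsub>M\<^esub> x)\<rparr>"

text \<open>Generation of profinite modules is topological.\<close>

definition finitely_generated_module ::
    "('r, 'a) ring_scheme \<Rightarrow> ('r, 'm, 'b) top_module_scheme \<Rightarrow> bool" where
  "finitely_generated_module R M \<longleftrightarrow>
    (\<exists>X. finite X \<and> X \<subseteq> carrier M \<and>
      (\<forall>N. submodule N R M \<and> closedin (mtopology M) N \<and> X \<subseteq> N \<longrightarrow> N = carrier M))"

definition direct_sum_decomposition ::
    "('r, 'a) ring_scheme \<Rightarrow> ('r, 'm, 'b) top_module_scheme \<Rightarrow> 'm set \<Rightarrow> 'm set \<Rightarrow> bool" where
  "direct_sum_decomposition R M A B \<longleftrightarrow>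
    submodule A R M \<and> submodule B R M \<and>
    homeomorphic_map
      (prod_topology (subtopology (mtopology M) A) (subtopology (mtopology M) B))
      (mtopology M) (\<lambda>(x, y). x \<oplus>\<^bsub>M\<^esub> y)"

definition indecomposable_module ::
    "('r, 'a) ring_scheme \<Rightarrow> ('r, 'm, 'b) top_module_scheme \<Rightarrow> bool" where
  "indecomposable_module R M \<longleftrightarrow>
    carrier M \<noteq> {\<zero>\<^bsub>M\<^esub>} \<and>
    (\<forall>A B. direct_sum_decomposition R M A B \<longrightarrow> A = {\<zero>\<^bsub>M\<^esub>} \<or> B = {\<zero>\<^bsub>M\<^esub>})"


section \<open>Relative projectivity and vertices\<close>

definition relative_lifting ::
    "('k, 'a) ring_scheme \<Rightarrow> ('g, 'b) top_group_scheme \<Rightarrow> 'g set \<Rightarrow>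
      (('g, 'k) cga, 'u) top_module \<Rightarrow> (('g, 'k) cga, 'v) top_module \<Rightarrow>
      (('g, 'k) cga, 'w) top_module \<Rightarrow> bool" where
  "relative_lifting k G H U V W \<longleftrightarrow>
    (\<forall>\<beta>\<in>continuous_epi (completed_group_algebra k G) V W.
     \<forall>\<phi>\<in>continuous_hom (completed_group_algebra k G) U W.
       (\<exists>\<psi>\<in>continuous_hom (completed_group_algebra k (sub_top_group G H))
             (restrict_scalars (cga_incl k G H) U) (restrict_scalars (cga_incl k G H) V).
          \<forall>u\<in>carrier U. \<beta> (\<psi> u) = \<phi> u) \<longrightarrow>
       (\<exists>\<rho>\<in>continuous_hom (completed_group_algebra k G) U V.
          \<forall>u\<in>carrier U. \<beta> (\<rho> u) = \<phi> u))"

text \<open>HOL cannot quantify over all types inside a definition, so the test modules \<open>V\<close> and \<open>W\<close>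
  range over the profinite modules carried by subsets of the type \<open>test_universe\<close> below.  This is
  no restriction: by \<open>relatively_projective_lifting\<close> the lifting property then
  holds for profinite modules \<open>V\<close> and \<open>W\<close> carried by arbitrary types.\<close>

type_synonym ('g, 'k, 'u) test_universe = "(('g, 'k) cga \<times> 'u) list set set"

definition relatively_projective ::
    "('k, 'a) ring_scheme \<Rightarrow> ('g, 'b) top_group_scheme \<Rightarrow> 'g set \<Rightarrow>
      (('g, 'k) cga, 'u) top_module \<Rightarrow> bool" where
  "relatively_projective k G H U \<longleftrightarrow>
    (\<forall>(V :: (('g, 'k) cga, ('g, 'k, 'u) test_universe) top_module)
      (W :: (('g, 'k) cga, ('g, 'k, 'u) test_universe) top_module).
        profinite_module (completed_group_algebra k G) V \<and>
        profinite_module (completed_group_algebra k G) W \<longrightarrow>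
        relative_lifting k G H U V W)"

definition is_vertex ::
    "('k, 'a) ring_scheme \<Rightarrow> ('g, 'b) top_group_scheme \<Rightarrow>
      (('g, 'k) cga, 'u) top_module \<Rightarrow> 'g set \<Rightarrow> bool" where
  "is_vertex k G U Q \<longleftrightarrow>
    closed_subgroup Q G \<and> relatively_projective k G Q U \<and>
    (\<forall>Q'. closed_subgroup Q' G \<and> Q' \<subset> Q \<longrightarrow> \<not> relatively_projective k G Q' U)"


section \<open>Independence of the test universe\<close>

lemma profinite_space_homeomorphic:
  assumes h: "homeomorphic_map X Y f" and Y: "profinite_space Y"
  shows "profinite_space X"
proof -
  have sp: "X homeomorphic_space Y"
    by (rule homeomorphic_map_imp_homeomorphic_space[OF h])
  have "totally_disconnected_space X"
    unfolding totally_disconnected_space_def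
  proof (intro allI impI)
    fix S assume S: "connectedin X S"
    then have "connectedin Y (f ` S)"
      by (rule connectedin_continuous_map_image[OF homeomorphic_imp_continuous_map[OF h]])
    then obtain a where "f ` S \<subseteq> {a}"
      using Y unfolding profinite_space_def totally_disconnected_space_def by blast
    moreover have "inj_on f S"
      using h S inj_on_subset by (auto simp: homeomorphic_map_def connectedin_def)
    ultimately have eq: "x = y" if "x \<in> S" "y \<in> S" for x y
      using that by (auto simp: inj_on_def image_subset_iff)
    show "\<exists>a. S \<subseteq> {a}"
    proof (cases "S = {}")
      case False
      then obtain x where "x \<in> S" by blast
      then have "S \<subseteq> {x}" using eq by blast
      then show ?thesis by blast
    qed simp
  qed
  then show ?thesis
    using Y homeomorphic_compact_space[OF sp] homeomorphic_Hausdorff_space[OF sp]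
    by (simp add: profinite_space_def)
qed

lemma profinite_space_closed_subtopology:
  assumes "profinite_space X" "closedin X S"
  shows "profinite_space (subtopology X S)"
  using assms unfolding profinite_space_def totally_disconnected_space_def
  by (auto simp: connectedin_subtopology Hausdorff_space_subtopology
      closedin_compact_space compact_space_subtopology)

definition transport_module ::
    "('m \<Rightarrow> 'n) \<Rightarrow> 'm set \<Rightarrow> ('r, 'm, 'b) top_module_scheme \<Rightarrow> ('r, 'n) top_module" where
  "transport_module i N M =
    \<lparr>carrier = i ` N, mult = undefined, one = undefined, zero = i \<zero>\<^bsub>M\<^esub>,
     add = (\<lambda>x y. i (inv_into N i x \<oplus>\<^bsub>M\<^esub> inv_into N i y)),
     smult = (\<lambda>r x. i (r \<odot>\<^bsub>M\<^esub> inv_into N i x)),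
     mtopology = pullback_topology (i ` N) (inv_into N i) (mtopology M)\<rparr>"

lemma submodule_facts:
  assumes N: "submodule N R M"
  shows "N \<subseteq> carrier M" "\<zero>\<^bsub>M\<^esub> \<in> N"
    "\<And>x y. \<lbrakk>x \<in> N; y \<in> N\<rbrakk> \<Longrightarrow> x \<oplus>\<^bsub>M\<^esub> y \<in> N"
    "\<And>x. x \<in> N \<Longrightarrow> \<ominus>\<^bsub>M\<^esub> x \<in> N"
    "\<And>r x. \<lbrakk>r \<in> carrier R; x \<in> N\<rbrakk> \<Longrightarrow> r \<odot>\<^bsub>M\<^esub> x \<in> N"
proof -
  interpret S: submodule N R M by (fact N)
  show "N \<subseteq> carrier M" using S.subset by simp
  show "\<zero>\<^bsub>M\<^esub> \<in> N" using S.one_closed by simp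
  show "\<And>x y. \<lbrakk>x \<in> N; y \<in> N\<rbrakk> \<Longrightarrow> x \<oplus>\<^bsub>M\<^esub> y \<in> N" using S.m_closed by simp
  show "\<And>x. x \<in> N \<Longrightarrow> \<ominus>\<^bsub>M\<^esub> x \<in> N" using S.m_inv_closed by (simp add: a_inv_def)
  show "\<And>r x. \<lbrakk>r \<in> carrier R; x \<in> N\<rbrakk> \<Longrightarrow> r \<odot>\<^bsub>M\<^esub> x \<in> N" using S.smult_closed by simp
qed

context
  fixes R :: "('r, 'a) top_ring_scheme" and M :: "('r, 'm, 'b) top_module_scheme"
    and N :: "'m set" and i :: "'m \<Rightarrow> 'n"
  assumes M: "profinite_module R M" and N: "submodule N R M"
    and cl: "closedin (mtopology M) N" and inj: "inj_on i N"
begin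

interpretation M: profinite_module R M by (fact M)

lemmas transported_facts = submodule_facts[OF N]

lemma transport_homeomorphic:
  "homeomorphic_map (mtopology (transport_module i N M)) (subtopology (mtopology M) N)
     (inv_into N i)"
proof -
  let ?j = "inv_into N i" and ?T = "mtopology (transport_module i N M)"
  have T: "?T = pullback_topology (i ` N) ?j (mtopology M)"
    by (simp add: transport_module_def)
  have j: "?j (i x) = x" if "x \<in> N" for x using that inj by simp
  have top: "topspace ?T = i ` N"
    using transported_facts(1) M.topspace_mtopology
    by (auto simp: T topspace_pullback_topology j)
  have c1: "continuous_map ?T (mtopology M) ?j"
  proof -
    have "continuous_map ?T (mtopology M) (id \<circ> ?j)"
      unfolding T by (rule continuous_map_pullback) simp
    then show ?thesis by simp
  qed
  have c2: "continuous_map (subtopology (mtopology M) N) ?T i"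
    unfolding T
  proof (rule continuous_map_pullback')
    show "continuous_map (subtopology (mtopology M) N) (mtopology M) (?j \<circ> i)"
      by (rule continuous_map_eq[of _ _ id]) (auto simp: j continuous_map_from_subtopology)
    show "topspace (subtopology (mtopology M) N) \<subseteq> i -` i ` N" by auto
  qed
  have "homeomorphic_maps ?T (subtopology (mtopology M) N) ?j i"
    unfolding homeomorphic_maps_def
    using c1 c2 top j transported_facts(1)
    by (auto simp: continuous_map_in_subtopology)
  then show ?thesis using homeomorphic_maps_map by blast
qed

lemma continuous_into_transport:
  assumes f: "continuous_map X (mtopology M) f" and im: "\<And>x. x \<in> topspace X \<Longrightarrow> f x \<in> N"
  shows "continuous_map X (mtopology (transport_module i N M)) (\<lambda>x. i (f x))"
proof -
  have "continuous_map X (pullback_topology (i ` N) (inv_into N i) (mtopology M)) (\<lambda>x. i (f x))"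
  proof (rule continuous_map_pullback')
    show "continuous_map X (mtopology M) (inv_into N i \<circ> (\<lambda>x. i (f x)))"
      by (rule continuous_map_eq[OF f]) (use im inj in auto)
    show "topspace X \<subseteq> (\<lambda>x. i (f x)) -` i ` N" using im by auto
  qed
  then show ?thesis by (simp add: transport_module_def)
qed

lemma transport_inv_hom:
  "inv_into N i \<in> continuous_hom R (transport_module i N M) M"
proof -
  have "continuous_map (mtopology (transport_module i N M)) (mtopology M) (inv_into N i)"
    using transport_homeomorphic homeomorphic_imp_continuous_map
    by (metis continuous_map_in_subtopology)
  then show ?thesis
    using transported_facts inj
    by (auto simp: continuous_hom_def transport_module_def)
qed

lemma continuous_hom_into_transport:
  assumes f: "f \<in> continuous_hom R' X (restrict_scalars \<theta> M)"
    and X: "topspace (mtopology X) = carrier X"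
    and im: "\<And>x. x \<in> carrier X \<Longrightarrow> f x \<in> N"
  shows "(\<lambda>x. i (f x)) \<in> continuous_hom R' X (restrict_scalars \<theta> (transport_module i N M))"
proof -
  have "continuous_map (mtopology X) (mtopology M) f"
    using f by (simp add: continuous_hom_def restrict_scalars_def)
  then have "continuous_map (mtopology X) (mtopology (transport_module i N M)) (\<lambda>x. i (f x))"
    by (rule continuous_into_transport) (use X im in simp)
  then show ?thesis
    using f im inj by (simp add: continuous_hom_def restrict_scalars_def transport_module_def)
qed

lemma transport_profinite:
  assumes topR: "topspace (rtopology R) = carrier R"
  shows "profinite_module R (transport_module i N M)"
proof -
  let ?j = "inv_into N i" and ?M = "transport_module i N M"
  have j: "?j (i x) = x" if "x \<in> N" for x using that inj by simp
  have inN: "x \<in> carrier M" if "x \<in> N" for x using transported_facts(1) that by blast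
  have top: "topspace (mtopology ?M) = carrier ?M"
    using transported_facts(1) M.topspace_mtopology
    by (auto simp: transport_module_def topspace_pullback_topology j)
  have cj: "continuous_map (mtopology ?M) (mtopology M) ?j"
    using transport_inv_hom by (simp add: continuous_hom_def)
  have jN: "?j x \<in> N" if "x \<in> carrier ?M" for x
    using that by (auto simp: transport_module_def j)
  have "abelian_group ?M"
  proof (rule abelian_groupI)
    show "\<exists>y\<in>carrier ?M. y \<oplus>\<^bsub>?M\<^esub> x = \<zero>\<^bsub>?M\<^esub>" if "x \<in> carrier ?M" for x
    proof -
      obtain y where y: "y \<in> N" "x = i y" using \<open>x \<in> carrier ?M\<close>
        by (auto simp: transport_module_def)
      have "i (\<ominus>\<^bsub>M\<^esub> y) \<oplus>\<^bsub>?M\<^esub> x = \<zero>\<^bsub>?M\<^esub>" "i (\<ominus>\<^bsub>M\<^esub> y) \<in> carrier ?M"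
        using y transported_facts inN by (auto simp: transport_module_def j M.l_neg)
      then show ?thesis by blast
    qed
  qed (use transported_facts inN in \<open>auto simp: transport_module_def j M.a_ac\<close>)
  moreover have "ring R" by (rule M.R.ring_axioms)
  moreover have "left_module_axioms R ?M"
    by unfold_locales
      (use transported_facts inN in \<open>auto simp: transport_module_def j M.smult_l_distr M.smult_r_distr
         M.smult_assoc1\<close>)
  moreover have "profinite_module_axioms R ?M"
  proof
    show "topspace (mtopology ?M) = carrier ?M" by (fact top)
    show "profinite_space (mtopology ?M)"
      using transport_homeomorphic profinite_space_closed_subtopology[OF M.profinite_topology cl]
        profinite_space_homeomorphic by blast
    have "continuous_map (prod_topology (mtopology ?M) (mtopology ?M)) (mtopology M)
        ((\<lambda>(x, y). x \<oplus>\<^bsub>M\<^esub> y) \<circ> (\<lambda>(x, y). (?j x, ?j y)))"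
      by (rule continuous_map_compose[OF _ M.continuous_add])
        (use cj in \<open>simp add: continuous_map_prod_top\<close>)
    then have "continuous_map (prod_topology (mtopology ?M) (mtopology ?M)) (mtopology M)
        (\<lambda>z. ?j (fst z) \<oplus>\<^bsub>M\<^esub> ?j (snd z))"
      by (simp add: o_def case_prod_beta)
    from continuous_into_transport[OF this]
    show "continuous_map (prod_topology (mtopology ?M) (mtopology ?M)) (mtopology ?M)
        (\<lambda>(x, y). x \<oplus>\<^bsub>?M\<^esub> y)"
      using transported_facts jN top by (simp add: case_prod_unfold transport_module_def mem_Times_iff)
    have "continuous_map (prod_topology (rtopology R) (mtopology ?M)) (mtopology M)
        ((\<lambda>(x, y). x \<odot>\<^bsub>M\<^esub> y) \<circ> (\<lambda>(x, y). (id x, ?j y)))"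
      by (rule continuous_map_compose[OF _ M.continuous_smult])
        (use cj in \<open>simp add: continuous_map_prod_top\<close>)
    then have "continuous_map (prod_topology (rtopology R) (mtopology ?M)) (mtopology M)
        (\<lambda>z. fst z \<odot>\<^bsub>M\<^esub> ?j (snd z))"
      by (simp add: o_def case_prod_beta)
    from continuous_into_transport[OF this]
    show "continuous_map (prod_topology (rtopology R) (mtopology ?M)) (mtopology ?M)
        (\<lambda>(r, x). r \<odot>\<^bsub>?M\<^esub> x)"
      using transported_facts jN top topR by (simp add: case_prod_unfold transport_module_def mem_Times_iff)
  qed
  ultimately show ?thesis
    by (simp add: profinite_module_def left_module_def)
qed

end


lemma (in abelian_group) add_idem_zero:
  assumes "x \<in> carrier G" "x \<oplus> x = x"
  shows "x = \<zero>"
  using assms by (metis add.inv_solve_left' a_inv_closed add.r_inv_ex a_assoc r_zero r_neg)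

lemma (in left_module) smult_minus_one:
  assumes "x \<in> carrier M"
  shows "(\<ominus>\<^bsub>R\<^esub> \<one>\<^bsub>R\<^esub>) \<odot>\<^bsub>M\<^esub> x = \<ominus>\<^bsub>M\<^esub> x"
proof -
  have "\<zero>\<^bsub>R\<^esub> \<odot>\<^bsub>M\<^esub> x \<oplus>\<^bsub>M\<^esub> \<zero>\<^bsub>R\<^esub> \<odot>\<^bsub>M\<^esub> x = \<zero>\<^bsub>R\<^esub> \<odot>\<^bsub>M\<^esub> x"
    using assms by (simp flip: smult_l_distr)
  then have z: "\<zero>\<^bsub>R\<^esub> \<odot>\<^bsub>M\<^esub> x = \<zero>\<^bsub>M\<^esub>"
    using assms by (intro M.add_idem_zero) auto
  have "(\<ominus>\<^bsub>R\<^esub> \<one>\<^bsub>R\<^esub>) \<odot>\<^bsub>M\<^esub> x \<oplus>\<^bsub>M\<^esub> x = (\<ominus>\<^bsub>R\<^esub> \<one>\<^bsub>R\<^esub> \<oplus>\<^bsub>R\<^esub> \<one>\<^bsub>R\<^esub>) \<odot>\<^bsub>M\<^esub> x"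
    using assms by (subst smult_l_distr) auto
  also have "\<dots> = \<zero>\<^bsub>M\<^esub>" using z by (simp add: R.l_neg)
  finally show ?thesis using assms by (metis M.minus_equality R.a_inv_closed R.one_closed smult_closed)
qed

lemma (in left_module) left_submoduleI:
  assumes "H \<subseteq> carrier M" "\<zero>\<^bsub>M\<^esub> \<in> H"
    and "\<And>x y. \<lbrakk>x \<in> H; y \<in> H\<rbrakk> \<Longrightarrow> x \<oplus>\<^bsub>M\<^esub> y \<in> H"
    and sm: "\<And>r x. \<lbrakk>r \<in> carrier R; x \<in> H\<rbrakk> \<Longrightarrow> r \<odot>\<^bsub>M\<^esub> x \<in> H"
  shows "submodule H R M"
proof -
  have "\<ominus>\<^bsub>M\<^esub> x \<in> H" if "x \<in> H" for x
    using sm[of "\<ominus>\<^bsub>R\<^esub> \<one>\<^bsub>R\<^esub>" x] that assms(1) by (auto simp: smult_minus_one)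
  then show ?thesis
    using assms by (auto intro!: submodule.intro subgroup.intro submodule_axioms.intro simp flip: a_inv_def)
qed

definition lin_comb ::
    "('r, 'm, 'b) module_scheme \<Rightarrow> ('u \<Rightarrow> 'm) \<Rightarrow> ('r \<times> 'u) list \<Rightarrow> 'm" where
  "lin_comb M f l = foldr (\<lambda>(r, u) s. r \<odot>\<^bsub>M\<^esub> f u \<oplus>\<^bsub>M\<^esub> s) l \<zero>\<^bsub>M\<^esub>"

context profinite_module
begin

lemma submodule_closure:
  assumes S: "S \<subseteq> carrier M" "\<zero>\<^bsub>M\<^esub> \<in> S"
    and add: "\<And>x y. \<lbrakk>x \<in> S; y \<in> S\<rbrakk> \<Longrightarrow> x \<oplus>\<^bsub>M\<^esub> y \<in> S"
    and sm: "\<And>r x. \<lbrakk>r \<in> carrier R; x \<in> S\<rbrakk> \<Longrightarrow> r \<odot>\<^bsub>M\<^esub> x \<in> S"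
    and topR: "topspace (rtopology R) = carrier R"
  shows "submodule (Abstract_Topology.closure_of (mtopology M) S) R M"
proof (rule left_submoduleI)
  let ?T = "mtopology M"
  let ?C = "Abstract_Topology.closure_of ?T S"
  show "?C \<subseteq> carrier M" using closure_of_subset_topspace topspace_mtopology by metis
  show "\<zero>\<^bsub>M\<^esub> \<in> ?C" using S closure_of_subset topspace_mtopology by (metis subsetD)
  show "x \<oplus>\<^bsub>M\<^esub> y \<in> ?C" if "x \<in> ?C" "y \<in> ?C" for x y
  proof -
    have "(x, y) \<in> Abstract_Topology.closure_of (prod_topology ?T ?T) (S \<times> S)"
      using that by (simp add: closure_of_Times)
    then have "x \<oplus>\<^bsub>M\<^esub> y \<in> (\<lambda>(x, y). x \<oplus>\<^bsub>M\<^esub> y) ` Abstract_Topology.closure_of (prod_topology ?T ?T) (S \<times> S)"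
      by force
    then have "x \<oplus>\<^bsub>M\<^esub> y \<in> Abstract_Topology.closure_of ?T ((\<lambda>(x, y). x \<oplus>\<^bsub>M\<^esub> y) ` (S \<times> S))"
      using continuous_map_image_closure_subset[OF continuous_add] by blast
    moreover have "(\<lambda>(x, y). x \<oplus>\<^bsub>M\<^esub> y) ` (S \<times> S) \<subseteq> S" using add by auto
    ultimately show ?thesis using closure_of_mono by blast
  qed
  show "r \<odot>\<^bsub>M\<^esub> x \<in> ?C" if "r \<in> carrier R" "x \<in> ?C" for r x
  proof -
    have "continuous_map ?T ?T ((\<lambda>(r, x). r \<odot>\<^bsub>M\<^esub> x) \<circ> (\<lambda>x. (r, x)))"
      by (rule continuous_map_compose[OF _ continuous_smult])
        (use that topR in \<open>simp add: continuous_map_pairedI\<close>)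
    then have "continuous_map ?T ?T (\<lambda>x. r \<odot>\<^bsub>M\<^esub> x)" by (simp add: o_def)
    from continuous_map_image_closure_subset[OF this, of S]
    have "r \<odot>\<^bsub>M\<^esub> x \<in> Abstract_Topology.closure_of ?T ((\<lambda>x. r \<odot>\<^bsub>M\<^esub> x) ` S)" using that by blast
    moreover have "(\<lambda>x. r \<odot>\<^bsub>M\<^esub> x) ` S \<subseteq> S" using sm that by auto
    ultimately show ?thesis using closure_of_mono by blast
  qed
qed

lemma lin_comb_props:
  assumes f: "f \<in> A \<rightarrow> carrier M"
  defines "L \<equiv> lists (carrier R \<times> A)"
  shows "l \<in> L \<Longrightarrow> lin_comb M f l \<in> carrier M"
    and "l \<in> L \<Longrightarrow> l' \<in> L \<Longrightarrow>
      lin_comb M f (l @ l') = lin_comb M f l \<oplus>\<^bsub>M\<^esub> lin_comb M f l'"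
    and "l \<in> L \<Longrightarrow> r \<in> carrier R \<Longrightarrow>
      lin_comb M f (map (\<lambda>(s, u). (r \<otimes>\<^bsub>R\<^esub> s, u)) l) = r \<odot>\<^bsub>M\<^esub> lin_comb M f l"
    and "u \<in> A \<Longrightarrow> lin_comb M f [(\<one>\<^bsub>R\<^esub>, u)] = f u"
proof -
  have cl: "lin_comb M f l \<in> carrier M" if "l \<in> L" for l
    using that f unfolding L_def by (induction l) (auto simp: lin_comb_def)
  then show "l \<in> L \<Longrightarrow> lin_comb M f l \<in> carrier M" .
  show "lin_comb M f (l @ l') = lin_comb M f l \<oplus>\<^bsub>M\<^esub> lin_comb M f l'" if "l \<in> L" "l' \<in> L"
    using that(1)
  proof (induction l)
    case Nil
    then show ?case using cl[OF that(2)] by (simp add: lin_comb_def)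
  next
    case (Cons a l)
    then have "l \<in> L" "fst a \<in> carrier R" "snd a \<in> A" by (auto simp: L_def)
    moreover from this f have "fst a \<odot>\<^bsub>M\<^esub> f (snd a) \<in> carrier M" by auto
    ultimately show ?case using Cons cl[OF that(2)] cl[of l]
      by (simp add: lin_comb_def case_prod_beta M.a_assoc)
  qed
  show "lin_comb M f (map (\<lambda>(s, u). (r \<otimes>\<^bsub>R\<^esub> s, u)) l) = r \<odot>\<^bsub>M\<^esub> lin_comb M f l"
    if "l \<in> L" "r \<in> carrier R"
    using that(1)
  proof (induction l)
    case Nil
    have "r \<odot>\<^bsub>M\<^esub> \<zero>\<^bsub>M\<^esub> \<oplus>\<^bsub>M\<^esub> r \<odot>\<^bsub>M\<^esub> \<zero>\<^bsub>M\<^esub> = r \<odot>\<^bsub>M\<^esub> \<zero>\<^bsub>M\<^esub>"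
      using that(2) by (simp flip: smult_r_distr)
    then have "r \<odot>\<^bsub>M\<^esub> \<zero>\<^bsub>M\<^esub> = \<zero>\<^bsub>M\<^esub>"
      using that(2) by (intro M.add_idem_zero) auto
    then show ?case by (simp add: lin_comb_def)
  next
    case (Cons a l)
    then have "l \<in> L" "fst a \<in> carrier R" "snd a \<in> A" by (auto simp: L_def)
    with Cons cl[of l] f that(2) show ?case
      by (auto simp: lin_comb_def case_prod_beta smult_r_distr smult_assoc1 Pi_iff)
  qed
  show "u \<in> A \<Longrightarrow> lin_comb M f [(\<one>\<^bsub>R\<^esub>, u)] = f u"
    using f by (simp add: lin_comb_def Pi_iff)
qed

text \<open>A profinite module topologically generated by the image of \<open>f\<close> has at most as many elements
  as there are families of sets of formal linear combinations: a point is determined by the traces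
  of its neighbourhoods on a dense subset.\<close>

lemma small_closed_submodule:
  fixes f :: "'u \<Rightarrow> 'm"
  assumes f: "f \<in> A \<rightarrow> carrier M" and topR: "topspace (rtopology R) = carrier R"
  obtains N and i :: "'m \<Rightarrow> ('r \<times> 'u) list set set"
  where "submodule N R M" "closedin (mtopology M) N" "f ` A \<subseteq> N" "inj_on i N"
proof -
  let ?T = "mtopology M"
  define L where "L = lists (carrier R \<times> A)"
  define S where "S = lin_comb M f ` L"
  define N where "N = Abstract_Topology.closure_of ?T S"
  define i where "i x = {{l \<in> L. lin_comb M f l \<in> Z} | Z. openin ?T Z \<and> x \<in> Z}" for x
  note lc = lin_comb_props[OF f, folded L_def]
  have SM: "S \<subseteq> carrier M" using lc(1) by (auto simp: S_def)
  have sub: "submodule N R M"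
    unfolding N_def
  proof (rule submodule_closure[OF SM _ _ _ topR])
    show "\<zero>\<^bsub>M\<^esub> \<in> S" unfolding S_def
      by (rule image_eqI[of _ _ "[]"]) (auto simp: lin_comb_def L_def)
    show "x \<oplus>\<^bsub>M\<^esub> y \<in> S" if "x \<in> S" "y \<in> S" for x y
    proof -
      obtain l l' where l: "l \<in> L" "l' \<in> L" "x = lin_comb M f l" "y = lin_comb M f l'"
        using \<open>x \<in> S\<close> \<open>y \<in> S\<close> by (auto simp: S_def)
      then have "l @ l' \<in> L" by (auto simp: L_def)
      then show ?thesis using lc(2)[OF l(1,2)] l(3,4) by (metis S_def image_eqI)
    qed
    show "r \<odot>\<^bsub>M\<^esub> x \<in> S" if r: "r \<in> carrier R" and "x \<in> S" for r x
    proof -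
      obtain l where l: "l \<in> L" "x = lin_comb M f l"
        using \<open>x \<in> S\<close> by (auto simp: S_def)
      then have "map (\<lambda>(s, u). (r \<otimes>\<^bsub>R\<^esub> s, u)) l \<in> L" using r
        by (auto simp: L_def in_lists_conv_set dest!: bspec)
      then show ?thesis using lc(3)[OF l(1) r] l(2) by (metis S_def image_eqI)
    qed
  qed
  have inS: "f ` A \<subseteq> S"
  proof
    fix x assume "x \<in> f ` A"
    then obtain u where "u \<in> A" "x = f u" by auto
    then show "x \<in> S" unfolding S_def
      by (intro image_eqI[of _ _ "[(\<one>\<^bsub>R\<^esub>, u)]"]) (auto simp: lc(4) L_def)
  qed
  have "S \<subseteq> N" unfolding N_def
    by (rule closure_of_subset) (use SM topspace_mtopology in simp)
  have "inj_on i N"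
  proof (rule inj_onI, rule ccontr)
    fix x y assume xy: "x \<in> N" "y \<in> N" "i x = i y" "x \<noteq> y"
    have "x \<in> topspace ?T" "y \<in> topspace ?T"
      using xy unfolding N_def by (meson in_closure_of)+
    then obtain X Y where XY: "openin ?T X" "openin ?T Y" "x \<in> X" "y \<in> Y" "disjnt X Y"
      using profinite_topology xy(4) unfolding profinite_space_def Hausdorff_space_def by metis
    have "{l \<in> L. lin_comb M f l \<in> X} \<in> i x"
      using XY(1,3) unfolding i_def by blast
    then have "{l \<in> L. lin_comb M f l \<in> X} \<in> i y" using xy(3) by simp
    then obtain Z where Z: "openin ?T Z" "y \<in> Z"
      "{l \<in> L. lin_comb M f l \<in> X} = {l \<in> L. lin_comb M f l \<in> Z}"
      unfolding i_def by blast
    have "openin ?T (Y \<inter> Z)" "y \<in> Y \<inter> Z" using XY Z by auto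
    then obtain s where "s \<in> S" "s \<in> Y \<inter> Z"
      using xy(2) unfolding N_def in_closure_of by blast
    then obtain l where "l \<in> L" "lin_comb M f l \<in> Y \<inter> Z" by (auto simp: S_def)
    with Z(3) have "lin_comb M f l \<in> X" by blast
    with \<open>lin_comb M f l \<in> Y \<inter> Z\<close> XY(5) show False by (auto simp: disjnt_def)
  qed
  moreover have "closedin ?T N" by (simp add: N_def)
  ultimately show thesis using that[of N i] sub inS \<open>S \<subseteq> N\<close> by blast
qed

end

lemma topspace_completed_group_algebra:
  "topspace (rtopology (completed_group_algebra k G)) = carrier (completed_group_algebra k G)"
  by (auto simp: completed_group_algebra_def cga_carrier_def)

theorem relatively_projective_lifting:
  fixes V :: "(('g, 'k) cga, 'v) top_module" and W :: "(('g, 'k) cga, 'w) top_module"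
    and U :: "(('g, 'k) cga, 'u) top_module"
  assumes proj: "relatively_projective k G H U"
    and U: "profinite_module (completed_group_algebra k G) U"
    and V: "profinite_module (completed_group_algebra k G) V"
    and W: "profinite_module (completed_group_algebra k G) W"
  shows "relative_lifting k G H U V W"
  unfolding relative_lifting_def
proof (intro ballI impI)
  let ?R = "completed_group_algebra k G"
  let ?RH = "completed_group_algebra k (sub_top_group G H)"
  let ?res = "\<lambda>M. restrict_scalars (cga_incl k G H) M"
  interpret U: profinite_module ?R U by (fact U)
  interpret V: profinite_module ?R V by (fact V)
  interpret W: profinite_module ?R W by (fact W)
  note topR = topspace_completed_group_algebra[of k G]
  fix \<beta> \<phi>
  assume \<beta>: "\<beta> \<in> continuous_epi ?R V W" and \<phi>: "\<phi> \<in> continuous_hom ?R U W"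
    and ex: "\<exists>\<psi>\<in>continuous_hom ?RH (?res U) (restrict_scalars (cga_incl k G H) V). \<forall>u\<in>carrier U. \<beta> (\<psi> u) = \<phi> u"
  obtain \<psi> where \<psi>: "\<psi> \<in> continuous_hom ?RH (?res U) (restrict_scalars (cga_incl k G H) V)"
    and \<psi>\<phi>: "\<And>u. u \<in> carrier U \<Longrightarrow> \<beta> (\<psi> u) = \<phi> u" using ex by blast
  have \<psi>_in: "\<psi> \<in> carrier U \<rightarrow> carrier V"
    using \<psi> by (auto simp: continuous_hom_def restrict_scalars_def)
  have \<beta>h: "\<beta> \<in> continuous_hom ?R V W" using \<beta> by (simp add: continuous_epi_def)
  obtain N and i :: "'v \<Rightarrow> ('g, 'k, 'u) test_universe"
    where N: "submodule N ?R V" "closedin (mtopology V) N" "\<psi> ` carrier U \<subseteq> N" "inj_on i N"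
    using V.small_closed_submodule[OF \<psi>_in topR] by blast
  note Nf = submodule_facts[OF N(1)]
  define P where "P = \<beta> ` N"
  define j where "j w = i (inv_into N \<beta> w)" for w
  have P: "submodule P ?R W"
  proof (rule W.left_submoduleI)
    show "P \<subseteq> carrier W" using \<beta>h Nf(1) by (auto simp: P_def continuous_hom_def)
    have "\<beta> \<zero>\<^bsub>V\<^esub> \<in> carrier W"
      using \<beta>h V.M.zero_closed by (simp add: continuous_hom_def Pi_iff)
    moreover have "\<beta> (\<zero>\<^bsub>V\<^esub> \<oplus>\<^bsub>V\<^esub> \<zero>\<^bsub>V\<^esub>) = \<beta> \<zero>\<^bsub>V\<^esub> \<oplus>\<^bsub>W\<^esub> \<beta> \<zero>\<^bsub>V\<^esub>"
      using \<beta>h V.M.zero_closed by (simp add: continuous_hom_def del: V.M.l_zero V.M.r_zero)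
    then have "\<beta> \<zero>\<^bsub>V\<^esub> \<oplus>\<^bsub>W\<^esub> \<beta> \<zero>\<^bsub>V\<^esub> = \<beta> \<zero>\<^bsub>V\<^esub>"
      using V.M.l_zero[OF V.M.zero_closed] by simp
    ultimately have "\<beta> \<zero>\<^bsub>V\<^esub> = \<zero>\<^bsub>W\<^esub>"
      by (intro W.M.add_idem_zero)
    then show "\<zero>\<^bsub>W\<^esub> \<in> P" using Nf(2) unfolding P_def by (metis image_eqI)
    show "x \<oplus>\<^bsub>W\<^esub> y \<in> P" if "x \<in> P" "y \<in> P" for x y
    proof -
      obtain a b where ab: "a \<in> N" "b \<in> N" "x = \<beta> a" "y = \<beta> b" using \<open>x \<in> P\<close> \<open>y \<in> P\<close> by (auto simp: P_def)
      then have "x \<oplus>\<^bsub>W\<^esub> y = \<beta> (a \<oplus>\<^bsub>V\<^esub> b)" using \<beta>h Nf(1) by (auto simp: continuous_hom_def subset_iff)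
      then show ?thesis using ab Nf(3) by (auto simp: P_def)
    qed
    show "r \<odot>\<^bsub>W\<^esub> x \<in> P" if "r \<in> carrier ?R" "x \<in> P" for r x
    proof -
      obtain a where a: "a \<in> N" "x = \<beta> a" using \<open>x \<in> P\<close> by (auto simp: P_def)
      then have "r \<odot>\<^bsub>W\<^esub> x = \<beta> (r \<odot>\<^bsub>V\<^esub> a)" using \<beta>h Nf(1) that by (auto simp: continuous_hom_def subset_iff)
      then show ?thesis using a that Nf(5) by (auto simp: P_def)
    qed
  qed
  have Pcl: "closedin (mtopology W) P"
  proof -
    have "compactin (mtopology V) N"
      using N(2) V.profinite_topology by (simp add: profinite_space_def closedin_compact_space)
    then have "compactin (mtopology W) P" unfolding P_def
      using \<beta>h image_compactin by (fastforce simp: continuous_hom_def)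
    then show ?thesis
      using W.profinite_topology compactin_imp_closedin by (auto simp: profinite_space_def)
  qed
  have jinj: "inj_on j P"
  proof (rule inj_onI)
    fix x y assume xy: "x \<in> P" "y \<in> P" "j x = j y"
    then have "inv_into N \<beta> x = inv_into N \<beta> y"
      using N(4) unfolding j_def P_def by (meson inj_onD inv_into_into)
    then show "x = y" using xy unfolding P_def by (metis f_inv_into_f)
  qed
  note Pf = submodule_facts[OF P]
  let ?V = "transport_module i N V" and ?W = "transport_module j P W"
  note tV = transport_inv_hom[OF V N(1,2,4)] and intoV = continuous_hom_into_transport[OF V N(1,2,4)]
  note tW = transport_inv_hom[OF W P Pcl jinj] and intoW = continuous_hom_into_transport[OF W P Pcl jinj]
  have V': "profinite_module ?R ?V" by (rule transport_profinite[OF V N(1,2,4) topR])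
  have W': "profinite_module ?R ?W" by (rule transport_profinite[OF W P Pcl jinj topR])
  have lift: "relative_lifting k G H U ?V ?W"
    using proj V' W' unfolding relatively_projective_def by blast
  define \<beta>' where "\<beta>' x = j (\<beta> (inv_into N i x))" for x
  have cV: "carrier ?V = i ` N" and cW: "carrier ?W = j ` P" by (simp_all add: transport_module_def)
  have iN: "inv_into N i (i x) = x" if "x \<in> N" for x using that N(4) by simp
  have \<beta>i: "(\<lambda>x. \<beta> (inv_into N i x)) \<in> continuous_hom ?R ?V W"
    using tV \<beta>h continuous_map_compose[of "mtopology ?V" "mtopology V" "inv_into N i" "mtopology W" \<beta>]
    by (auto simp: continuous_hom_def Pi_iff o_def)
  have \<beta>'h: "\<beta>' \<in> continuous_hom ?R ?V ?W"
    unfolding \<beta>'_def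
    using intoW[of _ ?R ?V id] \<beta>i profinite_module.topspace_mtopology[OF V']
    by (simp add: restrict_scalars_def cV P_def iN) (use iN in force)
  have "\<beta>' ` carrier ?V = carrier ?W"
    unfolding cV cW \<beta>'_def unfolding P_def using iN by (simp add: image_image cong: image_cong)
  with \<beta>'h have \<beta>': "\<beta>' \<in> continuous_epi ?R ?V ?W" by (simp add: continuous_epi_def)
  have \<phi>P: "\<phi> u \<in> P" if "u \<in> carrier U" for u
    using that \<psi>\<phi>[OF that] N(3) unfolding P_def by (metis image_subset_iff imageI)
  have \<phi>': "(\<lambda>u. j (\<phi> u)) \<in> continuous_hom ?R U ?W"
    using intoW[of \<phi> ?R U id] \<phi> U.topspace_mtopology \<phi>P by (simp add: restrict_scalars_def)
  have \<psi>': "(\<lambda>u. i (\<psi> u)) \<in> continuous_hom ?RH (?res U) (restrict_scalars (cga_incl k G H) ?V)"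
    by (rule intoV[OF \<psi>]) (use U.topspace_mtopology N(3) in \<open>auto simp: restrict_scalars_def\<close>)
  have "\<forall>u\<in>carrier U. \<beta>' (i (\<psi> u)) = j (\<phi> u)"
    using N(3) iN \<psi>\<phi> unfolding \<beta>'_def by (simp add: image_subset_iff)
  then have "\<exists>\<psi>\<in>continuous_hom ?RH (?res U) (restrict_scalars (cga_incl k G H) ?V).
      \<forall>u\<in>carrier U. \<beta>' (\<psi> u) = j (\<phi> u)"
    by (intro bexI[OF _ \<psi>'])
  with lift[unfolded relative_lifting_def, rule_format, OF \<beta>' \<phi>']
  obtain \<rho> where \<rho>: "\<rho> \<in> continuous_hom ?R U ?V" "\<And>u. u \<in> carrier U \<Longrightarrow> \<beta>' (\<rho> u) = j (\<phi> u)"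
    by auto
  show "\<exists>\<rho>\<in>continuous_hom ?R U V. \<forall>u\<in>carrier U. \<beta> (\<rho> u) = \<phi> u"
  proof (intro bexI ballI)
    show "(\<lambda>u. inv_into N i (\<rho> u)) \<in> continuous_hom ?R U V"
      using tV \<rho>(1) continuous_map_compose[of "mtopology U" "mtopology ?V" \<rho> "mtopology V" "inv_into N i"]
      by (auto simp: continuous_hom_def Pi_iff o_def)
    fix u assume u: "u \<in> carrier U"
    then have "\<rho> u \<in> i ` N" using \<rho>(1) cV by (auto simp: continuous_hom_def)
    then have "\<beta> (inv_into N i (\<rho> u)) \<in> P" by (auto simp: P_def iN)
    moreover have "j (\<beta> (inv_into N i (\<rho> u))) = j (\<phi> u)" using \<rho>(2)[OF u] by (simp add: \<beta>'_def)
    ultimately show "\<beta> (inv_into N i (\<rho> u)) = \<phi> u" using jinj \<phi>P[OF u] by (meson inj_onD)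
  qed
qed

end

theory Submission
  imports Defs "HOL-Algebra.Zassenhaus"
begin

text \<open>For an open subgroup \<open>H\<close>, testing relative projectivity on the module induced from \<open>H\<close> shows that
  the identity of \<open>U\<close> is a relative trace from \<open>H\<close> (Higman's criterion).  Multiplying the traces
  from the open subgroups \<open>QN\<close> and \<open>RN\<close> and collecting terms by orbits of \<open>G\<close> on \<open>G/QN \<times> G/RN\<close> writes
  the identity as a sum of endomorphisms of \<open>U\<close>.  As \<open>U\<close> is finitely generated and indecomposable, its
  endomorphism ring is local, so one summand is invertible, which makes \<open>U\<close> projective relative to the
  intersection of a conjugate of \<open>QN\<close> with a conjugate of \<open>RN\<close>.  By compactness of \<open>G \<times> G\<close> the
  conjugating elements can be chosen independently of \<open>N\<close>, and a second compactness argument lets \<open>N\<close>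
  shrink to the trivial group: \<open>U\<close> is projective relative to the intersection of a conjugate of \<open>Q\<close>
  with a conjugate of \<open>R\<close>.  Minimality of \<open>Q\<close> and of \<open>R\<close> then makes these conjugates equal.\<close>

section \<open>Profinite spaces and groups\<close>

text \<open>Only for finite \<open>G/H\<close> is induction from \<open>H\<close> a finite power of
  \<open>U\<close> and a relative trace a finite sum, hence the detour through open subgroups. The
  price is a limit: a lift over \<open>Q\<close> need not be equivariant under any open overgroup,
  but it is so modulo a prescribed open submodule once the overgroup is small. Lifting and
  equivariance are therefore developed modulo a submodule \<open>D\<close>. Elements of
  \<open>k[[G]]\<close> are not finite sums of group elements. Homomorphisms are handled as
  continuous \<open>k\<close>-linear maps commuting with the group, and density of
  \<open>k[G]\<close> makes them \<open>k[[G]]\<close>-linear. For the induced module the scalar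
  multiplication itself has to be defined on all of \<open>k[[G]]\<close>; its matrix entries come
  from viewing elements as measures on \<open>G\<close>. Pointwise limits of maps may lose
  continuity. Finite generation repairs this: the submodules \<open>augmentation N\<close> are open,
  and all maps in question carry them uniformly into prescribed open submodules. The same uniformity
  yields Fitting idempotents and thus locality of the endomorphism ring.\<close>

lemma openin_forall_compactin:
  assumes f: "continuous_map (prod_topology X Y) Z f" and K: "compactin Y K" and D: "openin Z D"
  shows "openin X {x \<in> topspace X. \<forall>y\<in>K. f (x, y) \<in> D}"
proof (subst openin_subopen, intro ballI)
  fix x assume x: "x \<in> {x \<in> topspace X. \<forall>y\<in>K. f (x, y) \<in> D}"
  define W where "W = {p \<in> topspace (prod_topology X Y). f p \<in> D}"
  have W: "openin (prod_topology X Y) W"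
    unfolding W_def by (rule openin_continuous_map_preimage[OF f D])
  have "{x} \<times> K \<subseteq> W" using x compactin_subset_topspace[OF K] by (auto simp: W_def)
  then obtain A B where AB: "openin X A" "openin Y B" "x \<in> A" "K \<subseteq> B" "A \<times> B \<subseteq> W"
    using tube_lemma_right[OF W K, of x] x by blast
  have "A \<subseteq> {x \<in> topspace X. \<forall>y\<in>K. f (x, y) \<in> D}"
    using AB openin_subset[OF AB(1)] by (auto simp: W_def)
  with AB show "\<exists>T. openin X T \<and> x \<in> T \<and> T \<subseteq> {x \<in> topspace X. \<forall>y\<in>K. f (x, y) \<in> D}" by blast
qed

text \<open>Limits are extracted in this form: from idempotents modulo \<open>L\<close>, from
  conjugating pairs for each \<open>N\<close>, and from approximate lifts. Adding
  \<open>topspace X\<close> to the family keeps the point in the space even when \<open>I\<close> is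
  empty.\<close>

lemma compact_space_fip_family:
  assumes X: "compact_space X" and cl: "\<And>i. i \<in> I \<Longrightarrow> closedin X (C i)"
    and fip: "\<And>J. finite J \<Longrightarrow> J \<subseteq> I \<Longrightarrow> \<exists>x\<in>topspace X. \<forall>j\<in>J. x \<in> C j"
  shows "\<exists>x\<in>topspace X. \<forall>i\<in>I. x \<in> C i"
proof -
  have "\<Inter> (insert (topspace X) (C ` I)) \<noteq> {}"
  proof (rule compact_space_fip[THEN iffD1, OF X, rule_format], intro conjI allI impI ballI)
    show "closedin X D" if "D \<in> insert (topspace X) (C ` I)" for D using that cl by auto
    fix \<F> assume F: "finite \<F> \<and> \<F> \<subseteq> insert (topspace X) (C ` I)"
    then have "finite (\<F> - {topspace X})" "\<F> - {topspace X} \<subseteq> C ` I" by auto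
    then obtain J where J: "J \<subseteq> I" "finite J" "\<F> - {topspace X} = C ` J"
      by (meson finite_subset_image)
    with fip[of J] show "\<Inter>\<F> \<noteq> {}" by (metis (no_types, lifting) DiffI InterI empty_iff imageE insertE)
  qed
  then show ?thesis by auto
qed

text \<open>In a compact Hausdorff space, a closed set that no connected set joins to
  \<open>x\<close> can be split off by a clopen set; total disconnectedness rules out every
  connected set with two different points.\<close>

lemma profinite_space_clopen:
  assumes X: "profinite_space X" and D: "openin X D" and x: "x \<in> D"
  obtains C where "openin X C" "closedin X C" "x \<in> C" "C \<subseteq> D"
proof -
  have tX: "x \<in> topspace X" using D x openin_subset by blast
  have "separated_between X {x} (topspace X - D)"
  proof (rule cut_wire_fence_theorem)
    show "compact_space X" "Hausdorff_space X" using X by (simp_all add: profinite_space_def)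
    then show "closedin X {x}" using closedin_Hausdorff_singleton tX by metis
    show "closedin X (topspace X - D)" using D by blast
    show "disjnt C {x} \<or> disjnt C (topspace X - D)" if "connectedin X C" for C
      using X that x unfolding profinite_space_def totally_disconnected_space_def
      by (metis DiffE disjnt_iff insertE singletonD singletonI subsetD)
  qed
  then obtain U V where UV: "openin X U" "openin X V" "U \<union> V = topspace X" "disjnt U V"
    "{x} \<subseteq> U" "topspace X - D \<subseteq> V" by (auto simp: separated_between_def)
  then have "U = topspace X - V" by (auto simp: disjnt_iff dest: openin_subset)
  with UV show thesis by (intro that[of U]) (auto simp: disjnt_iff)
qed

text \<open>A connected subset of the product projects to at most one point in each factor. Needed
  because the induced module is a finite power of \<open>M\<close>.\<close>

lemma profinite_space_product:
  assumes "\<And>i. i \<in> I \<Longrightarrow> profinite_space (X i)"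
  shows "profinite_space (product_topology X I)"
proof -
  have "\<exists>a. S \<subseteq> {a}" if S: "connectedin (product_topology X I) S" for S
  proof (cases "S = {}")
    case False
    then obtain a where a: "a \<in> S" by blast
    have SP: "S \<subseteq> (\<Pi>\<^sub>E i\<in>I. topspace (X i))"
      using S connectedin_subset_topspace by fastforce
    have "x = a" if x: "x \<in> S" for x
    proof (rule PiE_ext)
      show "x \<in> (\<Pi>\<^sub>E i\<in>I. topspace (X i))" "a \<in> (\<Pi>\<^sub>E i\<in>I. topspace (X i))" using x a SP by auto
      fix i assume i: "i \<in> I"
      have "connectedin (X i) ((\<lambda>x. x i) ` S)"
        by (rule connectedin_continuous_map_image[OF continuous_map_product_projection[OF i] S])
      then show "x i = a i" using assms[OF i] x a
        unfolding profinite_space_def totally_disconnected_space_def by blast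
    qed
    then show ?thesis by blast
  qed auto
  then show ?thesis using assms
    by (simp add: profinite_space_def compact_space_product_topology Hausdorff_space_product_topology
        totally_disconnected_space_def)
qed

section \<open>Open normal subgroups of a profinite group\<close>

context profinite_group
begin

abbreviation "Gtop \<equiv> gtopology G"

lemma compact_Gtop: "compact_space Gtop"
  using profinite_topology by (simp add: profinite_space_def)

lemma continuous_map_mult:
  assumes "continuous_map X Gtop f" "continuous_map X Gtop g"
  shows "continuous_map X Gtop (\<lambda>x. f x \<otimes> g x)"
proof -
  have "continuous_map X Gtop ((\<lambda>(x, y). x \<otimes> y) \<circ> (\<lambda>x. (f x, g x)))"
    by (rule continuous_map_compose[OF _ continuous_mult]) (use assms in \<open>simp add: continuous_map_pairedI\<close>)
  then show ?thesis by (simp add: o_def)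
qed

lemma continuous_map_inv:
  assumes "continuous_map X Gtop f"
  shows "continuous_map X Gtop (\<lambda>x. inv (f x))"
  using continuous_map_compose[OF assms continuous_inv] by (simp add: o_def)

text \<open>Take a clopen neighbourhood \<open>C\<close> of the identity and the elements
  \<open>x\<close> such that all conjugates of \<open>x\<close> and of its inverse map
  \<open>C\<close> into itself by left translation. They form a normal subgroup, which lies in
  \<open>C\<close> because \<open>C\<close> contains the identity, and which is open by the tube
  lemma, since the condition ranges over the compact set
  \<open>carrier G \<times> C\<close>.\<close>

lemma open_normal_inside:
  assumes D: "openin Gtop D" and one: "\<one> \<in> D"
  obtains N where "N \<in> open_normal_subgroups G" "N \<subseteq> D"
proof -
  obtain C where C: "openin Gtop C" "closedin Gtop C" "\<one> \<in> C" "C \<subseteq> D"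
    using profinite_space_clopen[OF profinite_topology D one] by blast
  have CG: "C \<subseteq> carrier G" using C(1) openin_subset topspace_gtopology by fastforce
  have K: "compactin (prod_topology Gtop Gtop) (carrier G \<times> C)"
    using compact_Gtop C(2) closedin_compact_space topspace_gtopology
    by (metis compactin_Times compact_space_def)
  define A where "A = {x \<in> topspace Gtop. \<forall>y\<in>carrier G \<times> C.
     (\<lambda>(x, g, c). g \<otimes> x \<otimes> inv g \<otimes> c) (x, y) \<in> C}"
  define B where "B = {x \<in> topspace Gtop. \<forall>y\<in>carrier G \<times> C.
     (\<lambda>(x, g, c). g \<otimes> inv x \<otimes> inv g \<otimes> c) (x, y) \<in> C}"
  let ?P = "prod_topology Gtop (prod_topology Gtop Gtop)"
  have c: "continuous_map ?P Gtop fst" "continuous_map ?P Gtop (\<lambda>p. fst (snd p))"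
    "continuous_map ?P Gtop (\<lambda>p. snd (snd p))"
    using continuous_map_compose[OF continuous_map_snd continuous_map_fst, of Gtop Gtop Gtop]
      continuous_map_compose[OF continuous_map_snd continuous_map_snd, of Gtop Gtop Gtop]
    by (simp_all add: o_def continuous_map_fst)
  have "openin Gtop A" unfolding A_def
    by (rule openin_forall_compactin[OF _ K C(1)], unfold case_prod_beta,
        intro continuous_map_mult continuous_map_inv c)
  moreover have "openin Gtop B" unfolding B_def
    by (rule openin_forall_compactin[OF _ K C(1)], unfold case_prod_beta,
        intro continuous_map_mult continuous_map_inv c)
  ultimately have op: "openin Gtop (A \<inter> B)" by blast
  have mem: "x \<in> A \<inter> B \<longleftrightarrow> x \<in> carrier G \<and>
      (\<forall>g\<in>carrier G. \<forall>c\<in>C. g \<otimes> x \<otimes> inv g \<otimes> c \<in> C \<and> g \<otimes> inv x \<otimes> inv g \<otimes> c \<in> C)" for x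
    by (auto simp: A_def B_def topspace_gtopology)
  have conj: "g \<otimes> (x \<otimes> y) \<otimes> inv g \<otimes> c = g \<otimes> x \<otimes> inv g \<otimes> (g \<otimes> y \<otimes> inv g \<otimes> c)"
    if "g \<in> carrier G" "x \<in> carrier G" "y \<in> carrier G" "c \<in> carrier G" for g x y c
    using that by (simp add: m_assoc) (simp add: m_assoc[symmetric])
  have "subgroup (A \<inter> B) G"
  proof (rule subgroupI)
    show "A \<inter> B \<subseteq> carrier G" using mem by auto
    have "\<one> \<in> A \<inter> B" unfolding mem using CG by (auto simp: subset_iff)
    then show "A \<inter> B \<noteq> {}" by blast
    show "inv a \<in> A \<inter> B" if "a \<in> A \<inter> B" for a using that unfolding mem by auto
    show "a \<otimes> b \<in> A \<inter> B" if "a \<in> A \<inter> B" "b \<in> A \<inter> B" for a b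
      using that CG unfolding mem by (auto simp: inv_mult_group conj subset_iff)
  qed
  moreover have "x \<otimes> h \<otimes> inv x \<in> A \<inter> B" if "x \<in> carrier G" "h \<in> A \<inter> B" for x h
  proof -
    have eq: "g \<otimes> (x \<otimes> h' \<otimes> inv x) \<otimes> inv g = (g \<otimes> x) \<otimes> h' \<otimes> inv (g \<otimes> x)"
      if "g \<in> carrier G" "h' \<in> carrier G" for g h'
      using that \<open>x \<in> carrier G\<close> by (simp add: inv_mult_group m_assoc)
    have i: "inv (x \<otimes> h \<otimes> inv x) = x \<otimes> inv h \<otimes> inv x"
      using that mem[of h] by (simp add: inv_mult_group m_assoc)
    show ?thesis using that mem[of h] unfolding mem[of "x \<otimes> h \<otimes> inv x"] i
      by (simp add: eq)
  qed
  ultimately have "A \<inter> B \<lhd> G" by (simp add: normal_inv_iff)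
  moreover have "A \<inter> B \<subseteq> D"
  proof
    fix x assume "x \<in> A \<inter> B"
    then have "x \<in> carrier G" "\<one> \<otimes> x \<otimes> inv \<one> \<otimes> \<one> \<in> C" using C(3) unfolding mem by blast+
    then show "x \<in> D" using C(4) by auto
  qed
  ultimately show thesis using op that by (simp add: open_normal_subgroups_def)
qed

lemma openin_r_coset:
  assumes "openin Gtop A" "g \<in> carrier G"
  shows "openin Gtop (A #> g)"
proof -
  have AG: "A \<subseteq> carrier G" using assms(1) openin_subset topspace_gtopology by fastforce
  have "A #> g = {x \<in> topspace Gtop. x \<otimes> inv g \<in> A}"
    using AG assms(2) by (force simp: r_coset_def topspace_gtopology m_assoc subset_iff)
  moreover have "openin Gtop \<dots>"
    by (rule openin_continuous_map_preimage[OF continuous_map_mult assms(1)])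
      (use assms(2) in \<open>auto simp: topspace_gtopology\<close>)
  ultimately show ?thesis by simp
qed

text \<open>The cosets form an open cover by disjoint nonempty sets, so a finite subcover must
  already contain all of them.\<close>

lemma finite_rcosets_open:
  assumes "subgroup A G" "openin Gtop A"
  shows "finite (rcosets A)"
proof -
  interpret A: subgroup A G by fact
  have "\<forall>U\<in>rcosets A. openin Gtop U"
    using openin_r_coset[OF assms(2)] by (auto simp: RCOSETS_def)
  moreover have "topspace Gtop \<subseteq> \<Union>(rcosets A)"
    using rcosets_part_G[OF assms(1)] topspace_gtopology by simp
  ultimately obtain F where F: "finite F" "F \<subseteq> rcosets A" "topspace Gtop \<subseteq> \<Union>F"
    using compact_Gtop unfolding compact_space_alt by meson
  have "rcosets A \<subseteq> F"
  proof
    fix C assume C: "C \<in> rcosets A"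
    then have ne: "C \<noteq> {}" "C \<subseteq> carrier G"
      using A.rcosets_non_empty A.rcosets_carrier[OF is_group] by blast+
    then obtain x where "x \<in> C" "x \<in> carrier G" by blast
    then obtain D where "D \<in> F" "x \<in> D" using F(3) topspace_gtopology by blast
    with C F(2) \<open>x \<in> C\<close> rcos_disjoint[OF assms(1)] show "C \<in> F"
      by (metis disjnt_iff pairwiseD subsetD)
  qed
  then show ?thesis using F(1) finite_subset by blast
qed

lemma closedin_open_subgroup:
  assumes "subgroup A G" "openin Gtop A"
  shows "closedin Gtop A"
proof -
  interpret A: subgroup A G by fact
  have "topspace Gtop - A = \<Union>(rcosets A - {A})"
  proof -
    have "A \<in> rcosets A" using subgroup.subgroup_in_rcosets[OF assms(1) is_group] .
    moreover have "A \<inter> C = {}" if "C \<in> rcosets A - {A}" for C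
      using that \<open>A \<in> rcosets A\<close> rcos_disjoint[OF assms(1)] by (metis DiffE insertCI pairwiseD disjnt_def)
    then have "A \<inter> \<Union>(rcosets A - {A}) = {}" by blast
    moreover have "\<Union>(rcosets A) = A \<union> \<Union>(rcosets A - {A})" using \<open>A \<in> rcosets A\<close> by blast
    ultimately show ?thesis
      using rcosets_part_G[OF assms(1)] topspace_gtopology by auto
  qed
  moreover have "openin Gtop (\<Union>(rcosets A - {A}))"
    using openin_r_coset[OF assms(2)] by (auto simp: RCOSETS_def intro!: openin_Union)
  ultimately show ?thesis
    using A.subset topspace_gtopology by (simp add: closedin_def)
qed

lemma open_normal_Int:
  assumes "N \<in> open_normal_subgroups G" "M \<in> open_normal_subgroups G"
  shows "N \<inter> M \<in> open_normal_subgroups G"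
  using assms by (auto simp: open_normal_subgroups_def normal_subgroup_intersect)

lemma carrier_open_normal: "carrier G \<in> open_normal_subgroups G"
  using openin_topspace[of Gtop] topspace_gtopology normal_inv_iff[of "carrier G"] subgroup_self
  by (simp add: open_normal_subgroups_def)

lemma open_normalD:
  assumes "N \<in> open_normal_subgroups G"
  shows "N \<lhd> G" "subgroup N G" "openin Gtop N" "closedin Gtop N" "finite (carrier (G Mod N))"
    "N \<subseteq> carrier G" "\<one> \<in> N"
proof -
  show n: "N \<lhd> G" and o: "openin Gtop N" using assms by (auto simp: open_normal_subgroups_def)
  show s: "subgroup N G" by (rule normal_imp_subgroup[OF n])
  show "closedin Gtop N" "finite (carrier (G Mod N))" "N \<subseteq> carrier G" "\<one> \<in> N"
    using closedin_open_subgroup[OF s o] finite_rcosets_open[OF s o] subgroup.subset[OF s]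
      subgroup.one_closed[OF s] by (simp_all add: FactGroup_def)
qed

lemma profinite_sub_top_group:
  assumes "closed_subgroup H G"
  shows "profinite_group (sub_top_group G H)"
proof -
  have H: "subgroup H G" "closedin Gtop H" using assms by (auto simp: closed_subgroup_def)
  have HG: "H \<subseteq> carrier G" using subgroup.subset[OF H(1)] .
  let ?S = "subtopology Gtop H"
  have g: "group (G\<lparr>carrier := H, gtopology := ?S\<rparr>)"
  proof (rule groupI)
    fix x assume "x \<in> carrier (G\<lparr>carrier := H, gtopology := ?S\<rparr>)"
    then have "inv x \<in> H" "inv x \<otimes> x = \<one>" using subgroup.m_inv_closed[OF H(1)] HG by auto
    then show "\<exists>y\<in>carrier (G\<lparr>carrier := H, gtopology := ?S\<rparr>). y \<otimes>\<^bsub>G\<lparr>carrier := H, gtopology := ?S\<rparr>\<^esub> x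
        = \<one>\<^bsub>G\<lparr>carrier := H, gtopology := ?S\<rparr>\<^esub>" by auto
  qed (use subgroup.m_closed[OF H(1)] subgroup.one_closed[OF H(1)] HG in \<open>auto simp: m_assoc subset_iff\<close>)
  have i: "inv\<^bsub>G\<lparr>carrier := H, gtopology := ?S\<rparr>\<^esub> x = inv x" if "x \<in> H" for x
    using m_inv_consistent[OF H(1) that] by (simp add: m_inv_def)
  have 1: "continuous_map ?S Gtop (\<lambda>x. inv x)"
    by (rule continuous_map_from_subtopology[OF continuous_inv])
  have 2: "continuous_map (prod_topology ?S ?S) Gtop (\<lambda>(x, y). x \<otimes> y)"
    unfolding case_prod_beta
    by (intro continuous_map_mult continuous_map_into_fulltopology[OF continuous_map_fst]
        continuous_map_into_fulltopology[OF continuous_map_snd])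
  show ?thesis
    unfolding sub_top_group_def
  proof (intro profinite_group.intro g profinite_group_axioms.intro)
    show "topspace (gtopology (G\<lparr>carrier := H, gtopology := ?S\<rparr>)) = carrier (G\<lparr>carrier := H, gtopology := ?S\<rparr>)"
      using HG topspace_gtopology by auto
    show "profinite_space (gtopology (G\<lparr>carrier := H, gtopology := ?S\<rparr>))"
      using profinite_space_closed_subtopology[OF profinite_topology H(2)] by simp
    have "continuous_map ?S ?S (\<lambda>x. inv x)"
      using 1 subgroup.m_inv_closed[OF H(1)] by (auto simp: continuous_map_in_subtopology)
    then have "continuous_map ?S ?S (\<lambda>x. inv\<^bsub>G\<lparr>carrier := H, gtopology := ?S\<rparr>\<^esub> x)"
      by (rule continuous_map_eq) (use i in auto)
    then show "continuous_map (gtopology (G\<lparr>carrier := H, gtopology := ?S\<rparr>)) (gtopology (G\<lparr>carrier := H, gtopology := ?S\<rparr>))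
        (\<lambda>x. inv\<^bsub>G\<lparr>carrier := H, gtopology := ?S\<rparr>\<^esub> x)"
      by simp
    show "continuous_map (prod_topology (gtopology (G\<lparr>carrier := H, gtopology := ?S\<rparr>)) (gtopology (G\<lparr>carrier := H, gtopology := ?S\<rparr>)))
        (gtopology (G\<lparr>carrier := H, gtopology := ?S\<rparr>)) (\<lambda>(x, y). x \<otimes>\<^bsub>G\<lparr>carrier := H, gtopology := ?S\<rparr>\<^esub> y)"
      using 2 subgroup.m_closed[OF H(1)] by (auto simp: continuous_map_in_subtopology)
  qed
qed

lemma open_normal_sub_top_group:
  assumes "closed_subgroup H G" "N \<in> open_normal_subgroups G"
  shows "H \<inter> N \<in> open_normal_subgroups (sub_top_group G H)"
proof -
  have H: "subgroup H G" using assms by (auto simp: closed_subgroup_def)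
  have "H \<inter> N \<lhd> G\<lparr>carrier := H\<rparr>"
    using normal_Int_subgroup[OF H open_normalD(1)[OF assms(2)]] by (simp add: Int_commute)
  then have "H \<inter> N \<lhd> sub_top_group G H"
    unfolding sub_top_group_def
    using profinite_group.axioms(1)[OF profinite_sub_top_group[OF assms(1)]]
    by (simp add: normal_def normal_axioms_def subgroup_def sub_top_group_def
       r_coset_def l_coset_def m_inv_def)
  moreover have "openin (subtopology Gtop H) (H \<inter> N)"
    using open_normalD(3)[OF assms(2)] by (metis openin_subtopology_Int2)
  ultimately show ?thesis by (simp add: open_normal_subgroups_def sub_top_group_def)
qed

end

section \<open>Elements of the completed group algebra\<close>

lemma product_topology_cong:
  assumes "\<And>i. i \<in> I \<Longrightarrow> T i = S i"
  shows "product_topology T I = product_topology S I"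
proof -
  have "finite {i \<in> I. U i \<noteq> topspace (T i)} \<longleftrightarrow> finite {i \<in> I. U i \<noteq> topspace (S i)}"
    "(\<forall>i\<in>I. openin (T i) (U i)) \<longleftrightarrow> (\<forall>i\<in>I. openin (S i) (U i))" for U
    using assms by (auto cong: conj_cong)
  then show ?thesis unfolding topology_eq openin_product_topology_alt by simp
qed

text \<open>The element \<open>c g\<close> of \<open>k[[G]]\<close>.\<close>

definition cga_point ::
    "('k, 'a) ring_scheme \<Rightarrow> ('g, 'b) top_group_scheme \<Rightarrow> 'k \<Rightarrow> 'g \<Rightarrow> ('g, 'k) cga" where
  "cga_point k G c g = (\<lambda>N\<in>open_normal_subgroups G. \<lambda>C\<in>carrier (G Mod N).
     if g \<in> C then c else \<zero>\<^bsub>k\<^esub>)"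

text \<open>Finiteness of \<open>k\<close> makes every \<open>k[G/N]\<close> a finite set and hence
  \<open>k[[G]]\<close> compact, so that the tube lemma can be applied with scalars as the compact
  factor.\<close>

locale cga_base = G: profinite_group G + k: field k
  for k :: "('k, 'a) ring_scheme" and G :: "('g, 'b) top_group_scheme" +
  assumes finite_k: "finite (carrier k)"
begin

abbreviation "ONS \<equiv> open_normal_subgroups G"
abbreviation "cosets N \<equiv> carrier (G Mod N)"
abbreviation "KG \<equiv> completed_group_algebra k G"
abbreviation "KGtop \<equiv> rtopology KG"
abbreviation "pt \<equiv> cga_point k G"

lemmas ONS = G.open_normalD

lemma coset_eq:
  assumes "N \<in> ONS" "C \<in> cosets N" "z \<in> C"
  shows "C = N #>\<^bsub>G\<^esub> z" "z \<in> carrier G"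
proof -
  obtain x where x: "x \<in> carrier G" "C = N #>\<^bsub>G\<^esub> x" using assms(2) by (auto simp: carrier_FactGroup)
  then show "C = N #>\<^bsub>G\<^esub> z" using G.repr_independence[OF _ _ ONS(2)[OF assms(1)]] assms(3) by blast
  show "z \<in> carrier G" using x assms(3) ONS(6)[OF assms(1)] G.r_coset_subset_G by blast
qed

lemma coset_mem:
  assumes "N \<in> ONS" "g \<in> carrier G"
  shows "N #>\<^bsub>G\<^esub> g \<in> cosets N" "g \<in> N #>\<^bsub>G\<^esub> g"
  using assms G.rcos_self[OF _ ONS(2)] by (auto simp: carrier_FactGroup)

lemma coset_nonempty: "N \<in> ONS \<Longrightarrow> C \<in> cosets N \<Longrightarrow> \<exists>z. z \<in> C"
  using coset_mem(2) by (auto simp: carrier_FactGroup)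

lemma coset_subset:
  assumes "N \<in> ONS" "M \<in> ONS" "N \<subseteq> M" "D \<in> cosets N" "C \<in> cosets M" "z \<in> D" "z \<in> C"
  shows "D \<subseteq> C"
  using coset_eq(1)[OF assms(1,4,6)] coset_eq(1)[OF assms(2,5,7)] assms(3)
  by (auto simp: r_coset_def)

lemma carrier_group_algebra:
  "N \<in> ONS \<Longrightarrow> carrier (group_algebra k (G Mod N)) = cosets N \<rightarrow>\<^sub>E carrier k"
  using ONS(5) by (auto simp: group_algebra_def)

text \<open>Finite support is automatic on the finite group \<open>G/N\<close>, so elements are
  compatible families of functions on the finite coset sets. Compatibility is finite additivity: the
  value at a coset is the sum over the smaller cosets inside it.\<close>

lemma mem_KG_iff:
  "a \<in> carrier KG \<longleftrightarrow> a \<in> (\<Pi>\<^sub>E N\<in>ONS. cosets N \<rightarrow>\<^sub>E carrier k) \<and>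
    (\<forall>N\<in>ONS. \<forall>M\<in>ONS. N \<subseteq> M \<longrightarrow> (\<forall>C\<in>cosets M. a M C = (\<Oplus>\<^bsub>k\<^esub>D\<in>{D \<in> cosets N. D \<subseteq> C}. a N D)))"
proof -
  have 1: "(\<Pi>\<^sub>E N\<in>ONS. carrier (group_algebra k (G Mod N))) = (\<Pi>\<^sub>E N\<in>ONS. cosets N \<rightarrow>\<^sub>E carrier k)"
    by (rule PiE_cong) (rule carrier_group_algebra)
  have 2: "a M = coset_push k (cosets N) (cosets M) (a N) \<longleftrightarrow>
      (\<forall>C\<in>cosets M. a M C = (\<Oplus>\<^bsub>k\<^esub>D\<in>{D \<in> cosets N. D \<subseteq> C}. a N D))"
    if "a \<in> (\<Pi>\<^sub>E N\<in>ONS. cosets N \<rightarrow>\<^sub>E carrier k)" "M \<in> ONS" for N M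
  proof -
    have "a M \<in> extensional (cosets M)" using PiE_mem[OF that] by (simp add: PiE_def)
    then show ?thesis unfolding coset_push_def
      by (metis (no_types, lifting) extensionalityI restrict_apply restrict_extensional)
  qed
  have "carrier KG = {a \<in> (\<Pi>\<^sub>E N\<in>ONS. cosets N \<rightarrow>\<^sub>E carrier k).
      \<forall>N\<in>ONS. \<forall>M\<in>ONS. N \<subseteq> M \<longrightarrow> a M = coset_push k (cosets N) (cosets M) (a N)}"
    by (simp only: completed_group_algebra_def cga_carrier_def 1 partial_object.select_convs)
  then have "a \<in> carrier KG \<longleftrightarrow> a \<in> (\<Pi>\<^sub>E N\<in>ONS. cosets N \<rightarrow>\<^sub>E carrier k) \<and>
      (\<forall>N\<in>ONS. \<forall>M\<in>ONS. N \<subseteq> M \<longrightarrow> a M = coset_push k (cosets N) (cosets M) (a N))"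
    by (simp only: mem_Collect_eq)
  then show ?thesis by (simp only: 2 cong: conj_cong ball_cong)
qed

lemma KG_memI:
  assumes "a \<in> extensional ONS" "\<And>N. N \<in> ONS \<Longrightarrow> a N \<in> cosets N \<rightarrow>\<^sub>E carrier k"
    and "\<And>N M C. N \<in> ONS \<Longrightarrow> M \<in> ONS \<Longrightarrow> N \<subseteq> M \<Longrightarrow> C \<in> cosets M \<Longrightarrow>
      a M C = (\<Oplus>\<^bsub>k\<^esub>D\<in>{D \<in> cosets N. D \<subseteq> C}. a N D)"
  shows "a \<in> carrier KG"
proof -
  have "a \<in> (\<Pi>\<^sub>E N\<in>ONS. cosets N \<rightarrow>\<^sub>E carrier k)" using assms(1,2) by (simp add: PiE_iff[of a])
  then show ?thesis unfolding mem_KG_iff using assms(3) by blast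
qed

lemma KG_component: "a \<in> carrier KG \<Longrightarrow> N \<in> ONS \<Longrightarrow> a N \<in> cosets N \<rightarrow>\<^sub>E carrier k"
  by (rule PiE_mem[OF mem_KG_iff[THEN iffD1, THEN conjunct1]])

lemma KG_val: "a \<in> carrier KG \<Longrightarrow> N \<in> ONS \<Longrightarrow> C \<in> cosets N \<Longrightarrow> a N C \<in> carrier k"
  using PiE_mem[OF KG_component] .

lemma KG_push:
  assumes "a \<in> carrier KG" "N \<in> ONS" "M \<in> ONS" "N \<subseteq> M" "C \<in> cosets M"
  shows "a M C = (\<Oplus>\<^bsub>k\<^esub>D\<in>{D \<in> cosets N. D \<subseteq> C}. a N D)"
  by (rule mem_KG_iff[THEN iffD1, THEN conjunct2, rule_format, OF assms])

lemma KG_component_ext: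
  assumes "a \<in> carrier KG" "b \<in> carrier KG" "N \<in> ONS" "\<And>C. C \<in> cosets N \<Longrightarrow> a N C = b N C"
  shows "a N = b N"
proof (rule PiE_ext)
  show "a N \<in> cosets N \<rightarrow>\<^sub>E carrier k" "b N \<in> cosets N \<rightarrow>\<^sub>E carrier k"
    using KG_component assms(1-3) by auto
qed (use assms in auto)

lemma KG_ext:
  assumes "a \<in> carrier KG" "b \<in> carrier KG" "\<And>N C. N \<in> ONS \<Longrightarrow> C \<in> cosets N \<Longrightarrow> a N C = b N C"
  shows "a = b"
proof (rule PiE_ext)
  show "a \<in> (\<Pi>\<^sub>E N\<in>ONS. cosets N \<rightarrow>\<^sub>E carrier k)" "b \<in> (\<Pi>\<^sub>E N\<in>ONS. cosets N \<rightarrow>\<^sub>E carrier k)"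
    by (rule mem_KG_iff[THEN iffD1, THEN conjunct1, OF assms(1)],
        rule mem_KG_iff[THEN iffD1, THEN conjunct1, OF assms(2)])
qed (rule KG_component_ext[OF assms(1,2) _ assms(3)])

text \<open>By compatibility, values at larger cosets are sums of values at smaller ones. Conditions
  on finitely many components thus reduce to a condition on one.\<close>

lemma KG_component_mono:
  assumes "a \<in> carrier KG" "b \<in> carrier KG" "N \<in> ONS" "M \<in> ONS" "N \<subseteq> M" "a N = b N"
  shows "a M = b M"
  by (rule KG_component_ext[OF assms(1,2,4)])
    (use KG_push[OF assms(1,3-5)] KG_push[OF assms(2,3-5)] assms(6) in simp)

lemma KG_add: "N \<in> ONS \<Longrightarrow> C \<in> cosets N \<Longrightarrow> (a \<oplus>\<^bsub>KG\<^esub> b) N C = a N C \<oplus>\<^bsub>k\<^esub> b N C"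
  by (simp add: completed_group_algebra_def group_algebra_def)

lemma KG_zero: "N \<in> ONS \<Longrightarrow> C \<in> cosets N \<Longrightarrow> \<zero>\<^bsub>KG\<^esub> N C = \<zero>\<^bsub>k\<^esub>"
  by (simp add: completed_group_algebra_def group_algebra_def)

lemma KG_mult: "N \<in> ONS \<Longrightarrow> (a \<otimes>\<^bsub>KG\<^esub> b) N = a N \<otimes>\<^bsub>group_algebra k (G Mod N)\<^esub> b N"
  by (simp add: completed_group_algebra_def)

lemma finite_cosets_subset: "N \<in> ONS \<Longrightarrow> finite {D \<in> cosets N. P D}"
  using ONS(5) by simp

lemma pt_val: "N \<in> ONS \<Longrightarrow> C \<in> cosets N \<Longrightarrow> pt c g N C = (if g \<in> C then c else \<zero>\<^bsub>k\<^esub>)"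
  by (simp add: cga_point_def)

lemma finsum_indicator:
  assumes c: "c \<in> carrier k" and B: "finite B" and uniq: "\<And>D E. D \<in> B \<Longrightarrow> E \<in> B \<Longrightarrow> g \<in> D \<Longrightarrow> g \<in> E \<Longrightarrow> D = E"
  shows "(\<Oplus>\<^bsub>k\<^esub>D\<in>B. if g \<in> D then c else \<zero>\<^bsub>k\<^esub>) = (if \<exists>D\<in>B. g \<in> D then c else \<zero>\<^bsub>k\<^esub>)"
proof (cases "\<exists>D\<in>B. g \<in> D")
  case True
  then obtain D where D: "D \<in> B" "g \<in> D" by blast
  have "(\<Oplus>\<^bsub>k\<^esub>E\<in>B. if g \<in> E then c else \<zero>\<^bsub>k\<^esub>) = (\<Oplus>\<^bsub>k\<^esub>E\<in>B. if D = E then c else \<zero>\<^bsub>k\<^esub>)"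
    by (rule k.finsum_cong') (use D uniq c in auto)
  also have "\<dots> = c" using k.finsum_singleton[OF D(1) B, of "\<lambda>_. c"] c by simp
  finally show ?thesis using True by simp
next
  case False
  then have "(\<Oplus>\<^bsub>k\<^esub>D\<in>B. if g \<in> D then c else \<zero>\<^bsub>k\<^esub>) = (\<Oplus>\<^bsub>k\<^esub>D\<in>B. \<zero>\<^bsub>k\<^esub>)"
    by (intro k.finsum_cong') auto
  then show ?thesis using False by simp
qed

lemma coset_unique:
  assumes "N \<in> ONS" "D \<in> cosets N" "E \<in> cosets N" "g \<in> D" "g \<in> E"
  shows "D = E"
  using coset_eq(1)[OF assms(1,2,4)] coset_eq(1)[OF assms(1,3,5)] by simp

lemma pt_closed:
  assumes c: "c \<in> carrier k" and g: "g \<in> carrier G"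
  shows "pt c g \<in> carrier KG"
proof -
  have "pt c g M C = (\<Oplus>\<^bsub>k\<^esub>D\<in>{D \<in> cosets N. D \<subseteq> C}. pt c g N D)"
    if h: "N \<in> ONS" "M \<in> ONS" "N \<subseteq> M" "C \<in> cosets M" for N M C
  proof -
    have "(\<Oplus>\<^bsub>k\<^esub>D\<in>{D \<in> cosets N. D \<subseteq> C}. pt c g N D)
        = (\<Oplus>\<^bsub>k\<^esub>D\<in>{D \<in> cosets N. D \<subseteq> C}. if g \<in> D then c else \<zero>\<^bsub>k\<^esub>)"
      by (rule k.finsum_cong') (use h c in \<open>auto simp: pt_val\<close>)
    also have "\<dots> = (if \<exists>D\<in>{D \<in> cosets N. D \<subseteq> C}. g \<in> D then c else \<zero>\<^bsub>k\<^esub>)"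
      by (rule finsum_indicator[OF c finite_cosets_subset[OF h(1)]])
        (use coset_unique[OF h(1)] in blast)
    also have "(\<exists>D\<in>{D \<in> cosets N. D \<subseteq> C}. g \<in> D) \<longleftrightarrow> g \<in> C"
      using coset_subset[OF h(1-3) coset_mem(1)[OF h(1) g] h(4) coset_mem(2)[OF h(1) g]]
        coset_mem[OF h(1) g] by blast
    finally show ?thesis using h by (simp add: pt_val)
  qed
  moreover have "pt c g \<in> extensional ONS" "\<And>N. N \<in> ONS \<Longrightarrow> pt c g N \<in> cosets N \<rightarrow>\<^sub>E carrier k"
    using c by (auto simp: cga_point_def)
  ultimately show ?thesis by (intro KG_memI)
qed

lemma pt_mult:
  assumes c: "c \<in> carrier k" "d \<in> carrier k" and g: "g \<in> carrier G" "h \<in> carrier G"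
  shows "pt c g \<otimes>\<^bsub>KG\<^esub> pt d h = pt (c \<otimes>\<^bsub>k\<^esub> d) (g \<otimes>\<^bsub>G\<^esub> h)"
proof -
  have "(pt c g \<otimes>\<^bsub>KG\<^esub> pt d h) N = pt (c \<otimes>\<^bsub>k\<^esub> d) (g \<otimes>\<^bsub>G\<^esub> h) N" if N: "N \<in> ONS" for N
  proof -
    interpret N: normal N G using ONS(1)[OF N] .
    interpret Q: group "G Mod N" by (rule N.factorgroup_is_group)
    let ?S = "{y \<in> cosets N. pt c g N y \<noteq> \<zero>\<^bsub>k\<^esub>}"
    let ?C = "N #>\<^bsub>G\<^esub> g"
    have C: "?C \<in> cosets N" "g \<in> ?C" using coset_mem[OF N g(1)] by auto
    have val: "(\<Oplus>\<^bsub>k\<^esub>y\<in>?S. pt c g N y \<otimes>\<^bsub>k\<^esub> pt d h N (inv\<^bsub>G Mod N\<^esub> y \<otimes>\<^bsub>G Mod N\<^esub> x))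
        = (if g \<otimes>\<^bsub>G\<^esub> h \<in> x then c \<otimes>\<^bsub>k\<^esub> d else \<zero>\<^bsub>k\<^esub>)" if x: "x \<in> cosets N" for x
    proof -
      obtain b where b: "b \<in> carrier G" "x = N #>\<^bsub>G\<^esub> b" using x by (auto simp: carrier_FactGroup)
      have e: "inv\<^bsub>G Mod N\<^esub> ?C \<otimes>\<^bsub>G Mod N\<^esub> x = N #>\<^bsub>G\<^esub> (inv\<^bsub>G\<^esub> g \<otimes>\<^bsub>G\<^esub> b)"
        using N.inv_FactGroup[OF C(1)] b g N.rcos_inv N.rcos_sum by simp
      have ex: "inv\<^bsub>G Mod N\<^esub> ?C \<otimes>\<^bsub>G Mod N\<^esub> x \<in> cosets N"
        using x C(1) by (intro Q.m_closed Q.inv_closed)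
      have "h \<in> N #>\<^bsub>G\<^esub> (inv\<^bsub>G\<^esub> g \<otimes>\<^bsub>G\<^esub> b) \<longleftrightarrow> N #>\<^bsub>G\<^esub> (inv\<^bsub>G\<^esub> g \<otimes>\<^bsub>G\<^esub> b) = N #>\<^bsub>G\<^esub> h"
        using coset_eq(1)[OF N coset_mem(1)[OF N]] coset_mem(2)[OF N g(2)] g b by (metis G.inv_closed G.m_closed)
      also have "\<dots> \<longleftrightarrow> N #>\<^bsub>G\<^esub> b = N #>\<^bsub>G\<^esub> (g \<otimes>\<^bsub>G\<^esub> h)"
      proof
        assume "N #>\<^bsub>G\<^esub> (inv\<^bsub>G\<^esub> g \<otimes>\<^bsub>G\<^esub> b) = N #>\<^bsub>G\<^esub> h"
        then have "?C <#>\<^bsub>G\<^esub> (N #>\<^bsub>G\<^esub> (inv\<^bsub>G\<^esub> g \<otimes>\<^bsub>G\<^esub> b)) = ?C <#>\<^bsub>G\<^esub> (N #>\<^bsub>G\<^esub> h)" by simp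
        then show "N #>\<^bsub>G\<^esub> b = N #>\<^bsub>G\<^esub> (g \<otimes>\<^bsub>G\<^esub> h)"
          using g b by (simp add: N.rcos_sum G.m_assoc[symmetric])
      next
        assume "N #>\<^bsub>G\<^esub> b = N #>\<^bsub>G\<^esub> (g \<otimes>\<^bsub>G\<^esub> h)"
        then have "(N #>\<^bsub>G\<^esub> inv\<^bsub>G\<^esub> g) <#>\<^bsub>G\<^esub> (N #>\<^bsub>G\<^esub> b) = (N #>\<^bsub>G\<^esub> inv\<^bsub>G\<^esub> g) <#>\<^bsub>G\<^esub> (N #>\<^bsub>G\<^esub> (g \<otimes>\<^bsub>G\<^esub> h))" by simp
        then show "N #>\<^bsub>G\<^esub> (inv\<^bsub>G\<^esub> g \<otimes>\<^bsub>G\<^esub> b) = N #>\<^bsub>G\<^esub> h"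
          using g b by (simp add: N.rcos_sum G.m_assoc[symmetric])
      qed
      also have "\<dots> \<longleftrightarrow> g \<otimes>\<^bsub>G\<^esub> h \<in> x"
        using coset_eq(1)[OF N x] coset_mem(2)[OF N, of "g \<otimes>\<^bsub>G\<^esub> h"] g b by (metis G.m_closed)
      finally have hx: "h \<in> N #>\<^bsub>G\<^esub> (inv\<^bsub>G\<^esub> g \<otimes>\<^bsub>G\<^esub> b) \<longleftrightarrow> g \<otimes>\<^bsub>G\<^esub> h \<in> x" .
      have v: "pt d h N (inv\<^bsub>G Mod N\<^esub> ?C \<otimes>\<^bsub>G Mod N\<^esub> x) = (if g \<otimes>\<^bsub>G\<^esub> h \<in> x then d else \<zero>\<^bsub>k\<^esub>)"
        using pt_val[OF N ex, of d h] by (simp only: e hx)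
      \<comment> \<open>Convolution sums over the support of the first factor, which is empty when
        \<open>c\<close> is zero and is the single coset of \<open>g\<close> otherwise.\<close>
      show ?thesis
      proof (cases "c = \<zero>\<^bsub>k\<^esub>")
        case True
        then have "?S = {}" using N by (auto simp: pt_val)
        then show ?thesis using True c by (simp only: k.finsum_empty) simp
      next
        case False
        have "?S = {?C}"
        proof -
          have "y = ?C" if "y \<in> ?S" for y
          proof -
            have "y \<in> cosets N" "g \<in> y" using that N by (auto simp: pt_val split: if_splits)
            then show ?thesis by (rule coset_eq(1)[OF N])
          qed
          moreover have "?C \<in> ?S" using C False N by (simp add: pt_val)
          ultimately show ?thesis by blast
        qed
        moreover have "pt c g N ?C = c" using C N by (simp add: pt_val)
        ultimately show ?thesis using v c by (simp add: k.finsum_insert)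
      qed
    qed
    show ?thesis
      unfolding KG_mult[OF N] group_algebra_def
      using N val by (simp add: cga_point_def cong: restrict_cong)
  qed
  moreover have "pt c g \<otimes>\<^bsub>KG\<^esub> pt d h \<in> extensional ONS" "pt (c \<otimes>\<^bsub>k\<^esub> d) (g \<otimes>\<^bsub>G\<^esub> h) \<in> extensional ONS"
    by (auto simp: completed_group_algebra_def cga_point_def)
  ultimately show ?thesis by (metis extensionalityI)
qed

lemma pt_one: "\<one>\<^bsub>KG\<^esub> = pt \<one>\<^bsub>k\<^esub> \<one>\<^bsub>G\<^esub>"
proof -
  have "x = N \<longleftrightarrow> \<one>\<^bsub>G\<^esub> \<in> x" if "N \<in> ONS" "x \<in> cosets N" for N x
    using coset_eq(1)[OF that] ONS(7)[OF that(1)] G.coset_mult_one[OF ONS(6)[OF that(1)]] by auto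
  then show ?thesis
    by (auto simp: completed_group_algebra_def group_algebra_def cga_point_def intro!: restrict_ext)
qed

section \<open>Topology of \<open>k[[G]]\<close>\<close>

lemma topspace_KGtop: "topspace KGtop = carrier KG"
  by (rule topspace_completed_group_algebra)

lemma KGtop_eq: "KGtop = subtopology (product_topology (\<lambda>N. discrete_topology (cosets N \<rightarrow>\<^sub>E carrier k)) ONS) (carrier KG)"
proof -
  have "product_topology (\<lambda>N. discrete_topology (carrier (group_algebra k (G Mod N)))) ONS
      = product_topology (\<lambda>N. discrete_topology (cosets N \<rightarrow>\<^sub>E carrier k)) ONS"
    by (rule product_topology_cong) (simp add: carrier_group_algebra)
  then show ?thesis by (simp add: completed_group_algebra_def)
qed

lemma openin_component:
  assumes "N \<in> ONS" 
  shows "openin KGtop {s \<in> carrier KG. P (s N)}"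
proof -
  have c: "continuous_map KGtop (discrete_topology (cosets N \<rightarrow>\<^sub>E carrier k)) (\<lambda>a. a N)"
    unfolding KGtop_eq by (intro continuous_map_from_subtopology continuous_map_product_projection assms)
  have "openin KGtop {s \<in> topspace KGtop. s N \<in> {v \<in> cosets N \<rightarrow>\<^sub>E carrier k. P v}}"
    by (rule openin_continuous_map_preimage[OF c]) auto
  moreover have "{s \<in> topspace KGtop. s N \<in> {v \<in> cosets N \<rightarrow>\<^sub>E carrier k. P v}} = {s \<in> carrier KG. P (s N)}"
    using KG_component[OF _ assms] unfolding topspace_KGtop by blast
  ultimately show ?thesis by simp
qed

text \<open>The components carry discrete topologies, so continuity into \<open>k[[G]]\<close> is
  local constancy of every component.\<close>

lemma continuous_into_KG:
  assumes f: "f \<in> topspace X \<rightarrow> carrier KG"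
    and loc: "\<And>N x. N \<in> ONS \<Longrightarrow> x \<in> topspace X \<Longrightarrow> \<exists>U. openin X U \<and> x \<in> U \<and> (\<forall>y\<in>U. f y N = f x N)"
  shows "continuous_map X KGtop f"
  unfolding KGtop_eq continuous_map_in_subtopology continuous_map_componentwise
proof (intro conjI ballI)
  show "f ` topspace X \<subseteq> extensional ONS"
    using f mem_KG_iff[THEN iffD1, THEN conjunct1] by (auto simp: Pi_iff PiE_def)
  show "f \<in> topspace X \<rightarrow> carrier KG" by (fact f)
  fix N assume N: "N \<in> ONS"
  show "continuous_map X (discrete_topology (cosets N \<rightarrow>\<^sub>E carrier k)) (\<lambda>x. f x N)"
    unfolding continuous_map_def
  proof (intro conjI allI impI)
    show "(\<lambda>x. f x N) \<in> topspace X \<rightarrow> topspace (discrete_topology (cosets N \<rightarrow>\<^sub>E carrier k))"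
      using f KG_component[OF _ N] by (simp add: Pi_iff)
    fix V
    show "openin X {x \<in> topspace X. f x N \<in> V}"
    proof (subst openin_subopen, intro ballI)
      fix x assume x: "x \<in> {x \<in> topspace X. f x N \<in> V}"
      then obtain U where U: "openin X U" "x \<in> U" "\<forall>y\<in>U. f y N = f x N" using loc[OF N] by blast
      have "y \<in> topspace X" "f y N \<in> V" if "y \<in> U" for y
        using U(3)[rule_format, OF that] x openin_subset[OF U(1)] that by auto
      then have "U \<subseteq> {x \<in> topspace X. f x N \<in> V}" by blast
      with U show "\<exists>T. openin X T \<and> x \<in> T \<and> T \<subseteq> {x \<in> topspace X. f x N \<in> V}" by blast
    qed
  qed
qed

lemma continuous_KG_KG:
  assumes f: "f \<in> carrier KG \<rightarrow> carrier KG"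
    and loc: "\<And>N. N \<in> ONS \<Longrightarrow> \<exists>M\<in>ONS. \<forall>r\<in>carrier KG. \<forall>s\<in>carrier KG. r M = s M \<longrightarrow> f r N = f s N"
  shows "continuous_map KGtop KGtop f"
proof (rule continuous_into_KG)
  show "f \<in> topspace KGtop \<rightarrow> carrier KG" using f by (simp add: topspace_KGtop)
  fix N x assume N: "N \<in> ONS" and x: "x \<in> topspace KGtop"
  obtain M where M: "M \<in> ONS" "\<And>r s. r \<in> carrier KG \<Longrightarrow> s \<in> carrier KG \<Longrightarrow> r M = s M \<Longrightarrow> f r N = f s N"
    using loc[OF N] by blast
  show "\<exists>U. openin KGtop U \<and> x \<in> U \<and> (\<forall>y\<in>U. f y N = f x N)"
    using openin_component[OF M(1), of "\<lambda>v. v = x M"] x M(2) unfolding topspace_KGtop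
    by (intro exI[of _ "{s \<in> carrier KG. s M = x M}"]) blast
qed

lemma finite_Int_ONS:
  assumes "finite F" "F \<subseteq> ONS"
  shows "\<exists>M\<in>ONS. \<forall>N\<in>F. M \<subseteq> N"
  using assms
proof (induction F)
  case empty
  then show ?case using G.carrier_open_normal by auto
next
  case (insert N F)
  then obtain M where "M \<in> ONS" "\<forall>N\<in>F. M \<subseteq> N" by auto
  then show ?case using insert.prems G.open_normal_Int[of N M] by (intro bexI[of _ "N \<inter> M"]) auto
qed

text \<open>A basic open set restricts only finitely many components, and the component at the
  intersection of the subgroups involved determines them all.\<close>

lemma nbhd_component:
  assumes D: "openin KGtop D" and r: "r \<in> D"
  obtains N where "N \<in> ONS" "\<And>s. s \<in> carrier KG \<Longrightarrow> s N = r N \<Longrightarrow> s \<in> D"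
proof -
  let ?P = "product_topology (\<lambda>N. discrete_topology (cosets N \<rightarrow>\<^sub>E carrier k)) ONS"
  obtain T where T: "openin ?P T" "D = T \<inter> carrier KG"
    using D unfolding KGtop_eq openin_subtopology by blast
  then obtain U where U: "finite {N \<in> ONS. U N \<noteq> (cosets N \<rightarrow>\<^sub>E carrier k)}" "r \<in> Pi\<^sub>E ONS U" "Pi\<^sub>E ONS U \<subseteq> T"
    using r unfolding openin_product_topology_alt by fastforce
  obtain M where M: "M \<in> ONS" "\<forall>N\<in>{N \<in> ONS. U N \<noteq> (cosets N \<rightarrow>\<^sub>E carrier k)}. M \<subseteq> N"
    using finite_Int_ONS[OF U(1)] by blast
  have "s \<in> D" if s: "s \<in> carrier KG" "s M = r M" for s
  proof -
    have rK: "r \<in> carrier KG" using r T by blast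
    have "s N \<in> U N" if N: "N \<in> ONS" for N
    proof (cases "U N = (cosets N \<rightarrow>\<^sub>E carrier k)")
      case True then show ?thesis using KG_component[OF s(1) N] by simp
    next
      case False
      then have "s N = r N" using M N s rK KG_component_mono[OF s(1) rK M(1) N] by blast
      then show ?thesis using U(2) N by auto
    qed
    then have "s \<in> Pi\<^sub>E ONS U" using mem_KG_iff[THEN iffD1, THEN conjunct1, OF s(1)] by (simp add: PiE_def Pi_def)
    then show ?thesis using U(3) T(2) s(1) by blast
  qed
  with M(1) that show thesis by blast
qed

text \<open>The product of the finite discrete spaces is compact, and each compatibility condition
  compares two continuous maps into a discrete space, so it cuts out a closed set.\<close>

lemma compact_KG: "compact_space KGtop"
proof -
  let ?P = "product_topology (\<lambda>N. discrete_topology (cosets N \<rightarrow>\<^sub>E carrier k)) ONS"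
  have fin: "finite (cosets N \<rightarrow>\<^sub>E carrier k)" if "N \<in> ONS" for N
    using ONS(5)[OF that] finite_k by (simp add: finite_PiE)
  then have cP: "compact_space ?P" by (simp add: compact_space_product_topology compact_space_discrete_topology)
  let ?E = "\<lambda>N M. {a \<in> topspace ?P. a M = (\<lambda>C\<in>cosets M. \<Oplus>\<^bsub>k\<^esub>D\<in>{D \<in> cosets N. D \<subseteq> C}. a N D)}"
  have cl: "closedin ?P (?E N M)" if NM: "N \<in> ONS" "M \<in> ONS" for N M
  proof (rule closedin_continuous_maps_eq)
    show "Hausdorff_space (discrete_topology (cosets M \<rightarrow>\<^sub>E carrier k))" by simp
    show "continuous_map ?P (discrete_topology (cosets M \<rightarrow>\<^sub>E carrier k)) (\<lambda>a. a M)"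
      by (rule continuous_map_product_projection[OF NM(2)])
    have "continuous_map ?P (discrete_topology (cosets M \<rightarrow>\<^sub>E carrier k))
       ((\<lambda>v. \<lambda>C\<in>cosets M. \<Oplus>\<^bsub>k\<^esub>D\<in>{D \<in> cosets N. D \<subseteq> C}. v D) \<circ> (\<lambda>a. a N))"
      by (rule continuous_map_compose[OF continuous_map_product_projection[OF NM(1)]])
        (auto intro!: k.finsum_closed)
    then show "continuous_map ?P (discrete_topology (cosets M \<rightarrow>\<^sub>E carrier k))
       (\<lambda>a. \<lambda>C\<in>cosets M. \<Oplus>\<^bsub>k\<^esub>D\<in>{D \<in> cosets N. D \<subseteq> C}. a N D)" by (simp add: o_def)
  qed
  let ?I = "{(N, M). N \<in> ONS \<and> M \<in> ONS \<and> N \<subseteq> M}"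
  have "carrier KG = topspace ?P \<inter> (\<Inter>(N, M)\<in>?I. ?E N M)"
  proof -
    have "a M = (\<lambda>C\<in>cosets M. \<Oplus>\<^bsub>k\<^esub>D\<in>{D \<in> cosets N. D \<subseteq> C}. a N D) \<longleftrightarrow>
        (\<forall>C\<in>cosets M. a M C = (\<Oplus>\<^bsub>k\<^esub>D\<in>{D \<in> cosets N. D \<subseteq> C}. a N D))"
      if "a \<in> topspace ?P" "M \<in> ONS" for a N M
    proof -
      have "a M \<in> extensional (cosets M)" using that by (auto simp: PiE_iff)
      then show ?thesis
        by (metis (no_types, lifting) extensionalityI restrict_apply restrict_extensional)
    qed
    then show ?thesis unfolding set_eq_iff mem_KG_iff by auto
  qed
  moreover have "closedin ?P (topspace ?P \<inter> (\<Inter>(N, M)\<in>?I. ?E N M))"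
  proof -
    have "?I \<noteq> {}" using G.carrier_open_normal by auto
    then have "closedin ?P (\<Inter>(N, M)\<in>?I. ?E N M)"
      by (intro closedin_Inter) (use cl in auto)
    then show ?thesis by (intro closedin_Int closedin_topspace)
  qed
  ultimately have "closedin ?P (carrier KG)" by simp
  then show ?thesis
    unfolding KGtop_eq using cP by (simp add: closedin_compact_space compact_space_subtopology)
qed

lemma continuous_pt:
  assumes "c \<in> carrier k"
  shows "continuous_map G.Gtop KGtop (pt c)"
proof (rule continuous_into_KG)
  show "pt c \<in> topspace G.Gtop \<rightarrow> carrier KG"
    using pt_closed[OF assms] by (simp add: G.topspace_gtopology)
  fix N g assume N: "N \<in> ONS" and "g \<in> topspace G.Gtop"
  then have g: "g \<in> carrier G" by (simp add: G.topspace_gtopology)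
  have "pt c y N = pt c g N" if y: "y \<in> N #>\<^bsub>G\<^esub> g" for y
  proof -
    have "y \<in> C \<longleftrightarrow> g \<in> C" if C: "C \<in> cosets N" for C
      using coset_unique[OF N C coset_mem(1)[OF N g]] y coset_mem(2)[OF N g] by blast
    then show ?thesis using N by (auto simp: cga_point_def intro!: restrict_ext)
  qed
  then show "\<exists>U. openin G.Gtop U \<and> g \<in> U \<and> (\<forall>y\<in>U. pt c y N = pt c g N)"
    using G.openin_r_coset[OF ONS(3)[OF N] g] coset_mem(2)[OF N g] by blast
qed

section \<open>Density of finite combinations of group elements\<close>

inductive_set span :: "'g set \<Rightarrow> ('g, 'k) cga set" for H where
  zero: "\<zero>\<^bsub>KG\<^esub> \<in> span H"
| add: "c \<in> carrier k \<Longrightarrow> h \<in> H \<Longrightarrow> s \<in> span H \<Longrightarrow> pt c h \<oplus>\<^bsub>KG\<^esub> s \<in> span H"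

text \<open>Each set \<open>D\<close> of the family contributes its coefficient at one chosen
  element of \<open>H\<close> in it; at level \<open>N\<close> only the coset containing that
  element matters. The family is arbitrary because two are used: the cosets of \<open>N\<close>, and
  the cosets of \<open>H \<inter> N\<close> in \<open>H\<close>.\<close>

lemma span_approx:
  assumes N: "N \<in> ONS" and F: "finite F" and b: "b \<in> F \<rightarrow> carrier k"
    and H: "\<And>D. D \<in> F \<Longrightarrow> \<exists>h\<in>H. h \<in> D" and D: "\<And>D. D \<in> F \<Longrightarrow> \<exists>C\<in>cosets N. D \<subseteq> C"
  shows "\<exists>s\<in>span H. \<forall>C\<in>cosets N. s N C = (\<Oplus>\<^bsub>k\<^esub>D\<in>{D \<in> F. D \<subseteq> C}. b D)"
  using F b H D
proof (induction F)
  case empty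
  then show ?case using N by (intro bexI[of _ "\<zero>\<^bsub>KG\<^esub>"]) (auto simp: KG_zero span.zero)
next
  case (insert D F)
  then obtain s where s: "s \<in> span H" "\<And>C. C \<in> cosets N \<Longrightarrow> s N C = (\<Oplus>\<^bsub>k\<^esub>D\<in>{D \<in> F. D \<subseteq> C}. b D)"
    by auto
  obtain h where h: "h \<in> H" "h \<in> D" using insert.prems(2) by blast
  obtain E where E: "E \<in> cosets N" "D \<subseteq> E" using insert.prems(3) by blast
  have bD: "b D \<in> carrier k" using insert.prems(1) by auto
  have "(pt (b D) h \<oplus>\<^bsub>KG\<^esub> s) N C = (\<Oplus>\<^bsub>k\<^esub>D\<in>{D' \<in> insert D F. D' \<subseteq> C}. b D)" if C: "C \<in> cosets N" for C
  proof -
    have hC: "h \<in> C \<longleftrightarrow> D \<subseteq> C" using coset_unique[OF N C E(1)] h(2) E(2) by blast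
    have 1: "(\<Oplus>\<^bsub>k\<^esub>D\<in>{D \<in> F. D \<subseteq> C}. b D) \<in> carrier k"
      using insert.prems(1) by (intro k.finsum_closed) auto
    have v: "(pt (b D) h \<oplus>\<^bsub>KG\<^esub> s) N C = (if D \<subseteq> C then b D else \<zero>\<^bsub>k\<^esub>) \<oplus>\<^bsub>k\<^esub> (\<Oplus>\<^bsub>k\<^esub>D\<in>{D \<in> F. D \<subseteq> C}. b D)"
      using N C by (simp add: KG_add s(2) pt_val hC)
    show ?thesis
    proof (cases "D \<subseteq> C")
      case True
      then have "{D' \<in> insert D F. D' \<subseteq> C} = insert D {D \<in> F. D \<subseteq> C}" by auto
      moreover have "(\<Oplus>\<^bsub>k\<^esub>D\<in>insert D {D \<in> F. D \<subseteq> C}. b D) = b D \<oplus>\<^bsub>k\<^esub> (\<Oplus>\<^bsub>k\<^esub>D\<in>{D \<in> F. D \<subseteq> C}. b D)"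
        by (rule k.finsum_insert) (use insert.hyps insert.prems(1) in auto)
      ultimately show ?thesis using v True by simp
    next
      case False
      then have "{D' \<in> insert D F. D' \<subseteq> C} = {D \<in> F. D \<subseteq> C}" by auto
      then show ?thesis using v False 1 by simp
    qed
  qed
  then show ?case using span.add[OF bD h(1) s(1)] by blast
qed

lemma closed_approx:
  assumes A: "closedin KGtop A" "S \<subseteq> A" and r: "r \<in> carrier KG"
    and appr: "\<And>N. N \<in> ONS \<Longrightarrow> \<exists>s\<in>S. s N = r N"
  shows "r \<in> A"
proof (rule ccontr)
  assume "r \<notin> A"
  then have "r \<in> topspace KGtop - A" using r topspace_KGtop by simp
  moreover have "openin KGtop (topspace KGtop - A)" using A(1) by blast
  ultimately obtain N where N: "N \<in> ONS" "\<And>s. s \<in> carrier KG \<Longrightarrow> s N = r N \<Longrightarrow> s \<in> topspace KGtop - A"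
    using nbhd_component by metis
  obtain s where "s \<in> S" "s N = r N" using appr[OF N(1)] by blast
  then show False using N(2)[of s] A closedin_subset[OF A(1)] topspace_KGtop by blast
qed

lemma KG_add_closed:
  assumes "a \<in> carrier KG" "b \<in> carrier KG"
  shows "a \<oplus>\<^bsub>KG\<^esub> b \<in> carrier KG"
proof -
  have "a M C \<oplus>\<^bsub>k\<^esub> b M C = (\<Oplus>\<^bsub>k\<^esub>D\<in>{D \<in> cosets N. D \<subseteq> C}. a N D \<oplus>\<^bsub>k\<^esub> b N D)"
    if "N \<in> ONS" "M \<in> ONS" "N \<subseteq> M" "C \<in> cosets M" for N M C
    using KG_push[OF assms(1) that] KG_push[OF assms(2) that] KG_val[OF assms(1) that(1)] KG_val[OF assms(2) that(1)]
    by (simp add: k.finsum_addf Pi_iff)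
  then have "(a \<oplus>\<^bsub>KG\<^esub> b) M C = (\<Oplus>\<^bsub>k\<^esub>D\<in>{D \<in> cosets N. D \<subseteq> C}. (a \<oplus>\<^bsub>KG\<^esub> b) N D)"
    if "N \<in> ONS" "M \<in> ONS" "N \<subseteq> M" "C \<in> cosets M" for N M C
    using that KG_val[OF assms(1) that(1)] KG_val[OF assms(2) that(1)]
    unfolding KG_add[OF that(2,4)] \<open>\<And>N M C. \<lbrakk>N \<in> ONS; M \<in> ONS; N \<subseteq> M; C \<in> cosets M\<rbrakk> \<Longrightarrow>
      a M C \<oplus>\<^bsub>k\<^esub> b M C = (\<Oplus>\<^bsub>k\<^esub>D\<in>{D \<in> cosets N. D \<subseteq> C}. a N D \<oplus>\<^bsub>k\<^esub> b N D)\<close>[OF that]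
    by (intro k.finsum_cong') (auto simp: KG_add)
  moreover have "a \<oplus>\<^bsub>KG\<^esub> b \<in> extensional ONS" by (simp add: completed_group_algebra_def)
  moreover have "(a \<oplus>\<^bsub>KG\<^esub> b) N \<in> cosets N \<rightarrow>\<^sub>E carrier k" if "N \<in> ONS" for N
    using KG_val[OF assms(1) that] KG_val[OF assms(2) that] that
    by (auto simp: completed_group_algebra_def group_algebra_def)
  ultimately show ?thesis by (intro KG_memI)
qed

lemma span_subset: "H \<subseteq> carrier G \<Longrightarrow> span H \<subseteq> carrier KG"
proof
  fix s assume H: "H \<subseteq> carrier G" and "s \<in> span H"
  from this(2) show "s \<in> carrier KG"
  proof induction
    case zero
    show ?case
    proof (rule KG_memI)
      show "\<zero>\<^bsub>KG\<^esub> M C = (\<Oplus>\<^bsub>k\<^esub>D\<in>{D \<in> cosets N. D \<subseteq> C}. \<zero>\<^bsub>KG\<^esub> N D)"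
        if "N \<in> ONS" "M \<in> ONS" "N \<subseteq> M" "C \<in> cosets M" for N M C
        using that by (subst k.add.finprod_one_eqI) (simp_all add: KG_zero)
      show "\<zero>\<^bsub>KG\<^esub> \<in> extensional ONS" by (simp add: completed_group_algebra_def)
    qed (auto simp: completed_group_algebra_def group_algebra_def)
  next
    case add
    then show ?case using H by (intro KG_add_closed pt_closed) auto
  qed
qed

lemma KG_approx:
  assumes r: "r \<in> carrier KG" and N: "N \<in> ONS"
  shows "\<exists>s\<in>span (carrier G). s N = r N"
proof -
  obtain s where s: "s \<in> span (carrier G)" "\<And>C. C \<in> cosets N \<Longrightarrow> s N C = (\<Oplus>\<^bsub>k\<^esub>D\<in>{D \<in> cosets N. D \<subseteq> C}. r N D)"
  proof -
    have "\<exists>s\<in>span (carrier G). \<forall>C\<in>cosets N. s N C = (\<Oplus>\<^bsub>k\<^esub>D\<in>{D \<in> cosets N. D \<subseteq> C}. r N D)"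
    proof (rule span_approx[OF N ONS(5)[OF N]])
      show "r N \<in> cosets N \<rightarrow> carrier k" using KG_val[OF r N] by auto
      show "\<exists>h\<in>carrier G. h \<in> D" if "D \<in> cosets N" for D
        using coset_nonempty[OF N that] coset_eq(2)[OF N that] by blast
    qed blast
    then show thesis using that by blast
  qed
  have "s \<in> carrier KG" using s(1) span_subset[OF order_refl] by blast
  then have "s N = r N"
  proof (rule KG_component_ext[OF _ r N])
    show "s N C = r N C" if "C \<in> cosets N" for C
      unfolding s(2)[OF that] by (rule KG_push[OF r N N order_refl that, symmetric])
  qed
  then show ?thesis using s(1) by blast
qed

text \<open>Finite sums of points agree with \<open>r\<close> at any prescribed level, so a closed
  additive condition reaches \<open>r\<close>. Identities in \<open>k[[G]]\<close> are thereby
  reduced to computations with group elements.\<close>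

lemma KG_dense:
  assumes A: "closedin KGtop A" and z: "\<zero>\<^bsub>KG\<^esub> \<in> A"
    and a: "\<And>a b. a \<in> A \<Longrightarrow> b \<in> A \<Longrightarrow> a \<oplus>\<^bsub>KG\<^esub> b \<in> A"
    and p: "\<And>c g. c \<in> carrier k \<Longrightarrow> g \<in> carrier G \<Longrightarrow> pt c g \<in> A"
    and r: "r \<in> carrier KG"
  shows "r \<in> A"
proof (rule closed_approx[OF A _ r KG_approx[OF r]])
  show "span (carrier G) \<subseteq> A"
  proof
    fix s assume "s \<in> span (carrier G)"
    then show "s \<in> A" by induction (use z a p in auto)
  qed
qed

end

section \<open>Elements of \<open>k[[G]]\<close> as measures\<close>

context cga_base
begin

text \<open>In terms of measures: the mass of a union of \<open>M\<close>-cosets does not depend on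
  the level at which it is computed, because each \<open>M\<close>-coset is the disjoint union of
  its \<open>N\<close>-cosets.\<close>

lemma finsum_refine:
  assumes a: "a \<in> carrier KG" and NM: "N \<in> ONS" "M \<in> ONS" "N \<subseteq> M"
    and Z: "\<And>E z. E \<in> cosets M \<Longrightarrow> z \<in> E \<Longrightarrow> z \<in> Z \<Longrightarrow> E \<subseteq> Z"
  shows "(\<Oplus>\<^bsub>k\<^esub>D\<in>{D \<in> cosets N. D \<subseteq> Z}. a N D) = (\<Oplus>\<^bsub>k\<^esub>E\<in>{E \<in> cosets M. E \<subseteq> Z}. a M E)"
proof -
  let ?I = "{E \<in> cosets M. E \<subseteq> Z}" and ?A = "\<lambda>E. {D \<in> cosets N. D \<subseteq> E}"
  have "(\<Oplus>\<^bsub>k\<^esub>E\<in>?I. a M E) = (\<Oplus>\<^bsub>k\<^esub>E\<in>?I. \<Oplus>\<^bsub>k\<^esub>D\<in>?A E. a N D)"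
  proof (rule k.finsum_cong')
    show "(\<lambda>E. \<Oplus>\<^bsub>k\<^esub>D\<in>?A E. a N D) \<in> ?I \<rightarrow> carrier k"
      using KG_val[OF a NM(1)] by (intro Pi_I k.finsum_closed) auto
    show "a M E = (\<Oplus>\<^bsub>k\<^esub>D\<in>?A E. a N D)" if "E \<in> ?I" for E
      by (rule KG_push[OF a NM]) (use that in auto)
  qed simp
  also have "\<dots> = (\<Oplus>\<^bsub>k\<^esub>D\<in>\<Union>(?A ` ?I). a N D)"
  proof (rule k.add.finprod_UN_disjoint[symmetric])
    show "finite ?I" "\<And>E. finite (?A E)" using finite_cosets_subset NM by auto
    show "pairwise (\<lambda>E F. disjnt (?A E) (?A F)) ?I"
    proof (rule pairwiseI)
      fix E F assume EF: "E \<in> ?I" "F \<in> ?I" "E \<noteq> F"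
      have False if d: "D \<in> ?A E" "D \<in> ?A F" for D
      proof -
        obtain z where "z \<in> D" using coset_nonempty[OF NM(1)] d by blast
        then show False using coset_unique[OF NM(2), of E F z] d EF by blast
      qed
      then show "disjnt (?A E) (?A F)" by (auto simp: disjnt_iff)
    qed
    show "a N D \<in> carrier k" if "D \<in> ?A E" for E D using KG_val[OF a NM(1)] that by auto
  qed
  also have "\<Union>(?A ` ?I) = {D \<in> cosets N. D \<subseteq> Z}"
  proof -
    have "\<exists>E\<in>?I. D \<subseteq> E" if D: "D \<in> cosets N" "D \<subseteq> Z" for D
    proof -
      obtain z where z: "z \<in> D" using coset_nonempty[OF NM(1) D(1)] by blast
      have zG: "z \<in> carrier G" using coset_eq(2)[OF NM(1) D(1) z] .
      have E: "M #>\<^bsub>G\<^esub> z \<in> cosets M" "z \<in> M #>\<^bsub>G\<^esub> z" using coset_mem[OF NM(2) zG] by auto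
      show ?thesis using Z[OF E] coset_subset[OF NM D(1) E(1) z E(2)] E z D(2) by blast
    qed
    then show ?thesis by auto
  qed
  finally show ?thesis by simp
qed

text \<open>Each member of \<open>F\<close> is nonempty and so lies in exactly one
  \<open>N\<close>-coset, by which the sum over \<open>F\<close> may be grouped. Together with
  \<open>finsum_refine\<close> this gives compatibility of \<open>restr\<close> and of
  \<open>cga_incl\<close>.\<close>

lemma finsum_regroup:
  assumes NM: "N \<in> ONS" "M \<in> ONS" "N \<subseteq> M" and C: "C \<in> cosets M"
    and F: "finite F" "f \<in> F \<rightarrow> carrier k" "\<And>D. D \<in> F \<Longrightarrow> D \<noteq> {} \<and> (\<exists>C\<in>cosets N. D \<subseteq> C)"
  shows "(\<Oplus>\<^bsub>k\<^esub>E\<in>{E \<in> cosets N. E \<subseteq> C}. \<Oplus>\<^bsub>k\<^esub>D\<in>{D \<in> F. D \<subseteq> E}. f D) = (\<Oplus>\<^bsub>k\<^esub>D\<in>{D \<in> F. D \<subseteq> C}. f D)"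
proof -
  let ?I = "{E \<in> cosets N. E \<subseteq> C}" and ?A = "\<lambda>E. {D \<in> F. D \<subseteq> E}"
  have "(\<Oplus>\<^bsub>k\<^esub>D\<in>\<Union>(?A ` ?I). f D) = (\<Oplus>\<^bsub>k\<^esub>E\<in>?I. \<Oplus>\<^bsub>k\<^esub>D\<in>?A E. f D)"
  proof (rule k.add.finprod_UN_disjoint)
    show "finite ?I" "\<And>E. finite (?A E)" using finite_cosets_subset NM F(1) by auto
    show "pairwise (\<lambda>E F. disjnt (?A E) (?A F)) ?I"
    proof (rule pairwiseI)
      fix E F' assume EF: "E \<in> ?I" "F' \<in> ?I" "E \<noteq> F'"
      have False if d: "D \<in> ?A E" "D \<in> ?A F'" for D
      proof -
        obtain z where "z \<in> D" using F(3) d by blast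
        then show False using coset_unique[OF NM(1), of E F' z] d EF by blast
      qed
      then show "disjnt (?A E) (?A F')" by (auto simp: disjnt_iff)
    qed
    show "f D \<in> carrier k" if "D \<in> ?A E" for E D using F(2) that by auto
  qed
  moreover have "\<Union>(?A ` ?I) = {D \<in> F. D \<subseteq> C}"
  proof -
    have "\<exists>E\<in>?I. D \<subseteq> E" if D: "D \<in> F" "D \<subseteq> C" for D
    proof -
      obtain z E where z: "z \<in> D" and E: "E \<in> cosets N" "D \<subseteq> E" using F(3)[OF D(1)] by blast
      show ?thesis using coset_subset[OF NM E(1) C, of z] E z D(2) by blast
    qed
    then show ?thesis by auto
  qed
  ultimately show ?thesis by simp
qed

text \<open>An element of \<open>k[[G]]\<close> is a finitely additive \<open>k\<close>-valued measure on the clopen subsets of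
  \<open>G\<close>; \<open>restr L S\<close> restricts it to \<open>S\<close>, which has to be a union of cosets of \<open>L\<close>.\<close>

definition restr :: "'g set \<Rightarrow> 'g set \<Rightarrow> ('g, 'k) cga \<Rightarrow> ('g, 'k) cga" where
  "restr L S r = (\<lambda>N\<in>ONS. \<lambda>C\<in>cosets N. \<Oplus>\<^bsub>k\<^esub>D\<in>{D \<in> {D \<in> cosets (N \<inter> L). D \<subseteq> S}. D \<subseteq> C}. r (N \<inter> L) D)"

lemma restr_val:
  "N \<in> ONS \<Longrightarrow> C \<in> cosets N \<Longrightarrow>
    restr L S r N C = (\<Oplus>\<^bsub>k\<^esub>D\<in>{D \<in> {D \<in> cosets (N \<inter> L). D \<subseteq> S}. D \<subseteq> C}. r (N \<inter> L) D)"
  by (simp add: restr_def)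

lemma coset_Int_saturated:
  assumes L: "L \<in> ONS" and S: "\<forall>E\<in>cosets L. \<forall>z\<in>E. z \<in> S \<longrightarrow> E \<subseteq> S"
    and M: "M \<in> ONS" "C \<in> cosets M" and E: "E \<in> cosets (M \<inter> L)" "z \<in> E" "z \<in> S \<inter> C"
  shows "E \<subseteq> S \<inter> C"
proof -
  have MiL: "M \<inter> L \<in> ONS" using G.open_normal_Int[OF M(1) L] .
  have z: "z \<in> carrier G" using coset_eq(2)[OF MiL E(1,2)] .
  have "E \<subseteq> C" using coset_subset[OF MiL M(1) _ E(1) M(2) E(2)] E(3) by blast
  moreover have "E \<subseteq> L #>\<^bsub>G\<^esub> z" using coset_subset[OF MiL L _ E(1) coset_mem(1)[OF L z] E(2) coset_mem(2)[OF L z]] by blast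
  moreover have "L #>\<^bsub>G\<^esub> z \<subseteq> S" using S coset_mem[OF L z] E(3) by blast
  ultimately show ?thesis by blast
qed

context
  fixes L S :: "'g set"
  assumes L: "L \<in> ONS" and S: "\<forall>E\<in>cosets L. \<forall>z\<in>E. z \<in> S \<longrightarrow> E \<subseteq> S"
begin

text \<open>The mass of \<open>S \<inter> C\<close> is moved from level \<open>M \<inter> L\<close>
  to \<open>N \<inter> L\<close> and then distributed over the \<open>N\<close>-cosets in
  \<open>C\<close>. The intersection with \<open>L\<close> is there because \<open>S\<close> is
  known to be a union of cosets only from level \<open>L\<close> on.\<close>

lemma restr_closed:
  assumes r: "r \<in> carrier KG"
  shows "restr L S r \<in> carrier KG"
proof (rule KG_memI)
  show "restr L S r \<in> extensional ONS" by (simp add: restr_def)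
  show "restr L S r N \<in> cosets N \<rightarrow>\<^sub>E carrier k" if "N \<in> ONS" for N
    using that KG_val[OF r G.open_normal_Int[OF that L]] by (auto simp: restr_def intro!: k.finsum_closed)
  fix N M C assume h: "N \<in> ONS" "M \<in> ONS" "N \<subseteq> M" "C \<in> cosets M"
  have NL: "N \<inter> L \<in> ONS" and MiL: "M \<inter> L \<in> ONS" using G.open_normal_Int h L by auto
  let ?F = "{D \<in> cosets (N \<inter> L). D \<subseteq> S}"
  have eq: "{D \<in> {D \<in> cosets N'. D \<subseteq> S}. D \<subseteq> C} = {D \<in> cosets N'. D \<subseteq> S \<inter> C}" for N' by auto
  have "restr L S r M C = (\<Oplus>\<^bsub>k\<^esub>D\<in>{D \<in> cosets (M \<inter> L). D \<subseteq> S \<inter> C}. r (M \<inter> L) D)"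
    using h by (simp only: restr_val eq)
  also have "\<dots> = (\<Oplus>\<^bsub>k\<^esub>D\<in>{D \<in> cosets (N \<inter> L). D \<subseteq> S \<inter> C}. r (N \<inter> L) D)"
  proof (rule finsum_refine[OF r NL MiL, symmetric])
    show "E \<subseteq> S \<inter> C" if "E \<in> cosets (M \<inter> L)" "z \<in> E" "z \<in> S \<inter> C" for E z
      by (rule coset_Int_saturated[OF L S h(2,4) that])
  qed (use h in auto)
  also have "\<dots> = (\<Oplus>\<^bsub>k\<^esub>D\<in>{D \<in> ?F. D \<subseteq> C}. r (N \<inter> L) D)" by (simp only: eq)
  also have "\<dots> = (\<Oplus>\<^bsub>k\<^esub>E\<in>{E \<in> cosets N. E \<subseteq> C}. \<Oplus>\<^bsub>k\<^esub>D\<in>{D \<in> ?F. D \<subseteq> E}. r (N \<inter> L) D)"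
  proof (rule finsum_regroup[OF h, symmetric])
    show "finite ?F" using finite_cosets_subset[OF NL] .
    show "r (N \<inter> L) \<in> ?F \<rightarrow> carrier k" using KG_val[OF r NL] by auto
    show "D \<noteq> {} \<and> (\<exists>C\<in>cosets N. D \<subseteq> C)" if "D \<in> ?F" for D
    proof -
      have D: "D \<in> cosets (N \<inter> L)" using that by blast
      obtain z where z: "z \<in> D" using coset_nonempty[OF NL D] by blast
      have zG: "z \<in> carrier G" using coset_eq(2)[OF NL D z] .
      show ?thesis using z coset_mem[OF h(1) zG] coset_subset[OF NL h(1) _ D coset_mem(1)[OF h(1) zG] z] by blast
    qed
  qed
  also have "\<dots> = (\<Oplus>\<^bsub>k\<^esub>E\<in>{E \<in> cosets N. E \<subseteq> C}. restr L S r N E)"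
  proof (rule k.finsum_cong')
    show "restr L S r N \<in> {E \<in> cosets N. E \<subseteq> C} \<rightarrow> carrier k"
      using h(1) KG_val[OF r NL] by (auto simp: restr_val intro!: k.finsum_closed)
  qed (use h(1) in \<open>simp_all add: restr_val\<close>)
  finally show "restr L S r M C = (\<Oplus>\<^bsub>k\<^esub>E\<in>{E \<in> cosets N. E \<subseteq> C}. restr L S r N E)" .
qed

lemma restr_add:
  assumes a: "a \<in> carrier KG" and b: "b \<in> carrier KG"
  shows "restr L S (a \<oplus>\<^bsub>KG\<^esub> b) = restr L S a \<oplus>\<^bsub>KG\<^esub> restr L S b"
proof (rule KG_ext)
  show "restr L S (a \<oplus>\<^bsub>KG\<^esub> b) \<in> carrier KG" "restr L S a \<oplus>\<^bsub>KG\<^esub> restr L S b \<in> carrier KG"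
    using a b by (auto intro!: restr_closed KG_add_closed)
  fix N C assume N: "N \<in> ONS" and C: "C \<in> cosets N"
  have NL: "N \<inter> L \<in> ONS" using G.open_normal_Int N L by auto
  let ?F = "{D \<in> {D \<in> cosets (N \<inter> L). D \<subseteq> S}. D \<subseteq> C}"
  have "(\<Oplus>\<^bsub>k\<^esub>D\<in>?F. (a \<oplus>\<^bsub>KG\<^esub> b) (N \<inter> L) D) = (\<Oplus>\<^bsub>k\<^esub>D\<in>?F. a (N \<inter> L) D \<oplus>\<^bsub>k\<^esub> b (N \<inter> L) D)"
    by (rule k.finsum_cong') (use KG_val[OF a NL] KG_val[OF b NL] in \<open>auto simp: KG_add[OF NL]\<close>)
  also have "\<dots> = (\<Oplus>\<^bsub>k\<^esub>D\<in>?F. a (N \<inter> L) D) \<oplus>\<^bsub>k\<^esub> (\<Oplus>\<^bsub>k\<^esub>D\<in>?F. b (N \<inter> L) D)"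
    by (rule k.finsum_addf) (use KG_val[OF a NL] KG_val[OF b NL] in auto)
  finally show "restr L S (a \<oplus>\<^bsub>KG\<^esub> b) N C = (restr L S a \<oplus>\<^bsub>KG\<^esub> restr L S b) N C"
    using N C by (simp only: KG_add restr_val)
qed

lemma restr_pt:
  assumes c: "c \<in> carrier k" and g: "g \<in> carrier G"
  shows "restr L S (pt c g) = pt (if g \<in> S then c else \<zero>\<^bsub>k\<^esub>) g"
proof (rule KG_ext)
  show "restr L S (pt c g) \<in> carrier KG" "pt (if g \<in> S then c else \<zero>\<^bsub>k\<^esub>) g \<in> carrier KG"
    using c g by (auto intro!: restr_closed pt_closed)
  fix N C assume N: "N \<in> ONS" and C: "C \<in> cosets N"
  have NL: "N \<inter> L \<in> ONS" using G.open_normal_Int N L by auto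
  let ?F = "{D \<in> {D \<in> cosets (N \<inter> L). D \<subseteq> S}. D \<subseteq> C}"
  have "restr L S (pt c g) N C = (\<Oplus>\<^bsub>k\<^esub>D\<in>?F. if g \<in> D then c else \<zero>\<^bsub>k\<^esub>)"
    unfolding restr_val[OF N C] by (rule k.finsum_cong') (use c pt_val[OF NL] in auto)
  also have "\<dots> = (if \<exists>D\<in>?F. g \<in> D then c else \<zero>\<^bsub>k\<^esub>)"
    by (rule finsum_indicator[OF c]) (use finite_cosets_subset[OF NL] coset_unique[OF NL] in auto)
  also have "(\<exists>D\<in>?F. g \<in> D) \<longleftrightarrow> g \<in> S \<and> g \<in> C"
  proof
    assume "g \<in> S \<and> g \<in> C"
    then have "(N \<inter> L) #>\<^bsub>G\<^esub> g \<subseteq> S \<inter> C"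
      using coset_Int_saturated[OF L S N C coset_mem[OF NL g]] by blast
    then show "\<exists>D\<in>?F. g \<in> D" using coset_mem[OF NL g] by blast
  qed blast
  finally show "restr L S (pt c g) N C = pt (if g \<in> S then c else \<zero>\<^bsub>k\<^esub>) g N C"
    using pt_val[OF N C] by simp
qed

text \<open>Component \<open>N\<close> of the restriction involves only component
  \<open>N \<inter> L\<close> of the argument.\<close>

lemma continuous_restr: "continuous_map KGtop KGtop (restr L S)"
proof (rule continuous_KG_KG)
  show "restr L S \<in> carrier KG \<rightarrow> carrier KG" using restr_closed by blast
  fix N assume N: "N \<in> ONS"
  have "restr L S r N = restr L S s N" if "r (N \<inter> L) = s (N \<inter> L)" for r s
    using that N by (simp add: restr_def)
  then show "\<exists>M\<in>ONS. \<forall>r\<in>carrier KG. \<forall>s\<in>carrier KG. r M = s M \<longrightarrow> restr L S r N = restr L S s N"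
    using G.open_normal_Int[OF N L] by blast
qed

end

end

section \<open>The map from \<open>k[[H]]\<close> to \<open>k[[G]]\<close>\<close>

locale cga_subgroup = cga_base k G
  for k :: "('k, 'a) ring_scheme" and G :: "('g, 'b) top_group_scheme" +
  fixes H :: "'g set"
  assumes H: "closed_subgroup H G"

text \<open>A closed subgroup is again profinite, so all results on \<open>k[[G]]\<close> become
  available for \<open>k[[H]]\<close>, under the prefix \<open>H\<close>.\<close>

sublocale cga_subgroup \<subseteq> H: cga_base k "sub_top_group G H"
  by (intro cga_base.intro G.profinite_sub_top_group H k.field_axioms cga_base_axioms.intro finite_k)

context cga_subgroup
begin

lemma HG: "H \<subseteq> carrier G" and carrier_H: "carrier (sub_top_group G H) = H"
  using H subgroup.subset[of H G] by (simp_all add: closed_subgroup_def sub_top_group_def)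

lemma HN: "N \<in> ONS \<Longrightarrow> H \<inter> N \<in> H.ONS"
  using G.open_normal_sub_top_group[OF H] .

lemma H_coset:
  assumes N: "N \<in> ONS" and D: "D \<in> H.cosets (H \<inter> N)" and z: "z \<in> D"
  shows "z \<in> H" "D \<subseteq> N #>\<^bsub>G\<^esub> z"
proof -
  show "z \<in> H" using H.coset_eq(2)[OF HN[OF N] D z] carrier_H by simp
  show "D \<subseteq> N #>\<^bsub>G\<^esub> z"
    using H.coset_eq(1)[OF HN[OF N] D z] by (auto simp: r_coset_def sub_top_group_def)
qed

lemma incl_val:
  "N \<in> ONS \<Longrightarrow> C \<in> cosets N \<Longrightarrow>
    cga_incl k G H b N C = (\<Oplus>\<^bsub>k\<^esub>D\<in>{D \<in> H.cosets (H \<inter> N). D \<subseteq> C}. b (H \<inter> N) D)"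
  by (simp add: cga_incl_def coset_push_def)

lemma H_coset_in_coset:
  assumes "N \<in> ONS" "D \<in> H.cosets (H \<inter> N)"
  shows "D \<noteq> {} \<and> (\<exists>C\<in>cosets N. D \<subseteq> C)"
proof -
  obtain z where z: "z \<in> D" using H.coset_nonempty[OF HN[OF assms(1)] assms(2)] by blast
  then have "z \<in> carrier G" using H_coset(1)[OF assms] HG by blast
  then show ?thesis using coset_mem(1)[OF assms(1)] H_coset(2)[OF assms z] z by blast
qed

text \<open>Refinement takes place in \<open>H\<close> and regrouping in \<open>G\<close>: cosets of
  \<open>H \<inter> M\<close> are split into cosets of \<open>H \<inter> N\<close>, which are then
  collected by the \<open>N\<close>-cosets containing them.\<close>

lemma incl_closed:
  assumes b: "b \<in> carrier H.KG"
  shows "cga_incl k G H b \<in> carrier KG"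
proof (rule KG_memI)
  show "cga_incl k G H b \<in> extensional ONS" by (simp add: cga_incl_def)
  have cl: "(\<Oplus>\<^bsub>k\<^esub>D\<in>{D \<in> H.cosets (H \<inter> N). D \<subseteq> C}. b (H \<inter> N) D) \<in> carrier k" if "N \<in> ONS" for N C
    using H.KG_val[OF b HN[OF that]] by (intro k.finsum_closed) auto
  show "cga_incl k G H b N \<in> cosets N \<rightarrow>\<^sub>E carrier k" if "N \<in> ONS" for N
    using that cl by (auto simp: cga_incl_def coset_push_def)
  fix N M C assume h: "N \<in> ONS" "M \<in> ONS" "N \<subseteq> M" "C \<in> cosets M"
  let ?F = "H.cosets (H \<inter> N)"
  have "cga_incl k G H b M C = (\<Oplus>\<^bsub>k\<^esub>D\<in>{D \<in> H.cosets (H \<inter> M). D \<subseteq> C}. b (H \<inter> M) D)"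
    by (rule incl_val[OF h(2,4)])
  also have "\<dots> = (\<Oplus>\<^bsub>k\<^esub>D\<in>{D \<in> ?F. D \<subseteq> C}. b (H \<inter> N) D)"
  proof (rule H.finsum_refine[OF b HN[OF h(1)] HN[OF h(2)], symmetric])
    show "E \<subseteq> C" if E: "E \<in> H.cosets (H \<inter> M)" "z \<in> E" "z \<in> C" for E z
      using H_coset(2)[OF h(2) E(1,2)] coset_eq(1)[OF h(2,4) E(3)] by blast
  qed (use h in auto)
  also have "\<dots> = (\<Oplus>\<^bsub>k\<^esub>E\<in>{E \<in> cosets N. E \<subseteq> C}. \<Oplus>\<^bsub>k\<^esub>D\<in>{D \<in> ?F. D \<subseteq> E}. b (H \<inter> N) D)"
  proof (rule finsum_regroup[OF h, symmetric])
    show "finite ?F" using H.ONS(5)[OF HN[OF h(1)]] .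
    show "b (H \<inter> N) \<in> ?F \<rightarrow> carrier k" using H.KG_val[OF b HN[OF h(1)]] by auto
  qed (rule H_coset_in_coset[OF h(1)])
  also have "\<dots> = (\<Oplus>\<^bsub>k\<^esub>E\<in>{E \<in> cosets N. E \<subseteq> C}. cga_incl k G H b N E)"
    by (rule k.finsum_cong') (use h(1) cl[OF h(1)] in \<open>auto simp: incl_val\<close>)
  finally show "cga_incl k G H b M C = (\<Oplus>\<^bsub>k\<^esub>E\<in>{E \<in> cosets N. E \<subseteq> C}. cga_incl k G H b N E)" .
qed

lemma incl_pt:
  assumes c: "c \<in> carrier k" and h: "h \<in> H"
  shows "cga_incl k G H (H.pt c h) = pt c h"
proof (rule KG_ext)
  have hG: "h \<in> carrier G" using h HG by blast
  have hH: "h \<in> carrier (sub_top_group G H)" using h carrier_H by simp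
  show "cga_incl k G H (H.pt c h) \<in> carrier KG" "pt c h \<in> carrier KG"
    using incl_closed[OF H.pt_closed[OF c hH]] pt_closed[OF c hG] by auto
  fix N C assume N: "N \<in> ONS" and C: "C \<in> cosets N"
  let ?F = "{D \<in> H.cosets (H \<inter> N). D \<subseteq> C}"
  have "cga_incl k G H (H.pt c h) N C = (\<Oplus>\<^bsub>k\<^esub>D\<in>?F. if h \<in> D then c else \<zero>\<^bsub>k\<^esub>)"
    unfolding incl_val[OF N C] by (rule k.finsum_cong') (use c H.pt_val[OF HN[OF N]] in auto)
  also have "\<dots> = (if \<exists>D\<in>?F. h \<in> D then c else \<zero>\<^bsub>k\<^esub>)"
    by (rule finsum_indicator[OF c]) (use H.finite_cosets_subset[OF HN[OF N]] H.coset_unique[OF HN[OF N]] in auto)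
  also have "(\<exists>D\<in>?F. h \<in> D) \<longleftrightarrow> h \<in> C"
  proof
    assume "h \<in> C"
    then have "C = N #>\<^bsub>G\<^esub> h" using coset_eq(1)[OF N C] by simp
    then show "\<exists>D\<in>?F. h \<in> D"
      using H.coset_mem[OF HN[OF N] hH] H_coset(2)[OF N H.coset_mem[OF HN[OF N] hH]] by blast
  qed blast
  finally show "cga_incl k G H (H.pt c h) N C = pt c h N C" using pt_val[OF N C] by simp
qed

text \<open>At level \<open>N\<close> the image of \<open>b\<close> is a sum over the finitely many
  cosets of \<open>H \<inter> N\<close> in \<open>H\<close>, and each of these is represented by an
  element of \<open>H\<close>.\<close>

lemma incl_approx:
  assumes b: "b \<in> carrier H.KG" and N: "N \<in> ONS"
  shows "\<exists>s\<in>span H. s N = cga_incl k G H b N"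
proof -
  have "\<exists>s\<in>span H. \<forall>C\<in>cosets N. s N C = (\<Oplus>\<^bsub>k\<^esub>D\<in>{D \<in> H.cosets (H \<inter> N). D \<subseteq> C}. b (H \<inter> N) D)"
  proof (rule span_approx[OF N H.ONS(5)[OF HN[OF N]]])
    show "b (H \<inter> N) \<in> H.cosets (H \<inter> N) \<rightarrow> carrier k" using H.KG_val[OF b HN[OF N]] by auto
    show "\<exists>h\<in>H. h \<in> D" if "D \<in> H.cosets (H \<inter> N)" for D
      using H_coset_in_coset[OF N that] H_coset(1)[OF N that] by blast
    show "\<exists>C\<in>cosets N. D \<subseteq> C" if "D \<in> H.cosets (H \<inter> N)" for D
      using H_coset_in_coset[OF N that] by blast
  qed
  then obtain s where s: "s \<in> span H" "\<And>C. C \<in> cosets N \<Longrightarrow> s N C = cga_incl k G H b N C"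
    using incl_val[OF N] by auto
  have sK: "s \<in> carrier KG" using s(1) span_subset[OF HG] by blast
  have "s N = cga_incl k G H b N"
    by (rule KG_component_ext[OF sK incl_closed[OF b] N]) (erule s(2))
  then show ?thesis using s(1) by blast
qed

end

section \<open>Group actions on profinite modules\<close>

text \<open>The group and the field act through points of \<open>k[[G]]\<close>. Relative traces and
  conjugation are statements about this action; the way back to \<open>k[[G]]\<close>-linearity is
  density.\<close>

definition gact :: "('k, 'a) ring_scheme \<Rightarrow> ('g, 'b) top_group_scheme \<Rightarrow>
    (('g, 'k) cga, 'm) top_module \<Rightarrow> 'g \<Rightarrow> 'm \<Rightarrow> 'm" where
  "gact k G M g x = cga_point k G \<one>\<^bsub>k\<^esub> g \<odot>\<^bsub>M\<^esub> x"

definition kact :: "('k, 'a) ring_scheme \<Rightarrow> ('g, 'b) top_group_scheme \<Rightarrow>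
    (('g, 'k) cga, 'm) top_module \<Rightarrow> 'k \<Rightarrow> 'm \<Rightarrow> 'm" where
  "kact k G M c x = cga_point k G c \<one>\<^bsub>G\<^esub> \<odot>\<^bsub>M\<^esub> x"

definition klin :: "('k, 'a) ring_scheme \<Rightarrow> ('g, 'b) top_group_scheme \<Rightarrow>
    (('g, 'k) cga, 'm) top_module \<Rightarrow> (('g, 'k) cga, 'n) top_module \<Rightarrow> ('m \<Rightarrow> 'n) set" where
  "klin k G M N = {f \<in> carrier M \<rightarrow> carrier N.
     (\<forall>x\<in>carrier M. \<forall>y\<in>carrier M. f (x \<oplus>\<^bsub>M\<^esub> y) = f x \<oplus>\<^bsub>N\<^esub> f y) \<and>
     (\<forall>c\<in>carrier k. \<forall>x\<in>carrier M. f (kact k G M c x) = kact k G N c (f x)) \<and>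
     continuous_map (mtopology M) (mtopology N) f}"

text \<open>For a closed subgroup \<open>H\<close> these are the
  \<open>k[[H]]\<close>-homomorphisms, see \<open>continuous_hom_subgroup_eq_ghom\<close>. In this
  form the restriction of scalars disappears, and passing to a smaller group merely drops
  conditions.\<close>

definition ghom :: "('k, 'a) ring_scheme \<Rightarrow> ('g, 'b) top_group_scheme \<Rightarrow> 'g set \<Rightarrow>
    (('g, 'k) cga, 'm) top_module \<Rightarrow> (('g, 'k) cga, 'n) top_module \<Rightarrow> ('m \<Rightarrow> 'n) set" where
  "ghom k G H M N = {f \<in> klin k G M N. \<forall>h\<in>H. \<forall>x\<in>carrier M. f (gact k G M h x) = gact k G N h (f x)}"

lemma (in abelian_group) add_diff_add:
  assumes "a \<in> carrier G" "b \<in> carrier G" "c \<in> carrier G" "d \<in> carrier G"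
  shows "(a \<oplus> b) \<ominus> (c \<oplus> d) = (a \<ominus> c) \<oplus> (b \<ominus> d)"
  using assms by (simp add: a_minus_def minus_add a_ac)

lemma (in abelian_group) diff_diff_cancel:
  assumes "a \<in> carrier G" "b \<in> carrier G" "c \<in> carrier G"
  shows "(a \<ominus> b) \<oplus> (b \<ominus> c) = a \<ominus> c" "\<ominus> (a \<ominus> b) = b \<ominus> a"
    "b \<oplus> (a \<ominus> b) = a" "(a \<ominus> b) \<oplus> b = a" "a \<ominus> (a \<ominus> b) = b"
proof -
  have 1: "\<ominus> b \<oplus> (b \<oplus> x) = x" "b \<oplus> (\<ominus> b \<oplus> x) = x" "a \<oplus> (\<ominus> a \<oplus> x) = x" if "x \<in> carrier G" for x
    using that assms by (simp_all add: a_assoc[symmetric] l_neg r_neg)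
  show "(a \<ominus> b) \<oplus> (b \<ominus> c) = a \<ominus> c" using assms 1 by (simp add: a_minus_def a_assoc)
  show "\<ominus> (a \<ominus> b) = b \<ominus> a" using assms by (simp add: a_minus_def minus_add a_comm)
  show "b \<oplus> (a \<ominus> b) = a" using assms 1 by (simp add: a_minus_def a_lcomm r_neg)
  show "(a \<ominus> b) \<oplus> b = a" using assms 1 by (simp add: a_minus_def a_assoc l_neg)
  show "a \<ominus> (a \<ominus> b) = b" using assms 1 by (simp add: a_minus_def minus_add)
qed

lemma (in abelian_group) diff_eq_zero_iff:
  assumes "a \<in> carrier G" "b \<in> carrier G"
  shows "a \<ominus> b = \<zero> \<longleftrightarrow> a = b"
  using diff_diff_cancel(4)[OF assms assms(1)] assms by (auto simp: a_minus_def r_neg)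

locale cga_module = cga_base k G + M: profinite_module "completed_group_algebra k G" M
  for k :: "('k, 'a) ring_scheme" and G :: "('g, 'b) top_group_scheme"
    and M :: "(('g, 'k) cga, 'm) top_module"
begin

abbreviation "Mtop \<equiv> mtopology M"
abbreviation "act \<equiv> gact k G M"
abbreviation "sc \<equiv> kact k G M"

lemma topspace_Mtop: "topspace Mtop = carrier M"
  by (rule M.topspace_mtopology)

lemma compact_M: "compact_space Mtop" and Hausdorff_M: "Hausdorff_space Mtop"
  using M.profinite_topology by (simp_all add: profinite_space_def)

lemma act_closed [simp]: "g \<in> carrier G \<Longrightarrow> x \<in> carrier M \<Longrightarrow> act g x \<in> carrier M"
  and sc_closed [simp]: "c \<in> carrier k \<Longrightarrow> x \<in> carrier M \<Longrightarrow> sc c x \<in> carrier M"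
  by (simp_all add: gact_def kact_def pt_closed)

lemma act_add: "g \<in> carrier G \<Longrightarrow> x \<in> carrier M \<Longrightarrow> y \<in> carrier M \<Longrightarrow> act g (x \<oplus>\<^bsub>M\<^esub> y) = act g x \<oplus>\<^bsub>M\<^esub> act g y"
  and sc_add: "c \<in> carrier k \<Longrightarrow> x \<in> carrier M \<Longrightarrow> y \<in> carrier M \<Longrightarrow> sc c (x \<oplus>\<^bsub>M\<^esub> y) = sc c x \<oplus>\<^bsub>M\<^esub> sc c y"
  by (simp_all add: gact_def kact_def pt_closed M.smult_r_distr)

lemma act_one: "x \<in> carrier M \<Longrightarrow> act \<one>\<^bsub>G\<^esub> x = x"
  by (simp add: gact_def pt_one[symmetric])

lemma act_mult:
  "g \<in> carrier G \<Longrightarrow> h \<in> carrier G \<Longrightarrow> x \<in> carrier M \<Longrightarrow> act g (act h x) = act (g \<otimes>\<^bsub>G\<^esub> h) x"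
  by (simp add: gact_def pt_closed M.smult_assoc1[symmetric] pt_mult)

lemma act_inv:
  assumes "g \<in> carrier G" "x \<in> carrier M"
  shows "act g (act (inv\<^bsub>G\<^esub> g) x) = x" "act (inv\<^bsub>G\<^esub> g) (act g x) = x"
  using assms by (simp_all add: act_mult act_one)

lemma pt_smult:
  "c \<in> carrier k \<Longrightarrow> g \<in> carrier G \<Longrightarrow> x \<in> carrier M \<Longrightarrow> pt c g \<odot>\<^bsub>M\<^esub> x = sc c (act g x)"
  by (simp add: gact_def kact_def pt_closed M.smult_assoc1[symmetric] pt_mult)

lemma act_sc:
  "c \<in> carrier k \<Longrightarrow> g \<in> carrier G \<Longrightarrow> x \<in> carrier M \<Longrightarrow> act g (sc c x) = sc c (act g x)"
  by (simp add: gact_def kact_def pt_closed M.smult_assoc1[symmetric] pt_mult)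

lemma smult_zero: "r \<in> carrier KG \<Longrightarrow> r \<odot>\<^bsub>M\<^esub> \<zero>\<^bsub>M\<^esub> = \<zero>\<^bsub>M\<^esub>"
  by (rule M.M.add_idem_zero) (simp_all flip: M.smult_r_distr)

lemma zero_smult: "x \<in> carrier M \<Longrightarrow> \<zero>\<^bsub>KG\<^esub> \<odot>\<^bsub>M\<^esub> x = \<zero>\<^bsub>M\<^esub>"
  by (rule M.M.add_idem_zero) (simp_all flip: M.smult_l_distr)

lemma smult_minus: "r \<in> carrier KG \<Longrightarrow> x \<in> carrier M \<Longrightarrow> r \<odot>\<^bsub>M\<^esub> (\<ominus>\<^bsub>M\<^esub> x) = \<ominus>\<^bsub>M\<^esub> (r \<odot>\<^bsub>M\<^esub> x)"
  by (rule M.M.minus_equality[symmetric])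
    (simp_all add: smult_zero M.M.l_neg flip: M.smult_r_distr)

lemma smult_diff:
  "r \<in> carrier KG \<Longrightarrow> x \<in> carrier M \<Longrightarrow> y \<in> carrier M \<Longrightarrow>
    r \<odot>\<^bsub>M\<^esub> (x \<ominus>\<^bsub>M\<^esub> y) = r \<odot>\<^bsub>M\<^esub> x \<ominus>\<^bsub>M\<^esub> r \<odot>\<^bsub>M\<^esub> y"
  by (simp add: a_minus_def M.smult_r_distr smult_minus)

lemma continuous_add_maps:
  assumes "continuous_map X Mtop f" "continuous_map X Mtop g"
  shows "continuous_map X Mtop (\<lambda>x. f x \<oplus>\<^bsub>M\<^esub> g x)"
proof -
  have "continuous_map X Mtop ((\<lambda>(x, y). x \<oplus>\<^bsub>M\<^esub> y) \<circ> (\<lambda>x. (f x, g x)))"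
    by (rule continuous_map_compose[OF _ M.continuous_add]) (use assms in \<open>simp add: continuous_map_pairedI\<close>)
  then show ?thesis by (simp add: o_def)
qed

lemma continuous_smult_maps:
  assumes "continuous_map X KGtop f" "continuous_map X Mtop g"
  shows "continuous_map X Mtop (\<lambda>x. f x \<odot>\<^bsub>M\<^esub> g x)"
proof -
  have "continuous_map X Mtop ((\<lambda>(x, y). x \<odot>\<^bsub>M\<^esub> y) \<circ> (\<lambda>x. (f x, g x)))"
    by (rule continuous_map_compose[OF _ M.continuous_smult]) (use assms in \<open>simp add: continuous_map_pairedI\<close>)
  then show ?thesis by (simp add: o_def)
qed

lemma continuous_smult_const:
  assumes "r \<in> carrier KG" "continuous_map X Mtop g"
  shows "continuous_map X Mtop (\<lambda>x. r \<odot>\<^bsub>M\<^esub> g x)"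
  by (rule continuous_smult_maps[OF _ assms(2)]) (use assms(1) topspace_KGtop in auto)

lemma continuous_smult_fixed:
  assumes "x \<in> carrier M" "continuous_map X KGtop f"
  shows "continuous_map X Mtop (\<lambda>r. f r \<odot>\<^bsub>M\<^esub> x)"
  by (rule continuous_smult_maps[OF assms(2)]) (use assms(1) topspace_Mtop in auto)

lemma continuous_act_maps:
  assumes "continuous_map X G.Gtop f" "continuous_map X Mtop g"
  shows "continuous_map X Mtop (\<lambda>x. act (f x) (g x))"
  unfolding gact_def
  using continuous_map_compose[OF assms(1) continuous_pt[OF k.one_closed]] assms(2)
  by (intro continuous_smult_maps) (simp_all add: o_def)

lemma continuous_act_const:
  assumes "g \<in> carrier G" "continuous_map X Mtop f"
  shows "continuous_map X Mtop (\<lambda>x. act g (f x))"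
  unfolding gact_def by (rule continuous_smult_const) (use assms pt_closed in auto)

lemma continuous_minus_maps:
  assumes "continuous_map X Mtop f"
  shows "continuous_map X Mtop (\<lambda>x. \<ominus>\<^bsub>M\<^esub> f x)"
proof -
  have "continuous_map X Mtop (\<lambda>x. (\<ominus>\<^bsub>KG\<^esub> \<one>\<^bsub>KG\<^esub>) \<odot>\<^bsub>M\<^esub> f x)"
    by (rule continuous_smult_const) (use assms in auto)
  then show ?thesis
    by (rule continuous_map_eq) (use assms continuous_map_image_subset_topspace topspace_Mtop in
        \<open>force intro: M.smult_minus_one\<close>)
qed

lemma continuous_diff_maps:
  assumes "continuous_map X Mtop f" "continuous_map X Mtop g"
  shows "continuous_map X Mtop (\<lambda>x. f x \<ominus>\<^bsub>M\<^esub> g x)"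
  unfolding a_minus_def by (intro continuous_add_maps continuous_minus_maps assms)

lemma continuous_finsum_maps:
  assumes "finite I" "\<And>i. i \<in> I \<Longrightarrow> continuous_map X Mtop (f i)"
  shows "continuous_map X Mtop (\<lambda>x. \<Oplus>\<^bsub>M\<^esub>i\<in>I. f i x)"
  using assms
proof (induction I)
  case empty
  then show ?case using topspace_Mtop by simp
next
  case (insert j I)
  have cl: "f i x \<in> carrier M" if "i \<in> insert j I" "x \<in> topspace X" for i x
    using insert.prems[OF that(1)] that(2) topspace_Mtop by (auto simp: continuous_map_def)
  have "continuous_map X Mtop (\<lambda>x. f j x \<oplus>\<^bsub>M\<^esub> (\<Oplus>\<^bsub>M\<^esub>i\<in>I. f i x))"
    using insert by (intro continuous_add_maps) auto
  then show ?case
    by (rule continuous_map_eq) (use insert.hyps cl in \<open>simp add: M.M.finsum_insert Pi_iff\<close>)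
qed

lemma closedin_zero: "closedin Mtop {\<zero>\<^bsub>M\<^esub>}"
  using closedin_Hausdorff_singleton[OF Hausdorff_M] topspace_Mtop by simp

lemma submodule_zero: "submodule {\<zero>\<^bsub>M\<^esub>} KG M"
  by (rule M.left_submoduleI) (auto simp: smult_zero)

lemma submodule_diff: "submodule D KG M \<Longrightarrow> x \<in> D \<Longrightarrow> y \<in> D \<Longrightarrow> x \<ominus>\<^bsub>M\<^esub> y \<in> D"
  unfolding a_minus_def by (intro submodule_facts(3)[of D] submodule_facts(4)[of D])

lemma submodule_act: "submodule D KG M \<Longrightarrow> g \<in> carrier G \<Longrightarrow> x \<in> D \<Longrightarrow> act g x \<in> D"
  and submodule_sc: "submodule D KG M \<Longrightarrow> c \<in> carrier k \<Longrightarrow> x \<in> D \<Longrightarrow> sc c x \<in> D"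
  unfolding gact_def kact_def by (auto intro: submodule_facts(5) pt_closed)

lemma act_diff: "g \<in> carrier G \<Longrightarrow> x \<in> carrier M \<Longrightarrow> y \<in> carrier M \<Longrightarrow> act g (x \<ominus>\<^bsub>M\<^esub> y) = act g x \<ominus>\<^bsub>M\<^esub> act g y"
  and sc_diff: "c \<in> carrier k \<Longrightarrow> x \<in> carrier M \<Longrightarrow> y \<in> carrier M \<Longrightarrow> sc c (x \<ominus>\<^bsub>M\<^esub> y) = sc c x \<ominus>\<^bsub>M\<^esub> sc c y"
  by (simp_all add: gact_def kact_def pt_closed smult_diff)

lemma submodule_finsum:
  assumes "submodule D KG M" "finite I" "\<And>i. i \<in> I \<Longrightarrow> f i \<in> D"
  shows "(\<Oplus>\<^bsub>M\<^esub>i\<in>I. f i) \<in> D"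
  using assms(2,3)
proof (induction I)
  case empty
  then show ?case using submodule_facts(2)[OF assms(1)] by simp
next
  case (insert j I)
  have "f i \<in> carrier M" if "i \<in> insert j I" for i using insert.prems[OF that] submodule_facts(1)[OF assms(1)] by blast
  then show ?case using insert submodule_facts(3)[OF assms(1)] by (simp add: M.M.finsum_insert Pi_iff)
qed

lemma finsum_diff:
  assumes "finite I" "f \<in> I \<rightarrow> carrier M" "g \<in> I \<rightarrow> carrier M"
  shows "(\<Oplus>\<^bsub>M\<^esub>i\<in>I. f i) \<ominus>\<^bsub>M\<^esub> (\<Oplus>\<^bsub>M\<^esub>i\<in>I. g i) = (\<Oplus>\<^bsub>M\<^esub>i\<in>I. f i \<ominus>\<^bsub>M\<^esub> g i)"
  using assms
proof (induction I)
  case empty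
  then show ?case by (simp add: M.M.diff_eq_zero_iff)
next
  case (insert j I)
  then show ?case by (simp add: M.M.finsum_insert Pi_iff M.M.add_diff_add M.M.finsum_closed)
qed

lemma finsum_additive_map:
  fixes N :: "(('g, 'k) cga, 'n) top_module"
  assumes N: "abelian_group N" and f: "f \<in> carrier M \<rightarrow> carrier N"
    "\<And>x y. x \<in> carrier M \<Longrightarrow> y \<in> carrier M \<Longrightarrow> f (x \<oplus>\<^bsub>M\<^esub> y) = f x \<oplus>\<^bsub>N\<^esub> f y"
    and I: "finite I" "u \<in> I \<rightarrow> carrier M"
  shows "f (\<Oplus>\<^bsub>M\<^esub>i\<in>I. u i) = (\<Oplus>\<^bsub>N\<^esub>i\<in>I. f (u i))"
  using I
proof (induction I)
  interpret N: abelian_group N by fact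
  case empty
  have "f \<zero>\<^bsub>M\<^esub> \<oplus>\<^bsub>N\<^esub> f \<zero>\<^bsub>M\<^esub> = f \<zero>\<^bsub>M\<^esub>"
    using f(2)[OF M.M.zero_closed M.M.zero_closed] by simp
  then have "f \<zero>\<^bsub>M\<^esub> = \<zero>\<^bsub>N\<^esub>" using f(1) M.M.zero_closed by (intro N.add_idem_zero) auto
  then show ?case by (simp add: M.M.finsum_empty N.finsum_empty)
next
  interpret N: abelian_group N by fact
  case (insert j I)
  then have "(\<lambda>i. f (u i)) \<in> I \<rightarrow> carrier N" "f (u j) \<in> carrier N" "u \<in> I \<rightarrow> carrier M" "u j \<in> carrier M"
    using f(1) by (auto simp: Pi_iff)
  then show ?case using insert f(2) by (simp add: M.M.finsum_insert N.finsum_insert M.M.finsum_closed)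
qed

lemma act_finsum:
  assumes "g \<in> carrier G" "finite I" "u \<in> I \<rightarrow> carrier M"
  shows "act g (\<Oplus>\<^bsub>M\<^esub>i\<in>I. u i) = (\<Oplus>\<^bsub>M\<^esub>i\<in>I. act g (u i))"
  by (rule finsum_additive_map[OF M.M.abelian_group_axioms]) (use assms act_add in auto)

lemma sc_finsum:
  assumes "c \<in> carrier k" "finite I" "u \<in> I \<rightarrow> carrier M"
  shows "sc c (\<Oplus>\<^bsub>M\<^esub>i\<in>I. u i) = (\<Oplus>\<^bsub>M\<^esub>i\<in>I. sc c (u i))"
  by (rule finsum_additive_map[OF M.M.abelian_group_axioms]) (use assms sc_add in auto)

lemma smult_finsum:
  assumes "r \<in> carrier KG" "finite I" "u \<in> I \<rightarrow> carrier M"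
  shows "r \<odot>\<^bsub>M\<^esub> (\<Oplus>\<^bsub>M\<^esub>i\<in>I. u i) = (\<Oplus>\<^bsub>M\<^esub>i\<in>I. r \<odot>\<^bsub>M\<^esub> u i)"
  by (rule finsum_additive_map[OF M.M.abelian_group_axioms]) (use assms M.smult_r_distr in auto)

text \<open>As for open normal subgroups: \<open>W\<close> consists of the \<open>u\<close> such
  that translation by every multiple \<open>r u\<close> maps the clopen set \<open>C\<close> into
  itself. This is a submodule, it is open because \<open>carrier KG \<times> C\<close> is compact,
  and it lies in \<open>C\<close> because zero does.\<close>

lemma open_submodule_inside:
  assumes D: "openin Mtop D" and z: "\<zero>\<^bsub>M\<^esub> \<in> D"
  obtains W where "submodule W KG M" "openin Mtop W" "W \<subseteq> D"
proof -
  obtain C where C: "openin Mtop C" "closedin Mtop C" "\<zero>\<^bsub>M\<^esub> \<in> C" "C \<subseteq> D"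
    using profinite_space_clopen[OF M.profinite_topology D z] by blast
  have CM: "C \<subseteq> carrier M" using C(1) openin_subset topspace_Mtop by fastforce
  let ?P = "prod_topology Mtop (prod_topology KGtop Mtop)"
  have K: "compactin (prod_topology KGtop Mtop) (carrier KG \<times> C)"
    using compact_M compact_KG C(2) closedin_compact_space topspace_KGtop
    by (metis compactin_Times compact_space_def)
  have c: "continuous_map ?P Mtop fst" "continuous_map ?P KGtop (\<lambda>p. fst (snd p))"
    "continuous_map ?P Mtop (\<lambda>p. snd (snd p))"
    using continuous_map_compose[OF continuous_map_snd continuous_map_fst, of Mtop KGtop Mtop]
      continuous_map_compose[OF continuous_map_snd continuous_map_snd, of Mtop KGtop Mtop]
    by (simp_all add: o_def continuous_map_fst)
  define W where "W = {u \<in> topspace Mtop. \<forall>y\<in>carrier KG \<times> C.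
      (\<lambda>(u, r, v). r \<odot>\<^bsub>M\<^esub> u \<oplus>\<^bsub>M\<^esub> v) (u, y) \<in> C}"
  have op: "openin Mtop W" unfolding W_def
    by (rule openin_forall_compactin[OF _ K C(1)], unfold case_prod_beta,
        intro continuous_add_maps continuous_smult_maps c)
  have mem: "u \<in> W \<longleftrightarrow> u \<in> carrier M \<and> (\<forall>r\<in>carrier KG. \<forall>v\<in>C. r \<odot>\<^bsub>M\<^esub> u \<oplus>\<^bsub>M\<^esub> v \<in> C)" for u
    by (auto simp: W_def topspace_Mtop)
  have "submodule W KG M"
  proof (rule M.left_submoduleI)
    show "W \<subseteq> carrier M" using mem by auto
    show "\<zero>\<^bsub>M\<^esub> \<in> W" unfolding mem using CM by (auto simp: smult_zero subset_iff)
    show "x \<oplus>\<^bsub>M\<^esub> y \<in> W" if "x \<in> W" "y \<in> W" for x y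
      unfolding mem
    proof (intro conjI ballI)
      show "x \<oplus>\<^bsub>M\<^esub> y \<in> carrier M" using that by (auto simp: mem)
      fix r v assume rv: "r \<in> carrier KG" "v \<in> C"
      then have "r \<odot>\<^bsub>M\<^esub> x \<oplus>\<^bsub>M\<^esub> (r \<odot>\<^bsub>M\<^esub> y \<oplus>\<^bsub>M\<^esub> v) \<in> C" using that by (auto simp: mem)
      then show "r \<odot>\<^bsub>M\<^esub> (x \<oplus>\<^bsub>M\<^esub> y) \<oplus>\<^bsub>M\<^esub> v \<in> C"
        using that rv CM by (auto simp: mem M.smult_r_distr M.M.a_assoc subset_iff)
    qed
    show "s \<odot>\<^bsub>M\<^esub> x \<in> W" if "s \<in> carrier KG" "x \<in> W" for s x
      using that by (auto simp: mem M.smult_assoc1[symmetric])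
  qed
  moreover have "W \<subseteq> D"
  proof
    fix u assume u: "u \<in> W"
    then have "\<one>\<^bsub>KG\<^esub> \<odot>\<^bsub>M\<^esub> u \<oplus>\<^bsub>M\<^esub> \<zero>\<^bsub>M\<^esub> \<in> C" using C(3) M.R.one_closed unfolding mem by blast
    then show "u \<in> D" using u C(4) by (auto simp: mem)
  qed
  ultimately show thesis using op that by blast
qed

lemma closedin_translate:
  assumes "closedin Mtop D" "x \<in> carrier M"
  shows "closedin Mtop {u \<in> carrier M. u \<ominus>\<^bsub>M\<^esub> x \<in> D}"
proof -
  have "continuous_map Mtop Mtop (\<lambda>u. u \<ominus>\<^bsub>M\<^esub> x)"
    by (rule continuous_diff_maps) (use assms topspace_Mtop in auto)
  from closedin_continuous_map_preimage[OF this assms(1)] show ?thesis by (simp add: topspace_Mtop)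
qed

lemma openin_translate:
  assumes "openin Mtop D" "x \<in> carrier M"
  shows "openin Mtop {u \<in> carrier M. u \<ominus>\<^bsub>M\<^esub> x \<in> D}"
proof -
  have "continuous_map Mtop Mtop (\<lambda>u. u \<ominus>\<^bsub>M\<^esub> x)"
    by (rule continuous_diff_maps) (use assms topspace_Mtop in auto)
  from openin_continuous_map_preimage[OF this assms(1)] show ?thesis by (simp add: topspace_Mtop)
qed

lemma closedin_open_submodule:
  assumes W: "submodule W KG M" "openin Mtop W"
  shows "closedin Mtop W"
proof -
  note Wf = submodule_facts[OF W(1)]
  have "openin Mtop (carrier M - W)"
  proof (subst openin_subopen, intro ballI)
    fix x assume x: "x \<in> carrier M - W"
    let ?T = "{u \<in> carrier M. u \<ominus>\<^bsub>M\<^esub> x \<in> W}"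
    have "openin Mtop ?T" by (rule openin_translate[OF W(2)]) (use x in auto)
    moreover have "x \<in> ?T" using x Wf(2) M.M.diff_eq_zero_iff[of x x] by auto
    moreover have "u \<notin> W" if u: "u \<in> ?T" for u
    proof
      assume "u \<in> W"
      then have "u \<ominus>\<^bsub>M\<^esub> (u \<ominus>\<^bsub>M\<^esub> x) \<in> W" using submodule_diff[OF W(1)] u by blast
      then show False using M.M.diff_diff_cancel(5)[of u x x] u x by auto
    qed
    ultimately show "\<exists>T. openin Mtop T \<and> x \<in> T \<and> T \<subseteq> carrier M - W" by blast
  qed
  then show ?thesis using Wf(1) by (simp add: closedin_def topspace_Mtop)
qed

text \<open>\<open>M\<close> is Hausdorff and its open submodules form a neighbourhood basis of
  zero. The hypothesis amounts to \<open>x \<in> W\<close>; the form with a subset \<open>L\<close>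
  suits families that are only cofinal among the open submodules.\<close>

lemma zero_if_in_open_submodules:
  assumes x: "x \<in> carrier M" and D: "\<And>W. submodule W KG M \<Longrightarrow> openin Mtop W \<Longrightarrow> \<exists>L\<subseteq>W. x \<in> L"
  shows "x = \<zero>\<^bsub>M\<^esub>"
proof (rule ccontr)
  assume "x \<noteq> \<zero>\<^bsub>M\<^esub>"
  then obtain A B where AB: "openin Mtop A" "openin Mtop B" "\<zero>\<^bsub>M\<^esub> \<in> A" "x \<in> B" "disjnt A B"
    using Hausdorff_M x topspace_Mtop unfolding Hausdorff_space_def by (metis M.M.zero_closed)
  obtain W where "submodule W KG M" "openin Mtop W" "W \<subseteq> A" using open_submodule_inside[OF AB(1,3)] by blast
  then show False using D[of W] AB by (auto simp: disjnt_iff)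
qed

text \<open>Since \<open>M\<close> is compact, the scalars mapping \<open>M\<close> into
  \<open>W\<close> form an open set, and an open set containing zero contains the kernel of some
  component map.\<close>

lemma ideal_into_open:
  assumes W: "submodule W KG M" "openin Mtop W"
  obtains N where "N \<in> ONS" "\<And>r x. r \<in> carrier KG \<Longrightarrow> r N = \<zero>\<^bsub>KG\<^esub> N \<Longrightarrow> x \<in> carrier M \<Longrightarrow> r \<odot>\<^bsub>M\<^esub> x \<in> W"
proof -
  have op: "openin KGtop {r \<in> topspace KGtop. \<forall>x\<in>topspace Mtop. (\<lambda>(r, x). r \<odot>\<^bsub>M\<^esub> x) (r, x) \<in> W}"
    by (rule openin_forall_compactin[OF M.continuous_smult _ W(2)])
      (use compact_M in \<open>simp add: compact_space_def\<close>)
  have z: "\<zero>\<^bsub>KG\<^esub> \<in> {r \<in> topspace KGtop. \<forall>x\<in>topspace Mtop. (\<lambda>(r, x). r \<odot>\<^bsub>M\<^esub> x) (r, x) \<in> W}"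
    using submodule_facts(2)[OF W(1)] zero_smult by (auto simp: topspace_KGtop topspace_Mtop)
  obtain N where N: "N \<in> ONS" "\<And>s. s \<in> carrier KG \<Longrightarrow> s N = \<zero>\<^bsub>KG\<^esub> N \<Longrightarrow>
      s \<in> {r \<in> topspace KGtop. \<forall>x\<in>topspace Mtop. (\<lambda>(r, x). r \<odot>\<^bsub>M\<^esub> x) (r, x) \<in> W}"
    by (rule nbhd_component[OF op z]) blast
  show thesis by (rule that[OF N(1)]) (use N(2) topspace_Mtop in auto)
qed

end

section \<open>Equivariant maps and finite generation\<close>

lemma (in abelian_group) add_diff_cancel_left:
  assumes "a \<in> carrier G" "b \<in> carrier G"
  shows "(a \<oplus> b) \<ominus> a = b" "(b \<oplus> a) \<ominus> a = b"
proof -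
  show "(b \<oplus> a) \<ominus> a = b" using assms by (simp add: a_minus_def a_assoc r_neg)
  then show "(a \<oplus> b) \<ominus> a = b" using assms by (simp add: a_comm)
qed

lemma klinD:
  assumes "f \<in> klin k G M N"
  shows "x \<in> carrier M \<Longrightarrow> f x \<in> carrier N"
    "x \<in> carrier M \<Longrightarrow> y \<in> carrier M \<Longrightarrow> f (x \<oplus>\<^bsub>M\<^esub> y) = f x \<oplus>\<^bsub>N\<^esub> f y"
    "c \<in> carrier k \<Longrightarrow> x \<in> carrier M \<Longrightarrow> f (kact k G M c x) = kact k G N c (f x)"
    "continuous_map (mtopology M) (mtopology N) f"
  using assms by (auto simp: klin_def)

lemma klinI:
  assumes "\<And>x. x \<in> carrier M \<Longrightarrow> f x \<in> carrier N"
    "\<And>x y. x \<in> carrier M \<Longrightarrow> y \<in> carrier M \<Longrightarrow> f (x \<oplus>\<^bsub>M\<^esub> y) = f x \<oplus>\<^bsub>N\<^esub> f y"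
    "\<And>c x. c \<in> carrier k \<Longrightarrow> x \<in> carrier M \<Longrightarrow> f (kact k G M c x) = kact k G N c (f x)"
    "continuous_map (mtopology M) (mtopology N) f"
  shows "f \<in> klin k G M N"
  using assms by (auto simp: klin_def)

lemma klin_comp:
  assumes f: "f \<in> klin k G M N" and g: "g \<in> klin k G N P"
  shows "(\<lambda>x. g (f x)) \<in> klin k G M P"
  by (rule klinI) (use klinD[OF f] klinD[OF g] continuous_map_compose[OF klinD(4)[OF f] klinD(4)[OF g]]
    in \<open>auto simp: o_def\<close>)

lemma ghomD:
  assumes "f \<in> ghom k G H M N"
  shows "f \<in> klin k G M N" "h \<in> H \<Longrightarrow> x \<in> carrier M \<Longrightarrow> f (gact k G M h x) = gact k G N h (f x)"
  using assms by (auto simp: ghom_def)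

lemma continuous_homD:
  assumes "f \<in> continuous_hom R M N"
  shows "x \<in> carrier M \<Longrightarrow> f x \<in> carrier N"
    "x \<in> carrier M \<Longrightarrow> y \<in> carrier M \<Longrightarrow> f (x \<oplus>\<^bsub>M\<^esub> y) = f x \<oplus>\<^bsub>N\<^esub> f y"
    "r \<in> carrier R \<Longrightarrow> x \<in> carrier M \<Longrightarrow> f (r \<odot>\<^bsub>M\<^esub> x) = r \<odot>\<^bsub>N\<^esub> f x"
    "continuous_map (mtopology M) (mtopology N) f"
  using assms by (auto simp: continuous_hom_def)

section \<open>Continuous \<open>k\<close>-linear maps and equivariance\<close>

locale cga_hom = cga_base k G + U: cga_module k G U + V: cga_module k G V
  for k :: "('k, 'a) ring_scheme" and G :: "('g, 'b) top_group_scheme"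
    and U :: "(('g, 'k) cga, 'u) top_module" and V :: "(('g, 'k) cga, 'v) top_module"
begin

lemma additive_zero:
  assumes "f \<in> carrier U \<rightarrow> carrier V"
    "\<And>x y. x \<in> carrier U \<Longrightarrow> y \<in> carrier U \<Longrightarrow> f (x \<oplus>\<^bsub>U\<^esub> y) = f x \<oplus>\<^bsub>V\<^esub> f y"
  shows "f \<zero>\<^bsub>U\<^esub> = \<zero>\<^bsub>V\<^esub>"
proof (rule V.M.M.add_idem_zero)
  show "f \<zero>\<^bsub>U\<^esub> \<in> carrier V" using assms(1) by auto
  show "f \<zero>\<^bsub>U\<^esub> \<oplus>\<^bsub>V\<^esub> f \<zero>\<^bsub>U\<^esub> = f \<zero>\<^bsub>U\<^esub>" using assms(2)[of "\<zero>\<^bsub>U\<^esub>" "\<zero>\<^bsub>U\<^esub>"] by simp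
qed

lemma additive_minus:
  assumes f: "f \<in> carrier U \<rightarrow> carrier V"
    "\<And>x y. x \<in> carrier U \<Longrightarrow> y \<in> carrier U \<Longrightarrow> f (x \<oplus>\<^bsub>U\<^esub> y) = f x \<oplus>\<^bsub>V\<^esub> f y" and x: "x \<in> carrier U"
  shows "f (\<ominus>\<^bsub>U\<^esub> x) = \<ominus>\<^bsub>V\<^esub> f x"
proof (rule V.M.M.minus_equality[symmetric])
  show "f (\<ominus>\<^bsub>U\<^esub> x) \<oplus>\<^bsub>V\<^esub> f x = \<zero>\<^bsub>V\<^esub>"
    using f(2)[of "\<ominus>\<^bsub>U\<^esub> x" x] x additive_zero[OF f] by (simp add: U.M.M.l_neg)
qed (use f(1) x in auto)

lemma additive_diff:
  assumes f: "f \<in> carrier U \<rightarrow> carrier V"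
    "\<And>x y. x \<in> carrier U \<Longrightarrow> y \<in> carrier U \<Longrightarrow> f (x \<oplus>\<^bsub>U\<^esub> y) = f x \<oplus>\<^bsub>V\<^esub> f y"
    and x: "x \<in> carrier U" "y \<in> carrier U"
  shows "f (x \<ominus>\<^bsub>U\<^esub> y) = f x \<ominus>\<^bsub>V\<^esub> f y"
  using f(2)[of x "\<ominus>\<^bsub>U\<^esub> y"] additive_minus[OF f x(2)] x by (simp add: a_minus_def)

lemma klin_maps: "f \<in> klin k G U V \<Longrightarrow> f \<in> carrier U \<rightarrow> carrier V"
  by (auto dest: klinD(1))

lemma klin_zero: "f \<in> klin k G U V \<Longrightarrow> f \<zero>\<^bsub>U\<^esub> = \<zero>\<^bsub>V\<^esub>"
  by (rule additive_zero[OF klin_maps]) (auto intro: klinD(2))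

lemma klin_diff:
  "f \<in> klin k G U V \<Longrightarrow> x \<in> carrier U \<Longrightarrow> y \<in> carrier U \<Longrightarrow> f (x \<ominus>\<^bsub>U\<^esub> y) = f x \<ominus>\<^bsub>V\<^esub> f y"
  by (rule additive_diff[OF klin_maps]) (auto intro: klinD(2))

lemma klin_finsum:
  "f \<in> klin k G U V \<Longrightarrow> finite I \<Longrightarrow> u \<in> I \<rightarrow> carrier U \<Longrightarrow>
    f (\<Oplus>\<^bsub>U\<^esub>i\<in>I. u i) = (\<Oplus>\<^bsub>V\<^esub>i\<in>I. f (u i))"
  by (rule U.finsum_additive_map[OF V.M.M.abelian_group_axioms klin_maps]) (auto intro: klinD(2))

text \<open>The scalars for which \<open>f\<close> commutes modulo \<open>D\<close> form a closed
  set containing all finite combinations of \<open>H\<close>, hence all limits of such. The version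
  modulo \<open>D\<close> is required because approximate lifts commute with the group only modulo
  an open submodule.\<close>

lemma equivariant_mod:
  assumes f: "f \<in> klin k G U V" and D: "submodule D KG V" "closedin (mtopology V) D"
    and H: "H \<subseteq> carrier G"
    and eq: "\<And>h u. h \<in> H \<Longrightarrow> u \<in> carrier U \<Longrightarrow> f (U.act h u) \<ominus>\<^bsub>V\<^esub> V.act h (f u) \<in> D"
    and r: "r \<in> carrier KG" "\<And>N. N \<in> ONS \<Longrightarrow> \<exists>s\<in>span H. s N = r N"
    and u: "u \<in> carrier U"
  shows "f (r \<odot>\<^bsub>U\<^esub> u) \<ominus>\<^bsub>V\<^esub> r \<odot>\<^bsub>V\<^esub> f u \<in> D"
proof -
  note Df = submodule_facts[OF D(1)]
  have fu: "f u \<in> carrier V" using klinD(1)[OF f u] .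
  let ?A = "{r \<in> topspace KGtop. f (r \<odot>\<^bsub>U\<^esub> u) \<ominus>\<^bsub>V\<^esub> r \<odot>\<^bsub>V\<^esub> f u \<in> D}"
  have id: "continuous_map KGtop KGtop (\<lambda>r. r)" using continuous_map_id[of KGtop] by (simp add: id_def)
  have "continuous_map KGtop (mtopology V) (\<lambda>r. f (r \<odot>\<^bsub>U\<^esub> u))"
    using continuous_map_compose[OF U.continuous_smult_fixed[OF u id] klinD(4)[OF f]] by (simp add: o_def)
  then have "continuous_map KGtop (mtopology V) (\<lambda>r. f (r \<odot>\<^bsub>U\<^esub> u) \<ominus>\<^bsub>V\<^esub> r \<odot>\<^bsub>V\<^esub> f u)"
    by (rule V.continuous_diff_maps[OF _ V.continuous_smult_fixed[OF fu id]])
  then have cl: "closedin KGtop ?A" by (rule closedin_continuous_map_preimage[OF _ D(2)])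
  have "span H \<subseteq> ?A"
  proof
    fix s assume "s \<in> span H"
    then show "s \<in> ?A"
    proof induction
      case zero
      then show ?case using u fu klin_zero[OF f] Df(2) V.M.M.diff_eq_zero_iff[of "\<zero>\<^bsub>V\<^esub>" "\<zero>\<^bsub>V\<^esub>"]
        by (simp add: topspace_KGtop U.zero_smult V.zero_smult)
    next
      case (add c h s)
      have hG: "h \<in> carrier G" using add H by blast
      have p: "pt c h \<in> carrier KG" using pt_closed[OF add(1) hG] .
      have s: "s \<in> carrier KG" using add by (simp add: topspace_KGtop)
      have c1: "U.act h u \<in> carrier U" "U.sc c (U.act h u) \<in> carrier U" "s \<odot>\<^bsub>U\<^esub> u \<in> carrier U" using add hG u s by auto
      have "f (pt c h \<odot>\<^bsub>U\<^esub> u) \<ominus>\<^bsub>V\<^esub> pt c h \<odot>\<^bsub>V\<^esub> f u = V.sc c (f (U.act h u) \<ominus>\<^bsub>V\<^esub> V.act h (f u))"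
        using add(1) hG u fu c1 klinD[OF f]
        by (simp add: U.pt_smult V.pt_smult V.sc_diff)
      then have 1: "f (pt c h \<odot>\<^bsub>U\<^esub> u) \<ominus>\<^bsub>V\<^esub> pt c h \<odot>\<^bsub>V\<^esub> f u \<in> D"
        using V.submodule_sc[OF D(1) add(1) eq[OF add(2) u]] by simp
      have "f ((pt c h \<oplus>\<^bsub>KG\<^esub> s) \<odot>\<^bsub>U\<^esub> u) \<ominus>\<^bsub>V\<^esub> (pt c h \<oplus>\<^bsub>KG\<^esub> s) \<odot>\<^bsub>V\<^esub> f u
          = (f (pt c h \<odot>\<^bsub>U\<^esub> u) \<oplus>\<^bsub>V\<^esub> f (s \<odot>\<^bsub>U\<^esub> u)) \<ominus>\<^bsub>V\<^esub> (pt c h \<odot>\<^bsub>V\<^esub> f u \<oplus>\<^bsub>V\<^esub> s \<odot>\<^bsub>V\<^esub> f u)"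
        using p s u fu klinD[OF f] by (simp add: U.M.smult_l_distr V.M.smult_l_distr)
      also have "\<dots> = (f (pt c h \<odot>\<^bsub>U\<^esub> u) \<ominus>\<^bsub>V\<^esub> pt c h \<odot>\<^bsub>V\<^esub> f u) \<oplus>\<^bsub>V\<^esub> (f (s \<odot>\<^bsub>U\<^esub> u) \<ominus>\<^bsub>V\<^esub> s \<odot>\<^bsub>V\<^esub> f u)"
        using p s u fu klinD(1)[OF f] by (intro V.M.M.add_diff_add) auto
      also have "\<dots> \<in> D" using 1 add by (intro Df(3)) auto
      finally show ?case using KG_add_closed[OF p s] by (simp add: topspace_KGtop)
    qed
  qed
  from closed_approx[OF cl this r] show ?thesis by blast
qed

lemma equivariant_mod_KG:
  assumes "f \<in> klin k G U V" "submodule D KG V" "closedin (mtopology V) D"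
    and "\<And>h u. h \<in> carrier G \<Longrightarrow> u \<in> carrier U \<Longrightarrow> f (U.act h u) \<ominus>\<^bsub>V\<^esub> V.act h (f u) \<in> D"
    and "r \<in> carrier KG" "u \<in> carrier U"
  shows "f (r \<odot>\<^bsub>U\<^esub> u) \<ominus>\<^bsub>V\<^esub> r \<odot>\<^bsub>V\<^esub> f u \<in> D"
  by (rule equivariant_mod[OF assms(1-3) order_refl assms(4,5) KG_approx[OF assms(5)] assms(6)])

lemma equivariant_exact:
  assumes f: "f \<in> ghom k G H U V" and H: "H \<subseteq> carrier G"
    and r: "r \<in> carrier KG" "\<And>N. N \<in> ONS \<Longrightarrow> \<exists>s\<in>span H. s N = r N"
    and u: "u \<in> carrier U"
  shows "f (r \<odot>\<^bsub>U\<^esub> u) = r \<odot>\<^bsub>V\<^esub> f u"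
proof -
  have fl: "f \<in> klin k G U V" using ghomD(1)[OF f] .
  have "f (U.act h u) \<ominus>\<^bsub>V\<^esub> V.act h (f u) \<in> {\<zero>\<^bsub>V\<^esub>}" if "h \<in> H" "u \<in> carrier U" for h u
    using ghomD(2)[OF f that] that H klinD(1)[OF fl that(2)] V.M.M.diff_eq_zero_iff[of "V.act h (f u)" "V.act h (f u)"]
    by auto
  from equivariant_mod[OF fl V.submodule_zero V.closedin_zero H this r u]
  show ?thesis using V.M.M.diff_eq_zero_iff klinD(1)[OF fl] r(1) u by auto
qed

lemma continuous_hom_eq_ghom: "continuous_hom KG U V = ghom k G (carrier G) U V"
proof (intro equalityI subsetI)
  fix f assume f: "f \<in> continuous_hom KG U V"
  show "f \<in> ghom k G (carrier G) U V"
    unfolding ghom_def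
    using continuous_homD[OF f] pt_closed by (auto intro!: klinI simp: gact_def kact_def)
next
  fix f assume f: "f \<in> ghom k G (carrier G) U V"
  show "f \<in> continuous_hom KG U V"
    unfolding continuous_hom_def
    using klinD[OF ghomD(1)[OF f]] equivariant_exact[OF f order_refl _ KG_approx] by auto
qed

text \<open>The image of \<open>k[[H]]\<close> consists of limits of finite combinations of elements
  of \<open>H\<close>, so commuting with \<open>H\<close> and \<open>k\<close> suffices; conversely
  each \<open>c h\<close> is the image of a point of \<open>k[[H]]\<close>.\<close>

lemma continuous_hom_subgroup_eq_ghom:
  assumes H: "closed_subgroup H G"
  shows "continuous_hom (completed_group_algebra k (sub_top_group G H))
    (restrict_scalars (cga_incl k G H) U) (restrict_scalars (cga_incl k G H) V) = ghom k G H U V"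
proof -
  interpret S: cga_subgroup k G H by unfold_locales (rule H)
  show ?thesis
  proof (intro equalityI subsetI)
    fix f assume "f \<in> continuous_hom (completed_group_algebra k (sub_top_group G H))
      (restrict_scalars (cga_incl k G H) U) (restrict_scalars (cga_incl k G H) V)"
    then have f: "f \<in> carrier U \<rightarrow> carrier V"
      "\<And>x y. x \<in> carrier U \<Longrightarrow> y \<in> carrier U \<Longrightarrow> f (x \<oplus>\<^bsub>U\<^esub> y) = f x \<oplus>\<^bsub>V\<^esub> f y"
      "continuous_map (mtopology U) (mtopology V) f"
      and b: "\<And>b x. b \<in> carrier S.H.KG \<Longrightarrow> x \<in> carrier U \<Longrightarrow> f (cga_incl k G H b \<odot>\<^bsub>U\<^esub> x) = cga_incl k G H b \<odot>\<^bsub>V\<^esub> f x"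
      by (auto simp: continuous_hom_def restrict_scalars_def)
    have p: "f (pt c h \<odot>\<^bsub>U\<^esub> x) = pt c h \<odot>\<^bsub>V\<^esub> f x" if "c \<in> carrier k" "h \<in> H" "x \<in> carrier U" for c h x
      using b[OF S.H.pt_closed, of c h x] that S.carrier_H S.incl_pt by simp
    \<comment> \<open>Scalars from \<open>k\<close> sit at the identity, which belongs to
      \<open>H\<close>, so \<open>k\<close>-linearity is part of
      \<open>k[[H]]\<close>-linearity.\<close>
    have "\<one>\<^bsub>G\<^esub> \<in> H" using H by (auto simp: closed_subgroup_def subgroup.one_closed)
    then show "f \<in> ghom k G H U V"
      unfolding ghom_def using f p by (auto intro!: klinI simp: gact_def kact_def)
  next
    fix f assume f: "f \<in> ghom k G H U V"
    have "f (cga_incl k G H b \<odot>\<^bsub>U\<^esub> x) = cga_incl k G H b \<odot>\<^bsub>V\<^esub> f x"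
      if "b \<in> carrier S.H.KG" "x \<in> carrier U" for b x
      by (rule equivariant_exact[OF f S.HG S.incl_closed[OF that(1)] S.incl_approx[OF that(1)] that(2)])
    then show "f \<in> continuous_hom (completed_group_algebra k (sub_top_group G H))
      (restrict_scalars (cga_incl k G H) U) (restrict_scalars (cga_incl k G H) V)"
      using klinD[OF ghomD(1)[OF f]] by (auto simp: continuous_hom_def restrict_scalars_def)
  qed
qed

end

section \<open>Augmentation submodules of a finitely generated module\<close>

context cga_module
begin

text \<open>The closed submodule generated by \<open>I M\<close>, where \<open>I\<close> is the kernel of \<open>k[[G]] \<rightarrow> k[G/N]\<close>.  When
  \<open>M\<close> is finitely generated, these submodules are open and form a basis of neighbourhoods of zero, and
  every endomorphism preserves each of them.  This equicontinuity is what finite generation is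
  needed for.\<close>

definition augmentation :: "'g set \<Rightarrow> 'm set" where
  "augmentation N = \<Inter>{A. submodule A KG M \<and> closedin Mtop A \<and>
     (\<forall>r\<in>carrier KG. \<forall>x\<in>carrier M. r N = \<zero>\<^bsub>KG\<^esub> N \<longrightarrow> r \<odot>\<^bsub>M\<^esub> x \<in> A)}"

lemma augmentation_least:
  assumes "submodule A KG M" "closedin Mtop A"
    "\<And>r x. r \<in> carrier KG \<Longrightarrow> x \<in> carrier M \<Longrightarrow> r N = \<zero>\<^bsub>KG\<^esub> N \<Longrightarrow> r \<odot>\<^bsub>M\<^esub> x \<in> A"
  shows "augmentation N \<subseteq> A"
  using assms by (auto simp: augmentation_def)

lemma submodule_carrier: "submodule (carrier M) KG M"
  by (rule M.left_submoduleI) auto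

lemma closedin_carrier: "closedin Mtop (carrier M)"
  using closedin_topspace[of Mtop] topspace_Mtop by simp

lemma augmentation_props:
  shows "submodule (augmentation N) KG M" "closedin Mtop (augmentation N)"
    "\<And>r x. r \<in> carrier KG \<Longrightarrow> x \<in> carrier M \<Longrightarrow> r N = \<zero>\<^bsub>KG\<^esub> N \<Longrightarrow> r \<odot>\<^bsub>M\<^esub> x \<in> augmentation N"
proof -
  show "r \<odot>\<^bsub>M\<^esub> x \<in> augmentation N" if "r \<in> carrier KG" "x \<in> carrier M" "r N = \<zero>\<^bsub>KG\<^esub> N" for r x
    using that by (auto simp: augmentation_def)
  have "augmentation N \<subseteq> carrier M"
    by (rule augmentation_least[OF submodule_carrier closedin_carrier]) auto
  then show "submodule (augmentation N) KG M"
    by (rule M.left_submoduleI) (auto simp: augmentation_def submodule_facts)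
  show "closedin Mtop (augmentation N)"
    unfolding augmentation_def
    by (rule closedin_Inter) (use submodule_carrier closedin_carrier in auto)
qed

lemma finite_representatives:
  assumes N: "N \<in> ONS"
  obtains T where "finite T" "T \<subseteq> carrier KG" "\<And>r. r \<in> carrier KG \<Longrightarrow> \<exists>t\<in>T. r N = t N"
proof -
  have "(\<lambda>r. r N) ` carrier KG \<subseteq> cosets N \<rightarrow>\<^sub>E carrier k" using KG_component[OF _ N] by blast
  moreover have "finite (cosets N \<rightarrow>\<^sub>E carrier k)" using ONS(5)[OF N] finite_k by (simp add: finite_PiE)
  ultimately have "finite ((\<lambda>r. r N) ` carrier KG)" by (rule finite_subset)
  then obtain T where T: "T \<subseteq> carrier KG" "finite T" "(\<lambda>r. r N) ` carrier KG = (\<lambda>r. r N) ` T"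
    using finite_subset_image[of "(\<lambda>r. r N) ` carrier KG" "\<lambda>r. r N" "carrier KG"] by blast
  have "\<exists>t\<in>T. r N = t N" if "r \<in> carrier KG" for r
    using T(3) that by (metis (no_types, lifting) imageE imageI)
  with T that show thesis by blast
qed

lemma KG_diff_component:
  assumes r: "r \<in> carrier KG" "t \<in> carrier KG" and N: "N \<in> ONS" "r N = t N"
  shows "(r \<ominus>\<^bsub>KG\<^esub> t) N = \<zero>\<^bsub>KG\<^esub> N"
proof (rule KG_component_ext[OF _ M.R.zero_closed N(1)])
  show d: "r \<ominus>\<^bsub>KG\<^esub> t \<in> carrier KG" using r by simp
  fix C assume C: "C \<in> cosets N"
  have "(r \<ominus>\<^bsub>KG\<^esub> t) \<oplus>\<^bsub>KG\<^esub> t = r" using M.R.diff_diff_cancel(4) r by simp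
  then have "(r \<ominus>\<^bsub>KG\<^esub> t) N C \<oplus>\<^bsub>k\<^esub> t N C = t N C" using KG_add[OF N(1) C] N(2) by metis
  then show "(r \<ominus>\<^bsub>KG\<^esub> t) N C = \<zero>\<^bsub>KG\<^esub> N C"
    using KG_val[OF d N(1) C] KG_val[OF r(2) N(1) C] KG_zero[OF N(1) C] k.add.r_cancel_one by simp
qed

text \<open>Modulo \<open>augmentation N\<close> the scalars act through the finite set of
  components at \<open>N\<close>, so finitely many generators span only finitely many classes. The
  submodule of these classes is a finite union of closed translates, hence closed, and topological
  generation makes it all of \<open>M\<close>.\<close>

lemma augmentation_finite_index:
  assumes fg: "finitely_generated_module KG M" and N: "N \<in> ONS"
  obtains F where "finite F" "F \<subseteq> carrier M" "\<And>x. x \<in> carrier M \<Longrightarrow> \<exists>f\<in>F. x \<ominus>\<^bsub>M\<^esub> f \<in> augmentation N"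
proof -
  let ?L = "augmentation N"
  note L = augmentation_props[where N = N] and Lf = submodule_facts[OF augmentation_props(1)[where N = N]]
  obtain T where T: "finite T" "T \<subseteq> carrier KG" "\<And>r. r \<in> carrier KG \<Longrightarrow> \<exists>t\<in>T. r N = t N"
    using finite_representatives[OF N] by blast
  define B where "B F = {x \<in> carrier M. \<exists>f\<in>F. x \<ominus>\<^bsub>M\<^esub> f \<in> ?L}" for F
  obtain X where X: "finite X" "X \<subseteq> carrier M"
    "\<And>A. submodule A KG M \<Longrightarrow> closedin Mtop A \<Longrightarrow> X \<subseteq> A \<Longrightarrow> A = carrier M"
    using fg unfolding finitely_generated_module_def by blast
  have "\<exists>F. finite F \<and> F \<subseteq> carrier M \<and> submodule (B F) KG M \<and> X \<subseteq> B F"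
    using X(1,2)
  proof (induction X)
    case empty
    have "x \<ominus>\<^bsub>M\<^esub> \<zero>\<^bsub>M\<^esub> = x" if "x \<in> carrier M" for x
      using M.M.diff_diff_cancel(4)[of x "\<zero>\<^bsub>M\<^esub>" "\<zero>\<^bsub>M\<^esub>"] that by simp
    then have "B {\<zero>\<^bsub>M\<^esub>} = ?L" using Lf(1) by (auto simp: B_def)
    then show ?case using L(1) by (intro exI[of _ "{\<zero>\<^bsub>M\<^esub>}"]) auto
  next
    case (insert x X)
    then obtain F where F: "finite F" "F \<subseteq> carrier M" "submodule (B F) KG M" "X \<subseteq> B F" by auto
    have x: "x \<in> carrier M" using insert.prems by auto
    note Bf = submodule_facts[OF F(3)]
    \<comment> \<open>One more generator \<open>x\<close> enlarges the classes by all
      \<open>t x + f\<close>, where \<open>t\<close> runs through representatives of the components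
      at \<open>N\<close>.\<close>
    define F' where "F' = (\<lambda>(t, f). t \<odot>\<^bsub>M\<^esub> x \<oplus>\<^bsub>M\<^esub> f) ` (T \<times> F)"
    have F': "finite F'" "F' \<subseteq> carrier M" using F T x by (auto simp: F'_def subset_iff)
    have eq: "y \<in> B F' \<longleftrightarrow> (\<exists>r\<in>carrier KG. \<exists>b\<in>B F. y = r \<odot>\<^bsub>M\<^esub> x \<oplus>\<^bsub>M\<^esub> b)" for y
    proof
      assume "y \<in> B F'"
      then obtain t f where tf: "y \<in> carrier M" "t \<in> T" "f \<in> F" "y \<ominus>\<^bsub>M\<^esub> (t \<odot>\<^bsub>M\<^esub> x \<oplus>\<^bsub>M\<^esub> f) \<in> ?L"
        by (auto simp: B_def F'_def)
      have c: "t \<in> carrier KG" "f \<in> carrier M" "t \<odot>\<^bsub>M\<^esub> x \<in> carrier M" using tf T F x by auto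
      let ?b = "f \<oplus>\<^bsub>M\<^esub> (y \<ominus>\<^bsub>M\<^esub> (t \<odot>\<^bsub>M\<^esub> x \<oplus>\<^bsub>M\<^esub> f))"
      have "?b \<ominus>\<^bsub>M\<^esub> f = y \<ominus>\<^bsub>M\<^esub> (t \<odot>\<^bsub>M\<^esub> x \<oplus>\<^bsub>M\<^esub> f)"
        using c tf(1) by (intro M.M.add_diff_cancel_left) auto
      then have "?b \<ominus>\<^bsub>M\<^esub> f \<in> ?L" using tf(4) by simp
      then have "?b \<in> B F" unfolding B_def using tf c by blast
      moreover have "t \<odot>\<^bsub>M\<^esub> x \<oplus>\<^bsub>M\<^esub> ?b = y"
        using M.M.diff_diff_cancel(3)[of y "t \<odot>\<^bsub>M\<^esub> x \<oplus>\<^bsub>M\<^esub> f" y] c tf(1) by (simp add: M.M.a_assoc)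
      ultimately show "\<exists>r\<in>carrier KG. \<exists>b\<in>B F. y = r \<odot>\<^bsub>M\<^esub> x \<oplus>\<^bsub>M\<^esub> b"
        using c(1) by (intro bexI[of _ t] bexI[of _ ?b]) simp_all
    next
      assume "\<exists>r\<in>carrier KG. \<exists>b\<in>B F. y = r \<odot>\<^bsub>M\<^esub> x \<oplus>\<^bsub>M\<^esub> b"
      then obtain r b where rb: "r \<in> carrier KG" "b \<in> B F" "y = r \<odot>\<^bsub>M\<^esub> x \<oplus>\<^bsub>M\<^esub> b" by blast
      obtain f where f: "f \<in> F" "b \<ominus>\<^bsub>M\<^esub> f \<in> ?L" "b \<in> carrier M" using rb(2) by (auto simp: B_def)
      obtain t where t: "t \<in> T" "r N = t N" using T(3)[OF rb(1)] by blast
      have c: "t \<in> carrier KG" "f \<in> carrier M" using t T f F by auto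
      have "(r \<ominus>\<^bsub>KG\<^esub> t) \<odot>\<^bsub>M\<^esub> x = r \<odot>\<^bsub>M\<^esub> x \<ominus>\<^bsub>M\<^esub> t \<odot>\<^bsub>M\<^esub> x"
      proof -
        have "(r \<ominus>\<^bsub>KG\<^esub> t) \<odot>\<^bsub>M\<^esub> x \<oplus>\<^bsub>M\<^esub> t \<odot>\<^bsub>M\<^esub> x = r \<odot>\<^bsub>M\<^esub> x"
          using rb(1) c x M.R.diff_diff_cancel(4)[OF rb(1) c(1) c(1)] by (simp flip: M.smult_l_distr)
        then have "r \<odot>\<^bsub>M\<^esub> x \<ominus>\<^bsub>M\<^esub> t \<odot>\<^bsub>M\<^esub> x = ((r \<ominus>\<^bsub>KG\<^esub> t) \<odot>\<^bsub>M\<^esub> x \<oplus>\<^bsub>M\<^esub> t \<odot>\<^bsub>M\<^esub> x) \<ominus>\<^bsub>M\<^esub> t \<odot>\<^bsub>M\<^esub> x" by simp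
        also have "\<dots> = (r \<ominus>\<^bsub>KG\<^esub> t) \<odot>\<^bsub>M\<^esub> x"
          using rb(1) c x by (intro M.M.add_diff_cancel_left) auto
        finally show ?thesis by simp
      qed
      moreover have "(r \<ominus>\<^bsub>KG\<^esub> t) \<odot>\<^bsub>M\<^esub> x \<in> ?L"
        by (rule L(3)) (use rb(1) c x KG_diff_component[OF rb(1) c(1) N t(2)] in auto)
      ultimately have "r \<odot>\<^bsub>M\<^esub> x \<ominus>\<^bsub>M\<^esub> t \<odot>\<^bsub>M\<^esub> x \<in> ?L" by simp
      then have "y \<ominus>\<^bsub>M\<^esub> (t \<odot>\<^bsub>M\<^esub> x \<oplus>\<^bsub>M\<^esub> f) \<in> ?L"
        using rb c x f M.M.add_diff_add[of "r \<odot>\<^bsub>M\<^esub> x" b "t \<odot>\<^bsub>M\<^esub> x" f] Lf(3) by auto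
      moreover have "t \<odot>\<^bsub>M\<^esub> x \<oplus>\<^bsub>M\<^esub> f \<in> F'" using t f by (auto simp: F'_def)
      moreover have "y \<in> carrier M" using rb f x by simp
      ultimately show "y \<in> B F'" unfolding B_def by blast
    qed
    have "submodule (B F') KG M"
    proof (rule M.left_submoduleI)
      show "B F' \<subseteq> carrier M" by (auto simp: B_def)
      show "\<zero>\<^bsub>M\<^esub> \<in> B F'" unfolding eq
        by (rule bexI[of _ "\<zero>\<^bsub>KG\<^esub>"], rule bexI[of _ "\<zero>\<^bsub>M\<^esub>"]) (use x Bf(2) in \<open>auto simp: zero_smult\<close>)
      fix y z assume "y \<in> B F'" "z \<in> B F'"
      then obtain r b s d where *: "r \<in> carrier KG" "b \<in> B F" "y = r \<odot>\<^bsub>M\<^esub> x \<oplus>\<^bsub>M\<^esub> b"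
        "s \<in> carrier KG" "d \<in> B F" "z = s \<odot>\<^bsub>M\<^esub> x \<oplus>\<^bsub>M\<^esub> d" unfolding eq by blast
      have bd: "b \<in> carrier M" "d \<in> carrier M" using * Bf(1) by auto
      have "y \<oplus>\<^bsub>M\<^esub> z = (r \<oplus>\<^bsub>KG\<^esub> s) \<odot>\<^bsub>M\<^esub> x \<oplus>\<^bsub>M\<^esub> (b \<oplus>\<^bsub>M\<^esub> d)"
        using * bd x by (simp add: M.smult_l_distr M.M.a_ac)
      then show "y \<oplus>\<^bsub>M\<^esub> z \<in> B F'" unfolding eq using * Bf(3) by (metis M.R.a_closed)
    next
      fix s y assume s: "s \<in> carrier KG" and "y \<in> B F'"
      then obtain r b where *: "r \<in> carrier KG" "b \<in> B F" "y = r \<odot>\<^bsub>M\<^esub> x \<oplus>\<^bsub>M\<^esub> b" unfolding eq by blast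
      have "s \<odot>\<^bsub>M\<^esub> y = (s \<otimes>\<^bsub>KG\<^esub> r) \<odot>\<^bsub>M\<^esub> x \<oplus>\<^bsub>M\<^esub> s \<odot>\<^bsub>M\<^esub> b"
        using * s x Bf(1) by (simp add: M.smult_r_distr M.smult_assoc1 subset_iff)
      then show "s \<odot>\<^bsub>M\<^esub> y \<in> B F'" unfolding eq using * s Bf(5) by (metis M.R.m_closed)
    qed
    moreover have "x \<in> B F'" unfolding eq
      by (rule bexI[of _ "\<one>\<^bsub>KG\<^esub>"], rule bexI[of _ "\<zero>\<^bsub>M\<^esub>"]) (use x Bf(2) in auto)
    moreover have "y \<in> B F'" if "y \<in> B F" for y unfolding eq
      by (rule bexI[of _ "\<zero>\<^bsub>KG\<^esub>"], rule bexI[of _ y]) (use x that Bf(1) in \<open>auto simp: zero_smult\<close>)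
    ultimately show ?case using F' F(4) by (intro exI[of _ F']) auto
  qed
  then obtain F where F: "finite F" "F \<subseteq> carrier M" "submodule (B F) KG M" "X \<subseteq> B F" by blast
  have "B F = (\<Union>f\<in>F. {x \<in> carrier M. x \<ominus>\<^bsub>M\<^esub> f \<in> ?L})" by (auto simp: B_def)
  moreover have "closedin Mtop \<dots>"
    by (rule closedin_Union) (use F(1,2) closedin_translate[OF L(2)] in auto)
  ultimately have "closedin Mtop (B F)" by simp
  then have BM: "B F = carrier M" by (rule X(3)[OF F(3) _ F(4)])
  show thesis
  proof (rule that[OF F(1,2)])
    fix x assume "x \<in> carrier M"
    then have "x \<in> B F" using BM by simp
    then show "\<exists>f\<in>F. x \<ominus>\<^bsub>M\<^esub> f \<in> ?L" unfolding B_def by blast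
  qed
qed

text \<open>By finite index the complement is a finite union of closed translates.\<close>

lemma augmentation_open:
  assumes fg: "finitely_generated_module KG M" and N: "N \<in> ONS"
  shows "openin Mtop (augmentation N)"
proof -
  let ?L = "augmentation N"
  note L = augmentation_props[where N = N] and Lf = submodule_facts[OF augmentation_props(1)[where N = N]]
  obtain F where F: "finite F" "F \<subseteq> carrier M" "\<And>x. x \<in> carrier M \<Longrightarrow> \<exists>f\<in>F. x \<ominus>\<^bsub>M\<^esub> f \<in> ?L"
    using augmentation_finite_index[OF fg N] by blast
  have iff: "x \<in> ?L \<longleftrightarrow> f \<in> ?L" if "x \<in> carrier M" "f \<in> carrier M" "x \<ominus>\<^bsub>M\<^esub> f \<in> ?L" for x f
  proof
    assume "x \<in> ?L"
    then have "x \<ominus>\<^bsub>M\<^esub> (x \<ominus>\<^bsub>M\<^esub> f) \<in> ?L" using submodule_diff[OF L(1)] that by blast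
    then show "f \<in> ?L" using M.M.diff_diff_cancel(5)[OF that(1,2,2)] by simp
  next
    assume "f \<in> ?L"
    then show "x \<in> ?L" using Lf(3)[OF that(3)] M.M.diff_diff_cancel(4)[OF that(1,2,2)] by metis
  qed
  have "carrier M - ?L = (\<Union>f\<in>F - ?L. {x \<in> carrier M. x \<ominus>\<^bsub>M\<^esub> f \<in> ?L})"
  proof (intro equalityI subsetI)
    fix x assume "x \<in> carrier M - ?L"
    then show "x \<in> (\<Union>f\<in>F - ?L. {x \<in> carrier M. x \<ominus>\<^bsub>M\<^esub> f \<in> ?L})" using F(2) F(3)[of x] iff by blast
  next
    fix x assume "x \<in> (\<Union>f\<in>F - ?L. {x \<in> carrier M. x \<ominus>\<^bsub>M\<^esub> f \<in> ?L})"
    then show "x \<in> carrier M - ?L" using F(2) iff by blast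
  qed
  moreover have "closedin Mtop \<dots>"
    by (rule closedin_Union) (use F(1,2) closedin_translate[OF L(2)] in auto)
  ultimately show ?thesis using Lf(1) by (simp add: openin_closedin topspace_Mtop)
qed

end

context cga_hom
begin

text \<open>The preimage of \<open>D\<close> is a closed submodule containing every
  \<open>r u\<close> with \<open>r\<close> in the kernel at \<open>N\<close>. The level
  \<open>N\<close> is tied to \<open>D\<close> but not to \<open>f\<close>; this uniformity makes
  endomorphisms equicontinuous and keeps limits of approximate lifts continuous.\<close>

lemma augmentation_image:
  assumes f: "f \<in> klin k G U V" and D: "submodule D KG V" "closedin (mtopology V) D"
    and eq: "\<And>h u. h \<in> carrier G \<Longrightarrow> u \<in> carrier U \<Longrightarrow> f (U.act h u) \<ominus>\<^bsub>V\<^esub> V.act h (f u) \<in> D"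
    and N: "\<And>r v. r \<in> carrier KG \<Longrightarrow> r N = \<zero>\<^bsub>KG\<^esub> N \<Longrightarrow> v \<in> carrier V \<Longrightarrow> r \<odot>\<^bsub>V\<^esub> v \<in> D"
    and u: "u \<in> U.augmentation N"
  shows "f u \<in> D"
proof -
  note Df = submodule_facts[OF D(1)]
  let ?A = "{u \<in> carrier U. f u \<in> D}"
  have sm: "f (r \<odot>\<^bsub>U\<^esub> u) \<in> D" if "r \<in> carrier KG" "u \<in> carrier U" "r \<odot>\<^bsub>V\<^esub> f u \<in> D" for r u
  proof -
    have "(f (r \<odot>\<^bsub>U\<^esub> u) \<ominus>\<^bsub>V\<^esub> r \<odot>\<^bsub>V\<^esub> f u) \<oplus>\<^bsub>V\<^esub> r \<odot>\<^bsub>V\<^esub> f u \<in> D"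
      using Df(3)[OF equivariant_mod_KG[OF f D eq that(1,2)] that(3)] .
    moreover have "f (r \<odot>\<^bsub>U\<^esub> u) \<in> carrier V" "r \<odot>\<^bsub>V\<^esub> f u \<in> carrier V" using that klinD(1)[OF f] by auto
    ultimately show ?thesis using V.M.M.diff_diff_cancel(4) by metis
  qed
  have "U.augmentation N \<subseteq> ?A"
  proof (rule U.augmentation_least)
    show "submodule ?A KG U"
    proof (rule U.M.left_submoduleI)
      show "\<zero>\<^bsub>U\<^esub> \<in> ?A" using klin_zero[OF f] Df(2) by simp
      show "x \<oplus>\<^bsub>U\<^esub> y \<in> ?A" if "x \<in> ?A" "y \<in> ?A" for x y using that klinD(2)[OF f] Df(3) by simp
      show "r \<odot>\<^bsub>U\<^esub> x \<in> ?A" if "r \<in> carrier KG" "x \<in> ?A" for r x using that sm Df(5) by simp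
    qed auto
    show "closedin (mtopology U) ?A"
      using closedin_continuous_map_preimage[OF klinD(4)[OF f] D(2)] by (simp add: U.topspace_Mtop)
    show "r \<odot>\<^bsub>U\<^esub> x \<in> ?A" if "r \<in> carrier KG" "x \<in> carrier U" "r N = \<zero>\<^bsub>KG\<^esub> N" for r x
      using that sm N klinD(1)[OF f] by simp
  qed
  then show ?thesis using u by blast
qed

end

section \<open>Endomorphisms of an indecomposable module\<close>

context cga_module
begin

lemma eqv_refl: "submodule L KG M \<Longrightarrow> x \<in> carrier M \<Longrightarrow> x \<ominus>\<^bsub>M\<^esub> x \<in> L"
  using submodule_facts(2)[of L KG M] M.M.diff_eq_zero_iff[of x x] by simp

lemma eqv_sym:
  assumes "submodule L KG M" "x \<in> carrier M" "y \<in> carrier M" "x \<ominus>\<^bsub>M\<^esub> y \<in> L"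
  shows "y \<ominus>\<^bsub>M\<^esub> x \<in> L"
  using submodule_facts(4)[OF assms(1,4)] M.M.diff_diff_cancel(2)[OF assms(2,3,3)] by simp

lemma eqv_trans:
  assumes "submodule L KG M" "x \<in> carrier M" "y \<in> carrier M" "z \<in> carrier M"
    "x \<ominus>\<^bsub>M\<^esub> y \<in> L" "y \<ominus>\<^bsub>M\<^esub> z \<in> L"
  shows "x \<ominus>\<^bsub>M\<^esub> z \<in> L"
  using submodule_facts(3)[OF assms(1,5,6)] M.M.diff_diff_cancel(1)[OF assms(2-4)] by simp

lemma eqv_zero: "submodule L KG M \<Longrightarrow> x \<in> carrier M \<Longrightarrow> x \<ominus>\<^bsub>M\<^esub> \<zero>\<^bsub>M\<^esub> \<in> L \<longleftrightarrow> x \<in> L"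
  using M.M.diff_diff_cancel(4)[of x "\<zero>\<^bsub>M\<^esub>" x] by simp

text \<open>Translations are continuous, so an additive map is continuous once it is continuous at
  zero, and there the open submodules of \<open>N\<close> form a basis.\<close>

lemma continuous_additive:
  fixes N :: "(('g, 'k) cga, 'n) top_module"
  assumes N: "cga_module k G N" and f: "f \<in> carrier M \<rightarrow> carrier N"
    "\<And>x y. x \<in> carrier M \<Longrightarrow> y \<in> carrier M \<Longrightarrow> f (x \<oplus>\<^bsub>M\<^esub> y) = f x \<oplus>\<^bsub>N\<^esub> f y"
    and L: "\<And>W. submodule W KG N \<Longrightarrow> openin (mtopology N) W \<Longrightarrow>
      \<exists>L. openin Mtop L \<and> \<zero>\<^bsub>M\<^esub> \<in> L \<and> (\<forall>x\<in>L. f x \<in> W)"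
  shows "continuous_map Mtop (mtopology N) f"
proof -
  interpret N: cga_module k G N by fact
  interpret H: cga_hom k G M N by unfold_locales
  show ?thesis
    unfolding continuous_map_def
  proof (intro conjI allI impI)
    show "f \<in> topspace Mtop \<rightarrow> topspace (mtopology N)" using f(1) by (simp add: topspace_Mtop N.topspace_Mtop)
    fix D assume D: "openin (mtopology N) D"
    show "openin Mtop {x \<in> topspace Mtop. f x \<in> D}"
    proof (subst openin_subopen, intro ballI)
      fix x assume "x \<in> {x \<in> topspace Mtop. f x \<in> D}"
      then have x: "x \<in> carrier M" "f x \<in> D" "f x \<in> carrier N" using f(1) by (auto simp: topspace_Mtop)
      have "continuous_map (mtopology N) (mtopology N) (\<lambda>v. v \<oplus>\<^bsub>N\<^esub> f x)"
        by (rule N.continuous_add_maps) (use x N.topspace_Mtop in auto)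
      then have "openin (mtopology N) {v \<in> topspace (mtopology N). v \<oplus>\<^bsub>N\<^esub> f x \<in> D}"
        by (rule openin_continuous_map_preimage[OF _ D])
      moreover have "\<zero>\<^bsub>N\<^esub> \<in> {v \<in> topspace (mtopology N). v \<oplus>\<^bsub>N\<^esub> f x \<in> D}"
        using x by (simp add: N.topspace_Mtop)
      ultimately obtain W where W: "submodule W KG N" "openin (mtopology N) W"
        "W \<subseteq> {v \<in> topspace (mtopology N). v \<oplus>\<^bsub>N\<^esub> f x \<in> D}" by (rule N.open_submodule_inside)
      obtain L where L': "openin Mtop L" "\<zero>\<^bsub>M\<^esub> \<in> L" "\<forall>x\<in>L. f x \<in> W" using L[OF W(1,2)] by blast
      let ?T = "{u \<in> carrier M. u \<ominus>\<^bsub>M\<^esub> x \<in> L}"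
      have "openin Mtop ?T" by (rule openin_translate[OF L'(1) x(1)])
      moreover have "x \<in> ?T" using x(1) L'(2) M.M.diff_eq_zero_iff[of x x] by simp
      moreover have "f u \<in> D" if u: "u \<in> ?T" for u
      proof -
        have "f (u \<ominus>\<^bsub>M\<^esub> x) \<in> W" using u L'(3) by blast
        then have "(f u \<ominus>\<^bsub>N\<^esub> f x) \<oplus>\<^bsub>N\<^esub> f x \<in> D" using W(3) H.additive_diff[OF f] u x by auto
        moreover have "f u \<in> carrier N" using u f(1) by auto
        ultimately show ?thesis using N.M.M.diff_diff_cancel(4) x(3) by metis
      qed
      ultimately show "\<exists>T. openin Mtop T \<and> x \<in> T \<and> T \<subseteq> {x \<in> topspace Mtop. f x \<in> D}"
        unfolding topspace_Mtop by (intro exI[of _ ?T]) blast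
    qed
  qed
qed

end

section \<open>Endomorphisms of a finitely generated module\<close>

locale cga_fg = cga_module k G M
  for k :: "('k, 'a) ring_scheme" and G :: "('g, 'b) top_group_scheme"
    and M :: "(('g, 'k) cga, 'm) top_module" +
  assumes fg: "finitely_generated_module (completed_group_algebra k G) M"

sublocale cga_fg \<subseteq> E: cga_hom k G M M by unfold_locales

context cga_fg
begin

abbreviation "End \<equiv> continuous_hom KG M M"

text \<open>On the quotient by such an \<open>L\<close> the endomorphisms act as self-maps of a
  finite set; the representatives \<open>F\<close> are kept for the counting in
  \<open>idempotent_power\<close>.\<close>

definition fully_invariant :: "'m set \<Rightarrow> bool" where
  "fully_invariant L \<longleftrightarrow> submodule L KG M \<and> openin Mtop L \<and>
    (\<exists>F. finite F \<and> F \<subseteq> carrier M \<and> (\<forall>x\<in>carrier M. \<exists>f\<in>F. x \<ominus>\<^bsub>M\<^esub> f \<in> L)) \<and>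
    (\<forall>\<theta>\<in>End. \<forall>x\<in>L. \<theta> x \<in> L)"

lemma End_klin: "\<theta> \<in> End \<Longrightarrow> \<theta> \<in> klin k G M M"
  using E.continuous_hom_eq_ghom ghomD(1) by blast

lemma End_diff: "\<theta> \<in> End \<Longrightarrow> x \<in> carrier M \<Longrightarrow> y \<in> carrier M \<Longrightarrow> \<theta> (x \<ominus>\<^bsub>M\<^esub> y) = \<theta> x \<ominus>\<^bsub>M\<^esub> \<theta> y"
  by (rule E.klin_diff[OF End_klin])

lemma End_zero: "\<theta> \<in> End \<Longrightarrow> \<theta> \<zero>\<^bsub>M\<^esub> = \<zero>\<^bsub>M\<^esub>"
  by (rule E.klin_zero[OF End_klin])

lemma EndI:
  assumes "\<And>x. x \<in> carrier M \<Longrightarrow> \<theta> x \<in> carrier M"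
    "\<And>x y. x \<in> carrier M \<Longrightarrow> y \<in> carrier M \<Longrightarrow> \<theta> (x \<oplus>\<^bsub>M\<^esub> y) = \<theta> x \<oplus>\<^bsub>M\<^esub> \<theta> y"
    "\<And>r x. r \<in> carrier KG \<Longrightarrow> x \<in> carrier M \<Longrightarrow> \<theta> (r \<odot>\<^bsub>M\<^esub> x) = r \<odot>\<^bsub>M\<^esub> \<theta> x"
    "continuous_map Mtop Mtop \<theta>"
  shows "\<theta> \<in> End"
  using assms by (auto simp: continuous_hom_def)

lemma End_comp:
  assumes "\<theta> \<in> End" "\<eta> \<in> End"
  shows "(\<lambda>x. \<theta> (\<eta> x)) \<in> End"
  by (rule EndI) (use continuous_homD[OF assms(1)] continuous_homD[OF assms(2)]
    continuous_map_compose[OF continuous_homD(4)[OF assms(2)] continuous_homD(4)[OF assms(1)]] in \<open>auto simp: o_def\<close>)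

lemma End_add:
  assumes "\<theta> \<in> End" "\<eta> \<in> End"
  shows "(\<lambda>x. \<theta> x \<oplus>\<^bsub>M\<^esub> \<eta> x) \<in> End"
proof (rule EndI)
  note t = continuous_homD[OF assms(1)] and e = continuous_homD[OF assms(2)]
  show "continuous_map Mtop Mtop (\<lambda>x. \<theta> x \<oplus>\<^bsub>M\<^esub> \<eta> x)"
    by (rule continuous_add_maps[OF t(4) e(4)])
qed (use continuous_homD[OF assms(1)] continuous_homD[OF assms(2)] in \<open>auto simp: M.M.a_ac M.smult_r_distr\<close>)

lemma End_one_diff:
  assumes "\<theta> \<in> End"
  shows "(\<lambda>x. x \<ominus>\<^bsub>M\<^esub> \<theta> x) \<in> End"
proof (rule EndI)
  note t = continuous_homD[OF assms]
  have "continuous_map Mtop Mtop (\<lambda>x. x)" using continuous_map_id[of Mtop] by (simp add: id_def)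
  then show "continuous_map Mtop Mtop (\<lambda>x. x \<ominus>\<^bsub>M\<^esub> \<theta> x)"
    by (rule continuous_diff_maps[OF _ t(4)])
qed (use continuous_homD[OF assms] in \<open>auto simp: M.M.add_diff_add smult_diff\<close>)

lemma End_finsum:
  assumes "finite I" "\<And>i. i \<in> I \<Longrightarrow> \<theta> i \<in> End"
  shows "(\<lambda>x. \<Oplus>\<^bsub>M\<^esub>i\<in>I. \<theta> i x) \<in> End"
proof (rule EndI)
  note t = continuous_homD[OF assms(2)]
  show "continuous_map Mtop Mtop (\<lambda>x. \<Oplus>\<^bsub>M\<^esub>i\<in>I. \<theta> i x)"
    by (rule continuous_finsum_maps[OF assms(1) t(4)])
  show cl: "(\<Oplus>\<^bsub>M\<^esub>i\<in>I. \<theta> i x) \<in> carrier M" if "x \<in> carrier M" for x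
    using t(1) that by (intro M.M.finsum_closed) auto
  show "(\<Oplus>\<^bsub>M\<^esub>i\<in>I. \<theta> i (x \<oplus>\<^bsub>M\<^esub> y)) = (\<Oplus>\<^bsub>M\<^esub>i\<in>I. \<theta> i x) \<oplus>\<^bsub>M\<^esub> (\<Oplus>\<^bsub>M\<^esub>i\<in>I. \<theta> i y)"
    if "x \<in> carrier M" "y \<in> carrier M" for x y
  proof -
    have "(\<Oplus>\<^bsub>M\<^esub>i\<in>I. \<theta> i (x \<oplus>\<^bsub>M\<^esub> y)) = (\<Oplus>\<^bsub>M\<^esub>i\<in>I. \<theta> i x \<oplus>\<^bsub>M\<^esub> \<theta> i y)"
      by (rule M.M.finsum_cong') (use t that in auto)
    also have "\<dots> = (\<Oplus>\<^bsub>M\<^esub>i\<in>I. \<theta> i x) \<oplus>\<^bsub>M\<^esub> (\<Oplus>\<^bsub>M\<^esub>i\<in>I. \<theta> i y)"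
      by (rule M.M.finsum_addf) (use t that in auto)
    finally show ?thesis .
  qed
  show "(\<Oplus>\<^bsub>M\<^esub>i\<in>I. \<theta> i (r \<odot>\<^bsub>M\<^esub> x)) = r \<odot>\<^bsub>M\<^esub> (\<Oplus>\<^bsub>M\<^esub>i\<in>I. \<theta> i x)"
    if "r \<in> carrier KG" "x \<in> carrier M" for r x
  proof -
    have "(\<Oplus>\<^bsub>M\<^esub>i\<in>I. \<theta> i (r \<odot>\<^bsub>M\<^esub> x)) = (\<Oplus>\<^bsub>M\<^esub>i\<in>I. r \<odot>\<^bsub>M\<^esub> \<theta> i x)"
      by (rule M.M.finsum_cong') (use t that in auto)
    also have "\<dots> = r \<odot>\<^bsub>M\<^esub> (\<Oplus>\<^bsub>M\<^esub>i\<in>I. \<theta> i x)"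
      by (rule smult_finsum[symmetric]) (use t that assms(1) in auto)
    finally show ?thesis .
  qed
qed

lemma End_power:
  assumes "\<theta> \<in> End"
  shows "\<theta> ^^ n \<in> End"
proof (induction n)
  case 0
  show ?case by (rule EndI) auto
next
  case (Suc n)
  have "(\<lambda>x. \<theta> ((\<theta> ^^ n) x)) \<in> End" by (rule End_comp[OF assms Suc])
  then show ?case by (simp add: o_def)
qed

lemma fully_invariantD:
  assumes "fully_invariant L"
  shows "submodule L KG M" "openin Mtop L" "\<theta> \<in> End \<Longrightarrow> x \<in> L \<Longrightarrow> \<theta> x \<in> L" "closedin Mtop L"
  using assms closedin_open_submodule by (auto simp: fully_invariant_def)

text \<open>An open submodule in \<open>D\<close> contains all of \<open>r M\<close> once
  \<open>r\<close> vanishes at a suitable \<open>N\<close>, hence it contains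
  \<open>augmentation N\<close>. Endomorphisms commute with scalars and therefore preserve the
  latter, and finite generation makes it open of finite index.\<close>

lemma fully_invariant_inside:
  assumes D: "openin Mtop D" "\<zero>\<^bsub>M\<^esub> \<in> D"
  obtains L where "fully_invariant L" "L \<subseteq> D"
proof -
  obtain W where W: "submodule W KG M" "openin Mtop W" "W \<subseteq> D" using open_submodule_inside[OF D] by blast
  obtain N where N: "N \<in> ONS" "\<And>r x. r \<in> carrier KG \<Longrightarrow> r N = \<zero>\<^bsub>KG\<^esub> N \<Longrightarrow> x \<in> carrier M \<Longrightarrow> r \<odot>\<^bsub>M\<^esub> x \<in> W"
    by (rule ideal_into_open[OF W(1,2)]) blast
  let ?L = "augmentation N"
  have "?L \<subseteq> W" by (rule augmentation_least[OF W(1) closedin_open_submodule[OF W(1,2)]]) (use N(2) in auto)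
  moreover have "fully_invariant ?L"
    unfolding fully_invariant_def
  proof (intro conjI ballI)
    show "submodule ?L KG M" by (rule augmentation_props)
    show "openin Mtop ?L" by (rule augmentation_open[OF fg N(1)])
    show "\<exists>F. finite F \<and> F \<subseteq> carrier M \<and> (\<forall>x\<in>carrier M. \<exists>f\<in>F. x \<ominus>\<^bsub>M\<^esub> f \<in> ?L)"
      by (rule augmentation_finite_index[OF fg N(1)]) blast
    fix \<theta> x assume t: "\<theta> \<in> End" and x: "x \<in> ?L"
    show "\<theta> x \<in> ?L"
    proof (rule E.augmentation_image[OF End_klin[OF t] augmentation_props(1,2) _ _ x])
      show "\<theta> (act h u) \<ominus>\<^bsub>M\<^esub> act h (\<theta> u) \<in> ?L" if "h \<in> carrier G" "u \<in> carrier M" for h u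
        using continuous_homD(1,3)[OF t] that pt_closed eqv_refl[OF augmentation_props(1)]
        by (simp add: gact_def)
    qed (rule augmentation_props(3))
  qed
  ultimately show thesis using that W(3) by blast
qed

lemma fully_invariant_finite_Int:
  assumes "finite J" "\<And>L. L \<in> J \<Longrightarrow> fully_invariant L"
  obtains L where "fully_invariant L" "\<And>K. K \<in> J \<Longrightarrow> L \<subseteq> K"
proof -
  have "openin Mtop (topspace Mtop \<inter> \<Inter>J)"
    using assms fully_invariantD(2) by (cases "J = {}") (auto intro!: openin_Inter)
  moreover have "\<zero>\<^bsub>M\<^esub> \<in> topspace Mtop \<inter> \<Inter>J"
    using assms(2) fully_invariantD(1) submodule_facts(2) topspace_Mtop by fastforce
  ultimately obtain L where "fully_invariant L" "L \<subseteq> topspace Mtop \<inter> \<Inter>J" by (rule fully_invariant_inside)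
  then show thesis using that by blast
qed

lemma zero_if_in_all:
  assumes "x \<in> carrier M" "\<And>L. fully_invariant L \<Longrightarrow> x \<in> L"
  shows "x = \<zero>\<^bsub>M\<^esub>"
proof (rule zero_if_in_open_submodules[OF assms(1)])
  fix W assume "submodule W KG M" "openin Mtop W"
  then obtain L where "fully_invariant L" "L \<subseteq> W" using fully_invariant_inside submodule_facts(2) by metis
  then show "\<exists>L\<subseteq>W. x \<in> L" using assms(2) by blast
qed

lemma eq_if_eqv:
  assumes "x \<in> carrier M" "y \<in> carrier M" "\<And>L. fully_invariant L \<Longrightarrow> x \<ominus>\<^bsub>M\<^esub> y \<in> L"
  shows "x = y"
  using zero_if_in_all[of "x \<ominus>\<^bsub>M\<^esub> y"] assms M.M.diff_eq_zero_iff by simp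

lemma End_eqv:
  assumes "fully_invariant L" "\<theta> \<in> End" "x \<in> carrier M" "y \<in> carrier M" "x \<ominus>\<^bsub>M\<^esub> y \<in> L"
  shows "\<theta> x \<ominus>\<^bsub>M\<^esub> \<theta> y \<in> L"
  using fully_invariantD(3)[OF assms(1,2,5)] End_diff[OF assms(2-4)] by simp

text \<open>Modulo \<open>L\<close> the powers of \<open>\<theta>\<close> are maps on a finite set,
  so two of them coincide and the powers become periodic; a large multiple of the period is an
  idempotent exponent.\<close>

lemma idempotent_power:
  assumes L: "fully_invariant L" and t: "\<theta> \<in> End"
  obtains m where "m \<ge> 1" "\<And>x. x \<in> carrier M \<Longrightarrow> (\<theta> ^^ m) x \<ominus>\<^bsub>M\<^esub> (\<theta> ^^ (m + m)) x \<in> L"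
proof -
  note Ls = fully_invariantD(1)[OF L]
  have tc: "(\<theta> ^^ n) x \<in> carrier M" if "x \<in> carrier M" for n x
    using continuous_homD(1)[OF End_power[OF t]] that .
  obtain F where F: "finite F" "F \<subseteq> carrier M" "\<And>x. x \<in> carrier M \<Longrightarrow> \<exists>f\<in>F. x \<ominus>\<^bsub>M\<^esub> f \<in> L"
    using L unfolding fully_invariant_def by blast
  then obtain r where r: "\<And>x. x \<in> carrier M \<Longrightarrow> r x \<in> F" "\<And>x. x \<in> carrier M \<Longrightarrow> x \<ominus>\<^bsub>M\<^esub> r x \<in> L" by metis
  \<comment> \<open>\<open>g n\<close> records the map induced by the \<open>n\<close>-th power on
    the representatives, an element of a finite set.\<close>
  define g where "g n = (\<lambda>f\<in>F. r ((\<theta> ^^ n) f))" for n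
  have "g ` {1..} \<subseteq> F \<rightarrow>\<^sub>E F" using r(1) tc F(2) by (auto simp: g_def)
  moreover have "finite (F \<rightarrow>\<^sub>E F)" using F(1) by (simp add: finite_PiE)
  ultimately have "finite (g ` {1::nat..})" using finite_subset by blast
  then have "\<not> inj_on g {1::nat..}" using finite_imageD infinite_Ici by blast
  then obtain i' j' where "i' \<ge> 1" "j' \<ge> 1" "i' \<noteq> j'" "g i' = g j'" by (auto simp: inj_on_def)
  then obtain i j where ij: "1 \<le> i" "i < j" "g i = g j" by (metis linorder_neqE_nat)
  have 1: "(\<theta> ^^ i) x \<ominus>\<^bsub>M\<^esub> (\<theta> ^^ j) x \<in> L" if x: "x \<in> carrier M" for x
  proof -
    have f: "r x \<in> F" "r x \<in> carrier M" "x \<ominus>\<^bsub>M\<^esub> r x \<in> L" using r x F(2) by auto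
    have c: "(\<theta> ^^ n) x \<in> carrier M" "(\<theta> ^^ n) (r x) \<in> carrier M" "r ((\<theta> ^^ n) (r x)) \<in> carrier M" for n
      using tc x f r(1) F(2) by auto
    have 2: "(\<theta> ^^ n) x \<ominus>\<^bsub>M\<^esub> r ((\<theta> ^^ n) (r x)) \<in> L" for n
      using eqv_trans[OF Ls c(1,2,3) End_eqv[OF L End_power[OF t] x f(2,3)] r(2)[OF c(2)]] .
    have "r ((\<theta> ^^ i) (r x)) = r ((\<theta> ^^ j) (r x))"
      using fun_cong[OF ij(3), of "r x"] f(1) by (simp add: g_def)
    then have "(\<theta> ^^ j) x \<ominus>\<^bsub>M\<^esub> r ((\<theta> ^^ i) (r x)) \<in> L" using 2[of j] by simp
    then have "r ((\<theta> ^^ i) (r x)) \<ominus>\<^bsub>M\<^esub> (\<theta> ^^ j) x \<in> L" by (rule eqv_sym[OF Ls c(1,3)])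
    then show ?thesis by (rule eqv_trans[OF Ls c(1,3,1) 2])
  qed
  define d where "d = j - i"
  have 2: "(\<theta> ^^ a) x \<ominus>\<^bsub>M\<^esub> (\<theta> ^^ (a + n * d)) x \<in> L" if "i \<le> a" "x \<in> carrier M" for a n x
  proof (induction n)
    case 0
    show ?case using eqv_refl[OF Ls tc[OF that(2)]] by simp
  next
    case (Suc n)
    let ?y = "(\<theta> ^^ (a + n * d - i)) x"
    have p: "(\<theta> ^^ (p + q)) x = (\<theta> ^^ p) ((\<theta> ^^ q) x)" for p q by (simp add: funpow_add)
    have "i + (a + n * d - i) = a + n * d" "j + (a + n * d - i) = a + Suc n * d" using ij that(1) by (auto simp: d_def)
    then have "(\<theta> ^^ (a + n * d)) x \<ominus>\<^bsub>M\<^esub> (\<theta> ^^ (a + Suc n * d)) x \<in> L"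
      using 1[OF tc[OF that(2), of "a + n * d - i"]] p[of i "a + n * d - i"] p[of j "a + n * d - i"] by simp
    then show ?case by (rule eqv_trans[OF Ls tc[OF that(2)] tc[OF that(2)] tc[OF that(2)] Suc])
  qed
  have d: "d \<ge> 1" using ij by (simp add: d_def)
  \<comment> \<open>\<open>i * d\<close> is at least \<open>i\<close>, where periodicity starts, and
    is a multiple of the period \<open>d\<close>, so doubling it changes nothing modulo
    \<open>L\<close>.\<close>
  show thesis
  proof (rule that[of "i * d"])
    show "i * d \<ge> 1" using d ij by simp
    show "(\<theta> ^^ (i * d)) x \<ominus>\<^bsub>M\<^esub> (\<theta> ^^ (i * d + i * d)) x \<in> L" if "x \<in> carrier M" for x
      using 2[of "i * d" x i] that d by simp
  qed
qed

text \<open>An idempotent absorbs further factors of itself. This serves to compare the exponents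
  chosen for different \<open>L\<close> through a common multiple.\<close>

lemma idempotent_power_mult:
  assumes L: "fully_invariant L" and t: "\<theta> \<in> End"
    and m: "\<And>x. x \<in> carrier M \<Longrightarrow> (\<theta> ^^ m) x \<ominus>\<^bsub>M\<^esub> (\<theta> ^^ (m + m)) x \<in> L" and x: "x \<in> carrier M"
  shows "n \<ge> 1 \<Longrightarrow> (\<theta> ^^ m) x \<ominus>\<^bsub>M\<^esub> (\<theta> ^^ (n * m)) x \<in> L"
proof (induction n rule: nat_induct_at_least)
  note Ls = fully_invariantD(1)[OF L]
  have tc: "(\<theta> ^^ n) x \<in> carrier M" for n
    using continuous_homD(1)[OF End_power[OF t] x] .
  {
    case base
    show ?case using eqv_refl[OF Ls tc] by simp
  next
    case (Suc n)
    have "(\<theta> ^^ m) ((\<theta> ^^ m) x) \<ominus>\<^bsub>M\<^esub> (\<theta> ^^ m) ((\<theta> ^^ (n * m)) x) \<in> L"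
      by (rule End_eqv[OF L End_power[OF t] tc tc Suc(2)])
    then have "(\<theta> ^^ (m + m)) x \<ominus>\<^bsub>M\<^esub> (\<theta> ^^ (Suc n * m)) x \<in> L" by (simp add: funpow_add)
    then show ?case by (rule eqv_trans[OF Ls tc tc tc m[OF x]])
  }
qed

text \<open>Modulo a fully invariant open submodule \<open>L\<close> some power \<open>m L\<close> of \<open>\<theta>\<close> is idempotent, and this
  idempotent does not depend on the power; \<open>e\<close> is the limit over \<open>L\<close>.\<close>

lemma fitting_idempotent:
  assumes t: "\<theta> \<in> End"
  obtains e where "e \<in> End" "\<And>x. x \<in> carrier M \<Longrightarrow> e (e x) = e x"
    "\<And>L. fully_invariant L \<Longrightarrow> \<exists>m\<ge>1. \<forall>x\<in>carrier M. e x \<ominus>\<^bsub>M\<^esub> (\<theta> ^^ m) x \<in> L"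
proof -
  have tc: "(\<theta> ^^ n) x \<in> carrier M" if "x \<in> carrier M" for n x
    using continuous_homD(1)[OF End_power[OF t]] that .
  have "\<forall>L. \<exists>m. fully_invariant L \<longrightarrow> m \<ge> 1 \<and> (\<forall>x\<in>carrier M. (\<theta> ^^ m) x \<ominus>\<^bsub>M\<^esub> (\<theta> ^^ (m + m)) x \<in> L)"
    using idempotent_power[OF _ t] by metis
  then obtain m where m: "\<And>L. fully_invariant L \<Longrightarrow> m L \<ge> 1"
    "\<And>L x. fully_invariant L \<Longrightarrow> x \<in> carrier M \<Longrightarrow> (\<theta> ^^ m L) x \<ominus>\<^bsub>M\<^esub> (\<theta> ^^ (m L + m L)) x \<in> L" by metis
  \<comment> \<open>Modulo the larger submodule \<open>L\<close> both powers agree with the one of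
    exponent \<open>m L * m K\<close>, so the choices for different submodules are
    consistent.\<close>
  have coh: "(\<theta> ^^ m K) x \<ominus>\<^bsub>M\<^esub> (\<theta> ^^ m L) x \<in> L"
    if KL: "fully_invariant K" "fully_invariant L" "K \<subseteq> L" and x: "x \<in> carrier M" for K L x
  proof -
    note Ls = fully_invariantD(1)[OF KL(2)]
    have "(\<theta> ^^ m K) x \<ominus>\<^bsub>M\<^esub> (\<theta> ^^ (m L * m K)) x \<in> L"
      using idempotent_power_mult[OF KL(1) t m(2)[OF KL(1)] x m(1)[OF KL(2)]] KL(3) by blast
    moreover have "(\<theta> ^^ m L) x \<ominus>\<^bsub>M\<^esub> (\<theta> ^^ (m L * m K)) x \<in> L"
      using idempotent_power_mult[OF KL(2) t m(2)[OF KL(2)] x m(1)[OF KL(1)]] by (simp add: mult.commute)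
    then have "(\<theta> ^^ (m L * m K)) x \<ominus>\<^bsub>M\<^esub> (\<theta> ^^ m L) x \<in> L" by (rule eqv_sym[OF Ls tc[OF x] tc[OF x]])
    ultimately show ?thesis by (rule eqv_trans[OF Ls tc[OF x] tc[OF x] tc[OF x]])
  qed
  \<comment> \<open>The limit at \<open>x\<close> is a common point of the closed cosets
    \<open>(\<theta> ^^ m L) x + L\<close>. Finitely many of them meet, because a power taken for a
    submodule below all of theirs lies in each. The common point is unique by
    \<open>eq_if_eqv\<close>, which makes the limit additive and linear.\<close>
  have "\<exists>y\<in>carrier M. \<forall>L. fully_invariant L \<longrightarrow> y \<ominus>\<^bsub>M\<^esub> (\<theta> ^^ m L) x \<in> L" if x: "x \<in> carrier M" for x
  proof -
    have "\<exists>y\<in>topspace Mtop. \<forall>L\<in>Collect fully_invariant. y \<in> {y \<in> carrier M. y \<ominus>\<^bsub>M\<^esub> (\<theta> ^^ m L) x \<in> L}"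
    proof (rule compact_space_fip_family[OF compact_M])
      show "closedin Mtop {y \<in> carrier M. y \<ominus>\<^bsub>M\<^esub> (\<theta> ^^ m L) x \<in> L}" if "L \<in> Collect fully_invariant" for L
        by (rule closedin_translate[OF fully_invariantD(4) tc[OF x]]) (use that in auto)
      fix J assume J: "finite J" "J \<subseteq> Collect fully_invariant"
      then obtain K where K: "fully_invariant K" "\<And>L. L \<in> J \<Longrightarrow> K \<subseteq> L"
        using fully_invariant_finite_Int[of J] by blast
      show "\<exists>y\<in>topspace Mtop. \<forall>L\<in>J. y \<in> {y \<in> carrier M. y \<ominus>\<^bsub>M\<^esub> (\<theta> ^^ m L) x \<in> L}"
        by (rule bexI[of _ "(\<theta> ^^ m K) x"]) (use coh[OF K(1) _ K(2) x] J(2) tc[OF x] topspace_Mtop in auto)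
    qed
    then show ?thesis by (auto simp: topspace_Mtop)
  qed
  then obtain e where ec: "\<And>x. x \<in> carrier M \<Longrightarrow> e x \<in> carrier M"
    and e: "\<And>x L. x \<in> carrier M \<Longrightarrow> fully_invariant L \<Longrightarrow> e x \<ominus>\<^bsub>M\<^esub> (\<theta> ^^ m L) x \<in> L" by metis
  have add: "e (x \<oplus>\<^bsub>M\<^esub> y) = e x \<oplus>\<^bsub>M\<^esub> e y" if xy: "x \<in> carrier M" "y \<in> carrier M" for x y
  proof (rule eq_if_eqv)
    fix L assume L: "fully_invariant L"
    note Ls = fully_invariantD(1)[OF L]
    have 1: "(e x \<oplus>\<^bsub>M\<^esub> e y) \<ominus>\<^bsub>M\<^esub> ((\<theta> ^^ m L) x \<oplus>\<^bsub>M\<^esub> (\<theta> ^^ m L) y) \<in> L"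
      using submodule_facts(3)[OF Ls e[OF xy(1) L] e[OF xy(2) L]] M.M.add_diff_add[OF ec[OF xy(1)] ec[OF xy(2)] tc[OF xy(1)] tc[OF xy(2)]]
      by simp
    have 2: "e (x \<oplus>\<^bsub>M\<^esub> y) \<ominus>\<^bsub>M\<^esub> ((\<theta> ^^ m L) x \<oplus>\<^bsub>M\<^esub> (\<theta> ^^ m L) y) \<in> L"
      using e[of "x \<oplus>\<^bsub>M\<^esub> y" L] L xy continuous_homD(2)[OF End_power[OF t]] by simp
    show "e (x \<oplus>\<^bsub>M\<^esub> y) \<ominus>\<^bsub>M\<^esub> (e x \<oplus>\<^bsub>M\<^esub> e y) \<in> L"
      by (rule eqv_trans[OF Ls _ _ _ 2 eqv_sym[OF Ls _ _ 1]]) (use ec tc xy in auto)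
  qed (use ec that in auto)
  have sm: "e (r \<odot>\<^bsub>M\<^esub> x) = r \<odot>\<^bsub>M\<^esub> e x" if r: "r \<in> carrier KG" and x: "x \<in> carrier M" for r x
  proof (rule eq_if_eqv)
    fix L assume L: "fully_invariant L"
    note Ls = fully_invariantD(1)[OF L]
    have 1: "r \<odot>\<^bsub>M\<^esub> e x \<ominus>\<^bsub>M\<^esub> r \<odot>\<^bsub>M\<^esub> (\<theta> ^^ m L) x \<in> L"
      using submodule_facts(5)[OF Ls r e[OF x L]] smult_diff[OF r ec[OF x] tc[OF x]] by simp
    have 2: "e (r \<odot>\<^bsub>M\<^esub> x) \<ominus>\<^bsub>M\<^esub> r \<odot>\<^bsub>M\<^esub> (\<theta> ^^ m L) x \<in> L"
      using e[of "r \<odot>\<^bsub>M\<^esub> x" L] L r x continuous_homD(3)[OF End_power[OF t]] by simp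
    show "e (r \<odot>\<^bsub>M\<^esub> x) \<ominus>\<^bsub>M\<^esub> (r \<odot>\<^bsub>M\<^esub> e x) \<in> L"
      by (rule eqv_trans[OF Ls _ _ _ 2 eqv_sym[OF Ls _ _ 1]]) (use ec tc r x in auto)
  qed (use ec that in auto)
  \<comment> \<open>\<open>e\<close> agrees modulo \<open>L\<close> with a power of
    \<open>\<theta>\<close>, which preserves \<open>L\<close>; this gives continuity at
    zero.\<close>
  have pres: "e x \<in> L" if "fully_invariant L" "x \<in> L" for L x
  proof -
    note Ls = submodule_facts[OF fully_invariantD(1)[OF that(1)]]
    have x: "x \<in> carrier M" using Ls(1) that(2) by blast
    have "(e x \<ominus>\<^bsub>M\<^esub> (\<theta> ^^ m L) x) \<oplus>\<^bsub>M\<^esub> (\<theta> ^^ m L) x \<in> L"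
      using Ls(3)[OF e[OF x that(1)] fully_invariantD(3)[OF that(1) End_power[OF t] that(2)]] .
    then show ?thesis using M.M.diff_diff_cancel(4)[OF ec[OF x] tc[OF x] x] by simp
  qed
  have cont: "continuous_map Mtop Mtop e"
  proof (rule continuous_additive[OF cga_module_axioms])
    show "e \<in> carrier M \<rightarrow> carrier M" using ec by blast
    show "\<exists>L. openin Mtop L \<and> \<zero>\<^bsub>M\<^esub> \<in> L \<and> (\<forall>x\<in>L. e x \<in> W)"
      if W: "submodule W KG M" "openin Mtop W" for W
    proof -
      obtain L where L: "fully_invariant L" "L \<subseteq> W"
        using fully_invariant_inside[OF W(2) submodule_facts(2)[OF W(1)]] by blast
      show ?thesis
        using fully_invariantD(2)[OF L(1)] submodule_facts(2)[OF fully_invariantD(1)[OF L(1)]] pres[OF L(1)] L(2)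
        by (intro exI[of _ L]) blast
    qed
  qed (rule add)
  have E: "e \<in> End" by (rule EndI[OF ec add sm cont])
  \<comment> \<open>Checked modulo each \<open>L\<close>: \<open>e (e x)\<close>, the square of the
    power at \<open>x\<close>, the power at \<open>x\<close>, and \<open>e x\<close> are congruent
    in turn.\<close>
  have "e (e x) = e x" if x: "x \<in> carrier M" for x
  proof (rule eq_if_eqv)
    fix L assume L: "fully_invariant L"
    note Ls = fully_invariantD(1)[OF L]
    have "e (e x) \<ominus>\<^bsub>M\<^esub> (\<theta> ^^ m L) (e x) \<in> L" using e[OF ec[OF x] L] .
    moreover have "(\<theta> ^^ m L) (e x) \<ominus>\<^bsub>M\<^esub> (\<theta> ^^ m L) ((\<theta> ^^ m L) x) \<in> L"
      by (rule End_eqv[OF L End_power[OF t] ec[OF x] tc[OF x] e[OF x L]])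
    ultimately have 1: "e (e x) \<ominus>\<^bsub>M\<^esub> (\<theta> ^^ (m L + m L)) x \<in> L"
      using eqv_trans[OF Ls ec[OF ec[OF x]] tc[OF ec[OF x]] tc[OF tc[OF x]]] by (simp add: funpow_add)
    have 2: "(\<theta> ^^ (m L + m L)) x \<ominus>\<^bsub>M\<^esub> (\<theta> ^^ m L) x \<in> L"
      by (rule eqv_sym[OF Ls tc[OF x] tc[OF x] m(2)[OF L x]])
    have 3: "(\<theta> ^^ m L) x \<ominus>\<^bsub>M\<^esub> e x \<in> L" by (rule eqv_sym[OF Ls ec[OF x] tc[OF x] e[OF x L]])
    show "e (e x) \<ominus>\<^bsub>M\<^esub> e x \<in> L"
      using eqv_trans[OF Ls ec[OF ec[OF x]] tc[OF x] ec[OF x] eqv_trans[OF Ls ec[OF ec[OF x]] tc[OF x] tc[OF x] 1 2] 3] .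
  qed (use ec that in auto)
  then show thesis using that[OF E] e m(1) by blast
qed

text \<open>The image is compact, hence closed, so around a missed point some translate of a fully
  invariant submodule would avoid the image.\<close>

lemma End_surj_if_dense:
  assumes t: "\<theta> \<in> End" and d: "\<And>L x. fully_invariant L \<Longrightarrow> x \<in> carrier M \<Longrightarrow> \<exists>y\<in>carrier M. x \<ominus>\<^bsub>M\<^esub> \<theta> y \<in> L"
  shows "\<theta> ` carrier M = carrier M"
proof (rule ccontr)
  note tD = continuous_homD[OF t]
  assume "\<theta> ` carrier M \<noteq> carrier M"
  then obtain x where x: "x \<in> carrier M" "x \<notin> \<theta> ` carrier M" using tD(1) by blast
  have "compactin Mtop (\<theta> ` carrier M)"
    using image_compactin[OF _ tD(4)] compact_M topspace_Mtop by (metis compact_space_def)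
  then have cl: "closedin Mtop (\<theta> ` carrier M)" by (rule compactin_imp_closedin[OF Hausdorff_M])
  have "continuous_map Mtop Mtop (\<lambda>v. x \<ominus>\<^bsub>M\<^esub> v)"
    by (rule continuous_diff_maps) (use x topspace_Mtop in auto)
  then have "openin Mtop {v \<in> topspace Mtop. x \<ominus>\<^bsub>M\<^esub> v \<in> topspace Mtop - \<theta> ` carrier M}"
    by (rule openin_continuous_map_preimage) (use cl in blast)
  moreover have "\<zero>\<^bsub>M\<^esub> \<in> {v \<in> topspace Mtop. x \<ominus>\<^bsub>M\<^esub> v \<in> topspace Mtop - \<theta> ` carrier M}"
    using x M.M.diff_diff_cancel(4)[of x "\<zero>\<^bsub>M\<^esub>" x] by (simp add: topspace_Mtop)
  ultimately obtain L where L: "fully_invariant L" "L \<subseteq> {v \<in> topspace Mtop. x \<ominus>\<^bsub>M\<^esub> v \<in> topspace Mtop - \<theta> ` carrier M}"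
    by (rule fully_invariant_inside)
  obtain y where y: "y \<in> carrier M" "x \<ominus>\<^bsub>M\<^esub> \<theta> y \<in> L" using d[OF L(1) x(1)] by blast
  then have "x \<ominus>\<^bsub>M\<^esub> (x \<ominus>\<^bsub>M\<^esub> \<theta> y) \<notin> \<theta> ` carrier M" using L(2) by blast
  then show False using M.M.diff_diff_cancel(5)[OF x(1) tD(1)[OF y(1)] x(1)] y(1) by simp
qed

lemma End_inj_iff:
  assumes t: "\<theta> \<in> End" and z: "\<And>x. x \<in> carrier M \<Longrightarrow> \<theta> x = \<zero>\<^bsub>M\<^esub> \<Longrightarrow> x = \<zero>\<^bsub>M\<^esub>"
  shows "inj_on \<theta> (carrier M)"
proof (rule inj_onI)
  fix x y assume xy: "x \<in> carrier M" "y \<in> carrier M" "\<theta> x = \<theta> y"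
  have "\<theta> (x \<ominus>\<^bsub>M\<^esub> y) = \<zero>\<^bsub>M\<^esub>"
    using End_diff[OF t xy(1,2)] xy M.M.diff_eq_zero_iff continuous_homD(1)[OF t] by simp
  then show "x = y" using z[of "x \<ominus>\<^bsub>M\<^esub> y"] xy M.M.diff_eq_zero_iff by simp
qed

text \<open>The fixed points and the kernel of \<open>e\<close> are closed, hence compact, and a
  continuous bijection from a compact space to a Hausdorff space is a homeomorphism; the algebraic
  splitting is therefore a topological one.\<close>

lemma idempotent_decomposition:
  assumes E: "e \<in> End" and idem: "\<And>x. x \<in> carrier M \<Longrightarrow> e (e x) = e x"
  shows "direct_sum_decomposition KG M {x \<in> carrier M. e x = x} {x \<in> carrier M. e x = \<zero>\<^bsub>M\<^esub>}"
proof -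
  note eD = continuous_homD[OF E]
  let ?A = "{x \<in> carrier M. e x = x}" and ?B = "{x \<in> carrier M. e x = \<zero>\<^bsub>M\<^esub>}"
  have A: "submodule ?A KG M"
    by (rule M.left_submoduleI) (use eD End_zero[OF E] in auto)
  have B: "submodule ?B KG M"
    by (rule M.left_submoduleI) (use eD End_zero[OF E] smult_zero in auto)
  have "closedin Mtop {x \<in> topspace Mtop. e x = x}"
    by (rule closedin_continuous_maps_eq[OF Hausdorff_M eD(4)]) (use continuous_map_id[of Mtop] in \<open>simp add: id_def\<close>)
  then have Ac: "compactin Mtop ?A" using closedin_compact_space[OF compact_M] by (simp add: topspace_Mtop)
  have "closedin Mtop {x \<in> topspace Mtop. e x = \<zero>\<^bsub>M\<^esub>}"
    by (rule closedin_continuous_maps_eq[OF Hausdorff_M eD(4)]) (use topspace_Mtop in simp)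
  then have Bc: "compactin Mtop ?B" using closedin_compact_space[OF compact_M] by (simp add: topspace_Mtop)
  let ?P = "prod_topology (subtopology Mtop ?A) (subtopology Mtop ?B)"
  have tP: "topspace ?P = ?A \<times> ?B" by (auto simp: topspace_Mtop)
  have "homeomorphic_map ?P Mtop (\<lambda>(x, y). x \<oplus>\<^bsub>M\<^esub> y)"
  proof (rule continuous_imp_homeomorphic_map)
    show "compact_space ?P" using Ac Bc by (simp add: compact_space_prod_topology compact_space_subtopology)
    show "Hausdorff_space Mtop" by (rule Hausdorff_M)
    show "continuous_map ?P Mtop (\<lambda>(x, y). x \<oplus>\<^bsub>M\<^esub> y)"
      unfolding case_prod_beta
      by (intro continuous_add_maps continuous_map_into_fulltopology[OF continuous_map_fst]
        continuous_map_into_fulltopology[OF continuous_map_snd])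
    show "(\<lambda>(x, y). x \<oplus>\<^bsub>M\<^esub> y) ` topspace ?P = topspace Mtop"
      unfolding tP topspace_Mtop
    proof (intro equalityI subsetI)
      fix x assume x: "x \<in> carrier M"
      have "e x \<in> ?A" using idem eD(1) x by simp
      moreover have "x \<ominus>\<^bsub>M\<^esub> e x \<in> ?B"
        using End_diff[OF E x eD(1)[OF x]] idem[OF x] eD(1) x M.M.diff_eq_zero_iff by simp
      moreover have "x = e x \<oplus>\<^bsub>M\<^esub> (x \<ominus>\<^bsub>M\<^esub> e x)" using M.M.diff_diff_cancel(3)[OF x eD(1)[OF x] x] by simp
      ultimately show "x \<in> (\<lambda>(x, y). x \<oplus>\<^bsub>M\<^esub> y) ` (?A \<times> ?B)"
        by (intro image_eqI[of _ _ "(e x, x \<ominus>\<^bsub>M\<^esub> e x)"]) simp_all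
    qed auto
    show "inj_on (\<lambda>(x, y). x \<oplus>\<^bsub>M\<^esub> y) (topspace ?P)"
      unfolding tP
    proof (rule inj_onI, clarify)
      fix a b c d assume h: "a \<in> carrier M" "e a = a" "c \<in> carrier M" "e c = c" "b \<in> carrier M" "e b = \<zero>\<^bsub>M\<^esub>"
        "d \<in> carrier M" "e d = \<zero>\<^bsub>M\<^esub>" "a \<oplus>\<^bsub>M\<^esub> b = c \<oplus>\<^bsub>M\<^esub> d"
      have "a = e (a \<oplus>\<^bsub>M\<^esub> b)" using eD(2)[OF h(1,5)] h(1,2,6) by simp
      also have "\<dots> = e (c \<oplus>\<^bsub>M\<^esub> d)" by (simp only: h(9))
      also have "\<dots> = c" using eD(2)[OF h(3,7)] h(3,4,8) by simp
      finally have "a = c" .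
      then show "a = c \<and> b = d" using h by simp
    qed
  qed
  then show ?thesis using A B by (simp add: direct_sum_decomposition_def)
qed

text \<open>The inverse is continuous because \<open>M\<close> is compact and Hausdorff; its
  linearity is read off after applying the injective \<open>\<theta>\<close>.\<close>

lemma End_inverse:
  assumes t: "\<theta> \<in> End" and bij: "bij_betw \<theta> (carrier M) (carrier M)"
  obtains \<eta> where "\<eta> \<in> End" "\<And>x. x \<in> carrier M \<Longrightarrow> \<eta> (\<theta> x) = x" "\<And>x. x \<in> carrier M \<Longrightarrow> \<theta> (\<eta> x) = x"
proof -
  note tD = continuous_homD[OF t]
  have "homeomorphic_map Mtop Mtop \<theta>"
    by (rule continuous_imp_homeomorphic_map[OF tD(4) compact_M Hausdorff_M])
      (use bij in \<open>auto simp: topspace_Mtop bij_betw_def\<close>)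
  then obtain \<eta> where "homeomorphic_maps Mtop Mtop \<theta> \<eta>" using homeomorphic_map_maps by blast
  then have \<eta>: "continuous_map Mtop Mtop \<eta>" "\<And>x. x \<in> carrier M \<Longrightarrow> \<eta> (\<theta> x) = x" "\<And>x. x \<in> carrier M \<Longrightarrow> \<theta> (\<eta> x) = x"
    by (auto simp: homeomorphic_maps_def topspace_Mtop)
  have c: "\<eta> x \<in> carrier M" if "x \<in> carrier M" for x
    using \<eta>(1) that by (auto simp: continuous_map_def topspace_Mtop)
  have inj: "x = y" if "x \<in> carrier M" "y \<in> carrier M" "\<theta> x = \<theta> y" for x y
    using that \<eta>(2) by metis
  have "\<eta> \<in> End"
  proof (rule EndI[OF c _ _ \<eta>(1)])
    show "\<eta> (x \<oplus>\<^bsub>M\<^esub> y) = \<eta> x \<oplus>\<^bsub>M\<^esub> \<eta> y" if "x \<in> carrier M" "y \<in> carrier M" for x y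
      by (rule inj) (use that c tD(2) \<eta>(3) in auto)
    show "\<eta> (r \<odot>\<^bsub>M\<^esub> x) = r \<odot>\<^bsub>M\<^esub> \<eta> x" if "r \<in> carrier KG" "x \<in> carrier M" for r x
      by (rule inj) (use that c tD(3) \<eta>(3) in auto)
  qed
  then show thesis using that \<eta> by blast
qed

end

section \<open>Locality of the endomorphism ring\<close>

locale cga_indecomposable = cga_fg k G M
  for k :: "('k, 'a) ring_scheme" and G :: "('g, 'b) top_group_scheme"
    and M :: "(('g, 'k) cga, 'm) top_module" +
  assumes indecomposable: "indecomposable_module (completed_group_algebra k G) M"
begin

text \<open>Indecomposability forces the Fitting idempotent \<open>e\<close> to be zero or the
  identity. If \<open>e\<close> is zero, powers of \<open>\<theta>\<close> become arbitrarily small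
  and \<open>1 - \<theta>\<close> is inverted by the geometric series; if \<open>e\<close> is the
  identity, \<open>\<theta>\<close> is invertible modulo every \<open>L\<close>, since some positive
  power of it is the identity there.\<close>

lemma End_local:
  assumes t: "\<theta> \<in> End"
  shows "bij_betw \<theta> (carrier M) (carrier M) \<or> bij_betw (\<lambda>x. x \<ominus>\<^bsub>M\<^esub> \<theta> x) (carrier M) (carrier M)"
proof -
  note tD = continuous_homD[OF t]
  have tc: "(\<theta> ^^ n) x \<in> carrier M" if "x \<in> carrier M" for n x
    using continuous_homD(1)[OF End_power[OF t]] that .
  obtain e where e: "e \<in> End" "\<And>x. x \<in> carrier M \<Longrightarrow> e (e x) = e x"
    "\<And>L. fully_invariant L \<Longrightarrow> \<exists>m\<ge>1. \<forall>x\<in>carrier M. e x \<ominus>\<^bsub>M\<^esub> (\<theta> ^^ m) x \<in> L"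
    using fitting_idempotent[OF t] by blast
  note eD = continuous_homD[OF e(1)]
  have "{x \<in> carrier M. e x = x} = {\<zero>\<^bsub>M\<^esub>} \<or> {x \<in> carrier M. e x = \<zero>\<^bsub>M\<^esub>} = {\<zero>\<^bsub>M\<^esub>}"
    using indecomposable idempotent_decomposition[OF e(1,2)] unfolding indecomposable_module_def by blast
  then show ?thesis
  proof
    assume z: "{x \<in> carrier M. e x = x} = {\<zero>\<^bsub>M\<^esub>}"
    have e0: "e x = \<zero>\<^bsub>M\<^esub>" if "x \<in> carrier M" for x
    proof -
      have "e x \<in> {x \<in> carrier M. e x = x}" using e(2) eD(1) that by simp
      then show ?thesis using z by simp
    qed
    have nil: "\<exists>m\<ge>1. \<forall>x\<in>carrier M. (\<theta> ^^ m) x \<in> L" if L: "fully_invariant L" for L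
    proof -
      note Ls = fully_invariantD(1)[OF L]
      obtain m where m: "m \<ge> 1" "\<And>x. x \<in> carrier M \<Longrightarrow> e x \<ominus>\<^bsub>M\<^esub> (\<theta> ^^ m) x \<in> L" using e(3)[OF L] by blast
      have "(\<theta> ^^ m) x \<in> L" if x: "x \<in> carrier M" for x
        using eqv_sym[OF Ls eD(1)[OF x] tc[OF x] m(2)[OF x]] e0[OF x] eqv_zero[OF Ls tc[OF x]] by simp
      with m(1) show ?thesis by blast
    qed
    let ?h = "\<lambda>x. x \<ominus>\<^bsub>M\<^esub> \<theta> x"
    have h: "?h \<in> End" by (rule End_one_diff[OF t])
    have "inj_on ?h (carrier M)"
    proof (rule End_inj_iff[OF h])
      fix x assume x: "x \<in> carrier M" "?h x = \<zero>\<^bsub>M\<^esub>"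
      then have fx: "\<theta> x = x" using M.M.diff_eq_zero_iff[OF x(1) tD(1)[OF x(1)]] by simp
      have "(\<theta> ^^ n) x = x" for n by (induction n) (simp_all add: fx)
      then show "x = \<zero>\<^bsub>M\<^esub>" using nil x(1) by (intro zero_if_in_all) metis+
    qed
    moreover have "?h ` carrier M = carrier M"
    proof (rule End_surj_if_dense[OF h])
      fix L x assume L: "fully_invariant L" and x: "x \<in> carrier M"
      obtain m where m: "\<And>x. x \<in> carrier M \<Longrightarrow> (\<theta> ^^ m) x \<in> L" using nil[OF L] by blast
      \<comment> \<open>Telescoping: subtracting from \<open>x\<close> the image under
        \<open>?h\<close> of the \<open>n\<close>-th partial sum of the geometric series leaves
        \<open>(\<theta> ^^ n) x\<close>.\<close>
      have "\<exists>y\<in>carrier M. x \<ominus>\<^bsub>M\<^esub> ?h y = (\<theta> ^^ n) x" for n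
      proof (induction n)
        case 0
        have "?h \<zero>\<^bsub>M\<^esub> = \<zero>\<^bsub>M\<^esub>" by (rule End_zero[OF h])
        then show ?case using x M.M.diff_diff_cancel(4)[of x "\<zero>\<^bsub>M\<^esub>" x] by (intro bexI[of _ "\<zero>\<^bsub>M\<^esub>"]) auto
      next
        case (Suc n)
        then obtain y where y: "y \<in> carrier M" "x \<ominus>\<^bsub>M\<^esub> ?h y = (\<theta> ^^ n) x" by blast
        let ?z = "(\<theta> ^^ n) x"
        have zc: "?z \<in> carrier M" "?h ?z \<in> carrier M" "?h y \<in> carrier M"
          using tc[OF x] continuous_homD(1)[OF h] y(1) by blast+
        have "x \<ominus>\<^bsub>M\<^esub> ?h (y \<oplus>\<^bsub>M\<^esub> ?z) = x \<ominus>\<^bsub>M\<^esub> (?h y \<oplus>\<^bsub>M\<^esub> ?h ?z)"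
          using continuous_homD(2)[OF h y(1) zc(1)] by simp
        also have "\<dots> = (x \<ominus>\<^bsub>M\<^esub> ?h y) \<ominus>\<^bsub>M\<^esub> ?h ?z"
        proof -
          have "x \<ominus>\<^bsub>M\<^esub> (p \<oplus>\<^bsub>M\<^esub> q) = (x \<ominus>\<^bsub>M\<^esub> p) \<ominus>\<^bsub>M\<^esub> q" if "p \<in> carrier M" "q \<in> carrier M" for p q
            unfolding M.M.minus_eq using x that by (simp add: M.M.minus_add M.M.a_assoc)
          then show ?thesis using zc by blast
        qed
        also have "\<dots> = ?z \<ominus>\<^bsub>M\<^esub> ?h ?z" using y(2) by simp
        also have "\<dots> = \<theta> ?z" by (rule M.M.diff_diff_cancel(5)[OF zc(1) tD(1)[OF zc(1)] x])
        finally show ?case using y zc by (intro bexI[of _ "y \<oplus>\<^bsub>M\<^esub> ?z"]) auto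
      qed
      then show "\<exists>y\<in>carrier M. x \<ominus>\<^bsub>M\<^esub> ?h y \<in> L" using m[OF x] by metis
    qed
    ultimately show ?thesis by (simp add: bij_betw_def)
  next
    assume z: "{x \<in> carrier M. e x = \<zero>\<^bsub>M\<^esub>} = {\<zero>\<^bsub>M\<^esub>}"
    have e1: "e x = x" if x: "x \<in> carrier M" for x
    proof -
      have "x \<ominus>\<^bsub>M\<^esub> e x \<in> {x \<in> carrier M. e x = \<zero>\<^bsub>M\<^esub>}"
        using End_diff[OF e(1) x eD(1)[OF x]] e(2)[OF x] eD(1) x M.M.diff_eq_zero_iff by simp
      then show ?thesis using z M.M.diff_eq_zero_iff[OF x eD(1)[OF x]] by simp
    qed
    have "inj_on \<theta> (carrier M)"
    proof (rule End_inj_iff[OF t])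
      fix x assume x: "x \<in> carrier M" "\<theta> x = \<zero>\<^bsub>M\<^esub>"
      show "x = \<zero>\<^bsub>M\<^esub>"
      proof (rule zero_if_in_all[OF x(1)])
        fix L assume L: "fully_invariant L"
        obtain m where m: "m \<ge> 1" "\<And>x. x \<in> carrier M \<Longrightarrow> e x \<ominus>\<^bsub>M\<^esub> (\<theta> ^^ m) x \<in> L" using e(3)[OF L] by blast
        \<comment> \<open>An exponent of at least one lets a factor \<open>\<theta>\<close> be split
          off; with exponent zero the congruence would say nothing about
          \<open>\<theta>\<close>.\<close>
        obtain n where "m = Suc n" using m(1) by (cases m) auto
        then have "(\<theta> ^^ m) x = (\<theta> ^^ n) (\<theta> x)" by (simp add: funpow_swap1)
        then have "(\<theta> ^^ m) x = \<zero>\<^bsub>M\<^esub>" using x(2) End_zero[OF End_power[OF t]] by simp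
        then show "x \<in> L" using m(2)[OF x(1)] e1[OF x(1)] eqv_zero[OF fully_invariantD(1)[OF L] x(1)] by simp
      qed
    qed
    moreover have "\<theta> ` carrier M = carrier M"
    proof (rule End_surj_if_dense[OF t])
      fix L x assume L: "fully_invariant L" and x: "x \<in> carrier M"
      obtain m where m: "m \<ge> 1" "\<And>x. x \<in> carrier M \<Longrightarrow> e x \<ominus>\<^bsub>M\<^esub> (\<theta> ^^ m) x \<in> L" using e(3)[OF L] by blast
      obtain n where "m = Suc n" using m(1) by (cases m) auto
      then show "\<exists>y\<in>carrier M. x \<ominus>\<^bsub>M\<^esub> \<theta> y \<in> L"
        using m(2)[OF x] e1[OF x] tc[OF x] by (intro bexI[of _ "(\<theta> ^^ n) x"]) auto
    qed
    ultimately show ?thesis by (simp add: bij_betw_def)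
  qed
qed

text \<open>With \<open>v\<close> the inverse of the sum, \<open>v \<theta>\<close> and
  \<open>v \<eta>\<close> add up to the identity, so one of them is bijective by
  \<open>End_local\<close>; composing with the sum gives back \<open>\<theta>\<close> or
  \<open>\<eta>\<close>.\<close>

lemma End_local_add:
  assumes t: "\<theta> \<in> End" and h: "\<eta> \<in> End" and bij: "bij_betw (\<lambda>x. \<theta> x \<oplus>\<^bsub>M\<^esub> \<eta> x) (carrier M) (carrier M)"
  shows "bij_betw \<theta> (carrier M) (carrier M) \<or> bij_betw \<eta> (carrier M) (carrier M)"
proof -
  let ?u = "\<lambda>x. \<theta> x \<oplus>\<^bsub>M\<^esub> \<eta> x"
  note tD = continuous_homD[OF t] and hD = continuous_homD[OF h]
  have u: "?u \<in> End" by (rule End_add[OF t h])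
  obtain v where v: "v \<in> End" "\<And>x. x \<in> carrier M \<Longrightarrow> v (?u x) = x" "\<And>x. x \<in> carrier M \<Longrightarrow> ?u (v x) = x"
    using End_inverse[OF u bij] by metis
  note vD = continuous_homD[OF v(1)]
  have "(\<lambda>x. v (\<theta> x)) \<in> End" by (rule End_comp[OF v(1) t])
  from End_local[OF this] show ?thesis
  proof
    assume b: "bij_betw (\<lambda>x. v (\<theta> x)) (carrier M) (carrier M)"
    have "bij_betw (?u \<circ> (\<lambda>x. v (\<theta> x))) (carrier M) (carrier M)" by (rule bij_betw_trans[OF b bij])
    moreover have "(?u \<circ> (\<lambda>x. v (\<theta> x))) x = \<theta> x" if "x \<in> carrier M" for x using v(3) tD(1) that by simp
    ultimately show ?thesis using bij_betw_cong[of "carrier M" "?u \<circ> (\<lambda>x. v (\<theta> x))" \<theta>] by blast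
  next
    assume b: "bij_betw (\<lambda>x. x \<ominus>\<^bsub>M\<^esub> v (\<theta> x)) (carrier M) (carrier M)"
    have "bij_betw (?u \<circ> (\<lambda>x. x \<ominus>\<^bsub>M\<^esub> v (\<theta> x))) (carrier M) (carrier M)" by (rule bij_betw_trans[OF b bij])
    moreover have "(?u \<circ> (\<lambda>x. x \<ominus>\<^bsub>M\<^esub> v (\<theta> x))) x = \<eta> x" if x: "x \<in> carrier M" for x
    proof -
      have "?u (x \<ominus>\<^bsub>M\<^esub> v (\<theta> x)) = ?u x \<ominus>\<^bsub>M\<^esub> ?u (v (\<theta> x))"
        by (rule End_diff[OF u x vD(1)[OF tD(1)[OF x]]])
      also have "\<dots> = ?u x \<ominus>\<^bsub>M\<^esub> \<theta> x" using v(3)[OF tD(1)[OF x]] by simp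
      also have "\<dots> = \<eta> x" using M.M.add_diff_cancel_left(1)[OF tD(1)[OF x] hD(1)[OF x]] .
      finally show ?thesis by simp
    qed
    ultimately show ?thesis using bij_betw_cong[of "carrier M" "?u \<circ> (\<lambda>x. x \<ominus>\<^bsub>M\<^esub> v (\<theta> x))" \<eta>] by blast
  qed
qed

lemma End_local_finsum:
  assumes "finite I" "\<And>i. i \<in> I \<Longrightarrow> \<theta> i \<in> End"
    "bij_betw (\<lambda>x. \<Oplus>\<^bsub>M\<^esub>i\<in>I. \<theta> i x) (carrier M) (carrier M)"
  shows "\<exists>i\<in>I. bij_betw (\<theta> i) (carrier M) (carrier M)"
  using assms
proof (induction I)
  case empty
  \<comment> \<open>An empty sum is the zero map, which is bijective only on the zero module, and an
    indecomposable module is nonzero.\<close>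
  then have "bij_betw (\<lambda>x. \<zero>\<^bsub>M\<^esub>) (carrier M) (carrier M)" by simp
  then have "carrier M = {\<zero>\<^bsub>M\<^esub>}" by (auto simp: bij_betw_def)
  then show ?case using indecomposable by (simp add: indecomposable_module_def)
next
  case (insert j I)
  have cl: "\<theta> i x \<in> carrier M" if "i \<in> insert j I" "x \<in> carrier M" for i x
    using continuous_homD(1)[OF insert.prems(1)[OF that(1)] that(2)] .
  have eq: "(\<Oplus>\<^bsub>M\<^esub>i\<in>insert j I. \<theta> i x) = \<theta> j x \<oplus>\<^bsub>M\<^esub> (\<Oplus>\<^bsub>M\<^esub>i\<in>I. \<theta> i x)" if "x \<in> carrier M" for x
    by (rule M.M.finsum_insert[OF insert.hyps]) (use cl that in auto)
  have "bij_betw (\<lambda>x. \<theta> j x \<oplus>\<^bsub>M\<^esub> (\<Oplus>\<^bsub>M\<^esub>i\<in>I. \<theta> i x)) (carrier M) (carrier M)"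
    by (rule iffD1[OF bij_betw_cong[OF eq] insert.prems(2)])
  then have "bij_betw (\<theta> j) (carrier M) (carrier M) \<or> bij_betw (\<lambda>x. \<Oplus>\<^bsub>M\<^esub>i\<in>I. \<theta> i x) (carrier M) (carrier M)"
    by (intro End_local_add End_finsum) (use insert in auto)
  then show ?case using insert.IH insert.prems(1) by blast
qed

end

section \<open>Induced modules and relative traces\<close>

locale finite_gset = group G for G (structure) +
  fixes Om :: "'w set" and star :: "'a \<Rightarrow> 'w \<Rightarrow> 'w"
  assumes finite_Om: "finite Om"
    and star_closed: "g \<in> carrier G \<Longrightarrow> w \<in> Om \<Longrightarrow> star g w \<in> Om"
    and star_one: "w \<in> Om \<Longrightarrow> star \<one> w = w"
    and star_mult: "g \<in> carrier G \<Longrightarrow> h \<in> carrier G \<Longrightarrow> w \<in> Om \<Longrightarrow> star g (star h w) = star (g \<otimes> h) w"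
begin

lemma star_inv:
  assumes "g \<in> carrier G" "w \<in> Om"
  shows "star g (star (inv g) w) = w" "star (inv g) (star g w) = w"
  using assms by (simp_all add: star_mult star_one)

lemma star_eq_iff:
  assumes "g \<in> carrier G" "x \<in> Om" "y \<in> Om"
  shows "star g y = x \<longleftrightarrow> y = star (inv g) x"
  using assms star_inv by auto

lemma star_bij:
  assumes "g \<in> carrier G"
  shows "inj_on (star g) Om" "star g ` Om = Om"
proof -
  show "inj_on (star g) Om" by (rule inj_on_inverseI[of _ "star (inv g)"]) (use assms star_inv in auto)
  show "star g ` Om = Om"
  proof (intro equalityI subsetI)
    fix w assume w: "w \<in> Om"
    show "w \<in> star g ` Om"
      by (rule image_eqI[of _ _ "star (inv g) w"]) (use w assms star_inv star_closed in auto)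
  qed (use assms star_closed in auto)
qed

end

text \<open>For \<open>Om = G/H\<close> a family is determined by its member at the base point, an \<open>H\<close>-endomorphism
  whose relative trace from \<open>H\<close> to \<open>G\<close> is the identity, as in Higman's criterion.\<close>

definition gfamily :: "('k, 'a) ring_scheme \<Rightarrow> ('g, 'b) top_group_scheme \<Rightarrow>
    (('g, 'k) cga, 'm) top_module \<Rightarrow> 'w set \<Rightarrow> ('g \<Rightarrow> 'w \<Rightarrow> 'w) \<Rightarrow> ('w \<Rightarrow> 'm \<Rightarrow> 'm) \<Rightarrow> bool" where
  "gfamily k G M Om star \<alpha> \<longleftrightarrow> (\<forall>w\<in>Om. \<alpha> w \<in> klin k G M M) \<and>
    (\<forall>g\<in>carrier G. \<forall>w\<in>Om. \<forall>u\<in>carrier M. \<alpha> (star g w) (gact k G M g u) = gact k G M g (\<alpha> w u)) \<and>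
    (\<forall>u\<in>carrier M. (\<Oplus>\<^bsub>M\<^esub>w\<in>Om. \<alpha> w u) = u)"

section \<open>The permutation module on \<open>Om\<close> tensored with \<open>M\<close>\<close>

locale cga_induced = cga_module k G M + O: finite_gset G Om star
  for k :: "('k, 'a) ring_scheme" and G :: "('g, 'b) top_group_scheme"
    and M :: "(('g, 'k) cga, 'm) top_module" and Om :: "'w set" and star +
  fixes L :: "'g set"
  assumes L: "L \<in> open_normal_subgroups G" and L_trivial: "g \<in> L \<Longrightarrow> w \<in> Om \<Longrightarrow> star g w = w"
begin

definition mover :: "'w \<Rightarrow> 'w \<Rightarrow> 'g set" where
  "mover x y = {g \<in> carrier G. star g y = x}"

text \<open>The module \<open>k[Om] \<otimes> M\<close> with diagonal action, as functions \<open>Om \<rightarrow> M\<close>.  A group element acts by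
  \<open>(g f) x = g (f (g\<^sup>-\<^sup>1 x))\<close>, so in the matrix of a general element of \<open>k[[G]]\<close> the entry at \<open>(x, y)\<close> is its
  restriction to the clopen set \<open>mover x y\<close>.\<close>

definition ind :: "(('g, 'k) cga, 'w \<Rightarrow> 'm) top_module" where
  "ind = \<lparr>carrier = Om \<rightarrow>\<^sub>E carrier M, mult = undefined, one = undefined,
     zero = (\<lambda>w\<in>Om. \<zero>\<^bsub>M\<^esub>), add = (\<lambda>f h. \<lambda>w\<in>Om. f w \<oplus>\<^bsub>M\<^esub> h w),
     smult = (\<lambda>r f. \<lambda>x\<in>Om. \<Oplus>\<^bsub>M\<^esub>y\<in>Om. restr L (mover x y) r \<odot>\<^bsub>M\<^esub> f y),
     mtopology = product_topology (\<lambda>_. Mtop) Om\<rparr>"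

lemma ind_simps:
  "carrier ind = Om \<rightarrow>\<^sub>E carrier M" "\<zero>\<^bsub>ind\<^esub> = (\<lambda>w\<in>Om. \<zero>\<^bsub>M\<^esub>)"
  "f \<oplus>\<^bsub>ind\<^esub> h = (\<lambda>w\<in>Om. f w \<oplus>\<^bsub>M\<^esub> h w)"
  "r \<odot>\<^bsub>ind\<^esub> f = (\<lambda>x\<in>Om. \<Oplus>\<^bsub>M\<^esub>y\<in>Om. restr L (mover x y) r \<odot>\<^bsub>M\<^esub> f y)"
  "mtopology ind = product_topology (\<lambda>_. Mtop) Om"
  by (simp_all add: ind_def)

text \<open>The purpose of \<open>L\<close>: it encodes continuity of the action on the finite set,
  and since it acts trivially, \<open>mover x y\<close> is a union of its cosets, as
  \<open>restr\<close> demands.\<close>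

lemma mover_saturated:
  assumes y: "y \<in> Om"
  shows "\<forall>E\<in>cosets L. \<forall>z\<in>E. z \<in> mover x y \<longrightarrow> E \<subseteq> mover x y"
proof (intro ballI impI subsetI)
  fix E z e assume E: "E \<in> cosets L" "z \<in> E" and z: "z \<in> mover x y" and e: "e \<in> E"
  have zG: "z \<in> carrier G" "star z y = x" using z by (auto simp: mover_def)
  obtain l where l: "l \<in> L" "e = l \<otimes>\<^bsub>G\<^esub> z" using coset_eq(1)[OF L E] e by (auto simp: r_coset_def)
  have lG: "l \<in> carrier G" using l ONS(6)[OF L] by blast
  have "star e y = star l (star z y)" using O.star_mult[OF lG zG(1) y] l by simp
  then show "e \<in> mover x y" using zG lG l L_trivial O.star_closed[OF zG(1) y] by (simp add: mover_def)
qed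

lemma restr_in: "y \<in> Om \<Longrightarrow> r \<in> carrier KG \<Longrightarrow> restr L (mover x y) r \<in> carrier KG"
  by (rule restr_closed[OF L mover_saturated])

lemma term_closed: "y \<in> Om \<Longrightarrow> r \<in> carrier KG \<Longrightarrow> f \<in> carrier ind \<Longrightarrow> restr L (mover x y) r \<odot>\<^bsub>M\<^esub> f y \<in> carrier M"
  using restr_in by (auto simp: ind_simps)

lemma ind_topspace: "topspace (mtopology ind) = carrier ind"
  by (simp add: ind_simps topspace_Mtop)

lemma ind_profinite: "profinite_space (mtopology ind)"
  unfolding ind_simps by (rule profinite_space_product) (rule M.profinite_topology)

lemma continuous_into_ind:
  assumes "\<And>x. x \<in> topspace X \<Longrightarrow> f x \<in> extensional Om" "\<And>w. w \<in> Om \<Longrightarrow> continuous_map X Mtop (\<lambda>x. f x w)"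
  shows "continuous_map X (mtopology ind) f"
  unfolding ind_simps continuous_map_componentwise using assms by auto

lemma continuous_ind_component:
  assumes "continuous_map X (mtopology ind) f" "w \<in> Om"
  shows "continuous_map X Mtop (\<lambda>x. f x w)"
  using assms unfolding ind_simps continuous_map_componentwise by auto

lemma ind_abelian: "abelian_group ind"
proof (rule abelian_groupI)
  fix f assume f: "f \<in> carrier ind"
  show "\<exists>h\<in>carrier ind. h \<oplus>\<^bsub>ind\<^esub> f = \<zero>\<^bsub>ind\<^esub>"
    by (rule bexI[of _ "\<lambda>w\<in>Om. \<ominus>\<^bsub>M\<^esub> f w"])
      (use f in \<open>auto simp: ind_simps M.M.l_neg intro!: restrict_ext M.M.l_neg\<close>)
  show "\<zero>\<^bsub>ind\<^esub> \<oplus>\<^bsub>ind\<^esub> f = f"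
  proof (rule extensionalityI[of _ Om])
    show "f \<in> extensional Om" using f by (simp add: ind_simps PiE_def)
    show "(\<zero>\<^bsub>ind\<^esub> \<oplus>\<^bsub>ind\<^esub> f) w = f w" if "w \<in> Om" for w
      using that f PiE_mem[of f Om "\<lambda>_. carrier M" w] by (simp add: ind_simps)
  qed (simp add: ind_simps)
qed (auto simp: ind_simps PiE_iff M.M.a_ac intro!: restrict_ext)

lemma ind_smult_closed: "r \<in> carrier KG \<Longrightarrow> f \<in> carrier ind \<Longrightarrow> r \<odot>\<^bsub>ind\<^esub> f \<in> carrier ind"
  using term_closed by (auto simp: ind_simps intro!: M.M.finsum_closed)

lemma ind_l_distr:
  assumes "r \<in> carrier KG" "s \<in> carrier KG" "f \<in> carrier ind"
  shows "(r \<oplus>\<^bsub>KG\<^esub> s) \<odot>\<^bsub>ind\<^esub> f = r \<odot>\<^bsub>ind\<^esub> f \<oplus>\<^bsub>ind\<^esub> s \<odot>\<^bsub>ind\<^esub> f"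
proof -
  have "(\<Oplus>\<^bsub>M\<^esub>y\<in>Om. restr L (mover x y) (r \<oplus>\<^bsub>KG\<^esub> s) \<odot>\<^bsub>M\<^esub> f y)
      = (\<Oplus>\<^bsub>M\<^esub>y\<in>Om. restr L (mover x y) r \<odot>\<^bsub>M\<^esub> f y) \<oplus>\<^bsub>M\<^esub> (\<Oplus>\<^bsub>M\<^esub>y\<in>Om. restr L (mover x y) s \<odot>\<^bsub>M\<^esub> f y)" for x
  proof -
    have "(\<Oplus>\<^bsub>M\<^esub>y\<in>Om. restr L (mover x y) (r \<oplus>\<^bsub>KG\<^esub> s) \<odot>\<^bsub>M\<^esub> f y)
      = (\<Oplus>\<^bsub>M\<^esub>y\<in>Om. restr L (mover x y) r \<odot>\<^bsub>M\<^esub> f y \<oplus>\<^bsub>M\<^esub> restr L (mover x y) s \<odot>\<^bsub>M\<^esub> f y)"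
    proof (rule M.M.finsum_cong')
      fix y assume y: "y \<in> Om"
      have fy: "f y \<in> carrier M" using assms(3) y by (auto simp: ind_simps)
      show "restr L (mover x y) (r \<oplus>\<^bsub>KG\<^esub> s) \<odot>\<^bsub>M\<^esub> f y = restr L (mover x y) r \<odot>\<^bsub>M\<^esub> f y \<oplus>\<^bsub>M\<^esub> restr L (mover x y) s \<odot>\<^bsub>M\<^esub> f y"
        using restr_add[OF L mover_saturated[OF y] assms(1,2)] M.smult_l_distr[OF restr_in[OF y assms(1)] restr_in[OF y assms(2)] fy]
        by simp
    qed (use term_closed assms in auto)
    also have "\<dots> = (\<Oplus>\<^bsub>M\<^esub>y\<in>Om. restr L (mover x y) r \<odot>\<^bsub>M\<^esub> f y) \<oplus>\<^bsub>M\<^esub> (\<Oplus>\<^bsub>M\<^esub>y\<in>Om. restr L (mover x y) s \<odot>\<^bsub>M\<^esub> f y)"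
      by (rule M.M.finsum_addf) (use term_closed assms in auto)
    finally show ?thesis .
  qed
  then show ?thesis by (auto simp: ind_simps intro!: restrict_ext)
qed

lemma ind_r_distr:
  assumes r: "r \<in> carrier KG" and f: "f \<in> carrier ind" "h \<in> carrier ind"
  shows "r \<odot>\<^bsub>ind\<^esub> (f \<oplus>\<^bsub>ind\<^esub> h) = r \<odot>\<^bsub>ind\<^esub> f \<oplus>\<^bsub>ind\<^esub> r \<odot>\<^bsub>ind\<^esub> h"
proof -
  have "(\<Oplus>\<^bsub>M\<^esub>y\<in>Om. restr L (mover x y) r \<odot>\<^bsub>M\<^esub> (f \<oplus>\<^bsub>ind\<^esub> h) y)
      = (\<Oplus>\<^bsub>M\<^esub>y\<in>Om. restr L (mover x y) r \<odot>\<^bsub>M\<^esub> f y) \<oplus>\<^bsub>M\<^esub> (\<Oplus>\<^bsub>M\<^esub>y\<in>Om. restr L (mover x y) r \<odot>\<^bsub>M\<^esub> h y)" for x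
  proof -
    have "(\<Oplus>\<^bsub>M\<^esub>y\<in>Om. restr L (mover x y) r \<odot>\<^bsub>M\<^esub> (f \<oplus>\<^bsub>ind\<^esub> h) y)
      = (\<Oplus>\<^bsub>M\<^esub>y\<in>Om. restr L (mover x y) r \<odot>\<^bsub>M\<^esub> f y \<oplus>\<^bsub>M\<^esub> restr L (mover x y) r \<odot>\<^bsub>M\<^esub> h y)"
    proof (rule M.M.finsum_cong')
      fix y assume y: "y \<in> Om"
      have fy: "f y \<in> carrier M" "h y \<in> carrier M" using f y by (auto simp: ind_simps)
      show "restr L (mover x y) r \<odot>\<^bsub>M\<^esub> (f \<oplus>\<^bsub>ind\<^esub> h) y = restr L (mover x y) r \<odot>\<^bsub>M\<^esub> f y \<oplus>\<^bsub>M\<^esub> restr L (mover x y) r \<odot>\<^bsub>M\<^esub> h y"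
        using M.smult_r_distr[OF restr_in[OF y r] fy] y by (simp add: ind_simps)
    qed (use term_closed r f in auto)
    also have "\<dots> = (\<Oplus>\<^bsub>M\<^esub>y\<in>Om. restr L (mover x y) r \<odot>\<^bsub>M\<^esub> f y) \<oplus>\<^bsub>M\<^esub> (\<Oplus>\<^bsub>M\<^esub>y\<in>Om. restr L (mover x y) r \<odot>\<^bsub>M\<^esub> h y)"
      by (rule M.M.finsum_addf) (use term_closed r f in auto)
    finally show ?thesis .
  qed
  then show ?thesis unfolding ind_simps(4) by (auto simp: ind_simps(3) intro!: restrict_ext)
qed

lemma pt_zero_smult: "g \<in> carrier G \<Longrightarrow> x \<in> carrier M \<Longrightarrow> pt \<zero>\<^bsub>k\<^esub> g \<odot>\<^bsub>M\<^esub> x = \<zero>\<^bsub>M\<^esub>"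
proof -
  assume g: "g \<in> carrier G" and x: "x \<in> carrier M"
  have "pt \<zero>\<^bsub>k\<^esub> g = \<zero>\<^bsub>KG\<^esub>"
    by (rule KG_ext) (use g pt_closed in \<open>auto simp: pt_val KG_zero\<close>)
  then show ?thesis using zero_smult[OF x] by simp
qed

text \<open>The restriction of the point \<open>c g\<close> to \<open>mover x y\<close> vanishes
  unless \<open>g\<close> moves \<open>y\<close> to \<open>x\<close>, so only one summand can
  survive: the matrix definition extends the usual diagonal action.\<close>

lemma ind_pt_smult:
  assumes c: "c \<in> carrier k" and g: "g \<in> carrier G" and f: "f \<in> carrier ind"
  shows "pt c g \<odot>\<^bsub>ind\<^esub> f = (\<lambda>x\<in>Om. pt c g \<odot>\<^bsub>M\<^esub> f (star (inv\<^bsub>G\<^esub> g) x))"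
  unfolding ind_simps(4)
proof (rule restrict_ext)
  fix x assume x: "x \<in> Om"
  let ?y = "star (inv\<^bsub>G\<^esub> g) x"
  have yO: "?y \<in> Om" using x g O.star_closed by simp
  have fc: "f y \<in> carrier M" if "y \<in> Om" for y using f that by (auto simp: ind_simps)
  have pc: "pt c g \<odot>\<^bsub>M\<^esub> f y \<in> carrier M" if "y \<in> Om" for y using fc[OF that] pt_closed[OF c g] by simp
  have "(\<Oplus>\<^bsub>M\<^esub>y\<in>Om. restr L (mover x y) (pt c g) \<odot>\<^bsub>M\<^esub> f y) = (\<Oplus>\<^bsub>M\<^esub>y\<in>Om. if ?y = y then pt c g \<odot>\<^bsub>M\<^esub> f y else \<zero>\<^bsub>M\<^esub>)"
  proof (rule M.M.finsum_cong')
    fix y assume y: "y \<in> Om"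
    have "g \<in> mover x y \<longleftrightarrow> ?y = y" using O.star_eq_iff[OF g x y] g by (auto simp: mover_def)
    then show "restr L (mover x y) (pt c g) \<odot>\<^bsub>M\<^esub> f y = (if ?y = y then pt c g \<odot>\<^bsub>M\<^esub> f y else \<zero>\<^bsub>M\<^esub>)"
      using restr_pt[OF L mover_saturated[OF y] c g, of x] pt_zero_smult[OF g fc[OF y]] by simp
  qed (use pc in auto)
  also have "\<dots> = pt c g \<odot>\<^bsub>M\<^esub> f ?y"
    by (rule M.M.finsum_singleton[OF yO O.finite_Om]) (use pc in auto)
  finally show "(\<Oplus>\<^bsub>M\<^esub>y\<in>Om. restr L (mover x y) (pt c g) \<odot>\<^bsub>M\<^esub> f y) = pt c g \<odot>\<^bsub>M\<^esub> f ?y" .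
qed

lemma continuous_ind_smult:
  assumes p: "continuous_map X KGtop p" and q: "continuous_map X (mtopology ind) q"
  shows "continuous_map X (mtopology ind) (\<lambda>x. p x \<odot>\<^bsub>ind\<^esub> q x)"
proof (rule continuous_into_ind)
  show "p x \<odot>\<^bsub>ind\<^esub> q x \<in> extensional Om" for x by (simp add: ind_simps)
  fix w assume w: "w \<in> Om"
  have "continuous_map X Mtop (\<lambda>x. \<Oplus>\<^bsub>M\<^esub>y\<in>Om. restr L (mover w y) (p x) \<odot>\<^bsub>M\<^esub> q x y)"
  proof (rule continuous_finsum_maps[OF O.finite_Om])
    fix y assume y: "y \<in> Om"
    have "continuous_map X KGtop (\<lambda>x. restr L (mover w y) (p x))"
      using continuous_map_compose[OF p continuous_restr[OF L mover_saturated[OF y]]] by (simp add: o_def)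
    then show "continuous_map X Mtop (\<lambda>x. restr L (mover w y) (p x) \<odot>\<^bsub>M\<^esub> q x y)"
      by (rule continuous_smult_maps[OF _ continuous_ind_component[OF q y]])
  qed
  then show "continuous_map X Mtop (\<lambda>x. (p x \<odot>\<^bsub>ind\<^esub> q x) w)" using w by (simp add: ind_simps)
qed

lemma continuous_KG_mult:
  assumes "r \<in> carrier KG"
  shows "continuous_map KGtop KGtop (\<lambda>s. r \<otimes>\<^bsub>KG\<^esub> s)" "continuous_map KGtop KGtop (\<lambda>s. s \<otimes>\<^bsub>KG\<^esub> r)"
proof -
  have "(r \<otimes>\<^bsub>KG\<^esub> a) N = (r \<otimes>\<^bsub>KG\<^esub> b) N" "(a \<otimes>\<^bsub>KG\<^esub> r) N = (b \<otimes>\<^bsub>KG\<^esub> r) N"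
    if "N \<in> ONS" "a N = b N" for a b N using that by (simp_all add: KG_mult)
  then show "continuous_map KGtop KGtop (\<lambda>s. r \<otimes>\<^bsub>KG\<^esub> s)" "continuous_map KGtop KGtop (\<lambda>s. s \<otimes>\<^bsub>KG\<^esub> r)"
    using assms by (intro continuous_KG_KG Pi_I M.R.m_closed; blast)+
qed

text \<open>Both sides are continuous and additive in \<open>r\<close>, so density reduces the
  equation to points. The maps \<open>F\<close> and \<open>H\<close> are left open because
  associativity uses the principle once for each factor.\<close>

lemma ind_assoc_closed_induct:
  assumes f: "f \<in> carrier ind"
    and F: "continuous_map KGtop KGtop F" "\<And>r s. r \<in> carrier KG \<Longrightarrow> s \<in> carrier KG \<Longrightarrow> F (r \<oplus>\<^bsub>KG\<^esub> s) = F r \<oplus>\<^bsub>KG\<^esub> F s"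
    and H: "continuous_map KGtop (mtopology ind) H" "\<And>r s. r \<in> carrier KG \<Longrightarrow> s \<in> carrier KG \<Longrightarrow> H (r \<oplus>\<^bsub>KG\<^esub> s) = H r \<oplus>\<^bsub>ind\<^esub> H s"
    and p: "\<And>c g. c \<in> carrier k \<Longrightarrow> g \<in> carrier G \<Longrightarrow> F (pt c g) \<odot>\<^bsub>ind\<^esub> f = H (pt c g)"
    and r: "r \<in> carrier KG"
  shows "F r \<odot>\<^bsub>ind\<^esub> f = H r"
proof -
  interpret I: abelian_group ind by (rule ind_abelian)
  have Fc: "F s \<in> carrier KG" if "s \<in> carrier KG" for s
    using F(1) that by (auto simp: continuous_map_def topspace_KGtop)
  have Hc: "H s \<in> carrier ind" if "s \<in> carrier KG" for s
    using H(1) that by (auto simp: continuous_map_def topspace_KGtop ind_topspace)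
  have Hz: "H \<zero>\<^bsub>KG\<^esub> = \<zero>\<^bsub>ind\<^esub>"
    using H(2)[OF M.R.zero_closed M.R.zero_closed] Hc by (intro I.add_idem_zero) auto
  have Fz: "F \<zero>\<^bsub>KG\<^esub> = \<zero>\<^bsub>KG\<^esub>"
    using F(2)[OF M.R.zero_closed M.R.zero_closed] Fc by (intro M.R.add_idem_zero) auto
  have "\<zero>\<^bsub>KG\<^esub> \<odot>\<^bsub>ind\<^esub> f = \<zero>\<^bsub>ind\<^esub>"
    using ind_l_distr[OF M.R.zero_closed M.R.zero_closed f] ind_smult_closed[OF M.R.zero_closed f]
    by (intro I.add_idem_zero) auto
  moreover have "closedin KGtop {r \<in> topspace KGtop. F r \<odot>\<^bsub>ind\<^esub> f = H r}"
  proof (rule closedin_continuous_maps_eq[OF _ _ H(1)])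
    show "Hausdorff_space (mtopology ind)" using ind_profinite by (simp add: profinite_space_def)
    show "continuous_map KGtop (mtopology ind) (\<lambda>r. F r \<odot>\<^bsub>ind\<^esub> f)"
      by (rule continuous_ind_smult[OF F(1)]) (use f ind_topspace in auto)
  qed
  ultimately have "r \<in> {r \<in> topspace KGtop. F r \<odot>\<^bsub>ind\<^esub> f = H r}"
    using r by (elim KG_dense)
      (auto simp: topspace_KGtop Fz Hz F(2) H(2) p ind_l_distr[OF Fc Fc f] intro: KG_add_closed pt_closed)
  then show ?thesis by blast
qed

text \<open>The left factor is a point at first while the right one is arbitrary; then the left one
  becomes arbitrary too. For two points the claim reduces to the action law for the inverse of a
  product.\<close>

lemma ind_smult_assoc:
  assumes r: "r \<in> carrier KG" and s: "s \<in> carrier KG" and f: "f \<in> carrier ind"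
  shows "(r \<otimes>\<^bsub>KG\<^esub> s) \<odot>\<^bsub>ind\<^esub> f = r \<odot>\<^bsub>ind\<^esub> (s \<odot>\<^bsub>ind\<^esub> f)"
proof -
  have id: "continuous_map KGtop KGtop (\<lambda>r. r)" using continuous_map_id[of KGtop] by (simp add: id_def)
  have con: "continuous_map KGtop (mtopology ind) (\<lambda>_. h)" if "h \<in> carrier ind" for h using that ind_topspace by simp
  have 1: "(pt c g \<otimes>\<^bsub>KG\<^esub> s) \<odot>\<^bsub>ind\<^esub> f = pt c g \<odot>\<^bsub>ind\<^esub> (s \<odot>\<^bsub>ind\<^esub> f)"
    if cg: "c \<in> carrier k" "g \<in> carrier G" and s: "s \<in> carrier KG" for c g s
  proof (rule ind_assoc_closed_induct[OF f continuous_KG_mult(1)[OF pt_closed[OF cg]] _ _ _ _ s])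
    have p: "pt c g \<in> carrier KG" by (rule pt_closed[OF cg])
    show "pt c g \<otimes>\<^bsub>KG\<^esub> (r \<oplus>\<^bsub>KG\<^esub> s) = pt c g \<otimes>\<^bsub>KG\<^esub> r \<oplus>\<^bsub>KG\<^esub> pt c g \<otimes>\<^bsub>KG\<^esub> s"
      if "r \<in> carrier KG" "s \<in> carrier KG" for r s using p that by (simp add: M.R.r_distr)
    show "continuous_map KGtop (mtopology ind) (\<lambda>s. pt c g \<odot>\<^bsub>ind\<^esub> (s \<odot>\<^bsub>ind\<^esub> f))"
      by (intro continuous_ind_smult id con f) (use p topspace_KGtop in simp)
    show "pt c g \<odot>\<^bsub>ind\<^esub> ((r \<oplus>\<^bsub>KG\<^esub> s) \<odot>\<^bsub>ind\<^esub> f) = pt c g \<odot>\<^bsub>ind\<^esub> (r \<odot>\<^bsub>ind\<^esub> f) \<oplus>\<^bsub>ind\<^esub> pt c g \<odot>\<^bsub>ind\<^esub> (s \<odot>\<^bsub>ind\<^esub> f)"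
      if "r \<in> carrier KG" "s \<in> carrier KG" for r s
      using that f p ind_l_distr ind_r_distr ind_smult_closed by simp
    fix d h assume dh: "d \<in> carrier k" "h \<in> carrier G"
    have "(pt c g \<otimes>\<^bsub>KG\<^esub> pt d h) \<odot>\<^bsub>ind\<^esub> f = (\<lambda>x\<in>Om. pt (c \<otimes>\<^bsub>k\<^esub> d) (g \<otimes>\<^bsub>G\<^esub> h) \<odot>\<^bsub>M\<^esub> f (star (inv\<^bsub>G\<^esub> (g \<otimes>\<^bsub>G\<^esub> h)) x))"
      using pt_mult[OF cg(1) dh(1) cg(2) dh(2)] ind_pt_smult[OF _ _ f] cg dh by simp
    also have "\<dots> = (\<lambda>x\<in>Om. pt c g \<odot>\<^bsub>M\<^esub> (pt d h \<odot>\<^bsub>M\<^esub> f (star (inv\<^bsub>G\<^esub> h) (star (inv\<^bsub>G\<^esub> g) x))))"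
    proof (rule restrict_ext)
      fix x assume x: "x \<in> Om"
      let ?y = "star (inv\<^bsub>G\<^esub> h) (star (inv\<^bsub>G\<^esub> g) x)"
      have y: "?y = star (inv\<^bsub>G\<^esub> (g \<otimes>\<^bsub>G\<^esub> h)) x"
        using x cg dh O.star_mult by (simp add: G.inv_mult_group)
      have "?y \<in> Om" using x cg dh O.star_closed by simp
      then have fy: "f ?y \<in> carrier M" using f by (auto simp: ind_simps)
      show "pt (c \<otimes>\<^bsub>k\<^esub> d) (g \<otimes>\<^bsub>G\<^esub> h) \<odot>\<^bsub>M\<^esub> f (star (inv\<^bsub>G\<^esub> (g \<otimes>\<^bsub>G\<^esub> h)) x) = pt c g \<odot>\<^bsub>M\<^esub> (pt d h \<odot>\<^bsub>M\<^esub> f ?y)"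
        using M.smult_assoc1[OF p pt_closed[OF dh] fy] pt_mult[OF cg(1) dh(1) cg(2) dh(2)] y by simp
    qed
    also have "\<dots> = pt c g \<odot>\<^bsub>ind\<^esub> (pt d h \<odot>\<^bsub>ind\<^esub> f)"
      using ind_pt_smult[OF cg ind_smult_closed[OF pt_closed[OF dh] f]] ind_pt_smult[OF dh f] cg O.star_closed
      by (auto intro!: restrict_ext)
    finally show "(pt c g \<otimes>\<^bsub>KG\<^esub> pt d h) \<odot>\<^bsub>ind\<^esub> f = pt c g \<odot>\<^bsub>ind\<^esub> (pt d h \<odot>\<^bsub>ind\<^esub> f)" .
  qed
  show ?thesis
  proof (rule ind_assoc_closed_induct[OF f continuous_KG_mult(2)[OF s] _ _ _ _ r])
    show "continuous_map KGtop (mtopology ind) (\<lambda>r. r \<odot>\<^bsub>ind\<^esub> (s \<odot>\<^bsub>ind\<^esub> f))"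
      by (intro continuous_ind_smult id con ind_smult_closed f s)
    show "(a \<oplus>\<^bsub>KG\<^esub> b) \<otimes>\<^bsub>KG\<^esub> s = a \<otimes>\<^bsub>KG\<^esub> s \<oplus>\<^bsub>KG\<^esub> b \<otimes>\<^bsub>KG\<^esub> s" if "a \<in> carrier KG" "b \<in> carrier KG" for a b
      using that s by (simp add: M.R.l_distr)
    show "(a \<oplus>\<^bsub>KG\<^esub> b) \<odot>\<^bsub>ind\<^esub> (s \<odot>\<^bsub>ind\<^esub> f) = a \<odot>\<^bsub>ind\<^esub> (s \<odot>\<^bsub>ind\<^esub> f) \<oplus>\<^bsub>ind\<^esub> b \<odot>\<^bsub>ind\<^esub> (s \<odot>\<^bsub>ind\<^esub> f)"
      if "a \<in> carrier KG" "b \<in> carrier KG" for a b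
      using that ind_l_distr ind_smult_closed[OF s f] by simp
  qed (rule 1[OF _ _ s])
qed

lemma ind_module: "profinite_module KG ind"
proof -
  have one: "\<one>\<^bsub>KG\<^esub> \<odot>\<^bsub>ind\<^esub> f = f" if f: "f \<in> carrier ind" for f
    unfolding pt_one ind_pt_smult[OF k.one_closed G.one_closed f]
  proof (rule extensionalityI[of _ Om])
    show "f \<in> extensional Om" using f by (simp add: ind_simps PiE_def)
    show "(\<lambda>x\<in>Om. pt \<one>\<^bsub>k\<^esub> \<one>\<^bsub>G\<^esub> \<odot>\<^bsub>M\<^esub> f (star (inv\<^bsub>G\<^esub> \<one>\<^bsub>G\<^esub>) x)) x = f x" if "x \<in> Om" for x
    proof -
      have "f x \<in> carrier M" using f that by (auto simp: ind_simps)
      then show ?thesis using that O.star_one by (simp flip: pt_one)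
    qed
  qed simp
  have c: "continuous_map (prod_topology A (mtopology ind)) (mtopology ind) snd"
    "continuous_map (prod_topology KGtop B) KGtop fst" for A B by (simp_all add: continuous_map_fst continuous_map_snd)
  have "continuous_map (prod_topology KGtop (mtopology ind)) (mtopology ind) (\<lambda>z. fst z \<odot>\<^bsub>ind\<^esub> snd z)"
    by (rule continuous_ind_smult[OF c(2) c(1)])
  moreover have "continuous_map (prod_topology (mtopology ind) (mtopology ind)) (mtopology ind) (\<lambda>z. fst z \<oplus>\<^bsub>ind\<^esub> snd z)"
  proof (rule continuous_into_ind)
    fix w assume w: "w \<in> Om"
    have "continuous_map (prod_topology (mtopology ind) (mtopology ind)) Mtop (\<lambda>z. fst z w \<oplus>\<^bsub>M\<^esub> snd z w)"
      by (intro continuous_add_maps continuous_ind_component[OF continuous_map_fst w] continuous_ind_component[OF continuous_map_snd w])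
    then show "continuous_map (prod_topology (mtopology ind) (mtopology ind)) Mtop (\<lambda>z. (fst z \<oplus>\<^bsub>ind\<^esub> snd z) w)"
      using w by (simp add: ind_simps)
  qed (simp add: ind_simps)
  ultimately show ?thesis
    by (intro profinite_module.intro left_module.intro left_module_axioms.intro profinite_module_axioms.intro
        M.R.ring_axioms ind_abelian ind_smult_closed ind_l_distr ind_r_distr ind_smult_assoc one ind_topspace ind_profinite)
      (simp_all add: case_prod_unfold)
qed

sublocale I: cga_module k G ind
  by (intro cga_module.intro cga_base_axioms ind_module)

lemma ind_act:
  "g \<in> carrier G \<Longrightarrow> f \<in> carrier ind \<Longrightarrow> I.act g f = (\<lambda>x\<in>Om. act g (f (star (inv\<^bsub>G\<^esub> g) x)))"
  by (simp add: gact_def ind_pt_smult)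

lemma ind_sc:
  assumes "c \<in> carrier k" "f \<in> carrier ind"
  shows "I.sc c f = (\<lambda>x\<in>Om. sc c (f x))"
  unfolding kact_def ind_pt_smult[OF assms(1) G.one_closed assms(2)]
  by (rule restrict_ext) (simp add: O.star_one)

text \<open>The summation map \<open>\<beta>\<close> from \<open>ind\<close> to \<open>M\<close> is
  split over \<open>Q\<close> by placing \<open>u\<close> at the point \<open>w0\<close> fixed by
  \<open>Q\<close>. Relative projectivity turns this into a splitting over \<open>G\<close>, and the
  coordinates of that splitting form the family.\<close>

lemma relatively_projective_family:
  assumes proj: "relatively_projective k G Q M" and Q: "closed_subgroup Q G"
    and w0: "w0 \<in> Om" "\<And>q. q \<in> Q \<Longrightarrow> star q w0 = w0"
  obtains \<alpha> where "gfamily k G M Om star \<alpha>"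
proof -
  interpret MI: cga_hom k G M ind by unfold_locales
  interpret IM: cga_hom k G ind M by unfold_locales
  have QG: "Q \<subseteq> carrier G" "\<And>q. q \<in> Q \<Longrightarrow> inv\<^bsub>G\<^esub> q \<in> Q"
    using Q by (auto simp: closed_subgroup_def dest: subgroup.subset subgroup.m_inv_closed)
  have fc: "f w \<in> carrier M" if "f \<in> carrier ind" "w \<in> Om" for f w using that by (auto simp: ind_simps)
  define \<beta> where "\<beta> f = (\<Oplus>\<^bsub>M\<^esub>w\<in>Om. f w)" for f
  define \<psi> where "\<psi> u = (\<lambda>w\<in>Om. if w = w0 then u else \<zero>\<^bsub>M\<^esub>)" for u
  have \<psi>c: "\<psi> u \<in> carrier ind" if "u \<in> carrier M" for u using that by (auto simp: \<psi>_def ind_simps)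
  have \<beta>\<psi>: "\<beta> (\<psi> u) = u" if u: "u \<in> carrier M" for u
  proof -
    have "\<beta> (\<psi> u) = (\<Oplus>\<^bsub>M\<^esub>w\<in>Om. if w0 = w then u else \<zero>\<^bsub>M\<^esub>)"
      unfolding \<beta>_def \<psi>_def by (rule M.M.finsum_cong') (use u in auto)
    also have "\<dots> = u" by (rule M.M.finsum_singleton[OF w0(1) O.finite_Om]) (use u in auto)
    finally show ?thesis .
  qed
  have \<psi>: "\<psi> \<in> ghom k G Q M ind"
  proof -
    have "\<psi> \<in> klin k G M ind"
    proof (rule klinI[OF \<psi>c])
      show "\<psi> (x \<oplus>\<^bsub>M\<^esub> y) = \<psi> x \<oplus>\<^bsub>ind\<^esub> \<psi> y" if "x \<in> carrier M" "y \<in> carrier M" for x y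
        using that by (auto simp: \<psi>_def ind_simps intro!: restrict_ext)
      show "\<psi> (sc c x) = I.sc c (\<psi> x)" if "c \<in> carrier k" "x \<in> carrier M" for c x
        unfolding ind_sc[OF that(1) \<psi>c[OF that(2)]]
        using that smult_zero[OF pt_closed[OF that(1) G.one_closed]]
        by (auto simp: \<psi>_def kact_def intro!: restrict_ext)
      show "continuous_map Mtop (mtopology ind) \<psi>"
      proof (rule continuous_into_ind)
        show "continuous_map Mtop Mtop (\<lambda>u. \<psi> u w)" if "w \<in> Om" for w
          using that continuous_map_id[of Mtop] topspace_Mtop by (simp add: \<psi>_def id_def)
      qed (simp add: \<psi>_def)
    qed
    moreover have "\<psi> (act q x) = I.act q (\<psi> x)" if q: "q \<in> Q" and x: "x \<in> carrier M" for q x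
    proof -
      have qG: "q \<in> carrier G" using q QG by blast
      have "star (inv\<^bsub>G\<^esub> q) w = w0 \<longleftrightarrow> w = w0" if "w \<in> Om" for w
        using O.star_eq_iff[OF qG that w0(1)] w0(2)[OF q] by auto
      then show ?thesis
        unfolding ind_act[OF qG \<psi>c[OF x]]
        using qG O.star_closed smult_zero[OF pt_closed[OF k.one_closed qG]]
        by (auto simp: \<psi>_def gact_def intro!: restrict_ext)
    qed
    ultimately show ?thesis by (simp add: ghom_def)
  qed
  have \<beta>: "\<beta> \<in> continuous_hom KG ind M"
    unfolding IM.continuous_hom_eq_ghom ghom_def
  proof (intro CollectI conjI ballI klinI)
    show "\<beta> f \<in> carrier M" if "f \<in> carrier ind" for f
      unfolding \<beta>_def using fc[OF that] by (intro M.M.finsum_closed) auto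
    show "\<beta> (f \<oplus>\<^bsub>ind\<^esub> h) = \<beta> f \<oplus>\<^bsub>M\<^esub> \<beta> h" if "f \<in> carrier ind" "h \<in> carrier ind" for f h
    proof -
      have "\<beta> (f \<oplus>\<^bsub>ind\<^esub> h) = (\<Oplus>\<^bsub>M\<^esub>w\<in>Om. f w \<oplus>\<^bsub>M\<^esub> h w)"
        unfolding \<beta>_def by (rule M.M.finsum_cong') (use fc that in \<open>auto simp: ind_simps(3)\<close>)
      also have "\<dots> = \<beta> f \<oplus>\<^bsub>M\<^esub> \<beta> h" unfolding \<beta>_def by (rule M.M.finsum_addf) (use fc that in auto)
      finally show ?thesis .
    qed
    show "\<beta> (I.sc c f) = sc c (\<beta> f)" if "c \<in> carrier k" "f \<in> carrier ind" for c f
    proof -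
      have "\<beta> (I.sc c f) = (\<Oplus>\<^bsub>M\<^esub>w\<in>Om. sc c (f w))"
        unfolding \<beta>_def ind_sc[OF that] by (rule M.M.finsum_cong') (use fc that in auto)
      also have "\<dots> = sc c (\<beta> f)" unfolding \<beta>_def
        by (rule sc_finsum[symmetric]) (use fc that O.finite_Om in auto)
      finally show ?thesis .
    qed
    show "continuous_map (mtopology ind) Mtop \<beta>"
      unfolding \<beta>_def
      by (rule continuous_finsum_maps[OF O.finite_Om], unfold ind_simps, rule continuous_map_product_projection)
    show "\<beta> (I.act g f) = act g (\<beta> f)" if g: "g \<in> carrier G" and f: "f \<in> carrier ind" for g f
    proof -
      have ig: "inv\<^bsub>G\<^esub> g \<in> carrier G" using g by simp
      have "\<beta> (I.act g f) = (\<Oplus>\<^bsub>M\<^esub>w\<in>Om. act g (f (star (inv\<^bsub>G\<^esub> g) w)))"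
        unfolding \<beta>_def ind_act[OF g f] by (rule M.M.finsum_cong') (use fc[OF f] g O.star_closed in auto)
      also have "\<dots> = (\<Oplus>\<^bsub>M\<^esub>w\<in>star (inv\<^bsub>G\<^esub> g) ` Om. act g (f w))"
        by (rule M.M.finsum_reindex[symmetric, OF _ O.star_bij(1)[OF ig]]) (use fc[OF f] g O.star_closed in auto)
      also have "\<dots> = act g (\<beta> f)" unfolding O.star_bij(2)[OF ig] \<beta>_def
        by (rule act_finsum[symmetric]) (use fc[OF f] g O.finite_Om in auto)
      finally show ?thesis .
    qed
  qed
  have \<beta>epi: "\<beta> \<in> continuous_epi KG ind M"
  proof -
    have "u \<in> \<beta> ` carrier ind" if "u \<in> carrier M" for u
      by (rule image_eqI[of _ _ "\<psi> u"]) (use \<beta>\<psi>[OF that] \<psi>c[OF that] in auto)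
    then show ?thesis using \<beta> continuous_homD(1)[OF \<beta>] by (auto simp: continuous_epi_def)
  qed
  have idM: "(\<lambda>u. u) \<in> continuous_hom KG M M"
    using continuous_map_id[of Mtop] by (auto simp: continuous_hom_def id_def)
  \<comment> \<open>\<open>ind\<close> is carried by a type of functions into \<open>M\<close>, not
    by the test universe, so the lifting property comes from the theorem on arbitrary carrier
    types.\<close>
  have "relative_lifting k G Q M ind M"
    by (rule relatively_projective_lifting[OF proj M.profinite_module_axioms ind_module M.profinite_module_axioms])
  moreover have "\<exists>\<psi>\<in>ghom k G Q M ind. \<forall>u\<in>carrier M. \<beta> (\<psi> u) = u"
    using \<beta>\<psi> by (intro bexI[OF _ \<psi>]) blast
  ultimately have "\<exists>\<rho>\<in>continuous_hom KG M ind. \<forall>u\<in>carrier M. \<beta> (\<rho> u) = u"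
    unfolding relative_lifting_def MI.continuous_hom_subgroup_eq_ghom[OF Q]
    by (drule_tac bspec[OF _ \<beta>epi], drule_tac bspec[OF _ idM]) (erule mp)
  then obtain \<rho> where \<rho>: "\<rho> \<in> ghom k G (carrier G) M ind" "\<And>u. u \<in> carrier M \<Longrightarrow> \<beta> (\<rho> u) = u"
    unfolding MI.continuous_hom_eq_ghom by blast
  note \<rho>k = klinD[OF ghomD(1)[OF \<rho>(1)]]
  have "gfamily k G M Om star (\<lambda>w u. \<rho> u w)"
    unfolding gfamily_def
  proof (intro conjI ballI)
    fix w assume w: "w \<in> Om"
    show "(\<lambda>u. \<rho> u w) \<in> klin k G M M"
    proof (rule klinI)
      show "continuous_map Mtop Mtop (\<lambda>u. \<rho> u w)" by (rule continuous_ind_component[OF \<rho>k(4) w])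
    qed (use w \<rho>k fc in \<open>auto simp: ind_simps(3) ind_sc\<close>)
    fix g u assume g: "g \<in> carrier G" and u: "u \<in> carrier M"
    show "\<rho> (act g u) (star g w) = act g (\<rho> u w)"
      unfolding ghomD(2)[OF \<rho>(1) g u] ind_act[OF g \<rho>k(1)[OF u]]
      using w g O.star_closed O.star_inv by simp
  next
    show "(\<Oplus>\<^bsub>M\<^esub>w\<in>Om. \<rho> u w) = u" if "u \<in> carrier M" for u using \<rho>(2)[OF that] by (simp add: \<beta>_def)
  qed
  then show thesis by (rule that)
qed

end

section \<open>From a family back to lifts\<close>

context cga_hom
begin

text \<open>The translates \<open>c w\<close> of \<open>\<psi>\<close> lift \<open>\<phi>\<close> as
  well, and since the family sums to the identity, so does the sum of the composites of
  \<open>c w\<close> with \<open>\<alpha> w\<close>. A translate depends on the chosen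
  \<open>t w\<close> only modulo \<open>D\<close>, hence equivariance modulo \<open>D\<close>; the
  zero submodule as \<open>D\<close> gives exact lifts.\<close>

lemma gfamily_lift:
  fixes W :: "(('g, 'k) cga, 'w) top_module"
  assumes Om: "finite_gset G Om star" and \<alpha>: "gfamily k G U Om star \<alpha>"
    and w0: "w0 \<in> Om" and tr: "\<And>w. w \<in> Om \<Longrightarrow> \<exists>g\<in>carrier G. star g w0 = w"
    and W: "cga_module k G W"
    and \<beta>: "\<beta> \<in> continuous_hom KG V W" and \<phi>: "\<phi> \<in> continuous_hom KG U W"
    and \<psi>: "\<psi> \<in> klin k G U V" and \<beta>\<psi>: "\<And>u. u \<in> carrier U \<Longrightarrow> \<beta> (\<psi> u) = \<phi> u"
    and D: "submodule D KG V"
    and eq: "\<And>h u. h \<in> carrier G \<Longrightarrow> star h w0 = w0 \<Longrightarrow> u \<in> carrier U \<Longrightarrow>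
      \<psi> (U.act h u) \<ominus>\<^bsub>V\<^esub> V.act h (\<psi> u) \<in> D"
  obtains \<rho> where "\<rho> \<in> klin k G U V" "\<And>u. u \<in> carrier U \<Longrightarrow> \<beta> (\<rho> u) = \<phi> u"
    "\<And>g u. g \<in> carrier G \<Longrightarrow> u \<in> carrier U \<Longrightarrow> \<rho> (U.act g u) \<ominus>\<^bsub>V\<^esub> V.act g (\<rho> u) \<in> D"
proof -
  interpret O: finite_gset G Om star by fact
  interpret W: cga_module k G W by fact
  interpret VW: cga_hom k G V W by unfold_locales
  interpret UW: cga_hom k G U W by unfold_locales
  have \<beta>g: "\<beta> \<in> ghom k G (carrier G) V W" using \<beta> VW.continuous_hom_eq_ghom by simp
  have \<phi>g: "\<phi> \<in> ghom k G (carrier G) U W" using \<phi> UW.continuous_hom_eq_ghom by simp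
  note \<psi>k = klinD[OF \<psi>]
  have \<alpha>k: "\<alpha> w \<in> klin k G U U" if "w \<in> Om" for w using \<alpha> that by (simp add: gfamily_def)
  have \<alpha>g: "\<alpha> (star g w) (U.act g u) = U.act g (\<alpha> w u)" if "g \<in> carrier G" "w \<in> Om" "u \<in> carrier U" for g w u
    using \<alpha> that by (simp add: gfamily_def)
  have \<alpha>s: "(\<Oplus>\<^bsub>U\<^esub>w\<in>Om. \<alpha> w u) = u" if "u \<in> carrier U" for u using \<alpha> that by (simp add: gfamily_def)
  obtain t where t: "\<And>w. w \<in> Om \<Longrightarrow> t w \<in> carrier G" "\<And>w. w \<in> Om \<Longrightarrow> star (t w) w0 = w" using tr by metis
  define c where "c w u = V.act (t w) (\<psi> (U.act (inv\<^bsub>G\<^esub> (t w)) u))" for w u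
  have ck: "c w \<in> klin k G U V" if w: "w \<in> Om" for w
  proof (rule klinI)
    note tw = t(1)[OF w]
    have ti: "inv\<^bsub>G\<^esub> (t w) \<in> carrier G" using tw by simp
    show "c w x \<in> carrier V" if "x \<in> carrier U" for x using that tw ti \<psi>k(1) by (simp add: c_def)
    show "c w (x \<oplus>\<^bsub>U\<^esub> y) = c w x \<oplus>\<^bsub>V\<^esub> c w y" if "x \<in> carrier U" "y \<in> carrier U" for x y
      using that tw ti \<psi>k(1,2) by (simp add: c_def U.act_add V.act_add)
    show "c w (U.sc d x) = V.sc d (c w x)" if "d \<in> carrier k" "x \<in> carrier U" for d x
      using that tw ti \<psi>k(1,3) by (simp add: c_def U.act_sc V.act_sc)
    have "continuous_map (mtopology U) (mtopology U) (\<lambda>u. u)" using continuous_map_id[of "mtopology U"] by (simp add: id_def)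
    from continuous_map_compose[OF U.continuous_act_const[OF ti this] \<psi>k(4)]
    show "continuous_map (mtopology U) (mtopology V) (c w)"
      unfolding c_def by (intro V.continuous_act_const[OF tw]) (simp add: o_def)
  qed
  have \<beta>c: "\<beta> (c w u) = \<phi> u" if w: "w \<in> Om" and u: "u \<in> carrier U" for w u
  proof -
    have ti: "inv\<^bsub>G\<^esub> (t w) \<in> carrier G" using t(1)[OF w] by simp
    have "\<beta> (c w u) = W.act (t w) (\<phi> (U.act (inv\<^bsub>G\<^esub> (t w)) u))"
      using ghomD(2)[OF \<beta>g t(1)[OF w]] \<psi>k(1) \<beta>\<psi> ti u by (simp add: c_def)
    also have "\<dots> = \<phi> u"
      using ghomD(2)[OF \<phi>g ti u] W.act_inv(1)[OF t(1)[OF w]] klinD(1)[OF ghomD(1)[OF \<phi>g] u] by simp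
    finally show ?thesis .
  qed
  have cg: "c (star g w) (U.act g v) \<ominus>\<^bsub>V\<^esub> V.act g (c w v) \<in> D"
    if g: "g \<in> carrier G" and w: "w \<in> Om" and v: "v \<in> carrier U" for g w v
  proof -
    let ?t = "t (star g w)" and ?s = "t w"
    have gw: "star g w \<in> Om" using O.star_closed[OF g w] .
    have ts: "?t \<in> carrier G" "?s \<in> carrier G" using t(1) gw w by auto
    \<comment> \<open>\<open>?h\<close> compares the representative chosen for
      \<open>star g w\<close> with the translate by \<open>g\<close> of the one chosen for
      \<open>w\<close>; it fixes \<open>w0\<close>, so \<open>\<psi>\<close> commutes with it modulo
      \<open>D\<close>.\<close>
    let ?h = "inv\<^bsub>G\<^esub> ?t \<otimes>\<^bsub>G\<^esub> g \<otimes>\<^bsub>G\<^esub> ?s"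
    have h: "?h \<in> carrier G" using ts g by simp
    have "star ?h w0 = star (inv\<^bsub>G\<^esub> ?t) (star g (star ?s w0))"
      using ts g w0 by (simp add: O.star_mult O.star_closed G.m_assoc)
    also have "\<dots> = star (inv\<^bsub>G\<^esub> ?t) (star ?t w0)" using t(2)[OF w] t(2)[OF gw] by simp
    also have "\<dots> = w0" using O.star_inv(2)[OF ts(1) w0] .
    finally have hw: "star ?h w0 = w0" .
    let ?v = "U.act (inv\<^bsub>G\<^esub> ?s) v"
    have vc: "?v \<in> carrier U" "\<psi> ?v \<in> carrier V" "U.act ?h ?v \<in> carrier U" "\<psi> (U.act ?h ?v) \<in> carrier V"
      using v ts h \<psi>k(1) by auto
    have e1: "?h \<otimes>\<^bsub>G\<^esub> inv\<^bsub>G\<^esub> ?s = inv\<^bsub>G\<^esub> ?t \<otimes>\<^bsub>G\<^esub> g" using ts g by (simp add: G.m_assoc)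
    have e2: "?t \<otimes>\<^bsub>G\<^esub> ?h = g \<otimes>\<^bsub>G\<^esub> ?s" using ts g by (simp add: G.m_assoc[symmetric])
    have "U.act (inv\<^bsub>G\<^esub> ?t) (U.act g v) = U.act ?h ?v"
      using U.act_mult[OF h G.inv_closed[OF ts(2)] v] U.act_mult[OF G.inv_closed[OF ts(1)] g v] e1 by simp
    then have 1: "c (star g w) (U.act g v) = V.act ?t (\<psi> (U.act ?h ?v))" by (simp add: c_def)
    have 2: "V.act g (c w v) = V.act ?t (V.act ?h (\<psi> ?v))"
      using V.act_mult[OF g ts(2) vc(2)] V.act_mult[OF ts(1) h vc(2)] e2 by (simp add: c_def)
    have "V.act ?t (\<psi> (U.act ?h ?v) \<ominus>\<^bsub>V\<^esub> V.act ?h (\<psi> ?v)) \<in> D"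
      by (rule V.submodule_act[OF D ts(1) eq[OF h hw vc(1)]])
    then show ?thesis unfolding 1 2 using V.act_diff[OF ts(1) vc(4)] h vc(2) by simp
  qed
  define \<rho> where "\<rho> u = (\<Oplus>\<^bsub>V\<^esub>w\<in>Om. c w (\<alpha> w u))" for u
  have k: "(\<lambda>u. c w (\<alpha> w u)) \<in> klin k G U V" if "w \<in> Om" for w by (rule klin_comp[OF \<alpha>k[OF that] ck[OF that]])
  show thesis
  proof (rule that[of \<rho>])
    show "\<rho> \<in> klin k G U V"
    proof (rule klinI)
      show "\<rho> x \<in> carrier V" if "x \<in> carrier U" for x
        unfolding \<rho>_def using klinD(1)[OF k that] by (intro V.M.M.finsum_closed) auto
      show "\<rho> (x \<oplus>\<^bsub>U\<^esub> y) = \<rho> x \<oplus>\<^bsub>V\<^esub> \<rho> y" if "x \<in> carrier U" "y \<in> carrier U" for x y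
      proof -
        have "\<rho> (x \<oplus>\<^bsub>U\<^esub> y) = (\<Oplus>\<^bsub>V\<^esub>w\<in>Om. c w (\<alpha> w x) \<oplus>\<^bsub>V\<^esub> c w (\<alpha> w y))"
          unfolding \<rho>_def by (rule V.M.M.finsum_cong') (use klinD(1,2)[OF k] that in auto)
        also have "\<dots> = \<rho> x \<oplus>\<^bsub>V\<^esub> \<rho> y" unfolding \<rho>_def
          by (rule V.M.M.finsum_addf) (use klinD(1)[OF k] that in auto)
        finally show ?thesis .
      qed
      show "\<rho> (U.sc d x) = V.sc d (\<rho> x)" if "d \<in> carrier k" "x \<in> carrier U" for d x
      proof -
        have "\<rho> (U.sc d x) = (\<Oplus>\<^bsub>V\<^esub>w\<in>Om. V.sc d (c w (\<alpha> w x)))"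
          unfolding \<rho>_def by (rule V.M.M.finsum_cong') (use klinD(1,3)[OF k] that in auto)
        also have "\<dots> = V.sc d (\<rho> x)" unfolding \<rho>_def
          by (rule V.sc_finsum[symmetric]) (use klinD(1)[OF k] that O.finite_Om in auto)
        finally show ?thesis .
      qed
      show "continuous_map (mtopology U) (mtopology V) \<rho>"
        unfolding \<rho>_def by (rule V.continuous_finsum_maps[OF O.finite_Om]) (rule klinD(4)[OF k])
    qed
    show "\<beta> (\<rho> u) = \<phi> u" if u: "u \<in> carrier U" for u
    proof -
      have \<alpha>c: "\<alpha> w u \<in> carrier U" if "w \<in> Om" for w using klinD(1)[OF \<alpha>k[OF that] u] .
      have "\<beta> (\<rho> u) = (\<Oplus>\<^bsub>W\<^esub>w\<in>Om. \<beta> (c w (\<alpha> w u)))" unfolding \<rho>_def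
        by (rule VW.klin_finsum[OF ghomD(1)[OF \<beta>g] O.finite_Om]) (use klinD(1)[OF k u] in auto)
      also have "\<dots> = (\<Oplus>\<^bsub>W\<^esub>w\<in>Om. \<phi> (\<alpha> w u))"
        by (rule W.M.M.finsum_cong') (use \<beta>c \<alpha>c klinD(1)[OF ghomD(1)[OF \<phi>g]] in auto)
      also have "\<dots> = \<phi> (\<Oplus>\<^bsub>U\<^esub>w\<in>Om. \<alpha> w u)"
        by (rule UW.klin_finsum[OF ghomD(1)[OF \<phi>g] O.finite_Om, symmetric]) (use \<alpha>c in auto)
      finally show ?thesis using \<alpha>s[OF u] by simp
    qed
    show "\<rho> (U.act g u) \<ominus>\<^bsub>V\<^esub> V.act g (\<rho> u) \<in> D" if g: "g \<in> carrier G" and u: "u \<in> carrier U" for g u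
    proof -
      have \<alpha>c: "\<alpha> w u \<in> carrier U" if "w \<in> Om" for w using klinD(1)[OF \<alpha>k[OF that] u] .
      have cc: "c w x \<in> carrier V" if "w \<in> Om" "x \<in> carrier U" for w x using klinD(1)[OF ck[OF that(1)] that(2)] .
      have gu: "U.act g u \<in> carrier U" using g u by simp
      \<comment> \<open>Reindexing the sum over \<open>Om\<close> by \<open>star g\<close> makes it
        match the translated sum term by term modulo \<open>D\<close>.\<close>
      have "\<rho> (U.act g u) = (\<Oplus>\<^bsub>V\<^esub>w\<in>star g ` Om. c w (\<alpha> w (U.act g u)))"
        unfolding \<rho>_def O.star_bij(2)[OF g] ..
      also have "\<dots> = (\<Oplus>\<^bsub>V\<^esub>w\<in>Om. c (star g w) (\<alpha> (star g w) (U.act g u)))"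
        by (rule V.M.M.finsum_reindex[OF _ O.star_bij(1)[OF g]])
          (use klinD(1)[OF k gu] O.star_closed[OF g] in auto)
      also have "\<dots> = (\<Oplus>\<^bsub>V\<^esub>w\<in>Om. c (star g w) (U.act g (\<alpha> w u)))"
        by (rule V.M.M.finsum_cong') (use \<alpha>g[OF g _ u] cc O.star_closed[OF g] \<alpha>c g in auto)
      finally have 1: "\<rho> (U.act g u) = (\<Oplus>\<^bsub>V\<^esub>w\<in>Om. c (star g w) (U.act g (\<alpha> w u)))" .
      have 2: "V.act g (\<rho> u) = (\<Oplus>\<^bsub>V\<^esub>w\<in>Om. V.act g (c w (\<alpha> w u)))"
        unfolding \<rho>_def by (rule V.act_finsum[OF g O.finite_Om]) (use cc \<alpha>c in auto)
      have "\<rho> (U.act g u) \<ominus>\<^bsub>V\<^esub> V.act g (\<rho> u) = (\<Oplus>\<^bsub>V\<^esub>w\<in>Om. c (star g w) (U.act g (\<alpha> w u)) \<ominus>\<^bsub>V\<^esub> V.act g (c w (\<alpha> w u)))"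
        unfolding 1 2 by (rule V.finsum_diff[OF O.finite_Om]) (use cc O.star_closed[OF g] \<alpha>c g in auto)
      also have "\<dots> \<in> D"
        by (rule V.submodule_finsum[OF D O.finite_Om]) (use cg[OF g _ \<alpha>c] in auto)
      finally show ?thesis .
    qed
  qed
qed

end

section \<open>Products of relative traces\<close>

lemma closedin_Ball:
  assumes "\<And>i. i \<in> I \<Longrightarrow> closedin X {f \<in> topspace X. P i f}"
  shows "closedin X {f \<in> topspace X. \<forall>i\<in>I. P i f}"
proof -
  have "{f \<in> topspace X. \<forall>i\<in>I. P i f} = \<Inter>(insert (topspace X) ((\<lambda>i. {f \<in> topspace X. P i f}) ` I))" by auto
  moreover have "closedin X \<dots>" by (rule closedin_Inter) (use assms in auto)
  ultimately show ?thesis by simp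
qed

lemma closedin_Collect_conj:
  assumes "closedin X {f \<in> topspace X. P f}" "closedin X {f \<in> topspace X. Q f}"
  shows "closedin X {f \<in> topspace X. P f \<and> Q f}"
proof -
  have "{f \<in> topspace X. P f \<and> Q f} = {f \<in> topspace X. P f} \<inter> {f \<in> topspace X. Q f}" by auto
  then show ?thesis using closedin_Int[OF assms] by simp
qed

section \<open>Conjugates of subgroups and coset actions\<close>

context profinite_group
begin

text \<open>\<open>conj_pre H x\<close> is \<open>x\<^sup>-\<^sup>1 H x\<close>.\<close>

definition conj_pre :: "'g set \<Rightarrow> 'g \<Rightarrow> 'g set" where
  "conj_pre H x = {g \<in> carrier G. x \<otimes> g \<otimes> inv x \<in> H}"

lemma subgroup_conj_pre:
  assumes H: "subgroup H G" and x: "x \<in> carrier G"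
  shows "subgroup (conj_pre H x) G"
proof (rule subgroupI)
  note Hf = subgroup.one_closed[OF H] subgroup.m_closed[OF H] subgroup.m_inv_closed[OF H]
  show "conj_pre H x \<subseteq> carrier G" by (auto simp: conj_pre_def)
  have "\<one> \<in> conj_pre H x" using x Hf(1) by (simp add: conj_pre_def)
  then show "conj_pre H x \<noteq> {}" by blast
  show "inv a \<in> conj_pre H x" if a: "a \<in> conj_pre H x" for a
  proof -
    have "inv (x \<otimes> a \<otimes> inv x) \<in> H" using a Hf(3) by (simp add: conj_pre_def)
    moreover have "inv (x \<otimes> a \<otimes> inv x) = x \<otimes> inv a \<otimes> inv x"
      using a x by (simp add: conj_pre_def inv_mult_group m_assoc)
    ultimately show ?thesis using a by (simp add: conj_pre_def)
  qed
  show "a \<otimes> b \<in> conj_pre H x" if ab: "a \<in> conj_pre H x" "b \<in> conj_pre H x" for a b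
  proof -
    have "(x \<otimes> a \<otimes> inv x) \<otimes> (x \<otimes> b \<otimes> inv x) \<in> H" using ab Hf(2) by (simp add: conj_pre_def)
    moreover have "(x \<otimes> a \<otimes> inv x) \<otimes> (x \<otimes> b \<otimes> inv x) = x \<otimes> (a \<otimes> b) \<otimes> inv x"
      using ab x by (simp add: conj_pre_def m_assoc) (simp add: m_assoc[symmetric])
    ultimately show ?thesis using ab by (simp add: conj_pre_def)
  qed
qed

lemma continuous_conj: "x \<in> carrier G \<Longrightarrow> continuous_map Gtop Gtop (\<lambda>g. x \<otimes> g \<otimes> inv x)"
  using continuous_map_id[of Gtop] by (intro continuous_map_mult) (auto simp: topspace_gtopology id_def)

lemma openin_conj_pre: "openin Gtop H \<Longrightarrow> x \<in> carrier G \<Longrightarrow> openin Gtop (conj_pre H x)"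
  using openin_continuous_map_preimage[OF continuous_conj] by (simp add: conj_pre_def topspace_gtopology)

lemma closedin_conj_pre: "closedin Gtop H \<Longrightarrow> x \<in> carrier G \<Longrightarrow> closedin Gtop (conj_pre H x)"
  using closedin_continuous_map_preimage[OF continuous_conj] by (simp add: conj_pre_def topspace_gtopology)

lemma closed_subgroup_conj_pre: "closed_subgroup H G \<Longrightarrow> x \<in> carrier G \<Longrightarrow> closed_subgroup (conj_pre H x) G"
  by (simp add: closed_subgroup_def subgroup_conj_pre closedin_conj_pre)

lemma closed_subgroup_Int: "closed_subgroup H G \<Longrightarrow> closed_subgroup K G \<Longrightarrow> closed_subgroup (H \<inter> K) G"
  by (auto simp: closed_subgroup_def subgroups_Inter_pair)

text \<open>Cosets are right cosets here, so the left action is right multiplication by the inverse;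
  the stabilizer of the coset of \<open>x\<close> is then \<open>conj_pre H x\<close>.\<close>

lemma coset_gset:
  assumes H: "subgroup H G" "openin Gtop H"
  shows "finite_gset G (rcosets H) (\<lambda>g C. C #> inv g)"
proof -
  have HG: "H \<subseteq> carrier G" using subgroup.subset[OF H(1)] .
  have sub: "C \<subseteq> carrier G" if "C \<in> rcosets H" for C
    using subgroup.rcosets_carrier[OF H(1) is_group that] .
  show ?thesis
  proof (unfold_locales)
    show "finite (rcosets H)" by (rule finite_rcosets_open[OF H])
    show "C #> inv g \<in> rcosets H" if "g \<in> carrier G" "C \<in> rcosets H" for g C
    proof -
      obtain x where x: "x \<in> carrier G" "C = H #> x" using \<open>C \<in> rcosets H\<close> by (auto simp: RCOSETS_def)
      then have "C #> inv g = H #> (x \<otimes> inv g)" using coset_mult_assoc[OF HG x(1)] that by simp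
      then show ?thesis using x that by (auto simp: RCOSETS_def)
    qed
    show "C #> inv \<one> = C" if "C \<in> rcosets H" for C using sub[OF that] by simp
    show "C #> inv h #> inv g = C #> inv (g \<otimes> h)" if "g \<in> carrier G" "h \<in> carrier G" "C \<in> rcosets H" for g h C
      using coset_mult_assoc[OF sub[OF that(3)], of "inv h" "inv g"] that by (simp add: inv_mult_group)
  qed
qed

lemma coset_stabilizer:
  assumes H: "subgroup H G" and x: "x \<in> carrier G" and g: "g \<in> carrier G"
  shows "(H #> x) #> inv g = H #> x \<longleftrightarrow> x \<otimes> g \<otimes> inv x \<in> H"
proof -
  have HG: "H \<subseteq> carrier G" using subgroup.subset[OF H] .
  let ?y = "x \<otimes> inv g"
  have y: "?y \<in> carrier G" using x g by simp
  have "(H #> x) #> inv g = H #> ?y" using coset_mult_assoc[OF HG x] g by simp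
  moreover have "H #> ?y = H #> x \<longleftrightarrow> x \<in> H #> ?y"
    using repr_independence[OF _ y H, of x] repr_independenceD[OF H x, of ?y] by blast
  moreover have "x \<in> H #> ?y \<longleftrightarrow> x \<otimes> g \<otimes> inv x \<in> H"
  proof
    assume "x \<in> H #> ?y"
    then obtain h where h: "h \<in> H" "x = h \<otimes> ?y" by (auto simp: r_coset_def)
    have hG: "h \<in> carrier G" using h HG by blast
    have "x \<otimes> g \<otimes> inv x = x \<otimes> inv ?y" using x g by (simp add: inv_mult_group m_assoc)
    also have "\<dots> = h" using inv_solve_right[OF hG x y] h by simp
    finally show "x \<otimes> g \<otimes> inv x \<in> H" using h by simp
  next
    assume h: "x \<otimes> g \<otimes> inv x \<in> H"
    have "x = (x \<otimes> g \<otimes> inv x) \<otimes> ?y" using x g by (simp add: m_assoc) (simp add: m_assoc[symmetric])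
    then show "x \<in> H #> ?y" using h by (auto simp: r_coset_def)
  qed
  ultimately show ?thesis by simp
qed

text \<open>An open normal subgroup inside \<open>H\<close> lies in all conjugates of
  \<open>H\<close>, and these are the stabilizers of the cosets.\<close>

lemma coset_core:
  assumes H: "subgroup H G" "openin Gtop H"
  obtains L where "L \<in> open_normal_subgroups G" "\<And>g C. g \<in> L \<Longrightarrow> C \<in> rcosets H \<Longrightarrow> C #> inv g = C"
proof -
  obtain L where L: "L \<in> open_normal_subgroups G" "L \<subseteq> H"
    using open_normal_inside[OF H(2) subgroup.one_closed[OF H(1)]] by blast
  show thesis
  proof (rule that[OF L(1)])
    fix g C assume g: "g \<in> L" and "C \<in> rcosets H"
    then obtain x where x: "x \<in> carrier G" "C = H #> x" by (auto simp: RCOSETS_def)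
    have "x \<otimes> g \<otimes> inv x \<in> L" using open_normalD(1)[OF L(1)] g x by (simp add: normal_inv_iff)
    then show "C #> inv g = C" using coset_stabilizer[OF H(1) x(1)] g L(2) open_normalD(6)[OF L(1)] x(2) by blast
  qed
qed

lemma mult_open_normal:
  assumes Q: "subgroup Q G" and N: "N \<in> open_normal_subgroups G"
  shows "subgroup (N <#> Q) G" "openin Gtop (N <#> Q)" "Q \<subseteq> N <#> Q" "N \<subseteq> N <#> Q"
proof -
  have QG: "Q \<subseteq> carrier G" using subgroup.subset[OF Q] .
  note Nf = open_normalD[OF N]
  show "subgroup (N <#> Q) G" by (rule mult_norm_subgroup[OF Nf(1) Q])
  have "N <#> Q = (\<Union>q\<in>Q. N #> q)" by (auto simp: set_mult_def r_coset_def)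
  moreover have "openin Gtop \<dots>" by (rule openin_Union) (use openin_r_coset[OF Nf(3)] QG in auto)
  ultimately show "openin Gtop (N <#> Q)" by simp
  show "Q \<subseteq> N <#> Q"
  proof
    fix q assume q: "q \<in> Q"
    then have "\<one> \<otimes> q = q" using QG by auto
    then show "q \<in> N <#> Q" unfolding set_mult_def using q Nf(7) by force
  qed
  show "N \<subseteq> N <#> Q"
  proof
    fix n assume n: "n \<in> N"
    then have "n \<otimes> \<one> = n" using Nf(6) by auto
    then show "n \<in> N <#> Q" unfolding set_mult_def using n subgroup.one_closed[OF Q] by force
  qed
qed

text \<open>A point outside the closed set \<open>Q\<close> stays outside after multiplication by
  the inverse of any element of a small open normal \<open>N\<close>, so it cannot lie in
  \<open>N <#> Q\<close>.\<close>

lemma Inter_mult_open_normal: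
  assumes Q: "closed_subgroup Q G" and g: "g \<in> carrier G"
    and gN: "\<And>N. N \<in> open_normal_subgroups G \<Longrightarrow> g \<in> N <#> Q"
  shows "g \<in> Q"
proof (rule ccontr)
  assume gQ: "g \<notin> Q"
  have Qs: "subgroup Q G" "closedin Gtop Q" using Q by (auto simp: closed_subgroup_def)
  have QG: "Q \<subseteq> carrier G" using subgroup.subset[OF Qs(1)] .
  have "continuous_map Gtop Gtop (\<lambda>n. inv n \<otimes> g)"
    by (rule continuous_map_mult[OF continuous_inv]) (use g topspace_gtopology in simp)
  then have "openin Gtop {n \<in> topspace Gtop. inv n \<otimes> g \<in> topspace Gtop - Q}"
    by (rule openin_continuous_map_preimage) (use Qs(2) in blast)
  moreover have "\<one> \<in> {n \<in> topspace Gtop. inv n \<otimes> g \<in> topspace Gtop - Q}"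
    using g gQ by (simp add: topspace_gtopology)
  ultimately obtain N where N: "N \<in> open_normal_subgroups G" "N \<subseteq> {n \<in> topspace Gtop. inv n \<otimes> g \<in> topspace Gtop - Q}"
    by (rule open_normal_inside)
  obtain n q where nq: "n \<in> N" "q \<in> Q" "g = n \<otimes> q" using gN[OF N(1)] by (auto simp: set_mult_def)
  have "n \<in> carrier G" "q \<in> carrier G" using nq QG open_normalD(6)[OF N(1)] by auto
  then have "inv n \<otimes> g = q" using nq(3) by (simp add: m_assoc[symmetric])
  then show False using N(2) nq by blast
qed

end

context finite_gset
begin

definition orbit :: "'w \<Rightarrow> 'w set" where
  "orbit w = (\<lambda>g. star g w) ` carrier G"

lemma orbit_subset: "w \<in> Om \<Longrightarrow> orbit w \<subseteq> Om"
  by (auto simp: orbit_def star_closed)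

lemma orbit_self: "w \<in> Om \<Longrightarrow> w \<in> orbit w"
  unfolding orbit_def using star_one by force

lemma orbit_eq:
  assumes "w \<in> Om" "v \<in> orbit w"
  shows "orbit v = orbit w"
proof -
  obtain g where g: "g \<in> carrier G" "v = star g w" using assms(2) by (auto simp: orbit_def)
  have "star h v = star (h \<otimes> g) w" if "h \<in> carrier G" for h using g that assms(1) star_mult by simp
  moreover have "star h w = star (h \<otimes> inv g) v" if "h \<in> carrier G" for h
    using g that assms(1) star_mult by (simp add: m_assoc)
  ultimately show ?thesis using g(1) unfolding orbit_def
    by (intro equalityI subsetI) (auto intro: image_eqI)
qed

lemma orbit_gset: "w \<in> Om \<Longrightarrow> finite_gset G (orbit w) star"
proof -
  assume w: "w \<in> Om"
  have "star g v \<in> orbit w" if "g \<in> carrier G" "v \<in> orbit w" for g v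
    using orbit_eq[OF w that(2)] that(1) by (auto simp: orbit_def)
  then show ?thesis
    using orbit_subset[OF w] finite_subset[OF orbit_subset[OF w] finite_Om] star_one star_mult
    by unfold_locales auto
qed

lemma prod_gset:
  assumes "finite_gset G Om' star'"
  shows "finite_gset G (Om \<times> Om') (\<lambda>g (a, b). (star g a, star' g b))"
proof -
  interpret O': finite_gset G Om' star' by fact
  show ?thesis
    by unfold_locales
      (auto simp: finite_Om O'.finite_Om star_closed O'.star_closed star_one O'.star_one star_mult O'.star_mult)
qed

end

lemma (in abelian_monoid) finsum_Times:
  assumes "finite A" "finite B" "\<And>a b. a \<in> A \<Longrightarrow> b \<in> B \<Longrightarrow> f (a, b) \<in> carrier G"
  shows "(\<Oplus>p\<in>A \<times> B. f p) = (\<Oplus>b\<in>B. \<Oplus>a\<in>A. f (a, b))"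
proof -
  have "A \<times> B = (\<Union>b\<in>B. (\<lambda>a. (a, b)) ` A)" by auto
  moreover have "(\<Oplus>p\<in>(\<Union>b\<in>B. (\<lambda>a. (a, b)) ` A). f p) = (\<Oplus>b\<in>B. \<Oplus>p\<in>(\<lambda>a. (a, b)) ` A. f p)"
    by (rule add.finprod_UN_disjoint) (use assms in \<open>auto simp: pairwise_def disjnt_iff\<close>)
  moreover have "\<dots> = (\<Oplus>b\<in>B. \<Oplus>a\<in>A. f (a, b))"
  proof (rule finsum_cong')
    show "(\<lambda>b. \<Oplus>a\<in>A. f (a, b)) \<in> B \<rightarrow> carrier G" using assms(3) by (auto intro!: finsum_closed)
    show "(\<Oplus>p\<in>(\<lambda>a. (a, b)) ` A. f p) = (\<Oplus>a\<in>A. f (a, b))" if "b \<in> B" for b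
      by (rule finsum_reindex) (use assms(3) that in \<open>auto simp: inj_on_def\<close>)
  qed simp
  ultimately show ?thesis by simp
qed

section \<open>Relative projectivity under change of subgroup\<close>

context cga_module
begin

text \<open>The definition in terms of \<open>ghom\<close>, so that restriction of scalars along
  \<open>cga_incl\<close> does not have to be unfolded again.\<close>

lemma relatively_projectiveI:
  assumes "\<And>(V :: (('g, 'k) cga, ('g, 'k, 'm) test_universe) top_module)
      (W :: (('g, 'k) cga, ('g, 'k, 'm) test_universe) top_module) \<beta> \<phi> \<psi>.
      cga_module k G V \<Longrightarrow> cga_module k G W \<Longrightarrow> \<beta> \<in> continuous_epi KG V W \<Longrightarrow> \<phi> \<in> continuous_hom KG M W \<Longrightarrow>
      \<psi> \<in> ghom k G H M V \<Longrightarrow> (\<And>u. u \<in> carrier M \<Longrightarrow> \<beta> (\<psi> u) = \<phi> u) \<Longrightarrow>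
      \<exists>\<rho>\<in>continuous_hom KG M V. \<forall>u\<in>carrier M. \<beta> (\<rho> u) = \<phi> u"
    and H: "closed_subgroup H G"
  shows "relatively_projective k G H M"
  unfolding relatively_projective_def relative_lifting_def
proof (intro allI impI ballI, elim conjE bexE)
  fix V W :: "(('g, 'k) cga, ('g, 'k, 'm) test_universe) top_module" and \<beta> \<phi> \<psi>
  assume V: "profinite_module KG V" and W: "profinite_module KG W"
    and b: "\<beta> \<in> continuous_epi KG V W" and p: "\<phi> \<in> continuous_hom KG M W"
    and ps: "\<psi> \<in> continuous_hom (completed_group_algebra k (sub_top_group G H))
      (restrict_scalars (cga_incl k G H) M) (restrict_scalars (cga_incl k G H) V)"
    and e: "\<forall>u\<in>carrier M. \<beta> (\<psi> u) = \<phi> u"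
  have V': "cga_module k G V" and W': "cga_module k G W"
    by (intro cga_module.intro cga_base_axioms V W)+
  interpret V: cga_module k G V by (rule V')
  interpret h: cga_hom k G M V by unfold_locales
  have ps': "\<psi> \<in> ghom k G H M V" using ps h.continuous_hom_subgroup_eq_ghom[OF H] by simp
  show "\<exists>\<rho>\<in>continuous_hom KG M V. \<forall>u\<in>carrier M. \<beta> (\<rho> u) = \<phi> u"
    by (rule assms(1)[OF V' W' b p ps']) (use e in blast)
qed

lemma relatively_projectiveD:
  fixes V W :: "(('g, 'k) cga, ('g, 'k, 'm) test_universe) top_module"
  assumes proj: "relatively_projective k G H M" and H: "closed_subgroup H G"
    and V: "cga_module k G V" and W: "cga_module k G W"
    and b: "\<beta> \<in> continuous_epi KG V W" and p: "\<phi> \<in> continuous_hom KG M W"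
    and ps: "\<psi> \<in> ghom k G H M V" and e: "\<And>u. u \<in> carrier M \<Longrightarrow> \<beta> (\<psi> u) = \<phi> u"
  shows "\<exists>\<rho>\<in>continuous_hom KG M V. \<forall>u\<in>carrier M. \<beta> (\<rho> u) = \<phi> u"
proof -
  interpret V: cga_module k G V by fact
  interpret W: cga_module k G W by fact
  interpret h: cga_hom k G M V by unfold_locales
  have "relative_lifting k G H M V W"
    using proj V.M.profinite_module_axioms W.M.profinite_module_axioms unfolding relatively_projective_def by blast
  moreover have "\<exists>\<psi>\<in>ghom k G H M V. \<forall>u\<in>carrier M. \<beta> (\<psi> u) = \<phi> u"
    using e by (intro bexI[OF _ ps]) blast
  ultimately show ?thesis
    unfolding relative_lifting_def h.continuous_hom_subgroup_eq_ghom[OF H]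
    by (drule_tac bspec[OF _ b], drule_tac bspec[OF _ p]) (erule mp)
qed

text \<open>A map commuting with \<open>K\<close> commutes with \<open>H\<close>, so a lifting
  problem that is solvable over \<open>K\<close> is solvable over \<open>H\<close>.\<close>

lemma relatively_projective_mono:
  assumes "relatively_projective k G H M" "closed_subgroup H G" "closed_subgroup K G" "H \<subseteq> K"
  shows "relatively_projective k G K M"
proof (rule relatively_projectiveI[OF _ assms(3)])
  fix V W :: "(('g, 'k) cga, ('g, 'k, 'm) test_universe) top_module" and \<beta> \<phi> \<psi>
  assume *: "cga_module k G V" "cga_module k G W" "\<beta> \<in> continuous_epi KG V W" "\<phi> \<in> continuous_hom KG M W"
    "\<psi> \<in> ghom k G K M V" and e: "\<And>u. u \<in> carrier M \<Longrightarrow> \<beta> (\<psi> u) = \<phi> u"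
  have "\<psi> \<in> ghom k G H M V" using *(5) assms(4) by (auto simp: ghom_def)
  from relatively_projectiveD[OF assms(1,2) *(1-4) this e]
  show "\<exists>\<rho>\<in>continuous_hom KG M V. \<forall>u\<in>carrier M. \<beta> (\<rho> u) = \<phi> u" .
qed

text \<open>Conjugating a lift over \<open>H\<close> by \<open>x\<close> gives a lift over
  \<open>conj_pre H x\<close> of the same \<open>\<phi>\<close>, because \<open>\<beta>\<close> and
  \<open>\<phi>\<close> commute with \<open>x\<close>.\<close>

lemma relatively_projective_conj:
  assumes proj: "relatively_projective k G (G.conj_pre H x) M" and H: "closed_subgroup H G" and x: "x \<in> carrier G"
  shows "relatively_projective k G H M"
proof (rule relatively_projectiveI[OF _ H])
  fix V W :: "(('g, 'k) cga, ('g, 'k, 'm) test_universe) top_module" and \<beta> \<phi> \<psi>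
  assume *: "cga_module k G V" "cga_module k G W" "\<beta> \<in> continuous_epi KG V W" "\<phi> \<in> continuous_hom KG M W"
    and \<psi>: "\<psi> \<in> ghom k G H M V" and e: "\<And>u. u \<in> carrier M \<Longrightarrow> \<beta> (\<psi> u) = \<phi> u"
  interpret V: cga_module k G V by fact
  interpret W: cga_module k G W by fact
  interpret VW: cga_hom k G V W by unfold_locales
  interpret MW: cga_hom k G M W by unfold_locales
  note \<psi>k = klinD[OF ghomD(1)[OF \<psi>]]
  have ix: "inv\<^bsub>G\<^esub> x \<in> carrier G" using x by simp
  define \<psi>' where "\<psi>' u = V.act (inv\<^bsub>G\<^esub> x) (\<psi> (act x u))" for u
  have "\<psi>' \<in> klin k G M V"
  proof (rule klinI)
    show "\<psi>' u \<in> carrier V" if "u \<in> carrier M" for u using that x ix \<psi>k(1) by (simp add: \<psi>'_def)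
    show "\<psi>' (u \<oplus>\<^bsub>M\<^esub> v) = \<psi>' u \<oplus>\<^bsub>V\<^esub> \<psi>' v" if "u \<in> carrier M" "v \<in> carrier M" for u v
      using that x ix \<psi>k(1,2) by (simp add: \<psi>'_def act_add V.act_add)
    show "\<psi>' (sc c u) = V.sc c (\<psi>' u)" if "c \<in> carrier k" "u \<in> carrier M" for c u
      using that x ix \<psi>k(1,3) by (simp add: \<psi>'_def act_sc V.act_sc)
    have "continuous_map Mtop Mtop (\<lambda>u. u)" using continuous_map_id[of Mtop] by (simp add: id_def)
    from continuous_map_compose[OF continuous_act_const[OF x this] \<psi>k(4)]
    show "continuous_map Mtop (mtopology V) \<psi>'"
      unfolding \<psi>'_def by (intro V.continuous_act_const[OF ix]) (simp add: o_def)
  qed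
  moreover have "\<psi>' (act h u) = V.act h (\<psi>' u)" if h: "h \<in> G.conj_pre H x" and u: "u \<in> carrier M" for h u
  proof -
    let ?h = "x \<otimes>\<^bsub>G\<^esub> h \<otimes>\<^bsub>G\<^esub> inv\<^bsub>G\<^esub> x"
    have hG: "h \<in> carrier G" "?h \<in> H" "?h \<in> carrier G" using h x by (auto simp: G.conj_pre_def)
    have xu: "act x u \<in> carrier M" "\<psi> (act x u) \<in> carrier V" using x u \<psi>k(1) by auto
    have "act x (act h u) = act ?h (act x u)"
      using act_mult[OF x hG(1) u] act_mult[OF hG(3) x u] x hG by (simp add: G.m_assoc)
    then have "\<psi>' (act h u) = V.act (inv\<^bsub>G\<^esub> x) (V.act ?h (\<psi> (act x u)))"
      using ghomD(2)[OF \<psi> hG(2) xu(1)] by (simp add: \<psi>'_def)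
    also have "\<dots> = V.act h (\<psi>' u)"
      using V.act_mult[OF ix hG(3) xu(2)] V.act_mult[OF hG(1) ix xu(2)] x hG(1)
      by (simp add: \<psi>'_def G.m_assoc[symmetric])
    finally show ?thesis .
  qed
  ultimately have \<psi>': "\<psi>' \<in> ghom k G (G.conj_pre H x) M V" by (simp add: ghom_def)
  have \<beta>: "\<beta> \<in> ghom k G (carrier G) V W" using *(3) VW.continuous_hom_eq_ghom by (simp add: continuous_epi_def)
  have \<phi>: "\<phi> \<in> ghom k G (carrier G) M W" using *(4) MW.continuous_hom_eq_ghom by simp
  have "\<beta> (\<psi>' u) = \<phi> u" if u: "u \<in> carrier M" for u
  proof -
    have xu: "act x u \<in> carrier M" using x u by simp
    have "\<beta> (\<psi>' u) = W.act (inv\<^bsub>G\<^esub> x) (\<phi> (act x u))"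
      using ghomD(2)[OF \<beta> ix] \<psi>k(1)[OF xu] e[OF xu] by (simp add: \<psi>'_def)
    also have "\<dots> = \<phi> u"
      using ghomD(2)[OF \<phi> x u] W.act_inv(2)[OF x] klinD(1)[OF ghomD(1)[OF \<phi>] u] by simp
    finally show ?thesis .
  qed
  from relatively_projectiveD[OF proj G.closed_subgroup_conj_pre[OF H x] *(1-4) \<psi>' this]
  show "\<exists>\<rho>\<in>continuous_hom KG M V. \<forall>u\<in>carrier M. \<beta> (\<rho> u) = \<phi> u" .
qed

text \<open>The coset \<open>H\<close> itself serves as base point: it is fixed by \<open>H\<close>
  and hence by \<open>Q\<close>.\<close>

lemma gfamily_cosets:
  assumes proj: "relatively_projective k G Q M" and Q: "closed_subgroup Q G"
    and H: "subgroup H G" "openin G.Gtop H" "Q \<subseteq> H"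
  obtains \<alpha> where "gfamily k G M (rcosets\<^bsub>G\<^esub> H) (\<lambda>g C. C #>\<^bsub>G\<^esub> inv\<^bsub>G\<^esub> g) \<alpha>"
proof -
  obtain L where L: "L \<in> ONS" "\<And>g C. g \<in> L \<Longrightarrow> C \<in> rcosets\<^bsub>G\<^esub> H \<Longrightarrow> C #>\<^bsub>G\<^esub> inv\<^bsub>G\<^esub> g = C"
    using G.coset_core[OF H(1,2)] by blast
  interpret I: cga_induced k G M "rcosets\<^bsub>G\<^esub> H" "\<lambda>g C. C #>\<^bsub>G\<^esub> inv\<^bsub>G\<^esub> g" L
    by (intro cga_induced.intro cga_module_axioms G.coset_gset[OF H(1,2)] cga_induced_axioms.intro L)
  have HH: "H \<in> rcosets\<^bsub>G\<^esub> H" using subgroup.subgroup_in_rcosets[OF H(1) G.is_group] .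
  have "H #>\<^bsub>G\<^esub> inv\<^bsub>G\<^esub> q = H" if "q \<in> Q" for q
    using G.coset_join2[OF _ H(1), of "inv\<^bsub>G\<^esub> q"] subgroup.m_inv_closed[OF H(1)] subgroup.subset[OF H(1)] H(3) that by blast
  from I.relatively_projective_family[OF proj Q HH this] that show thesis by blast
qed

text \<open>The case of \<open>gfamily_lift\<close> in which \<open>D\<close> is the zero submodule.
  By transitivity every translate is obtained from the base point, so equivariance under its
  stabilizer is all that is asked of \<open>\<psi>\<close>.\<close>

lemma gfamily_relatively_projective:
  assumes Om: "finite_gset G Om star" and \<alpha>: "gfamily k G M Om star \<alpha>"
    and w0: "w0 \<in> Om" and tr: "\<And>w. w \<in> Om \<Longrightarrow> \<exists>g\<in>carrier G. star g w0 = w"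
    and K: "closed_subgroup {g \<in> carrier G. star g w0 = w0} G"
  shows "relatively_projective k G {g \<in> carrier G. star g w0 = w0} M"
proof (rule relatively_projectiveI[OF _ K])
  fix V W :: "(('g, 'k) cga, ('g, 'k, 'm) test_universe) top_module" and \<beta> \<phi> \<psi>
  assume *: "cga_module k G V" "cga_module k G W" "\<beta> \<in> continuous_epi KG V W" "\<phi> \<in> continuous_hom KG M W"
    and \<psi>: "\<psi> \<in> ghom k G {g \<in> carrier G. star g w0 = w0} M V" and e: "\<And>u. u \<in> carrier M \<Longrightarrow> \<beta> (\<psi> u) = \<phi> u"
  interpret V: cga_module k G V by fact
  interpret h: cga_hom k G M V by unfold_locales
  have \<beta>: "\<beta> \<in> continuous_hom KG V W" using *(3) by (simp add: continuous_epi_def)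
  have diff: "a \<ominus>\<^bsub>V\<^esub> b \<in> {\<zero>\<^bsub>V\<^esub>} \<longleftrightarrow> a = b" if "a \<in> carrier V" "b \<in> carrier V" for a b
    using V.M.M.diff_eq_zero_iff[OF that] by simp
  have eq: "\<psi> (act h u) \<ominus>\<^bsub>V\<^esub> V.act h (\<psi> u) \<in> {\<zero>\<^bsub>V\<^esub>}" if "h \<in> carrier G" "star h w0 = w0" "u \<in> carrier M" for h u
    using ghomD(2)[OF \<psi>, of h u] that diff klinD(1)[OF ghomD(1)[OF \<psi>]] by simp
  obtain \<rho> where \<rho>: "\<rho> \<in> klin k G M V" "\<And>u. u \<in> carrier M \<Longrightarrow> \<beta> (\<rho> u) = \<phi> u"
    "\<And>g u. g \<in> carrier G \<Longrightarrow> u \<in> carrier M \<Longrightarrow> \<rho> (act g u) \<ominus>\<^bsub>V\<^esub> V.act g (\<rho> u) \<in> {\<zero>\<^bsub>V\<^esub>}"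
    by (rule h.gfamily_lift[OF Om \<alpha> w0 tr *(2) \<beta> *(4) ghomD(1)[OF \<psi>] e V.submodule_zero eq]) blast+
  have "\<rho> \<in> ghom k G (carrier G) M V"
    using \<rho>(1,3) diff klinD(1)[OF \<rho>(1)] by (simp add: ghom_def)
  then show "\<exists>\<rho>\<in>continuous_hom KG M V. \<forall>u\<in>carrier M. \<beta> (\<rho> u) = \<phi> u"
    using \<rho>(2) h.continuous_hom_eq_ghom by blast
qed

text \<open>Multiplying two decompositions of the identity gives one over all pairs, and the
  diagonal action permutes its members compatibly.\<close>

lemma gfamily_prod:
  assumes A: "finite_gset G A s" "gfamily k G M A s \<alpha>" and B: "finite_gset G B t" "gfamily k G M B t \<beta>"
  shows "gfamily k G M (A \<times> B) (\<lambda>g (a, b). (s g a, t g b)) (\<lambda>(a, b) u. \<alpha> a (\<beta> b u))"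
proof -
  interpret A: finite_gset G A s by fact
  interpret B: finite_gset G B t by fact
  have ak: "\<And>a. a \<in> A \<Longrightarrow> \<alpha> a \<in> klin k G M M" and bk: "\<And>b. b \<in> B \<Longrightarrow> \<beta> b \<in> klin k G M M"
    using A(2) B(2) by (auto simp: gfamily_def)
  have sum: "(\<Oplus>\<^bsub>M\<^esub>p\<in>A \<times> B. (\<lambda>(a, b) u. \<alpha> a (\<beta> b u)) p u) = u" if u: "u \<in> carrier M" for u
  proof -
    have "(\<Oplus>\<^bsub>M\<^esub>p\<in>A \<times> B. (\<lambda>(a, b) u. \<alpha> a (\<beta> b u)) p u) = (\<Oplus>\<^bsub>M\<^esub>b\<in>B. \<Oplus>\<^bsub>M\<^esub>a\<in>A. \<alpha> a (\<beta> b u))"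
      using M.M.finsum_Times[OF A.finite_Om B.finite_Om, of "\<lambda>p. (\<lambda>(a, b) u. \<alpha> a (\<beta> b u)) p u"]
        klinD(1)[OF ak] klinD(1)[OF bk] u by simp
    also have "\<dots> = (\<Oplus>\<^bsub>M\<^esub>b\<in>B. \<beta> b u)"
      by (rule M.M.finsum_cong') (use A(2) klinD(1)[OF bk] u in \<open>auto simp: gfamily_def\<close>)
    also have "\<dots> = u" using B(2) u by (simp add: gfamily_def)
    finally show ?thesis .
  qed
  show ?thesis
    unfolding gfamily_def
  proof (intro conjI ballI sum)
    show "(\<lambda>(a, b) u. \<alpha> a (\<beta> b u)) p \<in> klin k G M M" if "p \<in> A \<times> B" for p
      using klin_comp[OF bk ak] that by auto
    fix g p u assume g: "g \<in> carrier G" and p: "p \<in> A \<times> B" and u: "u \<in> carrier M"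
    obtain a b where ab: "p = (a, b)" "a \<in> A" "b \<in> B" using p by auto
    show "(\<lambda>(a, b) u. \<alpha> a (\<beta> b u)) ((\<lambda>(a, b). (s g a, t g b)) p) (act g u) = act g ((\<lambda>(a, b) u. \<alpha> a (\<beta> b u)) p u)"
      using ab g u A(2) B(2) klinD(1)[OF bk[OF ab(3)] u] by (simp add: gfamily_def)
  qed
qed

end

section \<open>Orbit sums and the Mackey argument\<close>

context cga_indecomposable
begin

text \<open>Orbit sums commute with \<open>G\<close>, so they are endomorphisms with total the
  identity, and by locality one of them is invertible. Precomposing the members on that orbit with
  the inverse, which also commutes with \<open>G\<close>, normalizes their sum to the
  identity.\<close>

lemma gfamily_orbit:
  assumes Om: "finite_gset G Om star" and \<alpha>: "gfamily k G M Om star \<alpha>"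
  obtains w0 \<gamma> where "w0 \<in> Om" "gfamily k G M (finite_gset.orbit G star w0) star \<gamma>"
proof -
  interpret O: finite_gset G Om star by fact
  have ak: "\<And>w. w \<in> Om \<Longrightarrow> \<alpha> w \<in> klin k G M M"
    and ag: "\<And>g w u. g \<in> carrier G \<Longrightarrow> w \<in> Om \<Longrightarrow> u \<in> carrier M \<Longrightarrow> \<alpha> (star g w) (act g u) = act g (\<alpha> w u)"
    and as: "\<And>u. u \<in> carrier M \<Longrightarrow> (\<Oplus>\<^bsub>M\<^esub>w\<in>Om. \<alpha> w u) = u"
    using \<alpha> by (auto simp: gfamily_def)
  note ac = klinD(1)[OF ak]
  define \<theta> where "\<theta> S u = (\<Oplus>\<^bsub>M\<^esub>w\<in>S. \<alpha> w u)" for S u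
  have End: "\<theta> S \<in> End" if S: "S \<in> O.orbit ` Om" for S
  proof -
    obtain w where w: "w \<in> Om" "S = O.orbit w" using S by blast
    have SO: "S \<subseteq> Om" using O.orbit_subset w by blast
    have fS: "finite S" using finite_subset[OF SO O.finite_Om] .
    interpret S: finite_gset G S star using O.orbit_gset[OF w(1)] w(2) by simp
    have k: "\<alpha> w \<in> klin k G M M" if "w \<in> S" for w using ak SO that by blast
    note kc = klinD(1)[OF k]
    show ?thesis
      unfolding E.continuous_hom_eq_ghom ghom_def
    proof (intro CollectI conjI ballI klinI)
      show "\<theta> S x \<in> carrier M" if "x \<in> carrier M" for x
        unfolding \<theta>_def using kc that by (intro M.M.finsum_closed) auto
      show "\<theta> S (x \<oplus>\<^bsub>M\<^esub> y) = \<theta> S x \<oplus>\<^bsub>M\<^esub> \<theta> S y" if "x \<in> carrier M" "y \<in> carrier M" for x y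
      proof -
        have "\<theta> S (x \<oplus>\<^bsub>M\<^esub> y) = (\<Oplus>\<^bsub>M\<^esub>w\<in>S. \<alpha> w x \<oplus>\<^bsub>M\<^esub> \<alpha> w y)"
          unfolding \<theta>_def by (rule M.M.finsum_cong') (use klinD(1,2)[OF k] that in auto)
        also have "\<dots> = \<theta> S x \<oplus>\<^bsub>M\<^esub> \<theta> S y" unfolding \<theta>_def by (rule M.M.finsum_addf) (use kc that in auto)
        finally show ?thesis .
      qed
      show "\<theta> S (sc c x) = sc c (\<theta> S x)" if "c \<in> carrier k" "x \<in> carrier M" for c x
      proof -
        have "\<theta> S (sc c x) = (\<Oplus>\<^bsub>M\<^esub>w\<in>S. sc c (\<alpha> w x))"
          unfolding \<theta>_def by (rule M.M.finsum_cong') (use klinD(1,3)[OF k] that in auto)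
        also have "\<dots> = sc c (\<theta> S x)" unfolding \<theta>_def by (rule sc_finsum[symmetric]) (use kc that fS in auto)
        finally show ?thesis .
      qed
      show "continuous_map Mtop Mtop (\<theta> S)"
        unfolding \<theta>_def by (rule continuous_finsum_maps[OF fS]) (rule klinD(4)[OF k])
      show "\<theta> S (act g x) = act g (\<theta> S x)" if g: "g \<in> carrier G" and x: "x \<in> carrier M" for g x
      proof -
        have gx: "act g x \<in> carrier M" using g x by simp
        have "\<theta> S (act g x) = (\<Oplus>\<^bsub>M\<^esub>w\<in>star g ` S. \<alpha> w (act g x))" unfolding \<theta>_def S.star_bij(2)[OF g] ..
        also have "\<dots> = (\<Oplus>\<^bsub>M\<^esub>w\<in>S. \<alpha> (star g w) (act g x))"
          by (rule M.M.finsum_reindex[OF _ S.star_bij(1)[OF g]]) (use kc[OF _ gx] S.star_closed[OF g] in auto)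
        also have "\<dots> = (\<Oplus>\<^bsub>M\<^esub>w\<in>S. act g (\<alpha> w x))"
          by (rule M.M.finsum_cong') (use ag[OF g _ x] SO kc[OF _ x] g in auto)
        also have "\<dots> = act g (\<theta> S x)" unfolding \<theta>_def by (rule act_finsum[symmetric]) (use g kc x fS in auto)
        finally show ?thesis .
      qed
    qed
  qed
  have un: "\<Union>(O.orbit ` Om) = Om" using O.orbit_subset O.orbit_self by blast
  have "(\<Oplus>\<^bsub>M\<^esub>S\<in>O.orbit ` Om. \<theta> S u) = u" if u: "u \<in> carrier M" for u
  proof -
    have "(\<Oplus>\<^bsub>M\<^esub>w\<in>\<Union>(O.orbit ` Om). \<alpha> w u) = (\<Oplus>\<^bsub>M\<^esub>S\<in>O.orbit ` Om. \<Oplus>\<^bsub>M\<^esub>w\<in>S. \<alpha> w u)"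
    proof (rule M.M.add.finprod_Union_disjoint)
      show "finite (O.orbit ` Om)" using O.finite_Om by simp
      show "finite S \<and> (\<forall>w\<in>S. \<alpha> w u \<in> carrier M)" if S: "S \<in> O.orbit ` Om" for S
      proof -
        have SO: "S \<subseteq> Om" using S O.orbit_subset by blast
        show ?thesis using finite_subset[OF SO O.finite_Om] ac[OF _ u] SO by blast
      qed
      show "pairwise disjnt (O.orbit ` Om)"
      proof (rule pairwiseI)
        fix S T assume "S \<in> O.orbit ` Om" "T \<in> O.orbit ` Om" "S \<noteq> T"
        then obtain s t where st: "s \<in> Om" "t \<in> Om" "S = O.orbit s" "T = O.orbit t" "O.orbit s \<noteq> O.orbit t" by blast
        have False if "v \<in> S" "v \<in> T" for v
          using O.orbit_eq[OF st(1), of v] O.orbit_eq[OF st(2), of v] that st by simp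
        then show "disjnt S T" by (auto simp: disjnt_iff)
      qed
    qed
    then show ?thesis using as[OF u] un by (simp add: \<theta>_def)
  qed
  then have "bij_betw (\<lambda>u. \<Oplus>\<^bsub>M\<^esub>S\<in>O.orbit ` Om. \<theta> S u) (carrier M) (carrier M)"
    by (simp add: bij_betw_def inj_on_def)
  then have "\<exists>S\<in>O.orbit ` Om. bij_betw (\<theta> S) (carrier M) (carrier M)"
    by (intro End_local_finsum End) (use O.finite_Om in auto)
  then obtain w0 where w0: "w0 \<in> Om" "bij_betw (\<theta> (O.orbit w0)) (carrier M) (carrier M)" by blast
  have E0: "\<theta> (O.orbit w0) \<in> End" using End w0(1) by blast
  obtain \<eta> where \<eta>: "\<eta> \<in> End" "\<And>x. x \<in> carrier M \<Longrightarrow> \<theta> (O.orbit w0) (\<eta> x) = x"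
    by (rule End_inverse[OF E0 w0(2)]) blast
  have \<eta>g: "\<eta> \<in> ghom k G (carrier G) M M" using \<eta>(1) E.continuous_hom_eq_ghom by simp
  note \<eta>k = ghomD(1)[OF \<eta>g]
  have "gfamily k G M (O.orbit w0) star (\<lambda>w u. \<alpha> w (\<eta> u))"
    unfolding gfamily_def
  proof (intro conjI ballI)
    fix w assume "w \<in> O.orbit w0"
    then have w: "w \<in> Om" using O.orbit_subset[OF w0(1)] by blast
    show "(\<lambda>u. \<alpha> w (\<eta> u)) \<in> klin k G M M" by (rule klin_comp[OF \<eta>k ak[OF w]])
    show "\<alpha> (star g w) (\<eta> (act g u)) = act g (\<alpha> w (\<eta> u))" if "g \<in> carrier G" "u \<in> carrier M" for g u
      using ghomD(2)[OF \<eta>g that] ag[OF that(1) w klinD(1)[OF \<eta>k that(2)]] by simp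
  next
    show "(\<Oplus>\<^bsub>M\<^esub>w\<in>O.orbit w0. \<alpha> w (\<eta> u)) = u" if "u \<in> carrier M" for u
      using \<eta>(2)[OF that] by (simp add: \<theta>_def)
  qed
  then show thesis using that w0(1) by blast
qed

text \<open>Orbits on pairs of cosets correspond to the double cosets in Mackey's formula; the
  stabilizer of the pair of cosets of \<open>x\<close> and \<open>y\<close> is the intersection of
  the two conjugates.\<close>

lemma mackey:
  assumes Q: "relatively_projective k G Q M" "closed_subgroup Q G" "Q \<subseteq> H"
    and R: "relatively_projective k G R M" "closed_subgroup R G" "R \<subseteq> K"
    and H: "subgroup H G" "openin G.Gtop H" and K: "subgroup K G" "openin G.Gtop K"
  obtains x y where "x \<in> carrier G" "y \<in> carrier G"
    "relatively_projective k G (G.conj_pre H x \<inter> G.conj_pre K y) M"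
proof -
  let ?s = "\<lambda>g C. C #>\<^bsub>G\<^esub> inv\<^bsub>G\<^esub> g"
  obtain \<alpha> where \<alpha>: "gfamily k G M (rcosets\<^bsub>G\<^esub> H) ?s \<alpha>" using gfamily_cosets[OF Q(1,2) H Q(3)] by blast
  obtain \<beta> where \<beta>: "gfamily k G M (rcosets\<^bsub>G\<^esub> K) ?s \<beta>" using gfamily_cosets[OF R(1,2) K R(3)] by blast
  let ?Om = "(rcosets\<^bsub>G\<^esub> H) \<times> (rcosets\<^bsub>G\<^esub> K)" and ?t = "\<lambda>g (C, D). (?s g C, ?s g D)"
  have gs: "finite_gset G ?Om ?t"
    by (rule finite_gset.prod_gset[OF G.coset_gset[OF H] G.coset_gset[OF K]])
  interpret O: finite_gset G ?Om ?t by (rule gs)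
  obtain w0 \<gamma> where w0: "w0 \<in> ?Om" and \<gamma>: "gfamily k G M (O.orbit w0) ?t \<gamma>"
    by (rule gfamily_orbit[OF gs gfamily_prod[OF G.coset_gset[OF H] \<alpha> G.coset_gset[OF K] \<beta>]])
  obtain x y where xy: "x \<in> carrier G" "y \<in> carrier G" "w0 = (H #>\<^bsub>G\<^esub> x, K #>\<^bsub>G\<^esub> y)"
    using w0 by (auto simp: RCOSETS_def)
  have stab: "{g \<in> carrier G. ?t g w0 = w0} = G.conj_pre H x \<inter> G.conj_pre K y"
    using G.coset_stabilizer[OF H(1) xy(1)] G.coset_stabilizer[OF K(1) xy(2)] xy(3) by (auto simp: G.conj_pre_def)
  have "closed_subgroup H G" "closed_subgroup K G"
    using G.closedin_open_subgroup[OF H] G.closedin_open_subgroup[OF K] H K by (auto simp: closed_subgroup_def)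
  then have cl: "closed_subgroup {g \<in> carrier G. ?t g w0 = w0} G"
    unfolding stab using xy by (intro G.closed_subgroup_Int G.closed_subgroup_conj_pre)
  have "relatively_projective k G {g \<in> carrier G. ?t g w0 = w0} M"
    by (rule gfamily_relatively_projective[OF O.orbit_gset[OF w0] \<gamma> O.orbit_self[OF w0] _ cl])
      (auto simp: O.orbit_def)
  then show thesis using that xy stab by simp
qed

end

section \<open>Conjugacy of vertices\<close>

context cga_module
begin

text \<open>Finitely many conditions modulo open submodules are combined into one; intersecting with
  \<open>carrier M\<close> covers the empty family.\<close>

lemma open_submodule_Inter:
  assumes "finite J" "\<And>D. D \<in> J \<Longrightarrow> submodule D KG M \<and> openin Mtop D"
  shows "submodule (carrier M \<inter> \<Inter>J) KG M" "openin Mtop (carrier M \<inter> \<Inter>J)"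
proof -
  note f = submodule_facts[OF conjunct1[OF assms(2)]]
  show "submodule (carrier M \<inter> \<Inter>J) KG M"
    by (rule M.left_submoduleI) (auto intro: f(2,3,5))
  show "openin Mtop (carrier M \<inter> \<Inter>J)"
  proof (cases "J = {}")
    case True
    then show ?thesis using openin_topspace[of Mtop] topspace_Mtop by simp
  next
    case False
    then have "openin Mtop (\<Inter>J)" using assms by (intro openin_Inter) auto
    moreover have "carrier M \<inter> \<Inter>J = \<Inter>J" using False f(1) by blast
    ultimately show ?thesis by simp
  qed
qed

end

section \<open>Passage to the intersection of open subgroups\<close>

context cga_fg
begin

text \<open>A lift over \<open>Q\<close> is equivariant under some \<open>S N\<close> modulo any given open submodule \<open>D\<close> of \<open>V\<close>, so its trace
  is a lift that is \<open>G\<close>-equivariant modulo \<open>D\<close>.  An exact lift is then found by compactness of the space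
  of maps \<open>M \<rightarrow> V\<close>.\<close>

lemma relatively_projective_Inter:
  fixes S :: "'g set \<Rightarrow> 'g set"
  assumes Q: "closed_subgroup Q G"
    and S: "\<And>N. N \<in> ONS \<Longrightarrow> subgroup (S N) G \<and> openin G.Gtop (S N)"
    and proj: "\<And>N. N \<in> ONS \<Longrightarrow> relatively_projective k G (S N) M"
    and mono: "\<And>N N'. N \<in> ONS \<Longrightarrow> N' \<in> ONS \<Longrightarrow> N \<subseteq> N' \<Longrightarrow> S N \<subseteq> S N'"
    and Inter: "\<And>g. g \<in> carrier G \<Longrightarrow> (\<And>N. N \<in> ONS \<Longrightarrow> g \<in> S N) \<Longrightarrow> g \<in> Q"
  shows "relatively_projective k G Q M"
proof (rule relatively_projectiveI[OF _ Q])
  fix V W :: "(('g, 'k) cga, ('g, 'k, 'm) test_universe) top_module" and \<beta> \<phi> \<psi>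
  assume V: "cga_module k G V" and W: "cga_module k G W" and \<beta>e: "\<beta> \<in> continuous_epi KG V W"
    and \<phi>: "\<phi> \<in> continuous_hom KG M W"
    and \<psi>: "\<psi> \<in> ghom k G Q M V" and \<beta>\<psi>: "\<And>u. u \<in> carrier M \<Longrightarrow> \<beta> (\<psi> u) = \<phi> u"
  interpret V: cga_module k G V by fact
  interpret W: cga_module k G W by fact
  interpret h: cga_hom k G M V by unfold_locales
  have \<beta>: "\<beta> \<in> continuous_hom KG V W" using \<beta>e by (simp add: continuous_epi_def)
  note \<psi>k = klinD[OF ghomD(1)[OF \<psi>]]
  have SC: "closed_subgroup (S N) G" if "N \<in> ONS" for N
    using S[OF that] G.closedin_open_subgroup by (simp add: closed_subgroup_def)
  let ?Sub = "\<lambda>D. submodule D KG V \<and> openin (mtopology V) D"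
  have approx: "\<exists>\<rho>\<in>klin k G M V. (\<forall>u\<in>carrier M. \<beta> (\<rho> u) = \<phi> u) \<and>
      (\<forall>g\<in>carrier G. \<forall>u\<in>carrier M. \<rho> (act g u) \<ominus>\<^bsub>V\<^esub> V.act g (\<rho> u) \<in> D)" if D: "?Sub D" for D
  proof -
    \<comment> \<open>The group elements with which \<open>\<psi>\<close> commutes modulo
      \<open>D\<close> at every \<open>u\<close> simultaneously; this set is open because
      \<open>M\<close> is compact, and it contains \<open>Q\<close>.\<close>
    define E where "E = {g \<in> topspace G.Gtop. \<forall>u\<in>carrier M. (\<lambda>(g, u). \<psi> (act g u) \<ominus>\<^bsub>V\<^esub> V.act g (\<psi> u)) (g, u) \<in> D}"
    have "continuous_map (prod_topology G.Gtop Mtop) (mtopology V) (\<lambda>p. \<psi> (act (fst p) (snd p)) \<ominus>\<^bsub>V\<^esub> V.act (fst p) (\<psi> (snd p)))"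
    proof (rule V.continuous_diff_maps)
      show "continuous_map (prod_topology G.Gtop Mtop) (mtopology V) (\<lambda>p. \<psi> (act (fst p) (snd p)))"
        using continuous_map_compose[OF continuous_act_maps[OF continuous_map_fst continuous_map_snd] \<psi>k(4)]
        by (simp add: o_def)
      show "continuous_map (prod_topology G.Gtop Mtop) (mtopology V) (\<lambda>p. V.act (fst p) (\<psi> (snd p)))"
        using continuous_map_compose[OF continuous_map_snd \<psi>k(4)]
        by (intro V.continuous_act_maps continuous_map_fst) (simp add: o_def)
    qed
    then have "continuous_map (prod_topology G.Gtop Mtop) (mtopology V) (\<lambda>(g, u). \<psi> (act g u) \<ominus>\<^bsub>V\<^esub> V.act g (\<psi> u))"
      by (simp add: case_prod_unfold)
    then have Eo: "openin G.Gtop E"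
      unfolding E_def by (rule openin_forall_compactin) (use compact_M topspace_Mtop D in \<open>auto simp: compact_space_def\<close>)
    have QE: "g \<in> E" if "g \<in> Q" for g
    proof -
      have g: "g \<in> carrier G" using Q that by (auto simp: closed_subgroup_def dest: subgroup.subset)
      have "\<psi> (act g u) \<ominus>\<^bsub>V\<^esub> V.act g (\<psi> u) \<in> D" if "u \<in> carrier M" for u
        using ghomD(2)[OF \<psi> \<open>g \<in> Q\<close> that] V.eqv_refl[of D] D g \<psi>k(1)[OF that] by simp
      then show ?thesis using g by (simp add: E_def G.topspace_gtopology)
    qed
    \<comment> \<open>Otherwise the closed sets \<open>S N - E\<close> have the finite intersection
      property, and a common point would lie in \<open>Q\<close> but outside
      \<open>E\<close>.\<close>
    have "\<exists>N\<in>ONS. S N \<subseteq> E"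
    proof (rule ccontr)
      assume no: "\<not> (\<exists>N\<in>ONS. S N \<subseteq> E)"
      have "\<exists>g\<in>topspace G.Gtop. \<forall>N\<in>ONS. g \<in> S N - E"
      proof (rule compact_space_fip_family[OF G.compact_Gtop])
        show "closedin G.Gtop (S N - E)" if "N \<in> ONS" for N
          using SC[OF that] Eo by (auto simp: closed_subgroup_def intro: closedin_diff)
        fix J assume J: "finite J" "J \<subseteq> ONS"
        obtain N where N: "N \<in> ONS" "\<forall>N'\<in>J. N \<subseteq> N'" using finite_Int_ONS[OF J] by blast
        obtain g where g: "g \<in> S N" "g \<notin> E" using no N(1) by blast
        have "g \<in> topspace G.Gtop" using g(1) S[OF N(1)] openin_subset by blast
        moreover have "g \<in> S N' - E" if "N' \<in> J" for N' using mono[OF N(1), of N'] N(2) J(2) that g by blast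
        ultimately show "\<exists>g\<in>topspace G.Gtop. \<forall>N'\<in>J. g \<in> S N' - E" by blast
      qed
      then obtain g where g: "g \<in> carrier G" "\<And>N. N \<in> ONS \<Longrightarrow> g \<in> S N - E" by (auto simp: G.topspace_gtopology)
      have "g \<in> Q" by (rule Inter[OF g(1)]) (use g(2) in blast)
      then show False using QE[of g] g(2)[OF G.carrier_open_normal] by blast
    qed
    then obtain N where N: "N \<in> ONS" "S N \<subseteq> E" by blast
    let ?s = "\<lambda>g C. C #>\<^bsub>G\<^esub> inv\<^bsub>G\<^esub> g"
    have SN: "subgroup (S N) G" "openin G.Gtop (S N)" using S[OF N(1)] by auto
    obtain \<alpha> where \<alpha>: "gfamily k G M (rcosets\<^bsub>G\<^esub> S N) ?s \<alpha>"
      using gfamily_cosets[OF proj[OF N(1)] SC[OF N(1)] SN order_refl] by blast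
    have HG: "S N \<subseteq> carrier G" using subgroup.subset[OF SN(1)] .
    have w0: "S N \<in> rcosets\<^bsub>G\<^esub> S N" using subgroup.subgroup_in_rcosets[OF SN(1) G.is_group] .
    have tr: "\<exists>g\<in>carrier G. ?s g (S N) = C" if C: "C \<in> rcosets\<^bsub>G\<^esub> S N" for C
    proof -
      obtain x where x: "x \<in> carrier G" "C = S N #>\<^bsub>G\<^esub> x" using C by (auto simp: RCOSETS_def)
      then show ?thesis by (intro bexI[of _ "inv\<^bsub>G\<^esub> x"]) auto
    qed
    have eq: "\<psi> (act g u) \<ominus>\<^bsub>V\<^esub> V.act g (\<psi> u) \<in> D" if g: "g \<in> carrier G" "?s g (S N) = S N" and u: "u \<in> carrier M" for g u
    proof -
      have "\<one>\<^bsub>G\<^esub> \<otimes>\<^bsub>G\<^esub> g \<otimes>\<^bsub>G\<^esub> inv\<^bsub>G\<^esub> \<one>\<^bsub>G\<^esub> \<in> S N"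
        using G.coset_stabilizer[OF SN(1) G.one_closed g(1)] g(2) G.coset_mult_one[OF HG] by simp
      then have "g \<in> E" using N(2) g(1) by auto
      then show ?thesis using u by (simp add: E_def)
    qed
    show ?thesis
      by (rule h.gfamily_lift[OF G.coset_gset[OF SN] \<alpha> w0 tr W \<beta> \<phi> ghomD(1)[OF \<psi>] \<beta>\<psi> conjunct1[OF D] eq]) blast+
  qed
  have "\<exists>N. ?Sub D \<longrightarrow> N \<in> ONS \<and> (\<forall>r\<in>carrier KG. \<forall>v\<in>carrier V. r N = \<zero>\<^bsub>KG\<^esub> N \<longrightarrow> r \<odot>\<^bsub>V\<^esub> v \<in> D)" for D
  proof (cases "?Sub D")
    case True
    show ?thesis by (rule V.ideal_into_open[OF conjunct1[OF True] conjunct2[OF True]]) blast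
  qed auto
  then obtain \<nu> where \<nu>: "\<And>D. ?Sub D \<Longrightarrow> \<nu> D \<in> ONS"
    "\<And>D r v. ?Sub D \<Longrightarrow> r \<in> carrier KG \<Longrightarrow> v \<in> carrier V \<Longrightarrow> r (\<nu> D) = \<zero>\<^bsub>KG\<^esub> (\<nu> D) \<Longrightarrow> r \<odot>\<^bsub>V\<^esub> v \<in> D" by metis
  let ?P = "product_topology (\<lambda>_. mtopology V) (carrier M)"
  \<comment> \<open>All conditions on a candidate lift are pointwise, so they are closed in the
    product topology. The last one takes the place of continuity: as \<open>\<nu> D\<close> is
    chosen before any map, it holds for every sufficiently good approximate lift, passes to the
    limit, and gives continuity at zero there.\<close>
  define \<Lambda> where "\<Lambda> D = {f \<in> topspace ?P. (\<forall>x\<in>carrier M. \<forall>y\<in>carrier M. f (x \<oplus>\<^bsub>M\<^esub> y) = f x \<oplus>\<^bsub>V\<^esub> f y) \<and>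
      (\<forall>c\<in>carrier k. \<forall>x\<in>carrier M. f (sc c x) = V.sc c (f x)) \<and> (\<forall>x\<in>carrier M. \<beta> (f x) = \<phi> x) \<and>
      (\<forall>g\<in>carrier G. \<forall>x\<in>carrier M. f (act g x) \<ominus>\<^bsub>V\<^esub> V.act g (f x) \<in> D) \<and>
      (\<forall>x\<in>augmentation (\<nu> D). f x \<in> D)}" for D
  have aug: "augmentation N \<subseteq> carrier M" for N using submodule_facts(1)[OF augmentation_props(1)] .
  have ev: "continuous_map ?P (mtopology V) (\<lambda>f. f x)" if "x \<in> carrier M" for x
    using continuous_map_product_projection[OF that, of "\<lambda>_. mtopology V"] .
  have "\<exists>f\<in>topspace ?P. \<forall>D\<in>Collect ?Sub. f \<in> \<Lambda> D"
  proof (rule compact_space_fip_family)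
    show "compact_space ?P" by (simp add: compact_space_product_topology V.compact_M)
    fix D assume "D \<in> Collect ?Sub"
    then have Dc: "closedin (mtopology V) D" using V.closedin_open_submodule by blast
    have 1: "closedin ?P {f \<in> topspace ?P. f (x \<oplus>\<^bsub>M\<^esub> y) = f x \<oplus>\<^bsub>V\<^esub> f y}" if "x \<in> carrier M" "y \<in> carrier M" for x y
      by (rule closedin_continuous_maps_eq[OF V.Hausdorff_M ev V.continuous_add_maps[OF ev ev]]) (use that in auto)
    have 2: "closedin ?P {f \<in> topspace ?P. f (sc c x) = V.sc c (f x)}" if "c \<in> carrier k" "x \<in> carrier M" for c x
    proof (rule closedin_continuous_maps_eq[OF V.Hausdorff_M ev])
      show "continuous_map ?P (mtopology V) (\<lambda>f. V.sc c (f x))"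
        unfolding kact_def by (rule V.continuous_smult_const) (use that ev pt_closed in auto)
    qed (use that in auto)
    have 3: "closedin ?P {f \<in> topspace ?P. \<beta> (f x) = \<phi> x}" if "x \<in> carrier M" for x
    proof (rule closedin_continuous_maps_eq[OF W.Hausdorff_M])
      show "continuous_map ?P (mtopology W) (\<lambda>f. \<beta> (f x))"
        using continuous_map_compose[OF ev[OF that] continuous_homD(4)[OF \<beta>]] by (simp add: o_def)
      show "continuous_map ?P (mtopology W) (\<lambda>f. \<phi> x)"
        using continuous_homD(1)[OF \<phi> that] W.topspace_Mtop by simp
    qed
    have 4: "closedin ?P {f \<in> topspace ?P. f (act g x) \<ominus>\<^bsub>V\<^esub> V.act g (f x) \<in> D}" if "g \<in> carrier G" "x \<in> carrier M" for g x
      by (rule closedin_continuous_map_preimage[OF V.continuous_diff_maps[OF ev V.continuous_act_const[OF _ ev]] Dc])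
        (use that in auto)
    have 5: "closedin ?P {f \<in> topspace ?P. f x \<in> D}" if "x \<in> carrier M" for x
      by (rule closedin_continuous_map_preimage[OF ev[OF that] Dc])
    show "closedin ?P (\<Lambda> D)"
      unfolding \<Lambda>_def
      by (intro closedin_Collect_conj closedin_Ball 1 2 3 4 5) (use aug in auto)
  next
    fix J assume J: "finite J" "J \<subseteq> Collect ?Sub"
    have "?Sub (carrier V \<inter> \<Inter>J)" using V.open_submodule_Inter[OF J(1)] J(2) by blast
    from approx[OF this] obtain \<rho> where \<rho>: "\<rho> \<in> klin k G M V" "\<And>u. u \<in> carrier M \<Longrightarrow> \<beta> (\<rho> u) = \<phi> u"
      "\<And>g u. g \<in> carrier G \<Longrightarrow> u \<in> carrier M \<Longrightarrow> \<rho> (act g u) \<ominus>\<^bsub>V\<^esub> V.act g (\<rho> u) \<in> carrier V \<inter> \<Inter>J" by blast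
    note \<rho>k = klinD[OF \<rho>(1)]
    \<comment> \<open>Points of the product space are extensional functions, hence the restriction.
      Being equivariant modulo a submodule below all members of \<open>J\<close>, the map satisfies
      each of the conditions.\<close>
    have "restrict \<rho> (carrier M) \<in> \<Lambda> D" if D: "D \<in> J" for D
    proof -
      have Ds: "?Sub D" using D J(2) by blast
      have e: "\<rho> (act g u) \<ominus>\<^bsub>V\<^esub> V.act g (\<rho> u) \<in> D" if "g \<in> carrier G" "u \<in> carrier M" for g u
        using \<rho>(3)[OF that] D by blast
      have a: "\<rho> x \<in> D" if "x \<in> augmentation (\<nu> D)" for x
        by (rule h.augmentation_image[OF \<rho>(1) conjunct1[OF Ds] _ e _ that])
          (use V.closedin_open_submodule Ds \<nu>(2)[OF Ds] in auto)
      show ?thesis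
        unfolding \<Lambda>_def using \<rho>k(1-3) \<rho>(2) e a subsetD[OF aug] by (auto simp: V.topspace_Mtop)
    qed
    moreover have "restrict \<rho> (carrier M) \<in> topspace ?P" using \<rho>k(1) by (auto simp: V.topspace_Mtop)
    ultimately show "\<exists>f\<in>topspace ?P. \<forall>D\<in>J. f \<in> \<Lambda> D" by blast
  qed
  then obtain f where f: "f \<in> topspace ?P" "\<And>D. ?Sub D \<Longrightarrow> f \<in> \<Lambda> D" by blast
  have Sub0: "?Sub (carrier V)"
    using V.submodule_carrier openin_topspace[of "mtopology V"] V.topspace_Mtop by simp
  have fc: "f x \<in> carrier V" if "x \<in> carrier M" for x
    using f(1) that by (auto simp: V.topspace_Mtop PiE_iff)
  have f0: "\<And>x y. x \<in> carrier M \<Longrightarrow> y \<in> carrier M \<Longrightarrow> f (x \<oplus>\<^bsub>M\<^esub> y) = f x \<oplus>\<^bsub>V\<^esub> f y"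
    "\<And>c x. c \<in> carrier k \<Longrightarrow> x \<in> carrier M \<Longrightarrow> f (sc c x) = V.sc c (f x)"
    "\<And>x. x \<in> carrier M \<Longrightarrow> \<beta> (f x) = \<phi> x"
    using f(2)[OF Sub0] unfolding \<Lambda>_def by blast+
  have fD: "f (act g x) \<ominus>\<^bsub>V\<^esub> V.act g (f x) \<in> D" if "?Sub D" "g \<in> carrier G" "x \<in> carrier M" for D g x
    using f(2)[OF that(1)] that(2,3) unfolding \<Lambda>_def by blast
  have fa: "f x \<in> D" if "?Sub D" "x \<in> augmentation (\<nu> D)" for D x
    using f(2)[OF that(1)] that(2) unfolding \<Lambda>_def by blast
  have "continuous_map Mtop (mtopology V) f"
  proof (rule continuous_additive[OF V _ f0(1)])
    show "f \<in> carrier M \<rightarrow> carrier V" using fc by blast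
    fix D assume D: "submodule D KG V" "openin (mtopology V) D"
    show "\<exists>L. openin Mtop L \<and> \<zero>\<^bsub>M\<^esub> \<in> L \<and> (\<forall>x\<in>L. f x \<in> D)"
      using augmentation_open[OF fg \<nu>(1)] submodule_facts(2)[OF augmentation_props(1)] fa D
      by (intro exI[of _ "augmentation (\<nu> D)"]) blast
  qed
  then have "f \<in> klin k G M V" using fc f0 by (intro klinI) auto
  moreover have "f (act g x) = V.act g (f x)" if gx: "g \<in> carrier G" "x \<in> carrier M" for g x
  proof -
    have c: "f (act g x) \<in> carrier V" "V.act g (f x) \<in> carrier V" using fc gx by auto
    \<comment> \<open>The difference lies in every open submodule, so the limit is exactly
      equivariant.\<close>
    have "f (act g x) \<ominus>\<^bsub>V\<^esub> V.act g (f x) = \<zero>\<^bsub>V\<^esub>"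
      by (rule V.zero_if_in_open_submodules) (use c fD gx in auto)
    then show ?thesis using V.M.M.diff_eq_zero_iff[OF c] by simp
  qed
  ultimately have "f \<in> ghom k G (carrier G) M V" by (simp add: ghom_def)
  then show "\<exists>\<rho>\<in>continuous_hom KG M V. \<forall>u\<in>carrier M. \<beta> (\<rho> u) = \<phi> u"
    using f0(3) h.continuous_hom_eq_ghom by blast
qed

end

section \<open>Choice of the conjugating elements and minimality\<close>

context cga_indecomposable
begin

lemma simultaneous_conjugates:
  assumes Q: "relatively_projective k G Q M" "closed_subgroup Q G"
    and R: "relatively_projective k G R M" "closed_subgroup R G"
  obtains x y where "x \<in> carrier G" "y \<in> carrier G"
    "relatively_projective k G (G.conj_pre Q x \<inter> G.conj_pre R y) M"
proof -
  have Qs: "subgroup Q G" and Rs: "subgroup R G" using Q R by (auto simp: closed_subgroup_def)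
  note QN = G.mult_open_normal[OF Qs] and RN = G.mult_open_normal[OF Rs]
  \<comment> \<open>These open subgroups shrink with \<open>N\<close>, and they intersect in the
    wanted intersection of conjugates of \<open>Q\<close> and \<open>R\<close>, because a closed
    \<open>Q\<close> is the intersection of all \<open>N <#> Q\<close>.\<close>
  define S where "S N x y = G.conj_pre (N <#>\<^bsub>G\<^esub> Q) x \<inter> G.conj_pre (N <#>\<^bsub>G\<^esub> R) y" for N x y
  have So: "subgroup (S N x y) G \<and> openin G.Gtop (S N x y)" if "N \<in> ONS" "x \<in> carrier G" "y \<in> carrier G" for N x y
    unfolding S_def using QN[OF that(1)] RN[OF that(1)] that
    by (auto intro!: G.subgroups_Inter_pair G.subgroup_conj_pre openin_Int G.openin_conj_pre)
  have Sc: "closed_subgroup (S N x y) G" if "N \<in> ONS" "x \<in> carrier G" "y \<in> carrier G" for N x y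
    using So[OF that] G.closedin_open_subgroup by (simp add: closed_subgroup_def)
  have Sm: "S N x y \<subseteq> S N' x y" if "N \<subseteq> N'" for N N' x y
    using mono_set_mult[OF that order_refl] by (fastforce simp: S_def G.conj_pre_def)
  \<comment> \<open>The conjugate \<open>conj_pre H x\<close> depends only on the coset of
    \<open>x\<close> modulo \<open>H\<close>, so \<open>S N x y\<close> depends only on the
    \<open>N\<close>-cosets of \<open>x\<close> and \<open>y\<close>.\<close>
  have inv: "G.conj_pre H (n \<otimes>\<^bsub>G\<^esub> x) = G.conj_pre H x"
    if H: "subgroup H G" "n \<in> H" and x: "x \<in> carrier G" for H n x
  proof -
    have n: "n \<in> carrier G" "inv\<^bsub>G\<^esub> n \<in> H" using H subgroup.subset[OF H(1)] subgroup.m_inv_closed[OF H(1)] by auto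
    have "n \<otimes>\<^bsub>G\<^esub> x \<otimes>\<^bsub>G\<^esub> g \<otimes>\<^bsub>G\<^esub> inv\<^bsub>G\<^esub> (n \<otimes>\<^bsub>G\<^esub> x) \<in> H \<longleftrightarrow> x \<otimes>\<^bsub>G\<^esub> g \<otimes>\<^bsub>G\<^esub> inv\<^bsub>G\<^esub> x \<in> H" if g: "g \<in> carrier G" for g
    proof -
      let ?z = "x \<otimes>\<^bsub>G\<^esub> g \<otimes>\<^bsub>G\<^esub> inv\<^bsub>G\<^esub> x"
      have z: "?z \<in> carrier G" using x g by simp
      have 1: "n \<otimes>\<^bsub>G\<^esub> x \<otimes>\<^bsub>G\<^esub> g \<otimes>\<^bsub>G\<^esub> inv\<^bsub>G\<^esub> (n \<otimes>\<^bsub>G\<^esub> x) = n \<otimes>\<^bsub>G\<^esub> ?z \<otimes>\<^bsub>G\<^esub> inv\<^bsub>G\<^esub> n"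
        using n x g by (simp add: G.inv_mult_group G.m_assoc)
      have 2: "inv\<^bsub>G\<^esub> n \<otimes>\<^bsub>G\<^esub> (n \<otimes>\<^bsub>G\<^esub> ?z \<otimes>\<^bsub>G\<^esub> inv\<^bsub>G\<^esub> n) \<otimes>\<^bsub>G\<^esub> n = ?z"
        using n(1) z by (simp add: G.m_assoc) (simp add: G.m_assoc[symmetric])
      show ?thesis unfolding 1
        using subgroup.m_closed[OF H(1)] H(2) n(2) 2 by metis
    qed
    then show ?thesis unfolding G.conj_pre_def by auto
  qed
  let ?P = "prod_topology G.Gtop G.Gtop"
  have "\<exists>p\<in>topspace ?P. \<forall>N\<in>ONS. p \<in> {p \<in> topspace ?P. relatively_projective k G (S N (fst p) (snd p)) M}"
  proof (rule compact_space_fip_family)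
    show "compact_space ?P" by (simp add: compact_space_prod_topology G.compact_Gtop)
    fix N assume N: "N \<in> ONS"
    let ?B = "{p \<in> topspace ?P. \<not> relatively_projective k G (S N (fst p) (snd p)) M}"
    \<comment> \<open>Projectivity relative to \<open>S N x y\<close> is constant on products of
      \<open>N\<close>-cosets, so the pairs for which it fails form an open set.\<close>
    have "openin ?P ?B"
    proof (subst openin_subopen, intro ballI)
      fix p assume p: "p \<in> ?B"
      obtain x y where xy: "p = (x, y)" "x \<in> carrier G" "y \<in> carrier G" using p by (auto simp: G.topspace_gtopology)
      let ?T = "(N #>\<^bsub>G\<^esub> x) \<times> (N #>\<^bsub>G\<^esub> y)"
      have To: "openin ?P ?T" using G.openin_r_coset[OF ONS(3)[OF N]] xy by (simp add: openin_prod_Times_iff)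
      have "q \<in> ?B" if q: "q \<in> ?T" for q
      proof -
        obtain n m where nm: "n \<in> N" "m \<in> N" "q = (n \<otimes>\<^bsub>G\<^esub> x, m \<otimes>\<^bsub>G\<^esub> y)" using q by (auto simp: r_coset_def)
        have "S N (fst q) (snd q) = S N x y"
          unfolding S_def using nm QN(1,4)[OF N] RN(1,4)[OF N] xy inv[of "N <#>\<^bsub>G\<^esub> Q" n x] inv[of "N <#>\<^bsub>G\<^esub> R" m y]
          by auto
        moreover have "q \<in> topspace ?P" using openin_subset[OF To] q by blast
        ultimately show ?thesis using p xy by simp
      qed
      moreover have "p \<in> ?T" using coset_mem(2)[OF N] xy by simp
      ultimately show "\<exists>T. openin ?P T \<and> p \<in> T \<and> T \<subseteq> ?B" using To by (intro exI[of _ ?T]) blast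
    qed
    moreover have "{p \<in> topspace ?P. relatively_projective k G (S N (fst p) (snd p)) M} = topspace ?P - ?B" by blast
    ultimately show "closedin ?P {p \<in> topspace ?P. relatively_projective k G (S N (fst p) (snd p)) M}"
      by (metis (no_types, lifting) closedin_diff closedin_topspace)
  next
    fix J assume J: "finite J" "J \<subseteq> ONS"
    obtain N where N: "N \<in> ONS" "\<forall>N'\<in>J. N \<subseteq> N'" using finite_Int_ONS[OF J] by blast
    obtain x y where xy: "x \<in> carrier G" "y \<in> carrier G"
      "relatively_projective k G (G.conj_pre (N <#>\<^bsub>G\<^esub> Q) x \<inter> G.conj_pre (N <#>\<^bsub>G\<^esub> R) y) M"
      by (rule mackey[OF Q QN(3)[OF N(1)] R RN(3)[OF N(1)] QN(1,2)[OF N(1)] RN(1,2)[OF N(1)]])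
    \<comment> \<open>A pair found for an \<open>N\<close> below all members of \<open>J\<close>
      serves each of them, as relative projectivity passes to larger subgroups.\<close>
    then have SN: "relatively_projective k G (S N x y) M" by (simp add: S_def)
    have "relatively_projective k G (S N' x y) M" if "N' \<in> J" for N'
      using relatively_projective_mono[OF SN Sc[OF N(1) xy(1,2)] Sc[OF _ xy(1,2)] Sm] J(2) N(2) that by blast
    then show "\<exists>p\<in>topspace ?P. \<forall>N\<in>J. p \<in> {p \<in> topspace ?P. relatively_projective k G (S N (fst p) (snd p)) M}"
      using xy by (intro bexI[of _ "(x, y)"]) (auto simp: G.topspace_gtopology)
  qed
  then obtain x y where xy: "x \<in> carrier G" "y \<in> carrier G"
    "\<And>N. N \<in> ONS \<Longrightarrow> relatively_projective k G (S N x y) M" by (auto simp: G.topspace_gtopology)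
  have "relatively_projective k G (G.conj_pre Q x \<inter> G.conj_pre R y) M"
  proof (rule relatively_projective_Inter[where S = "\<lambda>N. S N x y"])
    show "closed_subgroup (G.conj_pre Q x \<inter> G.conj_pre R y) G"
      using Q R xy by (intro G.closed_subgroup_Int G.closed_subgroup_conj_pre)
    show "g \<in> G.conj_pre Q x \<inter> G.conj_pre R y" if g: "g \<in> carrier G" "\<And>N. N \<in> ONS \<Longrightarrow> g \<in> S N x y" for g
    proof -
      have "x \<otimes>\<^bsub>G\<^esub> g \<otimes>\<^bsub>G\<^esub> inv\<^bsub>G\<^esub> x \<in> Q"
        by (rule G.Inter_mult_open_normal[OF Q(2)]) (use g xy in \<open>auto simp: S_def G.conj_pre_def\<close>)
      moreover have "y \<otimes>\<^bsub>G\<^esub> g \<otimes>\<^bsub>G\<^esub> inv\<^bsub>G\<^esub> y \<in> R"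
        by (rule G.Inter_mult_open_normal[OF R(2)]) (use g xy in \<open>auto simp: S_def G.conj_pre_def\<close>)
      ultimately show ?thesis using g(1) by (simp add: G.conj_pre_def)
    qed
  qed (use So xy Sm in auto)
  then show thesis using that xy by blast
qed

text \<open>Conjugating back by \<open>x\<close> shows that \<open>M\<close> is projective relative
  to the part of \<open>Q\<close> that \<open>x\<close> conjugates into from \<open>K\<close>,
  namely \<open>Q \<inter> G.conj_pre K (inv x)\<close>; minimality of the vertex makes this part
  all of \<open>Q\<close>.\<close>

lemma vertex_transport:
  assumes Q: "is_vertex k G M Q" and K: "closed_subgroup K G" and x: "x \<in> carrier G"
    and proj: "relatively_projective k G (G.conj_pre Q x \<inter> K) M" and q: "q \<in> Q"
  shows "inv\<^bsub>G\<^esub> x \<otimes>\<^bsub>G\<^esub> q \<otimes>\<^bsub>G\<^esub> x \<in> K"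
proof -
  have Qc: "closed_subgroup Q G" using Q by (simp add: is_vertex_def)
  have QG: "Q \<subseteq> carrier G" using Qc by (auto simp: closed_subgroup_def dest: subgroup.subset)
  have ix: "inv\<^bsub>G\<^esub> x \<in> carrier G" using x by simp
  let ?K = "Q \<inter> G.conj_pre K (inv\<^bsub>G\<^esub> x)"
  have Kc: "closed_subgroup ?K G" using Qc K ix by (intro G.closed_subgroup_Int G.closed_subgroup_conj_pre)
  have e: "inv\<^bsub>G\<^esub> x \<otimes>\<^bsub>G\<^esub> (x \<otimes>\<^bsub>G\<^esub> g \<otimes>\<^bsub>G\<^esub> inv\<^bsub>G\<^esub> x) \<otimes>\<^bsub>G\<^esub> x = g" if "g \<in> carrier G" for g
    using that x by (simp add: G.m_assoc) (simp add: G.m_assoc[symmetric])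
  have "G.conj_pre ?K x = G.conj_pre Q x \<inter> K"
  proof -
    have "K \<subseteq> carrier G" using K by (auto simp: closed_subgroup_def dest: subgroup.subset)
    then show ?thesis using x QG e by (auto simp: G.conj_pre_def)
  qed
  then have "relatively_projective k G ?K M"
    using relatively_projective_conj[OF _ Kc x] proj by simp
  then have "\<not> ?K \<subset> Q" using Q Kc by (auto simp: is_vertex_def)
  then have "q \<in> G.conj_pre K (inv\<^bsub>G\<^esub> x)" using q by blast
  then show ?thesis using x by (simp add: G.conj_pre_def)
qed

end

theorem theorem4p6:
  fixes k :: "('k, 'a) ring_scheme"
    and p :: nat
    and G :: "('g, 'b) top_group_scheme"
    and U :: "(('g, 'k) cga, 'u) top_module"
    and Q R :: "'g set"
  assumes "field k" and "finite (carrier k)" and "ring_char k = p"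
    and "profinite_group G"
    and "profinite_module (completed_group_algebra k G) U"
    and "finitely_generated_module (completed_group_algebra k G) U"
    and "indecomposable_module (completed_group_algebra k G) U"
    and "is_vertex k G U Q" and "is_vertex k G U R"
  shows "\<exists>x\<in>carrier G. Q = (\<lambda>r. x \<otimes>\<^bsub>G\<^esub> r \<otimes>\<^bsub>G\<^esub> inv\<^bsub>G\<^esub> x) ` R"
proof -
  interpret cga_indecomposable k G U
    by (intro cga_indecomposable.intro cga_fg.intro cga_module.intro cga_base.intro cga_base_axioms.intro
        cga_fg_axioms.intro cga_indecomposable_axioms.intro assms)
  have Q: "relatively_projective k G Q U" "closed_subgroup Q G"
    and R: "relatively_projective k G R U" "closed_subgroup R G"
    using assms(8,9) by (auto simp: is_vertex_def)
  have QG: "Q \<subseteq> carrier G" and RG: "R \<subseteq> carrier G"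
    using Q R by (auto simp: closed_subgroup_def dest: subgroup.subset)
  obtain x y where x: "x \<in> carrier G" and y: "y \<in> carrier G"
    and proj: "relatively_projective k G (G.conj_pre Q x \<inter> G.conj_pre R y) U"
    by (rule simultaneous_conjugates[OF Q R])
  \<comment> \<open>Minimality of \<open>Q\<close> and of \<open>R\<close>, through
    \<open>vertex_transport\<close> in both directions, identifies \<open>conj_pre Q x\<close> with
    \<open>conj_pre R y\<close>. Solving for \<open>Q\<close> gives conjugation of \<open>R\<close>
    by \<open>x\<close> times the inverse of \<open>y\<close>.\<close>
  let ?z = "x \<otimes>\<^bsub>G\<^esub> inv\<^bsub>G\<^esub> y"
  have z: "?z \<in> carrier G" using x y by simp
  have q: "inv\<^bsub>G\<^esub> ?z \<otimes>\<^bsub>G\<^esub> q \<otimes>\<^bsub>G\<^esub> ?z \<in> R" if "q \<in> Q" for q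
  proof -
    have "inv\<^bsub>G\<^esub> x \<otimes>\<^bsub>G\<^esub> q \<otimes>\<^bsub>G\<^esub> x \<in> G.conj_pre R y"
      by (rule vertex_transport[OF assms(8) G.closed_subgroup_conj_pre[OF R(2) y] x proj that])
    then show ?thesis
      using x y that QG by (auto simp: G.conj_pre_def G.inv_mult_group G.m_assoc subset_iff)
  qed
  have r: "?z \<otimes>\<^bsub>G\<^esub> r \<otimes>\<^bsub>G\<^esub> inv\<^bsub>G\<^esub> ?z \<in> Q" if "r \<in> R" for r
  proof -
    have "inv\<^bsub>G\<^esub> y \<otimes>\<^bsub>G\<^esub> r \<otimes>\<^bsub>G\<^esub> y \<in> G.conj_pre Q x"
      by (rule vertex_transport[OF assms(9) G.closed_subgroup_conj_pre[OF Q(2) x] y _ that])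
        (use proj in \<open>simp add: Int_commute\<close>)
    then show ?thesis
      using x y that RG by (auto simp: G.conj_pre_def G.inv_mult_group G.m_assoc subset_iff)
  qed
  have "Q = (\<lambda>r. ?z \<otimes>\<^bsub>G\<^esub> r \<otimes>\<^bsub>G\<^esub> inv\<^bsub>G\<^esub> ?z) ` R"
  proof (intro equalityI subsetI)
    fix g assume g: "g \<in> Q"
    have "g = ?z \<otimes>\<^bsub>G\<^esub> (inv\<^bsub>G\<^esub> ?z \<otimes>\<^bsub>G\<^esub> g \<otimes>\<^bsub>G\<^esub> ?z) \<otimes>\<^bsub>G\<^esub> inv\<^bsub>G\<^esub> ?z"
    proof -
      have "w \<otimes>\<^bsub>G\<^esub> (inv\<^bsub>G\<^esub> w \<otimes>\<^bsub>G\<^esub> g \<otimes>\<^bsub>G\<^esub> w) \<otimes>\<^bsub>G\<^esub> inv\<^bsub>G\<^esub> w = g" if "w \<in> carrier G" for w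
        using that g QG by (simp add: G.m_assoc subset_iff) (simp add: G.m_assoc[symmetric] subset_iff)
      from this[OF z] show ?thesis by simp
    qed
    then show "g \<in> (\<lambda>r. ?z \<otimes>\<^bsub>G\<^esub> r \<otimes>\<^bsub>G\<^esub> inv\<^bsub>G\<^esub> ?z) ` R" using q[OF g] by (rule image_eqI)
  qed (use r in auto)
  then show ?thesis using z by blast
qed

end
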